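(* Let $k_0\ge2$, and let $\psi_{k_0}:N^{k_0-1}\to\mathbb S^{2k_0-1}$ be a compact connected minimal Legendrian immersion. For every $n\ge k_0$, iterated Calabi suspension yields a compact minimal Legendrian immersion $$\psi_n:\mathbb T^{n-k_0}\times N^{k_0-1}\longrightarrow\mathbb S^{2n-1}.$$ For each $\varepsilon\in\{-1,0,1\}$, combining $\psi_n$ with the Anciaux profiles $\gamma$, via $X(s,p)=\gamma(s)\psi_n(p)$, produces a one-parameter family (indexed by the first-integral value $E\in(0,e^{-\varepsilon/2})$ of the profile) of compact immersed Lagrangian solutions of $H+\varepsilon X^\perp=0$ in $\overline{\mathbb B}^{2n}$. Each member is defined on $[0,L]\times\mathbb T^{n-k_0}\times N^{k_0-1}$ for some $L>0$, its interior lies in the open unit ball $\mathbb B^{2n}$, and it has exactly two Legendrian capillary boundary components, both diffeomorphic to $\mathbb T^{n-k_0}\times N^{k_0-1}$, with supplementary contact angles (i.e. $\theta_0+\theta_1=\pi$).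
   Context: $\mathbb C^n=\mathbb R^{2n}$ carries the Euclidean inner product $\langle\cdot,\cdot\rangle$, the complex structure $J$ and the Kähler form $\omega(U,V)=\langle JU,V\rangle$; $\mathbb S^{2n-1}$ is the unit sphere, $\mathbb T^m=(S^1)^m$ (with $\mathbb T^0$ a point). An immersion $X:M^n\to\mathbb C^n$ is Lagrangian if $X^*\omega=0$. An immersion $\psi:N^{k-1}\to\mathbb S^{2k-1}\subset\mathbb C^k$ is Legendrian if $\langle J\psi,\psi_*W\rangle=0$ for all tangent $W$; minimal means minimal in the round sphere; compact means $N$ is closed. $H$ is the trace of the second fundamental form and $X^\perp$ the normal component of the position vector. Legendrian capillary boundary: for $\nu$ the outward unit conormal of the boundary, a boundary component mapped into $\mathbb S^{2n-1}$ is Legendrian capillary if $\nu=\sin\theta\,X+\cos\theta\,JX$ along it with $\theta$ constant (this forces the boundary immersion to be Legendrian); the contact angle is represented in $(0,\pi)$. Calabi suspension: for $\psi:N^{k-1}\to\mathbb S^{2k-1}\subset\mathbb C^k$, the map $\mathcal C_k(\psi):S^1\times N\to\mathbb S^{2k+1}\subset\mathbb C^{k+1}$ is $$\mathcal C_k(\psi)(t,p)=\left(\sqrt{\tfrac{k}{k+1}}\,e^{it}\psi(p),\ \tfrac1{\sqrt{k+1}}e^{-ikt}\right).$$ Iterated Calabi suspension is the recursion $\psi_{j+1}=\mathcal C_j(\psi_j)$, $j\ge k_0$. Anciaux profile (for $n,\varepsilon$): an arclength-parametrized curve $\gamma=re^{i\phi}:[0,L]\to\mathbb C\setminus\{0\}$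 which, with $\gamma'=e^{i\alpha}$ and $\Theta=\alpha-\phi$, satisfies $r'=\cos\Theta$, $\Theta'=(\varepsilon r-\frac nr)\sin\Theta$, $r(0)=r(L)=1$, and $0<r<1$ on $(0,L)$. Its first integral is the constant $E=r^ne^{-\varepsilon r^2/2}\sin\Theta$. *)

theory Defs
  imports "HOL-Analysis.Analysis"
begin

text \<open>
  The dimension varies inside the statement, so \<^term>\<open>Euclidean_space d\<close> (sequences of reals
  vanishing from index \<open>d\<close> on) serves as the model of \<open>d\<close>-dimensional space, and complex \<open>n\<close>-space
  is likewise a set of sequences. Both carry the product topology of the function type, which
  restricts to the Euclidean one.
\<close>

section \<open>Complex n-space\<close>

type_synonym cvec = "nat \<Rightarrow> complex"

definition Cn :: "nat \<Rightarrow> cvec set" where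
  "Cn n = {u. \<forall>a\<ge>n. u a = 0}"

text \<open>The inner product of type \<^typ>\<open>complex\<close> is the real one, so this is the Euclidean inner
  product of real \<open>2n\<close>-space.\<close>

definition cn_inner :: "nat \<Rightarrow> cvec \<Rightarrow> cvec \<Rightarrow> real" where
  "cn_inner n u v = (\<Sum>a<n. u a \<bullet> v a)"

definition cn_norm :: "nat \<Rightarrow> cvec \<Rightarrow> real" where
  "cn_norm n u = sqrt (cn_inner n u u)"

definition cn_J :: "cvec \<Rightarrow> cvec" where
  "cn_J u = (\<lambda>a. \<i> * u a)"

definition kaehler_form :: "nat \<Rightarrow> cvec \<Rightarrow> cvec \<Rightarrow> real" where
  "kaehler_form n u v = cn_inner n (cn_J u) v"

definition cn_sphere :: "nat \<Rightarrow> cvec set" where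
  "cn_sphere n = {u \<in> Cn n. cn_norm n u = 1}"

definition cn_ball :: "nat \<Rightarrow> cvec set" where
  "cn_ball n = {u \<in> Cn n. cn_norm n u < 1}"

definition cn_cball :: "nat \<Rightarrow> cvec set" where
  "cn_cball n = {u \<in> Cn n. cn_norm n u \<le> 1}"

text \<open>Component of \<open>v\<close> orthogonal to the linear subspace \<open>T\<close>.\<close>

definition normal_part :: "nat \<Rightarrow> cvec set \<Rightarrow> cvec \<Rightarrow> cvec" where
  "normal_part n T v =
     (THE w. w \<in> Cn n \<and> (\<forall>t\<in>T. cn_inner n w t = 0) \<and> (\<lambda>a. v a - w a) \<in> T)"


section \<open>Smoothness on (half-)open subsets of Euclidean space\<close>

definition half_space :: "nat \<Rightarrow> (nat \<Rightarrow> real) topology" where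
  "half_space d = subtopology (Euclidean_space d) {x. 0 \<le> x 0}"

definition chart_range :: "nat \<Rightarrow> (nat \<Rightarrow> real) set \<Rightarrow> bool" where
  "chart_range d V \<longleftrightarrow> openin (Euclidean_space d) V \<or> openin (half_space d) V"

text \<open>The derivative is taken within \<open>V\<close>: it is one-sided at points of the boundary of the
  half-space.\<close>

definition partial_d ::
  "(nat \<Rightarrow> real) set \<Rightarrow> nat \<Rightarrow> ((nat \<Rightarrow> real) \<Rightarrow> nat \<Rightarrow> 'b::real_normed_vector)
    \<Rightarrow> (nat \<Rightarrow> real) \<Rightarrow> nat \<Rightarrow> 'b" where
  "partial_d V i f x =
     (\<lambda>a. vector_derivative (\<lambda>t. f (x(i := t)) a) (at (x i) within {t. x(i := t) \<in> V}))"

definition partially_differentiable ::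
  "(nat \<Rightarrow> real) set \<Rightarrow> nat \<Rightarrow> ((nat \<Rightarrow> real) \<Rightarrow> nat \<Rightarrow> 'b::real_normed_vector) \<Rightarrow> bool" where
  "partially_differentiable V i f \<longleftrightarrow>
     (\<forall>x\<in>V. \<forall>a. (\<lambda>t. f (x(i := t)) a) differentiable (at (x i) within {t. x(i := t) \<in> V}))"

primrec Ck_on ::
  "nat \<Rightarrow> nat \<Rightarrow> (nat \<Rightarrow> real) set \<Rightarrow> ((nat \<Rightarrow> real) \<Rightarrow> nat \<Rightarrow> 'b::real_normed_vector) \<Rightarrow> bool" where
  "Ck_on 0 d V f \<longleftrightarrow> continuous_on V f"
| "Ck_on (Suc k) d V f \<longleftrightarrow> continuous_on V f \<and>
     (\<forall>i<d. partially_differentiable V i f \<and> Ck_on k d V (partial_d V i f))"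

text \<open>On a relatively open subset of the half-space this asks that all partial derivatives exist
  and are continuous up to the boundary, which by Seeley's extension theorem is the same as
  having local smooth extensions across the boundary.\<close>

definition smooth_on ::
  "nat \<Rightarrow> (nat \<Rightarrow> real) set \<Rightarrow> ((nat \<Rightarrow> real) \<Rightarrow> nat \<Rightarrow> 'b::real_normed_vector) \<Rightarrow> bool" where
  "smooth_on d V f \<longleftrightarrow> (\<forall>k. Ck_on k d V f)"


section \<open>Smooth manifolds with boundary\<close>

type_synonym 'a chart = "'a set \<times> ('a \<Rightarrow> nat \<Rightarrow> real)"

record 'a mfd =
  mtop :: "'a topology"
  mdim :: nat
  matlas :: "'a chart set"

abbreviation mpoints :: "'a mfd \<Rightarrow> 'a set" where
  "mpoints M \<equiv> topspace (mtop M)"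

definition smooth_mfd :: "'a mfd \<Rightarrow> bool" where
  "smooth_mfd M \<longleftrightarrow>
     Hausdorff_space (mtop M) \<and>
     (\<exists>\<B>. countable \<B> \<and> (\<forall>W\<in>\<B>. openin (mtop M) W) \<and>
        (\<forall>U x. openin (mtop M) U \<and> x \<in> U \<longrightarrow> (\<exists>W\<in>\<B>. x \<in> W \<and> W \<subseteq> U))) \<and>
     (\<Union>(U, \<phi>)\<in>matlas M. U) = mpoints M \<and>
     (\<forall>(U, \<phi>)\<in>matlas M. openin (mtop M) U \<and> chart_range (mdim M) (\<phi> ` U) \<and>
        homeomorphic_map (subtopology (mtop M) U)
          (subtopology (Euclidean_space (mdim M)) (\<phi> ` U)) \<phi>) \<and>
     (\<forall>(U, \<phi>)\<in>matlas M. \<forall>(V, \<kappa>)\<in>matlas M.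
        smooth_on (mdim M) (\<phi> ` (U \<inter> V)) (\<kappa> \<circ> inv_into U \<phi>))"

text \<open>A point of the boundary hyperplane counts only if the chart is a genuine half-space chart:
  a chart onto an open subset of the whole space may well meet the hyperplane.\<close>

definition mboundary :: "'a mfd \<Rightarrow> 'a set" where
  "mboundary M = {p. \<exists>(U, \<phi>)\<in>matlas M. p \<in> U \<and> \<phi> p 0 = 0 \<and>
     \<not> openin (Euclidean_space (mdim M)) (\<phi> ` U)}"

definition minterior :: "'a mfd \<Rightarrow> 'a set" where
  "minterior M = mpoints M - mboundary M"

definition compact_mfd :: "'a mfd \<Rightarrow> bool" where
  "compact_mfd M \<longleftrightarrow> smooth_mfd M \<and> compact_space (mtop M)"

definition closed_mfd :: "'a mfd \<Rightarrow> bool" where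
  "closed_mfd M \<longleftrightarrow> compact_mfd M \<and> mboundary M = {}"

definition boundary_mfd :: "'a mfd \<Rightarrow> 'a mfd" where
  "boundary_mfd M =
     \<lparr>mtop = subtopology (mtop M) (mboundary M),
      mdim = mdim M - 1,
      matlas = (\<lambda>(U, \<phi>). (U \<inter> mboundary M, \<lambda>p i. \<phi> p (Suc i))) `
        {(U, \<phi>) \<in> matlas M. U \<inter> mboundary M \<noteq> {}}\<rparr>"

definition open_submfd :: "'a mfd \<Rightarrow> 'a set \<Rightarrow> 'a mfd" where
  "open_submfd M S =
     \<lparr>mtop = subtopology (mtop M) S,
      mdim = mdim M,
      matlas = (\<lambda>(U, \<phi>). (U \<inter> S, \<phi>)) ` matlas M\<rparr>"

text \<open>A manifold with boundary is allowed in the first factor only, so that the coordinate \<open>0\<close> of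
  the product is the one constrained to be nonnegative.\<close>

definition prod_mfd :: "'a mfd \<Rightarrow> 'b mfd \<Rightarrow> ('a \<times> 'b) mfd" where
  "prod_mfd M N =
     \<lparr>mtop = prod_topology (mtop M) (mtop N),
      mdim = mdim M + mdim N,
      matlas = (\<lambda>((U, \<phi>), (V, \<kappa>)).
        (U \<times> V, \<lambda>(p, q) i. if i < mdim M then \<phi> p i else \<kappa> q (i - mdim M))) `
          (matlas M \<times> matlas N)\<rparr>"

definition interval_mfd :: "real \<Rightarrow> real mfd" where
  "interval_mfd L =
     \<lparr>mtop = top_of_set {0..L},
      mdim = 1,
      matlas = {({0..<L}, \<lambda>s i. if i = 0 then s else 0),
                ({0<..L}, \<lambda>s i. if i = 0 then L - s else 0)}\<rparr>"

text \<open>The \<open>m\<close>-torus as a subset of complex \<open>m\<close>-space (a point for \<open>m = 0\<close>), with the angular charts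
  centred at its points \<open>c\<close>.\<close>

definition torus_set :: "nat \<Rightarrow> cvec set" where
  "torus_set m = {z \<in> Cn m. \<forall>i<m. cmod (z i) = 1}"

definition torus_mfd :: "nat \<Rightarrow> cvec mfd" where
  "torus_mfd m =
     \<lparr>mtop = top_of_set (torus_set m),
      mdim = m,
      matlas = (\<lambda>c. ({z \<in> torus_set m. \<forall>i<m. z i \<noteq> - c i},
                     \<lambda>z i. if i < m then Arg (z i / c i) else 0)) ` torus_set m\<rparr>"

definition smooth_map :: "'a mfd \<Rightarrow> 'b mfd \<Rightarrow> ('a \<Rightarrow> 'b) \<Rightarrow> bool" where
  "smooth_map M N f \<longleftrightarrow> continuous_map (mtop M) (mtop N) f \<and>
     (\<forall>(U, \<phi>)\<in>matlas M. \<forall>(V, \<kappa>)\<in>matlas N.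
        smooth_on (mdim M) (\<phi> ` (U \<inter> f -` V)) (\<kappa> \<circ> f \<circ> inv_into U \<phi>))"

definition diffeomorphic :: "'a mfd \<Rightarrow> 'b mfd \<Rightarrow> bool" where
  "diffeomorphic M N \<longleftrightarrow> (\<exists>f g. smooth_map M N f \<and> smooth_map N M g \<and>
     (\<forall>p\<in>mpoints M. g (f p) = p) \<and> (\<forall>q\<in>mpoints N. f (g q) = q))"


section \<open>Immersions into complex n-space\<close>

definition chart_rep :: "'a chart \<Rightarrow> ('a \<Rightarrow> cvec) \<Rightarrow> (nat \<Rightarrow> real) \<Rightarrow> cvec" where
  "chart_rep c X = X \<circ> inv_into (fst c) (snd c)"

definition coord_d :: "'a chart \<Rightarrow> ('a \<Rightarrow> cvec) \<Rightarrow> nat \<Rightarrow> 'a \<Rightarrow> cvec" where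
  "coord_d c X i p = partial_d (snd c ` fst c) i (chart_rep c X) (snd c p)"

definition coord_d2 :: "'a chart \<Rightarrow> ('a \<Rightarrow> cvec) \<Rightarrow> nat \<Rightarrow> nat \<Rightarrow> 'a \<Rightarrow> cvec" where
  "coord_d2 c X i j p =
     partial_d (snd c ` fst c) i (partial_d (snd c ` fst c) j (chart_rep c X)) (snd c p)"

text \<open>The differential of \<open>X\<close> at \<open>p\<close>, applied to the tangent vector with components \<open>v\<close> in the
  chart \<open>c\<close>.\<close>

definition pushforward :: "'a mfd \<Rightarrow> 'a chart \<Rightarrow> ('a \<Rightarrow> cvec) \<Rightarrow> 'a \<Rightarrow> (nat \<Rightarrow> real) \<Rightarrow> cvec" where
  "pushforward M c X p v = (\<lambda>a. \<Sum>i<mdim M. v i *\<^sub>R coord_d c X i p a)"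

definition tangent_image :: "'a mfd \<Rightarrow> ('a \<Rightarrow> cvec) \<Rightarrow> 'a \<Rightarrow> cvec set" where
  "tangent_image M X p =
     {pushforward M c X p v | c v. c \<in> matlas M \<and> p \<in> fst c}"

definition immersion :: "'a mfd \<Rightarrow> nat \<Rightarrow> ('a \<Rightarrow> cvec) \<Rightarrow> bool" where
  "immersion M n X \<longleftrightarrow>
     X ` mpoints M \<subseteq> Cn n \<and>
     (\<forall>c\<in>matlas M. smooth_on (mdim M) (snd c ` fst c) (chart_rep c X)) \<and>
     (\<forall>c\<in>matlas M. \<forall>p\<in>fst c. \<forall>v. pushforward M c X p v = (\<lambda>a. 0) \<longrightarrow> (\<forall>i<mdim M. v i = 0))"

definition induced_metric :: "nat \<Rightarrow> 'a chart \<Rightarrow> ('a \<Rightarrow> cvec) \<Rightarrow> 'a \<Rightarrow> nat \<Rightarrow> nat \<Rightarrow> real" where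
  "induced_metric n c X p i j = cn_inner n (coord_d c X i p) (coord_d c X j p)"

definition inverse_metric :: "nat \<Rightarrow> (nat \<Rightarrow> nat \<Rightarrow> real) \<Rightarrow> nat \<Rightarrow> nat \<Rightarrow> real" where
  "inverse_metric d g =
     (THE h. (\<forall>i<d. \<forall>j<d. (\<Sum>k<d. g i k * h k j) = (if i = j then 1 else 0)) \<and>
             (\<forall>i j. \<not> (i < d \<and> j < d) \<longrightarrow> h i j = 0))"

definition metric_trace ::
  "nat \<Rightarrow> 'a mfd \<Rightarrow> 'a chart \<Rightarrow> ('a \<Rightarrow> cvec) \<Rightarrow> 'a \<Rightarrow> (nat \<Rightarrow> nat \<Rightarrow> cvec) \<Rightarrow> cvec" where
  "metric_trace n M c X p B =
     (\<lambda>a. \<Sum>i<mdim M. \<Sum>j<mdim M.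
        inverse_metric (mdim M) (induced_metric n c X p) i j *\<^sub>R B i j a)"

definition second_fundamental_form ::
  "nat \<Rightarrow> 'a mfd \<Rightarrow> 'a chart \<Rightarrow> ('a \<Rightarrow> cvec) \<Rightarrow> 'a \<Rightarrow> nat \<Rightarrow> nat \<Rightarrow> cvec" where
  "second_fundamental_form n M c X p i j =
     normal_part n (tangent_image M X p) (coord_d2 c X i j p)"

definition mean_curvature :: "nat \<Rightarrow> 'a mfd \<Rightarrow> 'a chart \<Rightarrow> ('a \<Rightarrow> cvec) \<Rightarrow> 'a \<Rightarrow> cvec" where
  "mean_curvature n M c X p =
     metric_trace n M c X p (second_fundamental_form n M c X p)"

text \<open>For an immersion into the unit sphere the flat derivative is replaced by the Levi-Civita
  derivative of the sphere, i.e. its component orthogonal to the position vector.\<close>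

definition sphere_second_fundamental_form ::
  "nat \<Rightarrow> 'a mfd \<Rightarrow> 'a chart \<Rightarrow> ('a \<Rightarrow> cvec) \<Rightarrow> 'a \<Rightarrow> nat \<Rightarrow> nat \<Rightarrow> cvec" where
  "sphere_second_fundamental_form n M c X p i j =
     normal_part n (tangent_image M X p)
       (\<lambda>a. coord_d2 c X i j p a - cn_inner n (coord_d2 c X i j p) (X p) *\<^sub>R X p a)"

definition sphere_mean_curvature :: "nat \<Rightarrow> 'a mfd \<Rightarrow> 'a chart \<Rightarrow> ('a \<Rightarrow> cvec) \<Rightarrow> 'a \<Rightarrow> cvec" where
  "sphere_mean_curvature n M c X p =
     metric_trace n M c X p (sphere_second_fundamental_form n M c X p)"

definition lagrangian_immersion :: "'a mfd \<Rightarrow> nat \<Rightarrow> ('a \<Rightarrow> cvec) \<Rightarrow> bool" where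
  "lagrangian_immersion M n X \<longleftrightarrow> mdim M = n \<and> immersion M n X \<and>
     (\<forall>p\<in>mpoints M. \<forall>U\<in>tangent_image M X p. \<forall>V\<in>tangent_image M X p. kaehler_form n U V = 0)"

definition legendrian_immersion :: "'a mfd \<Rightarrow> nat \<Rightarrow> ('a \<Rightarrow> cvec) \<Rightarrow> bool" where
  "legendrian_immersion M n X \<longleftrightarrow> mdim M + 1 = n \<and> immersion M n X \<and>
     X ` mpoints M \<subseteq> cn_sphere n \<and>
     (\<forall>p\<in>mpoints M. \<forall>W\<in>tangent_image M X p. cn_inner n (cn_J (X p)) W = 0)"

definition minimal_in_sphere :: "'a mfd \<Rightarrow> nat \<Rightarrow> ('a \<Rightarrow> cvec) \<Rightarrow> bool" where
  "minimal_in_sphere M n X \<longleftrightarrow>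
     (\<forall>c\<in>matlas M. \<forall>p\<in>fst c. sphere_mean_curvature n M c X p = (\<lambda>a. 0))"

definition soliton_equation :: "real \<Rightarrow> 'a mfd \<Rightarrow> nat \<Rightarrow> ('a \<Rightarrow> cvec) \<Rightarrow> bool" where
  "soliton_equation \<epsilon> M n X \<longleftrightarrow>
     (\<forall>c\<in>matlas M. \<forall>p\<in>fst c.
        (\<lambda>a. mean_curvature n M c X p a + \<epsilon> *\<^sub>R normal_part n (tangent_image M X p) (X p) a)
          = (\<lambda>a. 0))"

text \<open>At a boundary point the tangent vectors of the boundary are those with \<open>v 0 = 0\<close>, and the
  outward ones those with \<open>v 0 < 0\<close>.\<close>

definition outward_unit_conormal ::
  "nat \<Rightarrow> 'a mfd \<Rightarrow> ('a \<Rightarrow> cvec) \<Rightarrow> 'a \<Rightarrow> cvec \<Rightarrow> bool" where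
  "outward_unit_conormal n M X p \<nu> \<longleftrightarrow> cn_norm n \<nu> = 1 \<and>
     (\<forall>c\<in>matlas M. p \<in> fst c \<longrightarrow>
        (\<exists>v. v 0 < 0 \<and> \<nu> = pushforward M c X p v) \<and>
        (\<forall>v. v 0 = 0 \<longrightarrow> cn_inner n \<nu> (pushforward M c X p v) = 0))"

definition boundary_components :: "'a mfd \<Rightarrow> 'a set set" where
  "boundary_components M = connected_components_of (mtop (boundary_mfd M))"

definition legendrian_capillary ::
  "nat \<Rightarrow> 'a mfd \<Rightarrow> ('a \<Rightarrow> cvec) \<Rightarrow> 'a set \<Rightarrow> real \<Rightarrow> bool" where
  "legendrian_capillary n M X B \<theta> \<longleftrightarrow> 0 < \<theta> \<and> \<theta> < pi \<and> X ` B \<subseteq> cn_sphere n \<and>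
     (\<forall>p\<in>B. outward_unit_conormal n M X p (\<lambda>a. sin \<theta> *\<^sub>R X p a + cos \<theta> *\<^sub>R cn_J (X p) a))"


section \<open>Calabi suspension and Anciaux profiles\<close>

text \<open>Points of the circle are unit complex numbers \<open>z = exp (i t)\<close>.\<close>

definition calabi_suspension :: "nat \<Rightarrow> ('b \<Rightarrow> cvec) \<Rightarrow> complex \<times> 'b \<Rightarrow> cvec" where
  "calabi_suspension k \<psi> = (\<lambda>(z, p) a.
     if a < k then complex_of_real (sqrt (real k / real (k + 1))) * z * \<psi> p a
     else if a = k then complex_of_real (1 / sqrt (real (k + 1))) * z powi (- int k)
     else 0)"

text \<open>Suspending \<open>m\<close> times, with the product of a circle and the \<open>m\<close>-torus identified with the
  \<open>(m+1)\<close>-torus: the new circle variable is stored as coordinate \<open>m\<close>.\<close>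

primrec iterated_calabi :: "nat \<Rightarrow> ('b \<Rightarrow> cvec) \<Rightarrow> nat \<Rightarrow> cvec \<times> 'b \<Rightarrow> cvec" where
  "iterated_calabi k \<psi> 0 = (\<lambda>(z, p). \<psi> p)"
| "iterated_calabi k \<psi> (Suc m) =
     (\<lambda>(z, p). calabi_suspension (k + m) (iterated_calabi k \<psi> m) (z m, (z(m := 0), p)))"

text \<open>\<open>\<epsilon>\<close>-profile for dimension \<open>n\<close> on \<open>[0,L]\<close> whose first integral has the value \<open>E\<close>.\<close>

definition anciaux_profile :: "nat \<Rightarrow> real \<Rightarrow> real \<Rightarrow> (real \<Rightarrow> complex) \<Rightarrow> real \<Rightarrow> bool" where
  "anciaux_profile n \<epsilon> L \<gamma> E \<longleftrightarrow>
     (\<exists>r \<phi> \<alpha> :: real \<Rightarrow> real.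
        continuous_on {0..L} \<phi> \<and> continuous_on {0..L} \<alpha> \<and>
        (\<forall>s\<in>{0..L}.
           0 < r s \<and> \<gamma> s = complex_of_real (r s) * cis (\<phi> s) \<and>
           (\<gamma> has_vector_derivative cis (\<alpha> s)) (at s within {0..L}) \<and>
           (r has_real_derivative cos (\<alpha> s - \<phi> s)) (at s within {0..L}) \<and>
           ((\<lambda>s. \<alpha> s - \<phi> s) has_real_derivative
              (\<epsilon> * r s - real n / r s) * sin (\<alpha> s - \<phi> s)) (at s within {0..L}) \<and>
           r s ^ n * exp (- \<epsilon> * (r s)\<^sup>2 / 2) * sin (\<alpha> s - \<phi> s) = E) \<and>
        r 0 = 1 \<and> r L = 1 \<and> (\<forall>s\<in>{0<..<L}. r s < 1))"

definition profile_immersion :: "(real \<Rightarrow> complex) \<Rightarrow> ('b \<Rightarrow> cvec) \<Rightarrow> real \<times> 'b \<Rightarrow> cvec" where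
  "profile_immersion \<gamma> \<psi> = (\<lambda>(s, p) a. \<gamma> s * \<psi> p a)"

end

theory Submission
  imports Defs
begin

text \<open>
  Minimality, the soliton equation and the Lagrangian and Legendrian conditions are pointwise
  conditions on the position vector \<open>P\<close>, the first derivatives \<open>E i\<close> and the second derivatives
  \<open>D i j\<close> of the immersion in a single chart. Let \<open>h\<close> be the inverse of the Gram matrix of the \<open>E i\<close>.
  Since a normal component vanishes exactly on tangent vectors, an immersion of dimension \<open>d\<close> into the
  sphere is minimal iff \<open>\<Sum> h i j D i j + d P\<close> is a combination of the \<open>E i\<close> (the second derivatives
  have component \<open>- g i j P\<close> along \<open>P\<close>, and \<open>\<Sum> h i j g i j = d\<close>), and an immersion solves
  \<open>H + \<epsilon> X\<^sup>\<bottom> = 0\<close> iff \<open>\<Sum> h i j D i j + \<epsilon> P\<close> is. The predicates \<open>legendrian_jet\<close> and \<open>soliton_jet\<close>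
  record these conditions; \<open>legendrian_jet_of_immersion\<close>, \<open>legendrian_minimal_of_jets\<close> and
  \<open>lagrangian_soliton_of_jets\<close> translate between them and the geometric notions. The translation needs
  that the tangent space does not depend on the chart (the chain rule, up to the boundary) and that
  second derivatives commute: differentiating \<open>\<langle>J P, E j\<rangle> = 0\<close> shows that \<open>\<langle>J E i, E j\<rangle>\<close>, which
  is antisymmetric, equals the symmetric \<open>- \<langle>J P, D i j\<rangle>\<close>, so both vanish.

  The Calabi suspension and the map \<open>\<gamma>(s) \<psi>(p)\<close> have the common form \<open>A(t) F(x) + B(t)\<close>: a curve
  acts on a known map and adds one coordinate. Their 2-jets are therefore explicit, and their Gram
  matrices consist of one new diagonal entry and a multiple of the old matrix. For the suspension of
  \<open>\<psi>\<close> in complex \<open>k\<close>-space the new entry is \<open>k\<close> and the factor is \<open>k/(k+1)\<close>, and the trace condition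
  reduces to \<open>- 1/k - (k - 1)(k + 1)/k + k = 0\<close> in the first \<open>k\<close> components and to \<open>- k + k = 0\<close> in
  the last (\<open>legendrian_jet_calabi\<close>). For \<open>\<gamma> \<psi>\<close> in complex \<open>n\<close>-space it says that
  \<open>\<gamma>'' - (n - 1) \<gamma> / |\<gamma>|\<^sup>2 + \<epsilon> \<gamma>\<close> is a real multiple of \<open>\<gamma>'\<close> (\<open>profile_jet\<close>), which is
  the equation \<open>\<Theta>' = (\<epsilon> r - n/r) sin \<Theta>\<close> of the profile.

  A profile is only required to be differentiable, but \<open>\<gamma>\<close>, \<open>r\<close>, \<open>1/r\<close>, \<open>cos \<Theta>\<close> and \<open>sin \<Theta>\<close>
  generate an algebra that is closed under differentiation, so it is smooth
  (\<open>anciaux_profile_regular\<close>). For existence (\<open>anciaux_profile_exists\<close>) the first integral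
  \<open>F(r) sin \<Theta> = E\<close>, with \<open>F\<close> increasing on a neighbourhood of \<open>(0, 1]\<close>, gives \<open>r\<close> as a function of
  \<open>\<Theta>\<close>. The equation for \<open>\<Theta>\<close> is then autonomous and is solved by a quadrature, \<open>\<Theta>\<close> decreasing from
  \<open>\<pi> - q\<close> to \<open>q = arcsin (E / F(1))\<close>.

  At an end of the profile \<open>\<gamma>' = \<gamma> e\<^bsup>i\<Theta>\<^esup>\<close>, so the outward conormals \<open>- \<gamma>' \<psi>\<close> and \<open>\<gamma>' \<psi>\<close> are
  \<open>- cos \<Theta> X - sin \<Theta> J X\<close> at the initial end and \<open>cos \<Theta> X + sin \<Theta> J X\<close> at the final one. By the
  first integral \<open>sin \<Theta>\<close> has the same value \<open>E / F(1)\<close> in \<open>(0, 1)\<close> at both ends, and \<open>r < 1\<close> in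
  between forces \<open>cos \<Theta>\<close> to be negative at the first and positive at the second; hence the contact angles
  \<open>\<theta>\<^sub>1 = arccos (E / F(1))\<close> and \<open>\<theta>\<^sub>0 = \<pi> - \<theta>\<^sub>1\<close> (\<open>capillary_boundary\<close>).
\<close>

section \<open>Scalar functions differentiable along the coordinates\<close>

definition slice :: "(nat \<Rightarrow> real) set \<Rightarrow> nat \<Rightarrow> (nat \<Rightarrow> real) \<Rightarrow> real set" where
  "slice V i x = {t. x(i := t) \<in> V}"

text \<open>
  One-sided at points where the slice ends, like \<open>partial_d\<close>, but for scalar functions and as a
  relation.
\<close>

definition has_partial ::
  "(nat \<Rightarrow> real) set \<Rightarrow> nat \<Rightarrow> ((nat \<Rightarrow> real) \<Rightarrow> 'b::real_normed_vector) \<Rightarrow> 'b \<Rightarrow> (nat \<Rightarrow> real) \<Rightarrow> bool"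
  where "has_partial V i h h' x \<longleftrightarrow>
     ((\<lambda>t. h (x(i := t))) has_vector_derivative h') (at (x i) within slice V i x)"

text \<open>
  On such a set derivatives along the coordinates are unique, so that \<open>partial_d\<close> is determined by
  \<open>has_partial\<close>.
\<close>

definition slice_perfect :: "nat \<Rightarrow> (nat \<Rightarrow> real) set \<Rightarrow> bool" where
  "slice_perfect d V \<longleftrightarrow> (\<forall>x\<in>V. \<forall>i<d. x i islimpt slice V i x)"

text \<open>
  In contrast to \<open>Ck_on\<close> the derivatives are only asserted to exist. A closure property can then be
  proved by exhibiting the derivative that the usual rule provides, without knowing that it
  is the one that \<open>vector_derivative\<close> selects.
\<close>

primrec scalar_Ck :: "nat \<Rightarrow> nat \<Rightarrow> (nat \<Rightarrow> real) set \<Rightarrow> ((nat \<Rightarrow> real) \<Rightarrow> 'b::real_normed_vector) \<Rightarrow> bool"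
where
  "scalar_Ck 0 d V h \<longleftrightarrow> continuous_on V h"
| "scalar_Ck (Suc k) d V h \<longleftrightarrow> continuous_on V h \<and>
     (\<forall>i<d. \<exists>h'. (\<forall>x\<in>V. has_partial V i h (h' x) x) \<and> scalar_Ck k d V h')"

lemma partial_d_slice:
  "partial_d V i f x a = vector_derivative (\<lambda>t. f (x(i := t)) a) (at (x i) within slice V i x)"
  by (simp add: partial_d_def slice_def)

lemma mem_slice_self: "x \<in> V \<Longrightarrow> x i \<in> slice V i x"
  by (simp add: slice_def)

lemma has_partial_cong:
  assumes "\<And>y. y \<in> V \<Longrightarrow> f y = g y" "x \<in> V"
  shows "has_partial V i f f' x \<longleftrightarrow> has_partial V i g f' x"
  unfolding has_partial_def
  by (rule has_vector_derivative_cong_ev)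
     (auto intro!: always_eventually simp: assms slice_def eventually_at_filter)

lemma has_partial_unique:
  assumes "has_partial V i f u x" "has_partial V i f v x" "slice_perfect d V" "x \<in> V" "i < d"
  shows "u = v"
proof -
  have "at (x i) within slice V i x \<noteq> bot"
    using assms(3-5) by (auto simp: slice_perfect_def trivial_limit_within)
  then show ?thesis
    using assms(1,2) vector_derivative_unique_within unfolding has_partial_def by blast
qed

lemma partial_d_eqI:
  assumes "has_partial V i (\<lambda>y. f y a) u x" "slice_perfect d V" "x \<in> V" "i < d"
  shows "partial_d V i f x a = u"
proof -
  have "at (x i) within slice V i x \<noteq> bot"
    using assms(2-4) by (auto simp: slice_perfect_def trivial_limit_within)
  then show ?thesis
    using assms(1) by (simp add: has_partial_def partial_d_slice vector_derivative_within)
qed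

lemma partial_d_cong:
  assumes "\<And>y. y \<in> V \<Longrightarrow> f y = g y" "x \<in> V"
  shows "partial_d V i f x = partial_d V i g x"
proof
  fix a
  have "has_partial V i (\<lambda>y. f y a) u x \<longleftrightarrow> has_partial V i (\<lambda>y. g y a) u x" for u
    by (rule has_partial_cong) (use assms in auto)
  then show "partial_d V i f x a = partial_d V i g x a"
    by (simp add: partial_d_slice vector_derivative_def has_partial_def)
qed

lemma scalar_Ck_cong:
  assumes "\<And>y. y \<in> V \<Longrightarrow> f y = g y" "scalar_Ck k d V f"
  shows "scalar_Ck k d V g"
proof (cases k)
  case 0
  then show ?thesis using assms continuous_on_cong[of V V f g] by simp
next
  case (Suc l)
  have "continuous_on V f" using assms(2) Suc by simp
  then have "continuous_on V g" using assms(1) continuous_on_cong[of V V f g] by simp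
  then show ?thesis
    using assms Suc has_partial_cong[of V f g] by simp
qed

lemma scalar_Ck_imp_continuous: "scalar_Ck k d V h \<Longrightarrow> continuous_on V h"
  by (cases k) auto

lemma scalar_Ck_Suc_D: "scalar_Ck (Suc k) d V h \<Longrightarrow> scalar_Ck k d V h"
proof (induction k arbitrary: h)
  case 0
  then show ?case by simp
next
  case (Suc k)
  have "continuous_on V h" "\<And>i. i < d \<Longrightarrow> \<exists>h'. (\<forall>x\<in>V. has_partial V i h (h' x) x) \<and> scalar_Ck k d V h'"
    using Suc.prems Suc.IH unfolding scalar_Ck.simps(2)[of "Suc k"] by blast+
  then show ?case by simp
qed

lemma scalar_Ck_const: "scalar_Ck k d V (\<lambda>x. c)"
proof (induction k arbitrary: c)
  case (Suc k)
  then show ?case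
    by (auto simp: has_partial_def intro!: exI[of _ "\<lambda>x. 0"])
qed simp

lemma scalar_Ck_add: "scalar_Ck k d V f \<Longrightarrow> scalar_Ck k d V g \<Longrightarrow> scalar_Ck k d V (\<lambda>x. f x + g x)"
proof (induction k arbitrary: f g)
  case 0
  then show ?case by (simp add: continuous_on_add)
next
  case (Suc k)
  have "\<exists>h'. (\<forall>x\<in>V. has_partial V i (\<lambda>x. f x + g x) (h' x) x) \<and> scalar_Ck k d V h'" if i: "i < d" for i
  proof -
    obtain f' g' where "\<forall>x\<in>V. has_partial V i f (f' x) x" "scalar_Ck k d V f'"
      "\<forall>x\<in>V. has_partial V i g (g' x) x" "scalar_Ck k d V g'"
      using Suc.prems i unfolding scalar_Ck.simps by blast
    then show ?thesis
      using Suc.IH[of f' g']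
      by (intro exI[of _ "\<lambda>x. f' x + g' x"]) (auto simp: has_partial_def intro!: has_vector_derivative_add)
  qed
  then show ?case using Suc.prems by (auto intro: continuous_on_add)
qed

lemma scalar_Ck_mult:
  fixes f g :: "(nat \<Rightarrow> real) \<Rightarrow> 'b::real_normed_algebra"
  shows "scalar_Ck k d V f \<Longrightarrow> scalar_Ck k d V g \<Longrightarrow> scalar_Ck k d V (\<lambda>x. f x * g x)"
proof (induction k arbitrary: f g)
  case 0
  then show ?case by (simp add: continuous_on_mult)
next
  case (Suc k)
  have "\<exists>h'. (\<forall>x\<in>V. has_partial V i (\<lambda>x. f x * g x) (h' x) x) \<and> scalar_Ck k d V h'" if i: "i < d" for i
  proof -
    obtain f' g' where *: "\<forall>x\<in>V. has_partial V i f (f' x) x" "scalar_Ck k d V f'"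
      "\<forall>x\<in>V. has_partial V i g (g' x) x" "scalar_Ck k d V g'"
      using Suc.prems i unfolding scalar_Ck.simps by blast
    have "has_partial V i (\<lambda>x. f x * g x) (f x * g' x + f' x * g x) x" if "x \<in> V" for x
      using has_vector_derivative_mult[of "\<lambda>t. f (x(i := t))" "f' x" "x i" _ "\<lambda>t. g (x(i := t))" "g' x"]
        * that by (simp add: has_partial_def)
    moreover have "scalar_Ck k d V (\<lambda>x. f x * g' x + f' x * g x)"
      using * Suc.prems Suc.IH[of f g'] Suc.IH[of f' g] scalar_Ck_Suc_D scalar_Ck_add by blast
    ultimately show ?thesis by (intro exI[of _ "\<lambda>x. f x * g' x + f' x * g x"]) simp
  qed
  then show ?case using Suc.prems by (auto intro: continuous_on_mult)
qed

text \<open>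
  Continuity in the product topology is componentwise, and on a slice-perfect set every derivative
  that \<open>scalar_Ck\<close> provides is the one that \<open>partial_d\<close> computes.
\<close>

lemma Ck_on_iff_scalar_Ck:
  assumes "slice_perfect d V"
  shows "Ck_on k d V f \<longleftrightarrow> (\<forall>a. scalar_Ck k d V (\<lambda>x. f x a))"
proof (induction k arbitrary: f)
  case 0
  show ?case
    by (auto intro: continuous_on_product_then_coordinatewise continuous_on_coordinatewise_then_product)
next
  case (Suc k)
  have cont: "continuous_on V f \<longleftrightarrow> (\<forall>a. continuous_on V (\<lambda>x. f x a))"
    by (auto intro: continuous_on_product_then_coordinatewise continuous_on_coordinatewise_then_product)
  show ?case
  proof
    assume L: "Ck_on (Suc k) d V f"
    have "\<exists>h'. (\<forall>x\<in>V. has_partial V i (\<lambda>x. f x a) (h' x) x) \<and> scalar_Ck k d V h'" if i: "i < d" for i a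
    proof (intro exI conjI ballI)
      fix x assume "x \<in> V"
      then show "has_partial V i (\<lambda>x. f x a) (partial_d V i f x a) x"
        using L i by (simp add: has_partial_def partial_d_slice partially_differentiable_def
            vector_derivative_works flip: slice_def)
    next
      show "scalar_Ck k d V (\<lambda>x. partial_d V i f x a)"
        using L i Suc.IH by simp
    qed
    then show "\<forall>a. scalar_Ck (Suc k) d V (\<lambda>x. f x a)" using L cont by simp
  next
    assume R: "\<forall>a. scalar_Ck (Suc k) d V (\<lambda>x. f x a)"
    have "partially_differentiable V i f \<and> Ck_on k d V (partial_d V i f)" if i: "i < d" for i
    proof -
      have "\<exists>h'. (\<forall>x\<in>V. has_partial V i (\<lambda>x. f x a) (h' x) x) \<and> scalar_Ck k d V h'" for a
        using R i by simp
      then obtain h' where h': "\<And>a x. x \<in> V \<Longrightarrow> has_partial V i (\<lambda>x. f x a) (h' a x) x"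
        and C: "\<And>a. scalar_Ck k d V (h' a)"
        by metis
      have "partially_differentiable V i f"
        using h' by (auto simp: partially_differentiable_def has_partial_def simp flip: slice_def
            intro!: differentiableI_vector)
      moreover have "scalar_Ck k d V (\<lambda>x. partial_d V i f x a)" for a
        using C by (rule scalar_Ck_cong[rotated]) (use partial_d_eqI[OF h' assms _ i] in auto)
      ultimately show ?thesis using Suc.IH by blast
    qed
    then show "Ck_on (Suc k) d V f" using R cont by simp
  qed
qed

lemma smooth_on_partial_d:
  assumes "smooth_on d V f" "i < d"
  shows "smooth_on d V (partial_d V i f)"
  unfolding smooth_on_def
proof
  fix k
  have "Ck_on (Suc k) d V f" using assms by (simp add: smooth_on_def)
  then show "Ck_on k d V (partial_d V i f)" using assms(2) by simp
qed

lemma smooth_on_has_partial: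
  assumes "smooth_on d V f" "i < d" "x \<in> V"
  shows "has_partial V i (\<lambda>x. f x a) (partial_d V i f x a) x"
proof -
  have "Ck_on (Suc 0) d V f" using assms by (simp add: smooth_on_def)
  then show ?thesis using assms by (simp add: has_partial_def partial_d_slice partially_differentiable_def
            vector_derivative_works flip: slice_def)
qed

lemma smooth_on_continuous: "smooth_on d V f \<Longrightarrow> continuous_on V f"
  unfolding smooth_on_def using Ck_on.simps(1) by blast

text \<open>
  A substitution \<open>B\<close> that passes on each coordinate of its argument to at most one coordinate of the
  result needs no chain rule: each partial derivative of the composition is a partial derivative of \<open>g\<close>
  or zero. Dropping a coordinate and splitting off a group of coordinates are of this kind.
\<close>

lemma scalar_Ck_reindex:
  assumes "B ` V \<subseteq> W" "continuous_on V B"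
    and B: "\<And>i. i < d \<Longrightarrow> (\<exists>j<d'. \<forall>x\<in>V. x i = B x j \<and> (\<forall>t. B (x(i := t)) = (B x)(j := t)))
                   \<or> (\<forall>x\<in>V. \<forall>t. B (x(i := t)) = B x)"
    and "scalar_Ck k d' W g"
  shows "scalar_Ck k d V (\<lambda>x. g (B x))"
  using assms(4)
proof (induction k arbitrary: g)
  case 0
  then show ?case using continuous_on_compose2[of W g V B] assms(1,2) by simp
next
  case (Suc k)
  have "\<exists>h'. (\<forall>x\<in>V. has_partial V i (\<lambda>x. g (B x)) (h' x) x) \<and> scalar_Ck k d V h'" if i: "i < d" for i
    using B[OF i]
  proof
    assume "\<exists>j<d'. \<forall>x\<in>V. x i = B x j \<and> (\<forall>t. B (x(i := t)) = (B x)(j := t))"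
    then obtain j where j: "j < d'"
      and Bj: "\<And>x t. x \<in> V \<Longrightarrow> B (x(i := t)) = (B x)(j := t)" "\<And>x. x \<in> V \<Longrightarrow> x i = B x j"
      by blast
    obtain g' where g': "\<forall>y\<in>W. has_partial W j g (g' y) y" "scalar_Ck k d' W g'"
      using Suc.prems j by auto
    have "has_partial V i (\<lambda>x. g (B x)) (g' (B x)) x" if x: "x \<in> V" for x
    proof -
      have "slice V i x \<subseteq> slice W j (B x)"
        using assms(1) Bj(1)[OF x] by (force simp: slice_def)
      moreover have "((\<lambda>t. g ((B x)(j := t))) has_vector_derivative g' (B x))
          (at (B x j) within slice W j (B x))"
        using g' x assms(1) by (auto simp: has_partial_def)
      ultimately show ?thesis
        using Bj x by (auto simp: has_partial_def intro: has_vector_derivative_within_subset)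
    qed
    then show ?thesis using Suc.IH[OF g'(2)] by (intro exI[of _ "\<lambda>x. g' (B x)"]) simp
  next
    assume *: "\<forall>x\<in>V. \<forall>t. B (x(i := t)) = B x"
    have "has_partial V i (\<lambda>x. g (B x)) 0 x" if "x \<in> V" for x
    proof -
      have "(\<lambda>t. g (B (x(i := t)))) = (\<lambda>t. g (B x))" using * that by metis
      then show ?thesis by (simp add: has_partial_def)
    qed
    then show ?thesis by (intro exI[of _ "\<lambda>x. 0"]) (simp add: scalar_Ck_const)
  qed
  moreover have "continuous_on V (\<lambda>x. g (B x))"
    using continuous_on_compose2[of W g V B] assms(1,2) Suc.prems by simp
  ultimately show ?case unfolding scalar_Ck.simps by blast
qed

text \<open>
  Smoothness on \<open>S\<close> as a coinductive property: a function is smooth if it belongs to a family that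
  contains a derivative of each of its members. For exponentials and for solutions of differential
  equations such a family is easier to name than the higher derivatives are.
\<close>

definition smooth_curve :: "real set \<Rightarrow> (real \<Rightarrow> 'b::real_normed_vector) \<Rightarrow> bool" where
  "smooth_curve S u \<longleftrightarrow> (\<exists>A. u \<in> A \<and>
     (\<forall>f\<in>A. \<exists>f'\<in>A. \<forall>t\<in>S. (f has_vector_derivative f' t) (at t within S)))"

lemma smooth_curve_derivative:
  assumes "smooth_curve S u"
  obtains u' where "smooth_curve S u'" "\<And>t. t \<in> S \<Longrightarrow> (u has_vector_derivative u' t) (at t within S)"
proof -
  obtain A where A: "u \<in> A"
    "\<forall>f\<in>A. \<exists>f'\<in>A. \<forall>t\<in>S. (f has_vector_derivative f' t) (at t within S)"
    using assms unfolding smooth_curve_def by blast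
  then obtain u' where "u' \<in> A" "\<forall>t\<in>S. (u has_vector_derivative u' t) (at t within S)" by blast
  then show thesis using A(2) that unfolding smooth_curve_def by blast
qed

lemma smooth_curve_imp_scalar_Ck:
  assumes "\<And>x. x \<in> V \<Longrightarrow> slice V m x \<subseteq> S" "smooth_curve S u"
  shows "scalar_Ck k d V (\<lambda>x. u (x m))"
  using assms(2)
proof (induction k arbitrary: u)
  case 0
  then obtain u' where "\<And>t. t \<in> S \<Longrightarrow> (u has_vector_derivative u' t) (at t within S)"
    using smooth_curve_derivative by blast
  then have "continuous_on S u"
    by (meson continuous_on_eq_continuous_within has_vector_derivative_continuous)
  moreover have "x m \<in> S" if "x \<in> V" for x using assms(1)[OF that] mem_slice_self[OF that] by blast
  ultimately have "continuous_on V (\<lambda>x. u (x m))"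
    by (intro continuous_on_compose2[of S u V "\<lambda>x. x m"]
        continuous_on_subset[OF continuous_on_product_coordinates]) auto
  then show ?case by simp
next
  case (Suc k)
  obtain u' where u': "smooth_curve S u'" "\<And>t. t \<in> S \<Longrightarrow> (u has_vector_derivative u' t) (at t within S)"
    using smooth_curve_derivative[OF Suc.prems] by blast
  have "\<exists>h'. (\<forall>x\<in>V. has_partial V i (\<lambda>x. u (x m)) (h' x) x) \<and> scalar_Ck k d V h'" for i
  proof (cases "i = m")
    case True
    have "has_partial V i (\<lambda>x. u (x m)) (u' (x m)) x" if "x \<in> V" for x
      using u'(2)[of "x m"] assms(1)[OF that] mem_slice_self[OF that, of m] True
      by (auto simp: has_partial_def intro: has_vector_derivative_within_subset)
    then show ?thesis using Suc.IH[OF u'(1)] by (intro exI[of _ "\<lambda>x. u' (x m)"]) simp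
  next
    case False
    then have "has_partial V i (\<lambda>x. u (x m)) 0 x" for x by (simp add: has_partial_def)
    then show ?thesis by (intro exI[of _ "\<lambda>x. 0"]) (simp add: scalar_Ck_const)
  qed
  moreover have "continuous_on V (\<lambda>x. u (x m))"
    using scalar_Ck_imp_continuous[OF Suc.IH[OF Suc.prems]] .
  ultimately show ?case unfolding scalar_Ck.simps by blast
qed

section \<open>The chain rule on open subsets of a half-space\<close>

lemma Euclidean_space_top_of_set: "Euclidean_space d = top_of_set {x. \<forall>i\<ge>d. x i = 0}"
  by (simp add: Euclidean_space_def euclidean_product_topology)

text \<open>
  Chart ranges of both kinds are relatively open subsets of a product \<open>Q\<close> of lines, half-lines and points.
  In such a product single coordinates can be moved along segments.
\<close>

definition orthant_open :: "nat \<Rightarrow> (nat \<Rightarrow> real set) \<Rightarrow> (nat \<Rightarrow> real) set \<Rightarrow> bool" where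
  "orthant_open d Q V \<longleftrightarrow>
     (\<forall>i<d. Q i = UNIV \<or> Q i = {0..}) \<and> (\<forall>i\<ge>d. Q i = {0}) \<and>
     (\<exists>G. open G \<and> V = G \<inter> {x. \<forall>i. x i \<in> Q i})"

lemma openin_Euclidean_orthant:
  assumes "openin (Euclidean_space d) V"
  shows "orthant_open d (\<lambda>i. if i < d then UNIV else {0}) V"
proof -
  obtain G where "open G" "V = G \<inter> {x. \<forall>i\<ge>d. x i = 0}"
    using assms by (auto simp: Euclidean_space_top_of_set openin_open)
  moreover have "{x. \<forall>i\<ge>d. x i = 0} = {x. \<forall>i. x i \<in> (if i < d then UNIV else {0::real})}"
    by (auto simp: not_less)
  ultimately show ?thesis by (auto simp: orthant_open_def)
qed

lemma openin_half_space_orthant: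
  assumes "openin (half_space d) V"
  shows "orthant_open d (\<lambda>i. if i < d then if i = 0 then {0..} else UNIV else {0}) V"
proof -
  have "openin (top_of_set ({x. \<forall>i\<ge>d. x i = 0} \<inter> {x. 0 \<le> x 0})) V"
    using assms by (simp add: half_space_def Euclidean_space_top_of_set subtopology_subtopology)
  then obtain G where G: "open G" "V = ({x. \<forall>i\<ge>d. x i = 0} \<inter> {x. 0 \<le> x 0}) \<inter> G"
    unfolding openin_open by blast
  moreover have "{x. \<forall>i\<ge>d. x i = 0} \<inter> {x. 0 \<le> x 0} =
      {x. \<forall>i. x i \<in> (if i < d then if i = 0 then {0..} else UNIV else {0::real})}"
  proof (intro set_eqI iffI)
    fix x :: "nat \<Rightarrow> real"
    assume "x \<in> {x. \<forall>i\<ge>d. x i = 0} \<inter> {x. 0 \<le> x 0}"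
    then show "x \<in> {x. \<forall>i. x i \<in> (if i < d then if i = 0 then {0..} else UNIV else {0})}" by simp
  next
    fix x :: "nat \<Rightarrow> real"
    assume "x \<in> {x. \<forall>i. x i \<in> (if i < d then if i = 0 then {0..} else UNIV else {0})}"
    then have x: "x i \<in> (if i < d then if i = 0 then {0..} else UNIV else {0})" for i by simp
    have "x i = 0" if "i \<ge> d" for i using x[of i] that by simp
    moreover have "0 \<le> x 0" using x[of 0] by (simp split: if_splits)
    ultimately show "x \<in> {x. \<forall>i\<ge>d. x i = 0} \<inter> {x. 0 \<le> x 0}" by simp
  qed
  ultimately have "V = G \<inter> {x. \<forall>i. x i \<in> (if i < d then if i = 0 then {0..} else UNIV else {0})}"
    by (simp add: Int_commute)
  then show ?thesis using G(1) unfolding orthant_open_def by (intro conjI exI[of _ G]) auto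
qed

lemma chart_range_orthant: "chart_range d V \<Longrightarrow> \<exists>Q. orthant_open d Q V"
  unfolding chart_range_def
  by (elim disjE) (rule exI, erule openin_Euclidean_orthant, rule exI, erule openin_half_space_orthant)

text \<open>
  A basic open set of the product topology constrains finitely many coordinates only, so the
  smallest of their widths serves for all coordinates.
\<close>

lemma open_contains_cube:
  fixes x :: "nat \<Rightarrow> real"
  assumes "open G" "x \<in> G"
  obtains \<delta> where "\<delta> > 0" "\<And>z. (\<And>i. \<bar>z i - x i\<bar> < \<delta>) \<Longrightarrow> z \<in> G"
proof -
  have "openin (product_topology (\<lambda>i. euclidean) UNIV) G"
    using assms(1) by (simp add: euclidean_product_topology)
  then obtain U where "finite {i \<in> UNIV. U i \<noteq> topspace euclidean}"
    "\<forall>i\<in>UNIV. openin euclidean (U i)" "x \<in> Pi\<^sub>E UNIV U" "Pi\<^sub>E UNIV U \<subseteq> G"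
    using assms(2) unfolding openin_product_topology_alt by blast
  then have U: "finite {i. U i \<noteq> UNIV}" "\<And>i. open (U i)" "\<And>i. x i \<in> U i"
    "Pi\<^sub>E UNIV U \<subseteq> G"
    by (simp_all add: PiE_iff)
  have "\<exists>\<epsilon>>0. \<forall>y. \<bar>y - x i\<bar> < \<epsilon> \<longrightarrow> y \<in> U i" for i
    using U(2)[of i] U(3)[of i] unfolding open_dist by (auto simp: dist_real_def)
  then obtain \<epsilon> where \<epsilon>: "\<And>i. \<epsilon> i > 0" "\<And>i y. \<bar>y - x i\<bar> < \<epsilon> i \<Longrightarrow> y \<in> U i"
    by metis
  define \<delta> where "\<delta> = Min (insert 1 (\<epsilon> ` {i. U i \<noteq> UNIV}))"
  have "\<delta> > 0" using U(1) \<epsilon>(1) by (simp add: \<delta>_def)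
  moreover have "z \<in> G" if z: "\<And>i. \<bar>z i - x i\<bar> < \<delta>" for z
  proof -
    have "z i \<in> U i" for i
    proof (cases "U i = UNIV")
      case False
      then have "\<delta> \<le> \<epsilon> i" using U(1) by (simp add: \<delta>_def)
      then show ?thesis using \<epsilon>(2) z[of i] by force
    qed simp
    then show ?thesis using U(4) by (auto simp: PiE_iff)
  qed
  ultimately show thesis using that by blast
qed

lemma orthant_open_cube:
  assumes "orthant_open d Q V" "x \<in> V"
  obtains \<delta> where "\<delta> > 0" "\<And>z. (\<And>i. z i \<in> Q i) \<Longrightarrow> (\<And>i. \<bar>z i - x i\<bar> < \<delta>) \<Longrightarrow> z \<in> V"
proof -
  obtain G where "open G" "V = G \<inter> {x. \<forall>i. x i \<in> Q i}"
    using assms(1) by (auto simp: orthant_open_def)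
  moreover from this assms(2) have "x \<in> G" by simp
  ultimately obtain \<delta> where "\<delta> > 0" "\<And>z. (\<And>i. \<bar>z i - x i\<bar> < \<delta>) \<Longrightarrow> z \<in> G"
    using open_contains_cube[of G x] by metis
  with \<open>V = _\<close> show thesis by (intro that[of \<delta>]) simp_all
qed

lemma orthant_open_mem: "orthant_open d Q V \<Longrightarrow> x \<in> V \<Longrightarrow> x i \<in> Q i"
  by (auto simp: orthant_open_def)

lemma orthant_open_slice_perfect:
  assumes "orthant_open d Q V"
  shows "slice_perfect d V"
  unfolding slice_perfect_def
proof (intro ballI allI impI)
  fix x i assume x: "x \<in> V" and i: "i < d"
  obtain \<delta> where \<delta>: "\<delta> > 0" "\<And>z. (\<And>i. z i \<in> Q i) \<Longrightarrow> (\<And>i. \<bar>z i - x i\<bar> < \<delta>) \<Longrightarrow> z \<in> V"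
    using orthant_open_cube[OF assms x] by blast
  show "x i islimpt slice V i x"
    unfolding islimpt_approachable
  proof (intro allI impI)
    fix e :: real assume "e > 0"
    define t where "t = x i + min e \<delta> / 2"
    have "t \<in> Q i"
      using assms i orthant_open_mem[OF assms x, of i] \<open>e > 0\<close> \<open>\<delta> > 0\<close>
      by (auto simp: orthant_open_def t_def)
    then have "x(i := t) \<in> V"
      using \<open>e > 0\<close> \<delta>(1) orthant_open_mem[OF assms x] by (intro \<delta>(2)) (auto simp: t_def)
    then show "\<exists>x'\<in>slice V i x. x' \<noteq> x i \<and> dist x' (x i) < e"
      using \<open>e > 0\<close> \<open>\<delta> > 0\<close>
      by (intro bexI[of _ t]) (auto simp: slice_def t_def dist_real_def)
  qed
qed

lemma chart_range_slice_perfect: "chart_range d V \<Longrightarrow> slice_perfect d V"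
  using chart_range_orthant orthant_open_slice_perfect by blast

text \<open>
  Because \<open>u\<close> vanishes at \<open>t0\<close>, the product rule needs only a limit of \<open>m\<close> there, not a derivative.
\<close>

lemma has_vector_derivative_scaleR_vanishing:
  fixes m :: "real \<Rightarrow> 'b::real_normed_vector"
  assumes u: "(u has_real_derivative u') (at t0 within T)" "u t0 = 0"
    and m: "(m \<longlongrightarrow> m0) (at t0 within T)"
  shows "((\<lambda>t. u t *\<^sub>R m t) has_vector_derivative u' *\<^sub>R m0) (at t0 within T)"
proof -
  have q: "((\<lambda>t. u t / (t - t0)) \<longlongrightarrow> u') (at t0 within T)"
    using u by (simp add: has_field_derivative_iff)
  then have "((\<lambda>t. (u t / (t - t0)) *\<^sub>R m t - u' *\<^sub>R m0) \<longlongrightarrow> u' *\<^sub>R m0 - u' *\<^sub>R m0) (at t0 within T)"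
    using m by (intro tendsto_intros)
  then have *: "((\<lambda>t. (u t / (t - t0)) *\<^sub>R m t - u' *\<^sub>R m0) \<longlongrightarrow> 0) (at t0 within T)" by simp
  have "((\<lambda>t. (1 / norm (t - t0)) *\<^sub>R (u t *\<^sub>R m t - (t - t0) *\<^sub>R (u' *\<^sub>R m0))) \<longlongrightarrow> 0) (at t0 within T)"
  proof (rule Lim_transform_eventually[OF tendsto_norm_zero_cancel])
    show "((\<lambda>t. norm (sgn (t - t0) *\<^sub>R ((u t / (t - t0)) *\<^sub>R m t - u' *\<^sub>R m0))) \<longlongrightarrow> 0) (at t0 within T)"
      by (rule Lim_null_comparison[OF _ tendsto_norm_zero[OF *]])
        (auto simp: sgn_real_def eventually_at_filter)
    show "\<forall>\<^sub>F t in at t0 within T. sgn (t - t0) *\<^sub>R ((u t / (t - t0)) *\<^sub>R m t - u' *\<^sub>R m0) =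
        (1 / norm (t - t0)) *\<^sub>R (u t *\<^sub>R m t - (t - t0) *\<^sub>R (u' *\<^sub>R m0))"
      unfolding eventually_at_filter
    proof (intro always_eventually allI impI)
      fix t assume "t \<noteq> t0"
      then have "1 / norm (t - t0) = sgn (t - t0) / (t - t0)"
        by (simp add: sgn_real_def abs_if minus_divide_right)
      then show "sgn (t - t0) *\<^sub>R ((u t / (t - t0)) *\<^sub>R m t - u' *\<^sub>R m0) =
        (1 / norm (t - t0)) *\<^sub>R (u t *\<^sub>R m t - (t - t0) *\<^sub>R (u' *\<^sub>R m0))"
        using \<open>t \<noteq> t0\<close> by (simp add: scaleR_right_diff_distrib)
    qed
  qed
  then show ?thesis
    using u(2) bounded_linear_scaleR_left[of "u' *\<^sub>R m0"]
    by (simp add: has_vector_derivative_def has_derivative_within)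
qed

text \<open>
  Up to the boundary of \<open>V\<close> continuous partial derivatives are all that is known of \<open>G\<close>. Therefore the
  coordinates of \<open>c t0\<close> are replaced by those of \<open>c t\<close> one at a time; each step changes one coordinate, so
  that the mean value inequality for the corresponding partial derivative applies, and the steps add up.
\<close>

lemma chain_rule_partials:
  fixes G :: "(nat \<Rightarrow> real) \<Rightarrow> 'b::real_normed_vector"
  assumes V: "orthant_open d Q V"
    and G: "\<And>j y. j < d \<Longrightarrow> y \<in> V \<Longrightarrow> has_partial V j G (G' j y) y"
    and G'_cont: "\<And>j. j < d \<Longrightarrow> continuous_on V (G' j)"
    and c: "\<And>t. t \<in> T \<Longrightarrow> c t \<in> V" "t0 \<in> T"
    and c': "\<And>j. j < d \<Longrightarrow> ((\<lambda>t. c t j) has_real_derivative c' j) (at t0 within T)"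
  shows "((\<lambda>t. G (c t)) has_vector_derivative (\<Sum>j<d. c' j *\<^sub>R G' j (c t0))) (at t0 within T)"
proof -
  define x where "x = c t0"
  have x: "x \<in> V" using c by (simp add: x_def)
  (* the intermediate point with the first j coordinates already moved *)
  define z where "z t j = (\<lambda>i. if i < j then c t i else x i)" for t and j :: nat
  have step: "((\<lambda>t. G (z t (Suc j)) - G (z t j)) has_vector_derivative c' j *\<^sub>R G' j x)
      (at t0 within T)" if j: "j < d" for j
  proof -
    (* the difference quotient of G in coordinate j; its limit is the j-th partial derivative *)
    define m where "m t = (if c t j = x j then G' j x
        else (1 / (c t j - x j)) *\<^sub>R (G (z t (Suc j)) - G (z t j)))" for t
    have zS: "z t (Suc j) = (z t j)(j := c t j)" "z t j = (z t j)(j := x j)" for t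
      by (auto simp: z_def)
    have eq: "G (z t (Suc j)) - G (z t j) = (c t j - x j) *\<^sub>R m t" for t
      using zS[of t] by (auto simp: m_def)
    have "(m \<longlongrightarrow> G' j x) (at t0 within T)"
    proof (rule tendstoI)
      fix e :: real assume "e > 0"
      obtain \<delta>1 where \<delta>1: "\<delta>1 > 0"
        "\<And>z. (\<And>i. z i \<in> Q i) \<Longrightarrow> (\<And>i. \<bar>z i - x i\<bar> < \<delta>1) \<Longrightarrow> z \<in> V"
        using orthant_open_cube[OF V x] by blast
      obtain A where A: "open A" "A \<inter> V = G' j -` ball (G' j x) (e/4) \<inter> V"
        using G'_cont[OF j] unfolding continuous_on_open_invariant by (meson open_ball)
      have "x \<in> A" using A(2) x \<open>e > 0\<close> by auto
      then obtain \<delta>2 where \<delta>2: "\<delta>2 > 0" "\<And>z. (\<And>i. \<bar>z i - x i\<bar> < \<delta>2) \<Longrightarrow> z \<in> A"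
        using open_contains_cube[OF A(1)] by blast
      define \<delta> where "\<delta> = min \<delta>1 \<delta>2"
      have \<delta>: "\<delta> > 0" using \<delta>1 \<delta>2 by (simp add: \<delta>_def)
      have "\<forall>\<^sub>F t in at t0 within T. \<bar>c t i - x i\<bar> < \<delta>" if "i < d" for i
      proof -
        have "continuous (at t0 within T) (\<lambda>t. c t i)"
          using c'[OF that] by (rule DERIV_continuous)
        then have "((\<lambda>t. c t i) \<longlongrightarrow> x i) (at t0 within T)"
          by (simp add: continuous_within x_def)
        then show ?thesis using \<delta> by (auto simp: tendsto_iff dist_real_def)
      qed
      then have "\<forall>\<^sub>F t in at t0 within T. \<forall>i\<in>{..<d}. \<bar>c t i - x i\<bar> < \<delta>"
        by (intro eventually_ball_finite) auto
      moreover have "\<forall>\<^sub>F t in at t0 within T. t \<in> T"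
        by (simp add: eventually_at_filter)
      ultimately show "\<forall>\<^sub>F t in at t0 within T. dist (m t) (G' j x) < e"
      proof eventually_elim
        case (elim t)
        have ct: "\<bar>c t i - x i\<bar> < \<delta>" for i
        proof (cases "i < d")
          case False
          then have "c t i = 0" "x i = 0"
            using orthant_open_mem[OF V c(1)[OF elim(2)], of i] orthant_open_mem[OF V x, of i] V
            by (auto simp: orthant_open_def)
          then show ?thesis using \<delta> by simp
        qed (use elim in auto)
        (* along this segment coordinate j moves, and it stays inside the orthant and the cube *)
        define S where "S = closed_segment (x j) (c t j)"
        have SQ: "s \<in> Q j" "\<bar>s - x j\<bar> < \<delta>" if "s \<in> S" for s
        proof -
          have "Q j = UNIV \<or> Q j = {0..}" using V j by (auto simp: orthant_open_def)
          moreover have s: "min (x j) (c t j) \<le> s \<and> s \<le> max (x j) (c t j)"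
            using that by (simp add: S_def closed_segment_eq_real_ivl split: if_splits)
          moreover have "c t j \<in> Q j" "x j \<in> Q j"
            using orthant_open_mem[OF V c(1)[OF elim(2)], of j] orthant_open_mem[OF V x, of j] .
          ultimately show "s \<in> Q j" by (elim disjE) (auto simp: min_def split: if_splits)
          show "\<bar>s - x j\<bar> < \<delta>" using s ct[of j] by linarith
        qed
        define w where "w s = (z t j)(j := s)" for s
        have w: "w s \<in> V" "w s \<in> A" if "s \<in> S" for s
        proof -
          have wi: "w s i = (if i = j then s else if i < j then c t i else x i)" for i
            by (simp add: w_def z_def)
          have "w s i \<in> Q i" for i
            using SQ(1)[OF that] orthant_open_mem[OF V c(1)[OF elim(2)], of i]
              orthant_open_mem[OF V x, of i] by (simp add: wi)
          moreover have "\<bar>w s i - x i\<bar> < \<delta>" for i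
            using SQ(2)[OF that] ct[of i] \<delta> by (simp add: wi)
          ultimately show "w s \<in> V" "w s \<in> A"
            using \<delta>1(2)[of "w s"] \<delta>2(2)[of "w s"] by (auto simp: \<delta>_def)
        qed
        have near: "norm (G' j (w s) - G' j x) \<le> e/4" if "s \<in> S" for s
        proof -
          have "w s \<in> A \<inter> V" using w[OF that] by simp
          then have "G' j (w s) \<in> ball (G' j x) (e/4)" using A(2) by blast
          then show ?thesis by (simp add: dist_norm norm_minus_commute)
        qed
        have ends: "x j \<in> S" "c t j \<in> S" by (auto simp: S_def)
        have "((\<lambda>s. G (w s)) has_vector_derivative G' j (w s)) (at s within S)" if "s \<in> S" for s
        proof -
          have "has_partial V j G (G' j (w s)) (w s)" using G[OF j w(1)[OF that]] .
          then have "((\<lambda>s. G (w s)) has_vector_derivative G' j (w s)) (at s within slice V j (w s))"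
            by (simp add: has_partial_def w_def)
          moreover have "S \<subseteq> slice V j (w s)"
            using w(1) by (auto simp: slice_def w_def)
          ultimately show ?thesis by (rule has_vector_derivative_within_subset)
        qed
        moreover have "norm (G' j (w s) - G' j (w (x j))) \<le> e/2" if "s \<in> S" for s
          using norm_triangle_sub[of "G' j (w s) - G' j (w (x j))"] near[OF that] near[OF ends(1)]
            norm_triangle_ineq4[of "G' j (w s) - G' j x" "G' j (w (x j)) - G' j x"] by simp
        ultimately have "norm (G (w (c t j)) - G (w (x j)) - (c t j - x j) *\<^sub>R G' j (w (x j)))
            \<le> norm (c t j - x j) * (e/2)"
          using ends by (intro vector_differentiable_bound_linearization[where S = S and ?x0.0 = "x j"])
            (auto simp: S_def)
        then have bd: "norm ((c t j - x j) *\<^sub>R (m t - G' j (w (x j)))) \<le> \<bar>c t j - x j\<bar> * (e/2)"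
          using eq[of t] zS[of t] by (simp add: w_def scaleR_right_diff_distrib)
        show "dist (m t) (G' j x) < e"
        proof (cases "c t j = x j")
          case True
          then show ?thesis using \<open>e > 0\<close> by (simp add: m_def)
        next
          case False
          then have "norm (m t - G' j (w (x j))) \<le> e/2" using bd by simp
          then have "norm (m t - G' j x) \<le> e/2 + e/4"
            using near[OF ends(1)] norm_triangle_ineq[of "m t - G' j (w (x j))" "G' j (w (x j)) - G' j x"]
            by simp
          then show ?thesis using \<open>e > 0\<close> by (simp add: dist_norm)
        qed
      qed
    qed
    moreover have "((\<lambda>t. c t j - x j) has_real_derivative c' j) (at t0 within T)"
      using c'[OF j] by (auto intro!: derivative_eq_intros)
    ultimately show ?thesis
      unfolding eq by (intro has_vector_derivative_scaleR_vanishing) (auto simp: x_def)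
  qed
  have tele: "(\<Sum>j<d. G (z t (Suc j)) - G (z t j)) = G (c t) - G x" if "t \<in> T" for t
  proof -
    have "z t 0 = x" by (auto simp: z_def)
    moreover have "z t d = c t"
    proof
      fix i
      show "z t d i = c t i"
        using orthant_open_mem[OF V c(1)[OF that], of i] orthant_open_mem[OF V x, of i] V
        by (auto simp: z_def orthant_open_def)
    qed
    ultimately show ?thesis using sum_lessThan_telescope[of "\<lambda>j. G (z t j)" d] by simp
  qed
  have "((\<lambda>t. \<Sum>j<d. G (z t (Suc j)) - G (z t j)) has_vector_derivative (\<Sum>j<d. c' j *\<^sub>R G' j x))
      (at t0 within T)"
    by (intro has_vector_derivative_sum step) auto
  then have "((\<lambda>t. G (c t) - G x) has_vector_derivative (\<Sum>j<d. c' j *\<^sub>R G' j x)) (at t0 within T)"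
    by (rule has_vector_derivative_transform[OF c(2), rotated]) (simp add: tele)
  then have "((\<lambda>t. G (c t) - G x + G x) has_vector_derivative (\<Sum>j<d. c' j *\<^sub>R G' j x) + 0) (at t0 within T)"
    by (intro has_vector_derivative_add) auto
  then show ?thesis by (simp add: x_def)
qed

section \<open>Charts and tangent spaces\<close>

lemma smooth_mfd_chartD:
  assumes "smooth_mfd M" "(U, \<phi>) \<in> matlas M"
  shows "openin (mtop M) U" "chart_range (mdim M) (\<phi> ` U)" "inj_on \<phi> U" "U \<subseteq> mpoints M"
    "homeomorphic_map (subtopology (mtop M) U) (subtopology (Euclidean_space (mdim M)) (\<phi> ` U)) \<phi>"
    "\<phi> ` U \<subseteq> {x. \<forall>i\<ge>mdim M. x i = 0}"
proof -
  show o: "openin (mtop M) U" and r: "chart_range (mdim M) (\<phi> ` U)"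
    and h: "homeomorphic_map (subtopology (mtop M) U) (subtopology (Euclidean_space (mdim M)) (\<phi> ` U)) \<phi>"
    using assms unfolding smooth_mfd_def by fast+
  show U: "U \<subseteq> mpoints M" using openin_subset[OF o] .
  show "inj_on \<phi> U"
    using homeomorphic_imp_injective_map[OF h] U by (simp add: Int_absorb1)
  show "\<phi> ` U \<subseteq> {x. \<forall>i\<ge>mdim M. x i = 0}"
    using r openin_subset unfolding chart_range_def half_space_def
    by (fastforce simp: topspace_Euclidean_space)
qed

lemma smooth_mfd_transition:
  assumes "smooth_mfd M" "(U, \<phi>) \<in> matlas M" "(V, \<kappa>) \<in> matlas M"
  shows "smooth_on (mdim M) (\<phi> ` (U \<inter> V)) (\<kappa> \<circ> inv_into U \<phi>)"
proof -
  have "\<forall>(U, \<phi>)\<in>matlas M. \<forall>(V, \<kappa>)\<in>matlas M.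
      smooth_on (mdim M) (\<phi> ` (U \<inter> V)) (\<kappa> \<circ> inv_into U \<phi>)"
    using assms(1) unfolding smooth_mfd_def by (elim conjE)
  from bspec[OF this assms(2)] show ?thesis using assms(3) by auto
qed

text \<open>
  The kind of range, full space or half-space, is inherited, and not only the property of being a chart range:
  whether two charts can be multiplied depends on it.
\<close>

lemma openin_chart_image:
  assumes "smooth_mfd M" "(U, \<phi>) \<in> matlas M" "openin (mtop M) W" "W \<subseteq> U"
  shows "openin (Euclidean_space (mdim M)) (\<phi> ` U) \<Longrightarrow> openin (Euclidean_space (mdim M)) (\<phi> ` W)"
    and "openin (half_space (mdim M)) (\<phi> ` U) \<Longrightarrow> openin (half_space (mdim M)) (\<phi> ` W)"
proof -
  note c = smooth_mfd_chartD[OF assms(1,2)]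
  have W: "openin (subtopology (mtop M) U) W"
    unfolding openin_subtopology using assms(3,4) by (intro exI[of _ W]) auto
  have *: "openin (subtopology (Euclidean_space (mdim M)) (\<phi> ` U)) (\<phi> ` W)"
    using homeomorphic_imp_open_map[OF c(5)] W unfolding open_map_def by blast
  show "openin (Euclidean_space (mdim M)) (\<phi> ` W)" if "openin (Euclidean_space (mdim M)) (\<phi> ` U)"
    using * that openin_trans_full by blast
  show "openin (half_space (mdim M)) (\<phi> ` W)" if "openin (half_space (mdim M)) (\<phi> ` U)"
  proof -
    have "\<phi> ` U \<subseteq> {x. 0 \<le> x 0}" using openin_subset[OF that] by (auto simp: half_space_def)
    then have "subtopology (half_space (mdim M)) (\<phi> ` U) = subtopology (Euclidean_space (mdim M)) (\<phi> ` U)"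
      by (simp add: half_space_def subtopology_subtopology Int_absorb1)
    then show ?thesis using * that openin_trans_full by metis
  qed
qed

lemma chart_range_chart_image:
  assumes "smooth_mfd M" "(U, \<phi>) \<in> matlas M" "openin (mtop M) W" "W \<subseteq> U"
  shows "chart_range (mdim M) (\<phi> ` W)"
  using openin_chart_image[OF assms] smooth_mfd_chartD(2)[OF assms(1,2)]
  unfolding chart_range_def by blast

text \<open>
  The chain rule for \<open>X\<close> in the chart \<open>\<kappa>\<close>, composed with the change of charts. The partial derivatives of the left side
  are taken within the whole chart range and those of the change of charts within the overlap; both are
  unique because the overlap is again a chart range.
\<close>

lemma coord_d_change_of_chart:
  assumes M: "smooth_mfd M" and c1: "(U, \<phi>) \<in> matlas M" and c2: "(U', \<kappa>) \<in> matlas M"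
    and X1: "smooth_on (mdim M) (\<phi> ` U) (chart_rep (U, \<phi>) X)"
    and X2: "smooth_on (mdim M) (\<kappa> ` U') (chart_rep (U', \<kappa>) X)"
    and p: "p \<in> U" "p \<in> U'" and i: "i < mdim M"
  shows "coord_d (U, \<phi>) X i p a = (\<Sum>j<mdim M.
      partial_d (\<phi> ` (U \<inter> U')) i (\<kappa> \<circ> inv_into U \<phi>) (\<phi> p) j *\<^sub>R coord_d (U', \<kappa>) X j p a)"
proof -
  let ?d = "mdim M" and ?V = "\<phi> ` U" and ?V' = "\<kappa> ` U'" and ?W = "\<phi> ` (U \<inter> U')"
  define F where "F = chart_rep (U, \<phi>) X"
  define G where "G = chart_rep (U', \<kappa>) X"
  define \<tau> where "\<tau> = \<kappa> \<circ> inv_into U \<phi>"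
  define x where "x = \<phi> p"
  note C1 = smooth_mfd_chartD[OF M c1] and C2 = smooth_mfd_chartD[OF M c2]
  have W: "chart_range ?d ?W"
    by (rule chart_range_chart_image[OF M c1]) (use C1 C2 in auto)
  have xW: "x \<in> ?W" using p by (simp add: x_def)
  have \<tau>W: "\<tau> y \<in> ?V'" "F y = G (\<tau> y)" if "y \<in> ?W" for y
    using that C1(3) C2(3) by (auto simp: \<tau>_def F_def G_def chart_rep_def)
  have \<tau>x: "\<tau> x = \<kappa> p" using C1(3) p by (simp add: \<tau>_def x_def)
  have sm\<tau>: "smooth_on ?d ?W \<tau>" using smooth_mfd_transition[OF M c1 c2] by (simp add: \<tau>_def)
  obtain Q where Q: "orthant_open ?d Q ?V'" using chart_range_orthant[OF C2(2)] by blast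
  have "((\<lambda>t. G (\<tau> (x(i := t))) a) has_vector_derivative
      (\<Sum>j<?d. partial_d ?W i \<tau> x j *\<^sub>R partial_d ?V' j G (\<tau> (x(i := x i))) a))
      (at (x i) within slice ?W i x)"
  proof (rule chain_rule_partials[OF Q, where G = "\<lambda>y. G y a" and c = "\<lambda>t. \<tau> (x(i := t))"
        and G' = "\<lambda>j y. partial_d ?V' j G y a"])
    fix j y assume j: "j < ?d"
    show "has_partial ?V' j (\<lambda>y. G y a) (partial_d ?V' j G y a) y" if "y \<in> ?V'"
      using smooth_on_has_partial[OF X2 j that] by (simp add: G_def)
    show "continuous_on ?V' (\<lambda>y. partial_d ?V' j G y a)"
      using smooth_on_continuous[OF smooth_on_partial_d[OF X2 j]]
      by (auto simp: G_def intro: continuous_on_product_then_coordinatewise)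
    show "((\<lambda>t. \<tau> (x(i := t)) j) has_real_derivative partial_d ?W i \<tau> x j) (at (x i) within slice ?W i x)"
      using smooth_on_has_partial[OF sm\<tau> i xW, of j]
      by (simp add: has_partial_def has_real_derivative_iff_has_vector_derivative)
  qed (use \<tau>W mem_slice_self[OF xW] in \<open>auto simp: slice_def\<close>)
  then have "has_partial ?W i (\<lambda>y. G (\<tau> y) a)
      (\<Sum>j<?d. partial_d ?W i \<tau> x j *\<^sub>R partial_d ?V' j G (\<kappa> p) a) x"
    by (simp add: has_partial_def \<tau>x)
  then have "has_partial ?W i (\<lambda>y. F y a)
      (\<Sum>j<?d. partial_d ?W i \<tau> x j *\<^sub>R partial_d ?V' j G (\<kappa> p) a) x"
    using has_partial_cong[of ?W "\<lambda>y. F y a" "\<lambda>y. G (\<tau> y) a" x i] \<tau>W(2) xW by simp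
  moreover have "has_partial ?W i (\<lambda>y. F y a) (partial_d ?V i F x a) x"
  proof -
    have "has_partial ?V i (\<lambda>y. F y a) (partial_d ?V i F x a) x"
      using smooth_on_has_partial[OF X1 i, of x] p by (simp add: F_def x_def)
    moreover have "slice ?W i x \<subseteq> slice ?V i x" by (auto simp: slice_def)
    ultimately show ?thesis unfolding has_partial_def by (rule has_vector_derivative_within_subset)
  qed
  ultimately show ?thesis
    using has_partial_unique[OF _ _ chart_range_slice_perfect[OF W] xW i]
    by (simp add: coord_d_def F_def G_def x_def \<tau>_def)
qed

text \<open>
  All that the geometric definitions use of the tangent space is thereby reduced to one chart. An inclusion for
  every pair of charts suffices, since the tangent space is the union over all charts.
\<close>

lemma tangent_image_chart:
  assumes M: "smooth_mfd M" and c: "c \<in> matlas M" "p \<in> fst c"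
    and X: "\<And>c. c \<in> matlas M \<Longrightarrow> smooth_on (mdim M) (snd c ` fst c) (chart_rep c X)"
  shows "tangent_image M X p = range (pushforward M c X p)"
proof -
  have "pushforward M c' X p v \<in> range (pushforward M c X p)" if c': "c' \<in> matlas M" "p \<in> fst c'" for c' v
  proof -
    obtain U' \<kappa> where c1: "c = (U', \<kappa>)" by (rule prod.exhaust)
    obtain U \<phi> where c2: "c' = (U, \<phi>)" by (rule prod.exhaust)
    define D where "D i j = partial_d (\<phi> ` (U \<inter> U')) i (\<kappa> \<circ> inv_into U \<phi>) (\<phi> p) j" for i j
    have cd: "coord_d c' X i p a = (\<Sum>j<mdim M. D i j *\<^sub>R coord_d c X j p a)" if "i < mdim M" for i a
      unfolding c1 c2 D_def
      by (rule coord_d_change_of_chart[OF M])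
        (use c c' X[of c] X[of c'] that in \<open>simp_all add: c1 c2\<close>)
    have "pushforward M c' X p v a = pushforward M c X p (\<lambda>j. \<Sum>i<mdim M. v i * D i j) a" for a
    proof -
      have "pushforward M c' X p v a = (\<Sum>i<mdim M. v i *\<^sub>R (\<Sum>j<mdim M. D i j *\<^sub>R coord_d c X j p a))"
        by (simp add: pushforward_def cd)
      also have "\<dots> = (\<Sum>j<mdim M. \<Sum>i<mdim M. (v i * D i j) *\<^sub>R coord_d c X j p a)"
        by (subst sum.swap) (simp add: scaleR_sum_right)
      finally show ?thesis by (simp add: pushforward_def scaleR_sum_left)
    qed
    then have "pushforward M c' X p v = pushforward M c X p (\<lambda>j. \<Sum>i<mdim M. v i * D i j)" by (rule ext)
    then show ?thesis by simp
  qed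
  then show ?thesis using c unfolding tangent_image_def by blast
qed

text \<open>
  The difference of \<open>F\<close> in direction \<open>j\<close> is an integral of \<open>partial_d V j F\<close>. Differentiating it in direction
  \<open>i\<close> under the integral sign and then in direction \<open>j\<close> by the fundamental theorem gives the claim.
\<close>

lemma partial_d_commute:
  fixes F :: "(nat \<Rightarrow> real) \<Rightarrow> nat \<Rightarrow> complex"
  assumes V: "openin (Euclidean_space d) V" and F: "smooth_on d V F"
    and x: "x \<in> V" and ij: "i < d" "j < d"
  shows "partial_d V i (partial_d V j F) x = partial_d V j (partial_d V i F) x"
proof (cases "i = j")
  case False
  define Q :: "nat \<Rightarrow> real set" where "Q = (\<lambda>k. if k < d then UNIV else {0})"
  have Q: "orthant_open d Q V" using openin_Euclidean_orthant[OF V] by (simp add: Q_def)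
  obtain \<delta> where \<delta>: "\<delta> > 0"
    "\<And>z. (\<And>k. z k \<in> Q k) \<Longrightarrow> (\<And>i. \<bar>z i - x i\<bar> < \<delta>) \<Longrightarrow> z \<in> V"
    using orthant_open_cube[OF Q x] by blast
  define \<eta> where "\<eta> = \<delta> / 2"
  have \<eta>: "\<eta> > 0" "\<eta> < \<delta>" using \<delta> by (auto simp: \<eta>_def)
  (* the two-dimensional slice through x, on a square that it maps into V *)
  define P where "P u v = x(i := u, j := v)" for u v
  define I where "I = {x i - \<eta>..x i + \<eta>}"
  define K where "K = {x j - \<eta>..x j + \<eta>}"
  have PV: "P u v \<in> V" if "u \<in> I" "v \<in> K" for u v
  proof (rule \<delta>(2))
    show "P u v k \<in> Q k" for k
      using orthant_open_mem[OF Q x, of k] ij by (auto simp: P_def Q_def)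
    show "\<bar>P u v k - x k\<bar> < \<delta>" for k
    proof -
      have "\<bar>u - x i\<bar> < \<delta>" "\<bar>v - x j\<bar> < \<delta>"
        using that \<eta> unfolding I_def K_def atLeastAtMost_iff abs_less_iff by linarith+
      then show ?thesis using \<delta>(1) by (simp add: P_def)
    qed
  qed
  have P0: "P (x i) (x j) = x" by (simp add: P_def)
  have Pcont: "continuous_on S (\<lambda>q. P (f q) (g q))"
    if "continuous_on S f" "continuous_on S g" for S :: "'q::topological_space set" and f g
  proof (rule continuous_on_coordinatewise_then_product)
    fix k show "continuous_on S (\<lambda>q. P (f q) (g q) k)"
      unfolding P_def using that by (cases "k = j"; cases "k = i") auto
  qed
  have dI: "((\<lambda>u. H (P u v) a) has_vector_derivative partial_d V i H (P u v) a) (at u within I)"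
    if "smooth_on d V H" "u \<in> I" "v \<in> K" for H :: "(nat \<Rightarrow> real) \<Rightarrow> nat \<Rightarrow> complex" and u v a
  proof -
    have "I \<subseteq> slice V i (P u v)"
      using PV that(3) False by (auto simp: slice_def P_def fun_upd_twist)
    moreover have "((\<lambda>t. H ((P u v)(i := t)) a) has_vector_derivative partial_d V i H (P u v) a)
        (at u within slice V i (P u v))"
      using smooth_on_has_partial[OF that(1) ij(1) PV[OF that(2,3)], of a] False
      by (simp add: has_partial_def P_def)
    moreover have "(P u v)(i := t) = P t v" for t using False by (simp add: P_def fun_upd_twist)
    ultimately show ?thesis by (auto intro: has_vector_derivative_within_subset)
  qed
  have dK: "((\<lambda>v. H (P u v) a) has_vector_derivative partial_d V j H (P u v) a) (at v within K)"
    if "smooth_on d V H" "u \<in> I" "v \<in> K" for H :: "(nat \<Rightarrow> real) \<Rightarrow> nat \<Rightarrow> complex" and u v a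
  proof -
    have "K \<subseteq> slice V j (P u v)"
      using PV that(2) by (auto simp: slice_def P_def)
    moreover have "((\<lambda>t. H ((P u v)(j := t)) a) has_vector_derivative partial_d V j H (P u v) a)
        (at v within slice V j (P u v))"
      using smooth_on_has_partial[OF that(1) ij(2) PV[OF that(2,3)], of a]
      by (simp add: has_partial_def P_def)
    moreover have "(P u v)(j := t) = P u t" for t by (simp add: P_def)
    ultimately show ?thesis by (auto intro: has_vector_derivative_within_subset)
  qed
  have Hcont: "continuous_on V (\<lambda>y. H y a)" if "smooth_on d V H" for H :: "(nat \<Rightarrow> real) \<Rightarrow> nat \<Rightarrow> complex" and a
    using smooth_on_continuous[OF that] by (rule continuous_on_product_then_coordinatewise)
  note Fi = smooth_on_partial_d[OF F ij(1)] and Fj = smooth_on_partial_d[OF F ij(2)]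
  note Fij = smooth_on_partial_d[OF Fj ij(1)]
  (* the integrals start at the lower edge of the square, so that x j is interior to their range *)
  define b where "b = x j - \<eta>"
  have bK: "b \<in> K" and xI: "x i \<in> I" and xK: "x j \<in> K" using \<eta> by (auto simp: b_def K_def I_def)
  show ?thesis
  proof
    fix a
    define g where "g s = partial_d V i (partial_d V j F) (P (x i) s) a" for s
    have gcont: "continuous_on K g"
      unfolding g_def
      by (rule continuous_on_compose2[OF Hcont[OF Fij] Pcont]) (use PV xI in \<open>auto intro!: continuous_intros\<close>)
    (* both sides are the derivative in direction i of the difference F (P u v) - F (P u b) *)
    have main: "partial_d V i F (P (x i) v) a - partial_d V i F (P (x i) b) a = integral (cbox b v) g"
      if v: "v \<in> K" for v
    proof -
      have bv: "b \<le> v" "cbox b v \<subseteq> K" using v by (auto simp: b_def K_def)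
      have "((\<lambda>u. integral (cbox b v) (\<lambda>s. partial_d V j F (P u s) a)) has_vector_derivative
          integral (cbox b v) (\<lambda>s. partial_d V i (partial_d V j F) (P (x i) s) a)) (at (x i) within I)"
      proof (rule leibniz_rule_vector_derivative)
        show "((\<lambda>u. partial_d V j F (P u s) a) has_vector_derivative
            partial_d V i (partial_d V j F) (P u s) a) (at u within I)" if "u \<in> I" "s \<in> cbox b v" for u s
          using dI[OF Fj] that bv by blast
        show "(\<lambda>s. partial_d V j F (P u s) a) integrable_on cbox b v" if "u \<in> I" for u
          by (rule integrable_continuous, rule continuous_on_compose2[OF Hcont[OF Fj] Pcont])
            (use PV that bv in \<open>auto intro!: continuous_intros\<close>)
        show "continuous_on (I \<times> cbox b v) (\<lambda>(u, s). partial_d V i (partial_d V j F) (P u s) a)"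
          unfolding case_prod_unfold
          by (rule continuous_on_compose2[OF Hcont[OF Fij] Pcont])
            (use PV bv in \<open>auto intro!: continuous_intros\<close>)
        show "x i \<in> I" "convex I" using xI by (auto simp: I_def)
      qed
      moreover have ftc: "F (P u v) a - F (P u b) a = integral (cbox b v) (\<lambda>s. partial_d V j F (P u s) a)"
        if "u \<in> I" for u
      proof -
        have "((\<lambda>s. partial_d V j F (P u s) a) has_integral F (P u v) a - F (P u b) a) {b..v}"
        proof (rule fundamental_theorem_of_calculus[OF bv(1)])
          fix s assume "s \<in> {b..v}"
          then have "s \<in> K" using bv by auto
          then show "((\<lambda>s. F (P u s) a) has_vector_derivative partial_d V j F (P u s) a) (at s within {b..v})"
            by (rule has_vector_derivative_within_subset[OF dK[OF F that]]) (use bv in auto)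
        qed
        then show ?thesis by (simp add: integral_unique cbox_interval)
      qed
      ultimately have "((\<lambda>u. F (P u v) a - F (P u b) a) has_vector_derivative integral (cbox b v) g)
          (at (x i) within I)"
        unfolding g_def by (intro has_vector_derivative_transform[OF xI ftc])
      moreover have "((\<lambda>u. F (P u v) a - F (P u b) a) has_vector_derivative
          partial_d V i F (P (x i) v) a - partial_d V i F (P (x i) b) a) (at (x i) within I)"
        using dI[OF F xI v] dI[OF F xI bK] by (rule has_vector_derivative_diff)
      moreover have "at (x i) within I \<noteq> bot"
        using \<eta> by (auto simp: I_def trivial_limit_within intro!: islimpt_Icc)
      ultimately show ?thesis using vector_derivative_unique_within by blast
    qed
    have "((\<lambda>v. integral {b..v} g) has_vector_derivative g (x j)) (at (x j) within K)"
      using gcont xK \<eta> by (auto simp: K_def b_def intro!: integral_has_vector_derivative)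
    then have "((\<lambda>v. partial_d V i F (P (x i) v) a - partial_d V i F (P (x i) b) a)
        has_vector_derivative g (x j)) (at (x j) within K)"
      by (rule has_vector_derivative_transform[OF xK, rotated]) (simp add: main cbox_interval)
    moreover have "((\<lambda>v. partial_d V i F (P (x i) v) a - partial_d V i F (P (x i) b) a)
        has_vector_derivative partial_d V j (partial_d V i F) (P (x i) (x j)) a - 0) (at (x j) within K)"
      by (intro has_vector_derivative_diff dK[OF Fi xI xK]) auto
    moreover have "at (x j) within K \<noteq> bot"
      using \<eta> by (auto simp: K_def trivial_limit_within intro!: islimpt_Icc)
    ultimately have "g (x j) = partial_d V j (partial_d V i F) x a"
      using vector_derivative_unique_within P0 by fastforce
    then show "partial_d V i (partial_d V j F) x a = partial_d V j (partial_d V i F) x a"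
      by (simp add: g_def P0)
  qed
qed simp

section \<open>Inverses of positive definite matrices\<close>

text \<open>
  Elimination of the last unknown: the equations for the other indices are solved by induction, and the
  last equation has the Schur complement as its coefficient, which is the value of the quadratic form at
  the vector \<open>(- y, 1)\<close> and hence positive.
\<close>

lemma posdef_solve:
  fixes g :: "nat \<Rightarrow> nat \<Rightarrow> real"
  assumes "\<And>i j. i < d \<Longrightarrow> j < d \<Longrightarrow> g i j = g j i"
    and "\<And>v. \<exists>i<d. v i \<noteq> 0 \<Longrightarrow> 0 < (\<Sum>i<d. \<Sum>j<d. v i * v j * g i j)"
  shows "\<exists>x. \<forall>i<d. (\<Sum>k<d. g i k * x k) = b i"
  using assms
proof (induction d arbitrary: b)
  case (Suc d)
  have pos: "0 < (\<Sum>i<d. \<Sum>j<d. v i * v j * g i j)" if "\<exists>i<d. v i \<noteq> 0" for v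
  proof -
    have "\<exists>i<Suc d. (v(d := 0)) i \<noteq> 0" using that by auto
    from Suc.prems(2)[OF this] show ?thesis by simp
  qed
  have solve: "\<exists>x. \<forall>i<d. (\<Sum>k<d. g i k * x k) = b i" for b
    using Suc.IH[of b] Suc.prems(1) pos by simp
  obtain y where y: "\<And>i. i < d \<Longrightarrow> (\<Sum>k<d. g i k * y k) = g i d" using solve[of "\<lambda>i. g i d"] by blast
  obtain x where x: "\<And>i. i < d \<Longrightarrow> (\<Sum>k<d. g i k * x k) = b i" using solve[of b] by blast
  define s where "s = g d d - (\<Sum>k<d. g d k * y k)"
  define v where "v i = (if i < d then - y i else 1)" for i
  have "0 < (\<Sum>i<Suc d. \<Sum>j<Suc d. v i * v j * g i j)"
    by (rule Suc.prems(2)) (auto simp: v_def intro!: exI[of _ d])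
  also have "\<dots> = (\<Sum>i<d. y i * ((\<Sum>j<d. g i j * y j) - g i d)) + s"
    by (simp add: v_def s_def sum.distrib sum_distrib_left sum_negf sum_subtractf algebra_simps)
  also have "\<dots> = s" by (simp add: y)
  finally have s: "s > 0" .
  define c where "c = (b d - (\<Sum>k<d. g d k * x k)) / s"
  have "\<forall>i<Suc d. (\<Sum>k<Suc d. g i k * (if k < d then x k - c * y k else c)) = b i"
  proof (intro allI impI)
    fix i assume "i < Suc d"
    have "(\<Sum>k<Suc d. g i k * (if k < d then x k - c * y k else c)) =
        (\<Sum>k<d. g i k * x k) - c * (\<Sum>k<d. g i k * y k) + c * g i d"
      by (simp add: sum_distrib_left sum_subtractf algebra_simps)
    also have "\<dots> = b i"
    proof (cases "i < d")
      case False
      then have "i = d" using \<open>i < Suc d\<close> by simp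
      moreover have "c * s = b d - (\<Sum>k<d. g d k * x k)" using s by (simp add: c_def)
      ultimately show ?thesis by (simp add: s_def algebra_simps)
    qed (simp add: x y)
    finally show "(\<Sum>k<Suc d. g i k * (if k < d then x k - c * y k else c)) = b i" .
  qed
  then show ?case by (intro exI[of _ "\<lambda>k. if k < d then x k - c * y k else c"])
qed simp

definition inverse_pair :: "nat \<Rightarrow> (nat \<Rightarrow> nat \<Rightarrow> real) \<Rightarrow> (nat \<Rightarrow> nat \<Rightarrow> real) \<Rightarrow> bool" where
  "inverse_pair d g h \<longleftrightarrow>
     (\<forall>i<d. \<forall>j<d. (\<Sum>k<d. g i k * h k j) = (if i = j then 1 else 0)) \<and>
     (\<forall>i<d. \<forall>j<d. (\<Sum>k<d. h i k * g k j) = (if i = j then 1 else 0))"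

lemma sum_delta_mult_left:
  fixes f :: "nat \<Rightarrow> 'a::comm_semiring_1"
  shows "i < d \<Longrightarrow> (\<Sum>k<d. (if i = k then 1 else 0) * f k) = f i"
    "i < d \<Longrightarrow> (\<Sum>k<d. f k * (if k = i then 1 else 0)) = f i"
  by (simp_all add: if_distrib[of "\<lambda>x. x * _"] if_distrib[of "\<lambda>x. _ * x"] sum.delta sum.delta' cong: if_cong)

lemma left_right_inverse_eq:
  fixes g h h' :: "nat \<Rightarrow> nat \<Rightarrow> real"
  assumes "\<forall>i<d. \<forall>j<d. (\<Sum>k<d. g i k * h k j) = (if i = j then 1 else 0)"
    and "\<forall>i<d. \<forall>j<d. (\<Sum>k<d. h' i k * g k j) = (if i = j then 1 else 0)"
    and "i < d" "j < d"
  shows "h' i j = h i j"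
proof -
  have "h' i j = (\<Sum>k<d. h' i k * (if k = j then 1 else 0))"
    using assms(4) by (simp add: sum_delta_mult_left)
  also have "\<dots> = (\<Sum>k<d. h' i k * (\<Sum>l<d. g k l * h l j))"
    using assms(1,4) by (intro sum.cong) auto
  also have "\<dots> = (\<Sum>l<d. (\<Sum>k<d. h' i k * g k l) * h l j)"
    unfolding sum_distrib_left sum_distrib_right by (subst sum.swap) (simp add: mult.assoc)
  also have "\<dots> = (\<Sum>l<d. (if i = l then 1 else 0) * h l j)"
    using assms(2,3) by (intro sum.cong) auto
  also have "\<dots> = h i j" using assms(3) by (simp add: sum_delta_mult_left)
  finally show ?thesis .
qed

lemma posdef_inverse_pair:
  fixes g :: "nat \<Rightarrow> nat \<Rightarrow> real"
  assumes sym: "\<And>i j. i < d \<Longrightarrow> j < d \<Longrightarrow> g i j = g j i"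
    and pos: "\<And>v. \<exists>i<d. v i \<noteq> 0 \<Longrightarrow> 0 < (\<Sum>i<d. \<Sum>j<d. v i * v j * g i j)"
  shows "\<exists>h. inverse_pair d g h"
proof -
  have "\<exists>x. \<forall>i<d. (\<Sum>k<d. g i k * x k) = (if i = j then 1 else 0)" for j
    by (rule posdef_solve[OF sym pos])
  then obtain x where x: "\<And>j. \<forall>i<d. (\<Sum>k<d. g i k * x j k) = (if i = j then 1 else 0)" by metis
  define h where "h k j = x j k" for k j
  have gh: "\<forall>i<d. \<forall>j<d. (\<Sum>k<d. g i k * h k j) = (if i = j then 1 else 0)"
    using x by (simp add: h_def)
  have hg: "\<forall>i<d. \<forall>j<d. (\<Sum>k<d. h k i * g k j) = (if i = j then 1 else 0)"
  proof (intro allI impI)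
    fix i j assume ij: "i < d" "j < d"
    have "(\<Sum>k<d. h k i * g k j) = (\<Sum>k<d. g j k * h k i)"
      using sym ij by (intro sum.cong) (auto simp: mult.commute)
    then show "(\<Sum>k<d. h k i * g k j) = (if i = j then 1 else 0)" using gh ij by auto
  qed
  have "h j i = h i j" if "i < d" "j < d" for i j
    using left_right_inverse_eq[OF gh hg that] .
  then have "(\<Sum>k<d. h i k * g k j) = (\<Sum>k<d. h k i * g k j)" if "i < d" for i j
    using that by (intro sum.cong) auto
  then have "\<forall>i<d. \<forall>j<d. (\<Sum>k<d. h i k * g k j) = (if i = j then 1 else 0)" using hg by simp
  then show ?thesis using gh unfolding inverse_pair_def by blast
qed

text \<open>
  The trace of the identity matrix; this is where the dimension enters the equation of minimality.
\<close>

lemma inverse_pair_trace: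
  assumes "inverse_pair d g h" and sym: "\<And>i j. g i j = g j i"
  shows "(\<Sum>i<d. \<Sum>j<d. h i j * g i j) = real d"
proof -
  have "(\<Sum>i<d. \<Sum>j<d. h i j * g i j) = (\<Sum>i<d. \<Sum>j<d. h i j * g j i)"
    by (intro sum.cong refl arg_cong[of _ _ "(*) _"] sym)
  also have "\<dots> = (\<Sum>i<d. 1)" using assms(1) by (intro sum.cong) (auto simp: inverse_pair_def)
  finally show ?thesis by simp
qed

text \<open>
  The description in the definition of \<open>inverse_metric\<close> asks for a right inverse only; a two-sided one
  shows that it is unique.
\<close>

lemma inverse_metric_eq:
  assumes h: "inverse_pair d g h" and "i < d" "j < d"
  shows "inverse_metric d g i j = h i j"
proof -
  define h0 where "h0 i j = (if i < d \<and> j < d then h i j else 0)" for i j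
  have "inverse_metric d g = h0"
    unfolding inverse_metric_def
  proof (rule the_equality)
    show "(\<forall>i<d. \<forall>j<d. (\<Sum>k<d. g i k * h0 k j) = (if i = j then 1 else 0)) \<and>
             (\<forall>i j. \<not> (i < d \<and> j < d) \<longrightarrow> h0 i j = 0)"
      using h by (auto simp: h0_def inverse_pair_def)
    fix h' assume h': "(\<forall>i<d. \<forall>j<d. (\<Sum>k<d. g i k * h' k j) = (if i = j then 1 else 0)) \<and>
             (\<forall>i j. \<not> (i < d \<and> j < d) \<longrightarrow> h' i j = 0)"
    have "h' i j = h0 i j" for i j
    proof (cases "i < d \<and> j < d")
      case True
      then have "h i j = h' i j"
        using left_right_inverse_eq[of d g h' h i j] h h' unfolding inverse_pair_def by blast
      then show ?thesis using True by (simp add: h0_def)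
    qed (use h' in \<open>auto simp: h0_def\<close>)
    then show "h' = h0" by blast
  qed
  then show ?thesis using assms(2,3) by (simp add: h0_def)
qed

section \<open>The real inner product of complex vectors\<close>

lemma cn_inner_commute: "cn_inner n u v = cn_inner n v u"
  by (simp add: cn_inner_def inner_commute)

lemma cn_inner_add_left: "cn_inner n (\<lambda>a. u a + v a) w = cn_inner n u w + cn_inner n v w"
  and cn_inner_diff_left: "cn_inner n (\<lambda>a. u a - v a) w = cn_inner n u w - cn_inner n v w"
  and cn_inner_scaleR_left: "cn_inner n (\<lambda>a. c *\<^sub>R u a) w = c * cn_inner n u w"
  and cn_inner_sum_left: "cn_inner n (\<lambda>a. \<Sum>i\<in>I. U i a) w = (\<Sum>i\<in>I. cn_inner n (U i) w)"
  by (simp_all add: cn_inner_def inner_add_left inner_diff_left sum.distrib sum_subtractf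
      sum_distrib_left inner_sum_left sum.swap[of _ I])

lemma cn_inner_sum_right: "cn_inner n w (\<lambda>a. \<Sum>i\<in>I. U i a) = (\<Sum>i\<in>I. cn_inner n w (U i))"
  and cn_inner_scaleR_right: "cn_inner n w (\<lambda>a. c *\<^sub>R u a) = c * cn_inner n w u"
  by (simp_all add: cn_inner_commute[of n w] cn_inner_sum_left cn_inner_scaleR_left)

lemma cn_inner_zero [simp]: "cn_inner n (\<lambda>a. 0) w = 0" "cn_inner n w (\<lambda>a. 0) = 0"
  by (simp_all add: cn_inner_def)

lemma cn_inner_nonneg: "0 \<le> cn_inner n u u"
  by (simp add: cn_inner_def sum_nonneg)

lemma cn_inner_eq_zero:
  assumes "cn_inner n u u = 0" "u \<in> Cn n"
  shows "u = (\<lambda>a. 0)"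
proof
  fix a
  have "\<forall>a\<in>{..<n}. u a \<bullet> u a = 0"
    using assms(1) unfolding cn_inner_def by (subst (asm) sum_nonneg_eq_0_iff) auto
  then show "u a = 0" using assms(2) by (cases "a < n") (auto simp: Cn_def)
qed

text \<open>
  The Hermitian product is sesquilinear; its real part is the inner product and its imaginary part the Kaehler
  form up to sign.
\<close>

lemma cn_inner_cmult:
  "cn_inner n (\<lambda>a. c * u a) (\<lambda>a. c' * v a) =
     Re (c * cnj c') * cn_inner n u v + Im (c * cnj c') * cn_inner n (cn_J u) v"
  unfolding cn_inner_def cn_J_def sum_distrib_left sum.distrib[symmetric]
  by (intro sum.cong) (auto simp: inner_complex_def algebra_simps)

lemma cn_J_skew: "cn_inner n (cn_J u) v = - cn_inner n (cn_J v) u"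
  unfolding cn_inner_def cn_J_def sum_negf[symmetric]
  by (intro sum.cong) (auto simp: inner_complex_def algebra_simps)

lemma cn_J_self [simp]: "cn_inner n (cn_J u) u = 0"
  using cn_J_skew[of n u u] by simp

section \<open>Orthogonal projection onto a span\<close>

definition lin_span :: "nat \<Rightarrow> (nat \<Rightarrow> cvec) \<Rightarrow> cvec set" where
  "lin_span d E = range (\<lambda>v a. \<Sum>i<d. v i *\<^sub>R E i a)"

text \<open>
  The orthogonal projection along the span of the \<open>E i\<close>, where \<open>h\<close> is the inverse of their Gram matrix.
\<close>

definition normal_proj :: "nat \<Rightarrow> nat \<Rightarrow> (nat \<Rightarrow> cvec) \<Rightarrow> (nat \<Rightarrow> nat \<Rightarrow> real) \<Rightarrow> cvec \<Rightarrow> cvec" where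
  "normal_proj n d E h v =
     (\<lambda>a. v a - (\<Sum>i<d. (\<Sum>j<d. h i j * cn_inner n v (E j)) *\<^sub>R E i a))"

lemma normal_proj_lin_span:
  assumes h: "inverse_pair d (\<lambda>i j. cn_inner n (E i) (E j)) h"
  shows "normal_proj n d E h (\<lambda>a. \<Sum>k<d. t k *\<^sub>R E k a) = (\<lambda>a. 0)"
proof
  fix a
  have "(\<Sum>j<d. h i j * cn_inner n (\<lambda>a. \<Sum>k<d. t k *\<^sub>R E k a) (E j)) = t i" if "i < d" for i
  proof -
    have "(\<Sum>j<d. h i j * cn_inner n (\<lambda>a. \<Sum>k<d. t k *\<^sub>R E k a) (E j)) =
        (\<Sum>k<d. (\<Sum>j<d. h i j * cn_inner n (E j) (E k)) * t k)"
      unfolding cn_inner_sum_left cn_inner_scaleR_left sum_distrib_left sum_distrib_right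
      by (subst sum.swap) (simp add: cn_inner_commute mult_ac)
    also have "\<dots> = (\<Sum>k<d. (if i = k then 1 else 0) * t k)"
      using h that by (intro sum.cong) (auto simp: inverse_pair_def)
    finally show ?thesis using that by (simp add: sum_delta_mult_left)
  qed
  then show "normal_proj n d E h (\<lambda>a. \<Sum>k<d. t k *\<^sub>R E k a) a = 0"
    by (simp add: normal_proj_def)
qed

lemma normal_proj_orthogonal:
  assumes h: "inverse_pair d (\<lambda>i j. cn_inner n (E i) (E j)) h" and k: "k < d"
  shows "cn_inner n (normal_proj n d E h v) (E k) = 0"
proof -
  have "cn_inner n (normal_proj n d E h v) (E k) =
      cn_inner n v (E k) - (\<Sum>i<d. \<Sum>j<d. h i j * cn_inner n v (E j) * cn_inner n (E i) (E k))"
    by (simp add: normal_proj_def cn_inner_diff_left cn_inner_sum_left cn_inner_scaleR_left sum_distrib_right)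
  also have "(\<Sum>i<d. \<Sum>j<d. h i j * cn_inner n v (E j) * cn_inner n (E i) (E k)) =
      (\<Sum>j<d. (\<Sum>i<d. cn_inner n (E k) (E i) * h i j) * cn_inner n v (E j))"
    unfolding sum_distrib_right by (subst sum.swap) (simp add: cn_inner_commute mult_ac)
  also have "\<dots> = (\<Sum>j<d. (if k = j then 1 else 0) * cn_inner n v (E j))"
    using h k by (intro sum.cong) (auto simp: inverse_pair_def)
  finally show ?thesis using k by (simp add: sum_delta_mult_left)
qed

text \<open>
  Two vectors with the defining property of \<open>normal_part\<close> differ by a vector that is both in the span and
  orthogonal to it. The restriction to \<open>Cn n\<close> matters, as \<open>cn_inner n\<close> does not see later components.
\<close>

lemma normal_part_eq_normal_proj:
  assumes h: "inverse_pair d (\<lambda>i j. cn_inner n (E i) (E j)) h"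
    and v: "v \<in> Cn n" and E: "\<And>i. i < d \<Longrightarrow> E i \<in> Cn n"
  shows "normal_part n (lin_span d E) v = normal_proj n d E h v"
  unfolding normal_part_def
proof (rule the_equality)
  have spanD: "cn_inner n w t = 0" if "\<And>k. k < d \<Longrightarrow> cn_inner n w (E k) = 0" "t \<in> lin_span d E" for w t
    using that by (auto simp: lin_span_def cn_inner_sum_right cn_inner_scaleR_right)
  have "normal_proj n d E h v \<in> Cn n"
    using v E by (auto simp: normal_proj_def Cn_def intro!: sum.neutral)
  moreover have "\<forall>t\<in>lin_span d E. cn_inner n (normal_proj n d E h v) t = 0"
    using spanD[OF normal_proj_orthogonal[OF h]] by blast
  moreover have "(\<lambda>a. v a - normal_proj n d E h v a) \<in> lin_span d E"
    unfolding lin_span_def normal_proj_def by (rule range_eqI) simp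
  ultimately show *: "normal_proj n d E h v \<in> Cn n \<and>
      (\<forall>t\<in>lin_span d E. cn_inner n (normal_proj n d E h v) t = 0) \<and>
      (\<lambda>a. v a - normal_proj n d E h v a) \<in> lin_span d E" by blast
  fix w assume w: "w \<in> Cn n \<and> (\<forall>t\<in>lin_span d E. cn_inner n w t = 0) \<and> (\<lambda>a. v a - w a) \<in> lin_span d E"
  obtain s t where s: "(\<lambda>a. v a - w a) = (\<lambda>a. \<Sum>i<d. s i *\<^sub>R E i a)"
    and t: "(\<lambda>a. v a - normal_proj n d E h v a) = (\<lambda>a. \<Sum>i<d. t i *\<^sub>R E i a)"
    using w * unfolding lin_span_def by blast
  define u where "u = (\<lambda>a. w a - normal_proj n d E h v a)"
  have "u = (\<lambda>a. \<Sum>i<d. (t i - s i) *\<^sub>R E i a)"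
  proof
    fix a
    have "u a = (v a - normal_proj n d E h v a) - (v a - w a)" by (simp add: u_def)
    then show "u a = (\<Sum>i<d. (t i - s i) *\<^sub>R E i a)"
      using fun_cong[OF s, of a] fun_cong[OF t, of a] by (simp add: scaleR_diff_left sum_subtractf)
  qed
  then have "u \<in> lin_span d E"
    unfolding lin_span_def by (rule range_eqI[where x = "\<lambda>i. t i - s i"])
  then have "cn_inner n u u = 0"
    using w * by (simp add: u_def cn_inner_diff_left)
  moreover have "u \<in> Cn n" using w * by (auto simp: u_def Cn_def)
  ultimately have "u = (\<lambda>a. 0)" by (rule cn_inner_eq_zero)
  then show "w = normal_proj n d E h v" by (auto simp: u_def fun_eq_iff)
qed

lemma normal_proj_sum:
  "normal_proj n d E h (\<lambda>a. \<Sum>k\<in>K. c k *\<^sub>R W k a) a = (\<Sum>k\<in>K. c k *\<^sub>R normal_proj n d E h (W k) a)"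
proof -
  have "(\<Sum>i<d. (\<Sum>j<d. h i j * cn_inner n (\<lambda>a. \<Sum>k\<in>K. c k *\<^sub>R W k a) (E j)) *\<^sub>R E i a) =
      (\<Sum>i<d. \<Sum>k\<in>K. c k *\<^sub>R ((\<Sum>j<d. h i j * cn_inner n (W k) (E j)) *\<^sub>R E i a))"
    by (intro sum.cong refl)
      (simp add: cn_inner_sum_left cn_inner_scaleR_left sum_distrib_left sum.swap[of _ K] scaleR_sum_left scaleR_sum_right mult_ac)
  also have "\<dots> = (\<Sum>k\<in>K. c k *\<^sub>R (\<Sum>i<d. (\<Sum>j<d. h i j * cn_inner n (W k) (E j)) *\<^sub>R E i a))"
    by (simp add: sum.swap[of _ K] scaleR_sum_right)
  finally show ?thesis
    by (simp add: normal_proj_def scaleR_diff_right sum_subtractf)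
qed

lemma normal_proj_add:
  "normal_proj n d E h (\<lambda>a. u a + w a) a = normal_proj n d E h u a + normal_proj n d E h w a"
  by (simp add: normal_proj_def cn_inner_add_left distrib_left sum.distrib scaleR_add_left)

lemma normal_proj_scaleR:
  "normal_proj n d E h (\<lambda>a. c *\<^sub>R u a) a = c *\<^sub>R normal_proj n d E h u a"
  using normal_proj_sum[of n d E h "\<lambda>_. c" "\<lambda>_. u" "{0::nat}"] by simp

lemma normal_proj_sum2:
  "normal_proj n d E h (\<lambda>a. \<Sum>i<p. \<Sum>j<q. c i j *\<^sub>R W i j a) a =
     (\<Sum>i<p. \<Sum>j<q. c i j *\<^sub>R normal_proj n d E h (W i j) a)"
  using normal_proj_sum[of n d E h "\<lambda>_. 1" "\<lambda>i a. \<Sum>j<q. c i j *\<^sub>R W i j a" "{..<p}" a]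
  by (simp add: normal_proj_sum)

section \<open>Matrices with one additional index\<close>

text \<open>
  The embedding of indices that leaves room for a new index \<open>m\<close>.
\<close>

definition skip :: "nat \<Rightarrow> nat \<Rightarrow> nat" where
  "skip m i = (if i < m then i else Suc i)"

lemma skip_simps [simp]: "skip m i = skip m j \<longleftrightarrow> i = j" "skip m i \<noteq> m" "m \<noteq> skip m i" "skip 0 i = Suc i"
  by (auto simp: skip_def)

lemma less_Suc_skip_cases:
  assumes "i < Suc d" "m \<le> d"
  obtains "i = m" | j where "j < d" "i = skip m j"
proof (cases "i = m")
  case False
  then have "i = skip m (if i < m then i else i - 1)" "(if i < m then i else i - 1) < d"
    using assms by (auto simp: skip_def)
  then show thesis using that by blast
qed (use that in blast)

lemma skip_less: "j < d \<Longrightarrow> skip m j < Suc d"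
  by (simp add: skip_def)

lemma sum_insert_index:
  assumes "m \<le> d"
  shows "(\<Sum>i<Suc d. f i) = f m + (\<Sum>i<d. f (skip m i))"
proof -
  have "{..<Suc d} = insert m (skip m ` {..<d})"
    using assms by (auto simp: skip_less elim: less_Suc_skip_cases)
  moreover have "inj_on (skip m) {..<d}" by (simp add: inj_on_def)
  moreover have "m \<notin> skip m ` {..<d}" by auto
  ultimately show ?thesis by (simp add: sum.reindex)
qed

text \<open>
  The inverse of the matrix with entry \<open>\<mu>\<close> at the new index \<open>m\<close>, the matrix \<open>c g\<close> at the old indices and
  zeros elsewhere, where \<open>h\<close> is the inverse of \<open>g\<close>.
\<close>

definition block_inverse :: "nat \<Rightarrow> real \<Rightarrow> real \<Rightarrow> (nat \<Rightarrow> nat \<Rightarrow> real) \<Rightarrow> nat \<Rightarrow> nat \<Rightarrow> real" where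
  "block_inverse m \<mu> c h i j =
     (if i = m \<and> j = m then 1 / \<mu> else if i = m \<or> j = m then 0
      else h (if i < m then i else i - 1) (if j < m then j else j - 1) / c)"

lemma block_inverse_simps [simp]:
  "block_inverse m \<mu> c h m m = 1 / \<mu>"
  "block_inverse m \<mu> c h m (skip m j) = 0"
  "block_inverse m \<mu> c h (skip m i) m = 0"
  "block_inverse m \<mu> c h (skip m i) (skip m j) = h i j / c"
proof -
  have "(if skip m i < m then skip m i else skip m i - 1) = i" for i by (simp add: skip_def)
  then show "block_inverse m \<mu> c h (skip m i) (skip m j) = h i j / c"
    by (simp only: block_inverse_def skip_simps) simp
qed (simp_all add: block_inverse_def)

lemma inverse_pair_block:
  assumes "inverse_pair d g h" "m \<le> d" "\<mu> \<noteq> 0" "c \<noteq> 0"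
    and g: "g' m m = \<mu>" "\<And>j. j < d \<Longrightarrow> g' m (skip m j) = 0" "\<And>i. i < d \<Longrightarrow> g' (skip m i) m = 0"
      "\<And>i j. i < d \<Longrightarrow> j < d \<Longrightarrow> g' (skip m i) (skip m j) = c * g i j"
  shows "inverse_pair (Suc d) g' (block_inverse m \<mu> c h)"
  unfolding inverse_pair_def
proof (intro conjI allI impI)
  fix i j assume ij: "i < Suc d" "j < Suc d"
  show "(\<Sum>k<Suc d. g' i k * block_inverse m \<mu> c h k j) = (if i = j then 1 else 0)"
    using ij(1) assms(2)
  proof (cases rule: less_Suc_skip_cases)
    case 1
    show ?thesis using ij(2) assms(2)
      by (cases rule: less_Suc_skip_cases) (use 1 assms in \<open>simp_all add: sum_insert_index[OF assms(2)] del: sum.lessThan_Suc\<close>)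
  next
    case (2 i')
    show ?thesis using ij(2) assms(2)
      by (cases rule: less_Suc_skip_cases)
        (use 2 assms in \<open>simp_all add: sum_insert_index[OF assms(2)] inverse_pair_def del: sum.lessThan_Suc\<close>)
  qed
  show "(\<Sum>k<Suc d. block_inverse m \<mu> c h i k * g' k j) = (if i = j then 1 else 0)"
    using ij(1) assms(2)
  proof (cases rule: less_Suc_skip_cases)
    case 1
    show ?thesis using ij(2) assms(2)
      by (cases rule: less_Suc_skip_cases) (use 1 assms in \<open>simp_all add: sum_insert_index[OF assms(2)] del: sum.lessThan_Suc\<close>)
  next
    case (2 i')
    show ?thesis using ij(2) assms(2)
      by (cases rule: less_Suc_skip_cases)
        (use 2 assms in \<open>simp_all add: sum_insert_index[OF assms(2)] inverse_pair_def del: sum.lessThan_Suc\<close>)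
  qed
qed

section \<open>Jets of Legendrian immersions and of solitons\<close>

text \<open>
  The 2-jet at a point of a minimal Legendrian immersion into the sphere: position \<open>P\<close>, first derivatives \<open>E\<close>, second
  derivatives \<open>D\<close> and the inverse metric \<open>h\<close>. The conditions that follow by differentiating the defining
  ones are included, so that they pass from one suspension to the next. In the last one the
  term \<open>d P\<close> compensates the component of the trace along \<open>P\<close>.
\<close>

definition legendrian_jet ::
  "nat \<Rightarrow> cvec \<Rightarrow> (nat \<Rightarrow> cvec) \<Rightarrow> (nat \<Rightarrow> nat \<Rightarrow> cvec) \<Rightarrow> (nat \<Rightarrow> nat \<Rightarrow> real) \<Rightarrow> bool" where
  "legendrian_jet d P E D h \<longleftrightarrow>
     P \<in> Cn (Suc d) \<and> (\<forall>i<d. E i \<in> Cn (Suc d)) \<and> (\<forall>i<d. \<forall>j<d. D i j \<in> Cn (Suc d)) \<and>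
     cn_inner (Suc d) P P = 1 \<and>
     (\<forall>i<d. cn_inner (Suc d) P (E i) = 0 \<and> cn_inner (Suc d) (cn_J P) (E i) = 0) \<and>
     (\<forall>i<d. \<forall>j<d. cn_inner (Suc d) (cn_J (E i)) (E j) = 0 \<and>
        cn_inner (Suc d) (D i j) P = - cn_inner (Suc d) (E i) (E j)) \<and>
     inverse_pair d (\<lambda>i j. cn_inner (Suc d) (E i) (E j)) h \<and>
     (\<exists>\<tau>. \<forall>a. (\<Sum>i<d. \<Sum>j<d. h i j *\<^sub>R D i j a) + real d *\<^sub>R P a = (\<Sum>i<d. \<tau> i *\<^sub>R E i a))"

lemma cn_inner_Suc_cmult:
  assumes "\<And>a. a < n \<Longrightarrow> U a = c * x a" "\<And>a. a < n \<Longrightarrow> V a = c' * y a"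
    and "c * cnj c' = z"
  shows "cn_inner (Suc n) U V = Re z * cn_inner n x y + Im z * cn_inner n (cn_J x) y + U n \<bullet> V n"
proof -
  have "cn_inner (Suc n) U V = cn_inner n (\<lambda>a. c * x a) (\<lambda>a. c' * y a) + U n \<bullet> V n"
    using assms by (simp add: cn_inner_def)
  then show ?thesis using assms(3) by (simp add: cn_inner_cmult)
qed

text \<open>
  The derivatives of the suspension in terms of those of \<open>\<psi>\<close>: \<open>u\<close> and \<open>w\<close> are the phases of its first \<open>k\<close>
  components and of the last one, and \<open>m\<close> is the index of the new angle. The weights \<open>s\<close> and \<open>b\<close> and the
  exponent \<open>- k\<close> make \<open>J P\<close> orthogonal to the derivative along the new angle (\<open>s\<^sup>2 = k b\<^sup>2\<close>), and they
  balance the trace.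
\<close>

lemma legendrian_jet_calabi:
  assumes jet: "legendrian_jet d P E D h" and m: "m \<le> d" and k: "k = Suc d"
    and u: "cmod u = 1" and w: "cmod w = 1"
    and s: "s = sqrt (real k / real (k + 1))" and b: "b = 1 / sqrt (real (k + 1))"
    and P': "P' = (\<lambda>a. if a < k then of_real s * u * P a else if a = k then of_real b * w else 0)"
    and Em: "E' m = (\<lambda>a. if a < k then \<i> * of_real s * u * P a
                          else if a = k then - (\<i> * of_real (real k * b) * w) else 0)"
    and Ei: "\<And>i. i < d \<Longrightarrow> E' (skip m i) = (\<lambda>a. if a < k then of_real s * u * E i a else 0)"
    and Dmm: "D' m m = (\<lambda>a. if a < k then - (of_real s * u * P a)
                            else if a = k then - (of_real ((real k)\<^sup>2 * b) * w) else 0)"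
    and Dmi: "\<And>i. i < d \<Longrightarrow> D' m (skip m i) = (\<lambda>a. if a < k then \<i> * of_real s * u * E i a else 0)"
    and Dim: "\<And>i. i < d \<Longrightarrow> D' (skip m i) m = (\<lambda>a. if a < k then \<i> * of_real s * u * E i a else 0)"
    and Dij: "\<And>i j. i < d \<Longrightarrow> j < d \<Longrightarrow>
        D' (skip m i) (skip m j) = (\<lambda>a. if a < k then of_real s * u * D i j a else 0)"
  shows "legendrian_jet (Suc d) P' E' D' (block_inverse m (real k) (s\<^sup>2) h)"
proof -
  have uu: "u * cnj u = 1" and ww: "w * cnj w = 1"
    using u w by (simp_all add: complex_norm_square[symmetric])
  have u2: "(Re u)\<^sup>2 + (Im u)\<^sup>2 = 1" using u by (simp add: cmod_def)
  have w2: "Re w * Re w + Im w * Im w = 1" using w by (simp add: cmod_def power2_eq_square)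
  have s2: "s * s = real k / (real k + 1)" and b2: "b * b = 1 / (real k + 1)"
    by (simp_all add: s b)
  have k0: "real k > 0" using k by simp
  have sk: "s * s + (real k)\<^sup>2 * (b * b) = real k"
  proof -
    have "s * s + (real k)\<^sup>2 * (b * b) = (real k * (real k + 1)) / (real k + 1)"
      by (simp add: s2 b2 add_divide_distrib[symmetric] power2_eq_square algebra_simps)
    then show ?thesis using k0 by simp
  qed
  have s0: "s > 0" using k0 by (simp add: s)
  define U where "U = of_real s * u"
  have UU: "U * cnj U = of_real (s * s)"
  proof -
    have "U * cnj U = of_real (s * s) * (u * cnj u)" by (simp add: U_def)
    then show ?thesis by (simp add: uu)
  qed
  have UU1: "\<i> * U * cnj U = \<i> * of_real (s * s)" "U * cnj (\<i> * U) = - \<i> * of_real (s * s)"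
    "\<i> * U * cnj (\<i> * U) = of_real (s * s)" "- U * cnj U = - of_real (s * s)"
    "- U * cnj (\<i> * U) = \<i> * of_real (s * s)"
    using UU by (simp_all add: mult.assoc mult.left_commute[of U])
  note j = jet[unfolded legendrian_jet_def, folded k]
  have PP: "cn_inner k P P = 1" and PE: "\<And>i. i < d \<Longrightarrow> cn_inner k P (E i) = 0"
    and JPE: "\<And>i. i < d \<Longrightarrow> cn_inner k (cn_J P) (E i) = 0"
    and JEE: "\<And>i l. i < d \<Longrightarrow> l < d \<Longrightarrow> cn_inner k (cn_J (E i)) (E l) = 0"
    and DP: "\<And>i l. i < d \<Longrightarrow> l < d \<Longrightarrow> cn_inner k (D i l) P = - cn_inner k (E i) (E l)"
    and inv: "inverse_pair d (\<lambda>i l. cn_inner k (E i) (E l)) h"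
    using j by auto
  have JEP: "cn_inner k (cn_J (E i)) P = 0" if "i < d" for i
    using JPE[OF that] cn_J_skew[of k "E i" P] by simp
  obtain \<tau> where \<tau>: "\<And>a. (\<Sum>i<d. \<Sum>l<d. h i l *\<^sub>R D i l a) + real d *\<^sub>R P a = (\<Sum>i<d. \<tau> i *\<^sub>R E i a)"
    using j by blast
  have P'a: "P' a = U * P a" "cn_J P' a = \<i> * U * P a" if "a < k" for a
    using that by (simp_all add: P' cn_J_def U_def)
  have Ema: "E' m a = \<i> * U * P a" "cn_J (E' m) a = - U * P a" if "a < k" for a
    using that by (simp_all add: Em cn_J_def U_def flip: mult.assoc)
  have Eia: "E' (skip m i) a = U * E i a" "cn_J (E' (skip m i)) a = \<i> * U * E i a" if "a < k" "i < d" for a i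
    using that by (simp_all add: Ei cn_J_def U_def)
  have Dmma: "D' m m a = - U * P a" if "a < k" for a
    using that by (simp add: Dmm U_def)
  have Dmia: "D' m (skip m i) a = \<i> * U * E i a" "D' (skip m i) m a = \<i> * U * E i a" if "a < k" "i < d" for a i
    using that by (simp_all add: Dmi Dim U_def)
  have Dija: "D' (skip m i) (skip m l) a = U * D i l a" if "a < k" "i < d" "l < d" for a i l
    using that by (simp add: Dij U_def)
  have last: "P' k = of_real b * w" "E' m k = - (\<i> * of_real (real k * b) * w)"
    "D' m m k = - (of_real ((real k)\<^sup>2 * b) * w)"
    by (simp_all add: P' Em Dmm)
  have last0: "E' (skip m i) k = 0" "D' m (skip m i) k = 0" "D' (skip m i) m k = 0" if "i < d" for i
    using that by (simp_all add: Ei Dmi Dim)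
  have last00: "D' (skip m i) (skip m l) k = 0" if "i < d" "l < d" for i l
    using that by (simp add: Dij)
  have kk: "(of_real x * w) \<bullet> (of_real y * w) = x * y" for x y
    using w2 by (simp add: inner_complex_def algebra_simps flip: distrib_left)
  have r1: "cn_inner (Suc k) P' P' = 1"
    using cn_inner_Suc_cmult[of k P' U P P' U P, OF P'a(1) P'a(1) UU] PP kk[of b b] s2 b2 k0
    by (simp add: last add_divide_distrib[symmetric])
  have g_mm: "cn_inner (Suc k) (E' m) (E' m) = real k"
  proof -
    have "E' m k \<bullet> E' m k = (real k)\<^sup>2 * (b * b)"
      using kk[of "real k * b" "real k * b"]
      by (simp add: last inner_complex_def power2_eq_square algebra_simps)
    then show ?thesis
      using cn_inner_Suc_cmult[of k "E' m" "\<i> * U" P "E' m" "\<i> * U" P, OF Ema(1) Ema(1) UU1(3)] PP sk by simp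
  qed
  have g_mi: "cn_inner (Suc k) (E' m) (E' (skip m i)) = 0" if "i < d" for i
    using cn_inner_Suc_cmult[of k "E' m" "\<i> * U" P "E' (skip m i)" U "E i", OF Ema(1) Eia(1)[OF _ that] UU1(1)] PE[OF that] JPE[OF that] last0[OF that] by simp
  have g_im: "cn_inner (Suc k) (E' (skip m i)) (E' m) = 0" if "i < d" for i
    using g_mi[OF that] by (simp add: cn_inner_commute)
  have g_ij: "cn_inner (Suc k) (E' (skip m i)) (E' (skip m l)) = s\<^sup>2 * cn_inner k (E i) (E l)"
    if "i < d" "l < d" for i l
    using cn_inner_Suc_cmult[of k "E' (skip m i)" U "E i" "E' (skip m l)" U "E l", OF Eia(1)[OF _ that(1)] Eia(1)[OF _ that(2)] UU] last0[OF that(1)]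
    by (simp add: power2_eq_square)
  have pe_m: "cn_inner (Suc k) P' (E' m) = 0"
  proof -
    have "(of_real b * w) \<bullet> (\<i> * of_real (real k * b) * w) = 0"
      by (simp add: inner_complex_def algebra_simps)
    then show ?thesis using cn_inner_Suc_cmult[of k P' U P "E' m" "\<i> * U" P, OF P'a(1) Ema(1) UU1(2)] by (simp add: last)
  qed
  have pe_i: "cn_inner (Suc k) P' (E' (skip m i)) = 0" if "i < d" for i
    using cn_inner_Suc_cmult[of k P' U P "E' (skip m i)" U "E i", OF P'a(1) Eia(1)[OF _ that] UU] PE[OF that] last0[OF that] by simp
  have jpe_m: "cn_inner (Suc k) (cn_J P') (E' m) = 0"
  proof -
    have "cn_J P' k \<bullet> E' m k = - (real k * (b * b))"
      using kk[of b "real k * b"] by (simp add: cn_J_def last inner_complex_def algebra_simps)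
    then show ?thesis using cn_inner_Suc_cmult[of k "cn_J P'" "\<i> * U" P "E' m" "\<i> * U" P, OF P'a(2) Ema(1) UU1(3)] PP s2 b2 by simp
  qed
  have jpe_i: "cn_inner (Suc k) (cn_J P') (E' (skip m i)) = 0" if "i < d" for i
    using cn_inner_Suc_cmult[of k "cn_J P'" "\<i> * U" P "E' (skip m i)" U "E i", OF P'a(2) Eia(1)[OF _ that] UU1(1)] PE[OF that] JPE[OF that] last0[OF that] by simp
  have jee_mi: "cn_inner (Suc k) (cn_J (E' m)) (E' (skip m i)) = 0" if "i < d" for i
    using cn_inner_Suc_cmult[of k "cn_J (E' m)" "- U" P "E' (skip m i)" U "E i", OF Ema(2) Eia(1)[OF _ that] UU1(4)] PE[OF that] last0[OF that] by simp
  have jee_im: "cn_inner (Suc k) (cn_J (E' (skip m i))) (E' m) = 0" if "i < d" for i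
    using jee_mi[OF that] cn_J_skew[of "Suc k" "E' (skip m i)" "E' m"] by simp
  have jee_ij: "cn_inner (Suc k) (cn_J (E' (skip m i))) (E' (skip m l)) = 0" if "i < d" "l < d" for i l
    using cn_inner_Suc_cmult[of k "cn_J (E' (skip m i))" "\<i> * U" "E i" "E' (skip m l)" U "E l", OF Eia(2)[OF _ that(1)] Eia(1)[OF _ that(2)] UU1(1)] JEE[OF that] last0[OF that(2)]
    by simp
  have dp_mm: "cn_inner (Suc k) (D' m m) P' = - real k"
  proof -
    have "D' m m k \<bullet> P' k = - ((real k)\<^sup>2 * (b * b))"
      using kk[of "(real k)\<^sup>2 * b" b] by (simp add: last)
    then show ?thesis
      using cn_inner_Suc_cmult[of k "D' m m" "- U" P P' U P, OF Dmma P'a(1) UU1(4)] PP sk by simp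
  qed
  have dp_mi: "cn_inner (Suc k) (D' m (skip m i)) P' = 0" if "i < d" for i
    using cn_inner_Suc_cmult[of k "D' m (skip m i)" "\<i> * U" "E i" P' U P, OF Dmia(1)[OF _ that] P'a(1) UU1(1)] JEP[OF that] last0[OF that] by simp
  have dp_im: "cn_inner (Suc k) (D' (skip m i) m) P' = 0" if "i < d" for i
    using cn_inner_Suc_cmult[of k "D' (skip m i) m" "\<i> * U" "E i" P' U P, OF Dmia(2)[OF _ that] P'a(1) UU1(1)] JEP[OF that] last0[OF that] by simp
  have dp_ij: "cn_inner (Suc k) (D' (skip m i) (skip m l)) P' = - (s\<^sup>2 * cn_inner k (E i) (E l))"
    if "i < d" "l < d" for i l
    using cn_inner_Suc_cmult[of k "D' (skip m i) (skip m l)" U "D i l" P' U P, OF Dija[OF _ that] P'a(1) UU] DP[OF that] last00[OF that]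
    by (simp add: power2_eq_square)
  have trace: "(\<Sum>i<Suc d. \<Sum>l<Suc d. block_inverse m (real k) (s\<^sup>2) h i l *\<^sub>R D' i l a)
      + real (Suc d) *\<^sub>R P' a = (\<Sum>i<Suc d. (if i = m then 0 else \<tau> (if i < m then i else i - 1) / s\<^sup>2) *\<^sub>R E' i a)" for a
  proof -
    have idx: "(if skip m i < m then skip m i else skip m i - 1) = i" for i by (simp add: skip_def)
    have L: "(\<Sum>i<Suc d. \<Sum>l<Suc d. block_inverse m (real k) (s\<^sup>2) h i l *\<^sub>R D' i l a) =
        (1 / real k) *\<^sub>R D' m m a + (\<Sum>i<d. \<Sum>l<d. (h i l / s\<^sup>2) *\<^sub>R D' (skip m i) (skip m l) a)"
      unfolding sum_insert_index[OF m] block_inverse_simps by simp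
    have R: "(\<Sum>i<Suc d. (if i = m then 0 else \<tau> (if i < m then i else i - 1) / s\<^sup>2) *\<^sub>R E' i a) =
        (\<Sum>i<d. (\<tau> i / s\<^sup>2) *\<^sub>R E' (skip m i) a)"
      unfolding sum_insert_index[OF m] idx by simp
    consider "a < k" | "a = k" | "a > k" by linarith
    then show ?thesis
    proof cases
      case 1
      have "(\<Sum>i<d. \<Sum>l<d. (h i l / s\<^sup>2) *\<^sub>R D' (skip m i) (skip m l) a) =
          of_real (1 / s\<^sup>2) * U * (\<Sum>i<d. \<Sum>l<d. h i l *\<^sub>R D i l a)"
        unfolding sum_distrib_left
        by (intro sum.cong refl) (use 1 in \<open>simp add: Dija scaleR_conv_of_real\<close>)
      also have "\<dots> = of_real (1 / s\<^sup>2) * U * ((\<Sum>i<d. \<tau> i *\<^sub>R E i a) - real d *\<^sub>R P a)"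
        using \<tau>[of a] by (simp add: eq_diff_eq)
      finally have S: "(\<Sum>i<d. \<Sum>l<d. (h i l / s\<^sup>2) *\<^sub>R D' (skip m i) (skip m l) a) =
        of_real (1 / s\<^sup>2) * U * (\<Sum>i<d. \<tau> i *\<^sub>R E i a) - of_real (real d / s\<^sup>2) * U * P a"
        by (simp add: algebra_simps scaleR_conv_of_real)
      have T: "(\<Sum>i<d. (\<tau> i / s\<^sup>2) *\<^sub>R E' (skip m i) a) = of_real (1 / s\<^sup>2) * U * (\<Sum>i<d. \<tau> i *\<^sub>R E i a)"
        unfolding sum_distrib_left
        by (intro sum.cong refl) (use 1 in \<open>simp add: Eia scaleR_conv_of_real\<close>)
      (* the contributions of the new angle, of the old trace and of the position vector cancel *)
      have c0: "- (1 / real k) - real d / s\<^sup>2 + real (Suc d) = 0"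
        using k0 by (simp add: power2_eq_square s2 k field_simps)
      have "(1 / real k) *\<^sub>R D' m m a - of_real (real d / s\<^sup>2) * U * P a + real (Suc d) *\<^sub>R P' a =
          of_real (- (1 / real k) - real d / s\<^sup>2 + real (Suc d)) * (U * P a)"
        unfolding Dmma[OF 1] P'a(1)[OF 1] scaleR_conv_of_real of_real_add of_real_diff of_real_minus
        by (simp add: algebra_simps)
      also have "\<dots> = 0" by (simp only: c0 of_real_0 mult_zero_left)
      finally show ?thesis unfolding L R S T by (simp add: algebra_simps)
    next
      case 2
      have "(1 / real k) *\<^sub>R D' m m a + real (Suc d) *\<^sub>R P' a = 0"
        using k0 by (simp add: 2 last k[symmetric] scaleR_conv_of_real power2_eq_square)
      then show ?thesis unfolding L R by (simp add: 2 last0 last00)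
    next
      case 3
      then show ?thesis unfolding L R by (simp add: P' Ei Dmm Dij)
    qed
  qed
  have Cn: "P' \<in> Cn (Suc k)" "E' m \<in> Cn (Suc k)" "D' m m \<in> Cn (Suc k)"
    by (auto simp: Cn_def P' Em Dmm)
  have Cn': "E' (skip m i) \<in> Cn (Suc k)" "D' m (skip m i) \<in> Cn (Suc k)" "D' (skip m i) m \<in> Cn (Suc k)"
    if "i < d" for i using that by (auto simp: Cn_def Ei Dmi Dim)
  have Cn'': "D' (skip m i) (skip m l) \<in> Cn (Suc k)" if "i < d" "l < d" for i l
    using that by (auto simp: Cn_def Dij)
  have all1: "(\<forall>i<k. Q i) \<longleftrightarrow> Q m \<and> (\<forall>i<d. Q (skip m i))" for Q
    using m unfolding k by (auto simp: skip_less elim!: less_Suc_skip_cases)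
  have inv': "inverse_pair (Suc d) (\<lambda>i l. cn_inner (Suc k) (E' i) (E' l)) (block_inverse m (real k) (s\<^sup>2) h)"
    by (rule inverse_pair_block[OF inv m]) (use k0 s0 g_mm g_mi g_im g_ij in auto)
  show ?thesis
    unfolding legendrian_jet_def k[symmetric] all1
    using Cn Cn' Cn'' r1 pe_m pe_i jpe_m jpe_i jee_mi jee_im jee_ij dp_mm dp_mi dp_im dp_ij
      g_mm g_mi g_im g_ij inv' trace
    unfolding k[symmetric] by auto
qed

text \<open>
  The 2-jet of a Lagrangian immersion with \<open>H + \<epsilon> X\<^sup>\<bottom> = 0\<close>; the last condition says that the trace of the
  second derivatives plus \<open>\<epsilon> P\<close> is tangent.
\<close>

definition soliton_jet ::
  "nat \<Rightarrow> real \<Rightarrow> cvec \<Rightarrow> (nat \<Rightarrow> cvec) \<Rightarrow> (nat \<Rightarrow> nat \<Rightarrow> cvec) \<Rightarrow> (nat \<Rightarrow> nat \<Rightarrow> real) \<Rightarrow> bool" where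
  "soliton_jet n \<epsilon> P E D h \<longleftrightarrow>
     P \<in> Cn n \<and> (\<forall>i<n. E i \<in> Cn n) \<and> (\<forall>i<n. \<forall>j<n. D i j \<in> Cn n) \<and>
     (\<forall>i<n. \<forall>j<n. cn_inner n (cn_J (E i)) (E j) = 0) \<and>
     inverse_pair n (\<lambda>i j. cn_inner n (E i) (E j)) h \<and>
     (\<exists>\<tau>. \<forall>a. (\<Sum>i<n. \<Sum>j<n. h i j *\<^sub>R D i j a) + \<epsilon> *\<^sub>R P a = (\<Sum>i<n. \<tau> i *\<^sub>R E i a))"

text \<open>
  Since the given jet is minimal in the sphere, the trace over the old indices is tangent up to
  \<open>- d G P / |G|\<^sup>2\<close>. What remains is a multiple of \<open>P\<close>, and \<open>ode\<close> says that it is tangent to the curve.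
\<close>

lemma profile_jet:
  assumes jet: "legendrian_jet d P E D h"
    and G: "G \<noteq> 0" and G1: "cmod G1 = 1"
    and ode: "G2 - of_real (real d / (cmod G)\<^sup>2) * G + of_real \<epsilon> * G = of_real \<kappa> * G1"
    and E0: "E' 0 = (\<lambda>a. G1 * P a)" and Ei: "\<And>i. i < d \<Longrightarrow> E' (Suc i) = (\<lambda>a. G * E i a)"
    and D00: "D' 0 0 = (\<lambda>a. G2 * P a)"
    and D0i: "\<And>i. i < d \<Longrightarrow> D' 0 (Suc i) = (\<lambda>a. G1 * E i a)"
    and Di0: "\<And>i. i < d \<Longrightarrow> D' (Suc i) 0 = (\<lambda>a. G1 * E i a)"
    and Dij: "\<And>i j. i < d \<Longrightarrow> j < d \<Longrightarrow> D' (Suc i) (Suc j) = (\<lambda>a. G * D i j a)"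
  shows "soliton_jet (Suc d) \<epsilon> (\<lambda>a. G * P a) E' D' (block_inverse 0 1 ((cmod G)\<^sup>2) h)"
proof -
  let ?n = "Suc d"
  define h' where "h' = block_inverse 0 1 ((cmod G)\<^sup>2) h"
  note j = jet[unfolded legendrian_jet_def]
  have PP: "cn_inner ?n P P = 1" and PE: "\<And>i. i < d \<Longrightarrow> cn_inner ?n P (E i) = 0"
    and JPE: "\<And>i. i < d \<Longrightarrow> cn_inner ?n (cn_J P) (E i) = 0"
    and JEE: "\<And>i l. i < d \<Longrightarrow> l < d \<Longrightarrow> cn_inner ?n (cn_J (E i)) (E l) = 0"
    and inv: "inverse_pair d (\<lambda>i l. cn_inner ?n (E i) (E l)) h"
    using j by auto
  obtain \<tau> where \<tau>: "\<And>a. (\<Sum>i<d. \<Sum>l<d. h i l *\<^sub>R D i l a) + real d *\<^sub>R P a = (\<Sum>i<d. \<tau> i *\<^sub>R E i a)"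
    using j by blast
  have GG: "G * cnj G = of_real ((cmod G)\<^sup>2)" "G1 * cnj G1 = 1"
    using complex_norm_square[of G] complex_norm_square[of G1] G1 by simp_all
  have G0: "(cmod G)\<^sup>2 \<noteq> 0" using G by simp
  have J: "cn_J (\<lambda>a. c * u a) = (\<lambda>a. (\<i> * c) * u a)" for c u by (simp add: cn_J_def mult.assoc)
  have g0i: "cn_inner ?n (E' 0) (E' (Suc l)) = 0" if "l < d" for l
    using that by (simp add: E0 Ei cn_inner_cmult PE JPE)
  have gi0: "cn_inner ?n (E' (Suc l)) (E' 0) = 0" if "l < d" for l
    using g0i[OF that] by (simp add: cn_inner_commute)
  have inv': "inverse_pair (Suc d) (\<lambda>i j. cn_inner (Suc d) (E' i) (E' j)) h'"
    unfolding h'_def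
    by (rule inverse_pair_block[OF inv])
      (use G0 g0i gi0 in \<open>simp_all add: E0 Ei cn_inner_cmult GG PP\<close>)
  have JE0: "cn_inner ?n (cn_J (E' 0)) (E' (Suc l)) = 0" if "l < d" for l
    using that by (simp add: E0 Ei J cn_inner_cmult PE JPE)
  have JEij: "cn_inner ?n (cn_J (E' (Suc i))) (E' (Suc l)) = 0" if "i < d" "l < d" for i l
  proof -
    have "\<i> * G * cnj G = \<i> * of_real ((cmod G)\<^sup>2)" using GG(1) by (simp add: mult.assoc)
    then show ?thesis
      unfolding Ei[OF that(1)] Ei[OF that(2)] J cn_inner_cmult by (simp add: JEE[OF that])
  qed
  have lag: "cn_inner (Suc d) (cn_J (E' i)) (E' j) = 0" if "i < Suc d" "j < Suc d" for i j
    using that JE0 JEij cn_J_skew[of ?n "E' i" "E' 0"] by (cases i; cases j) auto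
  have PC: "(\<lambda>a. G * P a) \<in> Cn (Suc d)" using j by (auto simp: Cn_def)
  have EC: "E' i \<in> Cn (Suc d)" if "i < Suc d" for i
    using that j by (cases i) (auto simp: E0 Ei Cn_def)
  have DC: "D' i j \<in> Cn (Suc d)" if "i < Suc d" "j < Suc d" for i j
    using that j by (cases i; cases j) (auto simp: D00 D0i Di0 Dij Cn_def)
  define \<sigma> where "\<sigma> i = (case i of 0 \<Rightarrow> \<kappa> | Suc l \<Rightarrow> \<tau> l / (cmod G)\<^sup>2)" for i
  have "(\<Sum>i<Suc d. \<Sum>l<Suc d. h' i l *\<^sub>R D' i l a) + \<epsilon> *\<^sub>R (G * P a) = (\<Sum>i<Suc d. \<sigma> i *\<^sub>R E' i a)" for a
  proof -
    have bi: "block_inverse 0 \<mu> c h 0 (Suc l) = 0" "block_inverse 0 \<mu> c h (Suc i) 0 = 0"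
      "block_inverse 0 \<mu> c h (Suc i) (Suc l) = h i l / c" for \<mu> c i l
      using block_inverse_simps[of 0] by simp_all
    have L: "(\<Sum>i<Suc d. \<Sum>l<Suc d. h' i l *\<^sub>R D' i l a) =
        D' 0 0 a + (\<Sum>i<d. \<Sum>l<d. (h i l / (cmod G)\<^sup>2) *\<^sub>R D' (Suc i) (Suc l) a)"
      unfolding sum.lessThan_Suc_shift h'_def bi by simp
    have "(\<Sum>i<d. \<Sum>l<d. (h i l / (cmod G)\<^sup>2) *\<^sub>R D' (Suc i) (Suc l) a) =
        of_real (1 / (cmod G)\<^sup>2) * G * (\<Sum>i<d. \<Sum>l<d. h i l *\<^sub>R D i l a)"
      unfolding sum_distrib_left
      by (intro sum.cong refl) (simp add: Dij scaleR_conv_of_real)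
    also have "(\<Sum>i<d. \<Sum>l<d. h i l *\<^sub>R D i l a) = (\<Sum>i<d. \<tau> i *\<^sub>R E i a) - real d *\<^sub>R P a"
      using \<tau>[of a] by (simp add: eq_diff_eq)
    finally have S: "(\<Sum>i<d. \<Sum>l<d. (h i l / (cmod G)\<^sup>2) *\<^sub>R D' (Suc i) (Suc l) a) =
        of_real (1 / (cmod G)\<^sup>2) * G * (\<Sum>i<d. \<tau> i *\<^sub>R E i a) - of_real (real d / (cmod G)\<^sup>2) * G * P a"
      by (simp add: algebra_simps scaleR_conv_of_real)
    have T: "(\<Sum>i<d. (\<tau> i / (cmod G)\<^sup>2) *\<^sub>R E' (Suc i) a) =
        of_real (1 / (cmod G)\<^sup>2) * G * (\<Sum>i<d. \<tau> i *\<^sub>R E i a)"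
      unfolding sum_distrib_left
      by (intro sum.cong refl) (simp add: Ei scaleR_conv_of_real)
    have "D' 0 0 a - of_real (real d / (cmod G)\<^sup>2) * G * P a + \<epsilon> *\<^sub>R (G * P a) =
        (G2 - of_real (real d / (cmod G)\<^sup>2) * G + of_real \<epsilon> * G) * P a"
      by (simp add: D00 algebra_simps scaleR_conv_of_real)
    also have "\<dots> = \<kappa> *\<^sub>R E' 0 a" by (simp only: ode E0 scaleR_conv_of_real mult.assoc)
    finally have "D' 0 0 a - of_real (real d / (cmod G)\<^sup>2) * G * P a + \<epsilon> *\<^sub>R (G * P a) = \<kappa> *\<^sub>R E' 0 a" .
    moreover have "(\<Sum>i<Suc d. \<sigma> i *\<^sub>R E' i a) =
        \<kappa> *\<^sub>R E' 0 a + (\<Sum>i<d. (\<tau> i / (cmod G)\<^sup>2) *\<^sub>R E' (Suc i) a)"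
      by (simp only: sum.lessThan_Suc_shift \<sigma>_def nat.case)
    ultimately show ?thesis unfolding L S T by (simp add: algebra_simps)
  qed
  then show ?thesis
    using inv' lag PC EC DC unfolding soliton_jet_def h'_def[symmetric] by blast
qed

section \<open>Inserting one coordinate\<close>

definition drop_coord :: "nat \<Rightarrow> (nat \<Rightarrow> real) \<Rightarrow> nat \<Rightarrow> real" where
  "drop_coord m x = (\<lambda>i. x (skip m i))"

definition insert_dom :: "nat \<Rightarrow> real set \<Rightarrow> (nat \<Rightarrow> real) set \<Rightarrow> (nat \<Rightarrow> real) set" where
  "insert_dom m S V = {x. x m \<in> S \<and> drop_coord m x \<in> V}"

text \<open>
  The common form of the suspension and of the profile immersion in coordinates: a curve with coordinate \<open>x m\<close> acts on \<open>F\<close>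
  componentwise and adds a vector.
\<close>

definition insert_fun :: "nat \<Rightarrow> (nat \<Rightarrow> real \<Rightarrow> complex) \<Rightarrow> (nat \<Rightarrow> real \<Rightarrow> complex) \<Rightarrow>
    ((nat \<Rightarrow> real) \<Rightarrow> cvec) \<Rightarrow> (nat \<Rightarrow> real) \<Rightarrow> cvec" where
  "insert_fun m A B F = (\<lambda>x a. A a (x m) * F (drop_coord m x) a + B a (x m))"

lemma drop_coord_upd [simp]:
  "drop_coord m (x(m := t)) = drop_coord m x"
  "drop_coord m (x(skip m i := t)) = (drop_coord m x)(i := t)"
  by (auto simp: drop_coord_def)

lemma drop_coord_apply: "drop_coord m x i = x (skip m i)"
  by (simp add: drop_coord_def)

lemma slice_insert_dom:
  assumes "x \<in> insert_dom m S V"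
  shows "slice (insert_dom m S V) m x = S"
    and "slice (insert_dom m S V) (skip m i) x = slice V i (drop_coord m x)"
  using assms by (auto simp: slice_def insert_dom_def)

lemma slice_perfect_insert_dom:
  assumes V: "slice_perfect d V" and S: "\<forall>t\<in>S. t islimpt S" and m: "m \<le> d"
  shows "slice_perfect (Suc d) (insert_dom m S V)"
  unfolding slice_perfect_def
proof (intro ballI allI impI)
  fix x i assume x: "x \<in> insert_dom m S V" and "i < Suc d"
  from \<open>i < Suc d\<close> m show "x i islimpt slice (insert_dom m S V) i x"
  proof (cases rule: less_Suc_skip_cases)
    case 1
    then show ?thesis using x S slice_insert_dom(1)[OF x] by (simp add: insert_dom_def)
  next
    case (2 j)
    then have "drop_coord m x j islimpt slice V j (drop_coord m x)"
      using V x by (auto simp: slice_perfect_def insert_dom_def)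
    then show ?thesis using 2 slice_insert_dom(2)[OF x, of j] by (simp add: drop_coord_def)
  qed
qed

lemma continuous_on_drop_coord: "continuous_on W (drop_coord m)"
  unfolding drop_coord_def
  by (intro continuous_on_coordinatewise_then_product continuous_on_subset[OF continuous_on_product_coordinates]) simp

lemma smooth_on_insert_fun:
  assumes V: "slice_perfect d V" and S: "\<forall>t\<in>S. t islimpt S" and m: "m \<le> d"
    and A: "\<And>a. smooth_curve S (A a)" and B: "\<And>a. smooth_curve S (B a)" and F: "smooth_on d V F"
  shows "smooth_on (Suc d) (insert_dom m S V) (insert_fun m A B F)"
  unfolding smooth_on_def
proof
  fix k
  let ?W = "insert_dom m S V"
  have sl: "slice ?W m x \<subseteq> S" if "x \<in> ?W" for x using slice_insert_dom(1)[OF that] by simp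
  have "scalar_Ck k (Suc d) ?W (\<lambda>x. F (drop_coord m x) a)" for a
  proof (rule scalar_Ck_reindex[where W = V and d' = d and g = "\<lambda>y. F y a"])
    show "drop_coord m ` ?W \<subseteq> V" by (auto simp: insert_dom_def)
    show "continuous_on ?W (drop_coord m)" by (rule continuous_on_drop_coord)
    show "scalar_Ck k d V (\<lambda>y. F y a)" using F Ck_on_iff_scalar_Ck[OF V, of k F] by (auto simp: smooth_on_def)
    fix i assume "i < Suc d"
    then show "(\<exists>j<d. \<forall>x\<in>?W. x i = drop_coord m x j \<and> (\<forall>t. drop_coord m (x(i := t)) = (drop_coord m x)(j := t))) \<or>
        (\<forall>x\<in>?W. \<forall>t. drop_coord m (x(i := t)) = drop_coord m x)"
      using m
    proof (cases rule: less_Suc_skip_cases)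
      case (2 j)
      then show ?thesis by (intro disjI1 exI[of _ j]) (simp add: drop_coord_apply)
    qed simp
  qed
  then have "scalar_Ck k (Suc d) ?W (\<lambda>x. A a (x m) * F (drop_coord m x) a + B a (x m))" for a
    by (intro scalar_Ck_add scalar_Ck_mult smooth_curve_imp_scalar_Ck[OF sl] A B)
  then show "Ck_on k (Suc d) ?W (insert_fun m A B F)"
    using Ck_on_iff_scalar_Ck[OF slice_perfect_insert_dom[OF V S m], of k "insert_fun m A B F"] by (simp add: insert_fun_def)
qed

text \<open>
  Differentiation preserves the form \<open>insert_fun\<close>, with the derivatives of the coefficients in direction \<open>m\<close>
  and that of \<open>F\<close> in the old directions, where the added vector disappears.
\<close>

lemma partial_d_insert_fun:
  assumes V: "slice_perfect d V" and S: "\<forall>t\<in>S. t islimpt S" and m: "m \<le> d"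
    and A: "\<And>a. \<forall>t\<in>S. (A a has_vector_derivative A' a t) (at t within S)"
    and B: "\<And>a. \<forall>t\<in>S. (B a has_vector_derivative B' a t) (at t within S)"
    and F: "smooth_on d V F" and x: "x \<in> insert_dom m S V"
  shows "partial_d (insert_dom m S V) m (insert_fun m A B F) x = insert_fun m A' B' F x"
    and "i < d \<Longrightarrow> partial_d (insert_dom m S V) (skip m i) (insert_fun m A B F) x =
       insert_fun m A (\<lambda>a t. 0) (partial_d V i F) x"
proof -
  let ?W = "insert_dom m S V"
  have slice_perfect: "slice_perfect (Suc d) ?W" by (rule slice_perfect_insert_dom[OF V S m])
  have xm: "x m \<in> S" "drop_coord m x \<in> V" using x by (auto simp: insert_dom_def)
  show "partial_d ?W m (insert_fun m A B F) x = insert_fun m A' B' F x"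
  proof
    fix a
    have "((\<lambda>t. A a t * F (drop_coord m x) a + B a t) has_vector_derivative
        A' a (x m) * F (drop_coord m x) a + B' a (x m)) (at (x m) within S)"
      using bspec[OF A[of a] xm(1)] bspec[OF B[of a] xm(1)]
      by (intro has_vector_derivative_add has_vector_derivative_mult_left)
    then have "has_partial ?W m (\<lambda>y. insert_fun m A B F y a) (insert_fun m A' B' F x a) x"
      by (simp add: has_partial_def slice_insert_dom(1)[OF x] insert_fun_def)
    then show "partial_d ?W m (insert_fun m A B F) x a = insert_fun m A' B' F x a"
      by (rule partial_d_eqI[OF _ slice_perfect x]) (rule le_imp_less_Suc[OF m])
  qed
  show "partial_d ?W (skip m i) (insert_fun m A B F) x = insert_fun m A (\<lambda>a t. 0) (partial_d V i F) x"
    if i: "i < d"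
  proof
    fix a
    have "((\<lambda>t. F ((drop_coord m x)(i := t)) a) has_vector_derivative partial_d V i F (drop_coord m x) a)
        (at (drop_coord m x i) within slice V i (drop_coord m x))"
      using smooth_on_has_partial[OF F i xm(2), of a] by (simp add: has_partial_def)
    then have "((\<lambda>t. A a (x m) * F ((drop_coord m x)(i := t)) a + B a (x m)) has_vector_derivative
        A a (x m) * partial_d V i F (drop_coord m x) a + 0) (at (drop_coord m x i) within slice V i (drop_coord m x))"
      by (intro has_vector_derivative_add has_vector_derivative_mult_right has_vector_derivative_const)
    then have "has_partial ?W (skip m i) (\<lambda>y. insert_fun m A B F y a)
        (insert_fun m A (\<lambda>a t. 0) (partial_d V i F) x a) x"
      by (simp add: has_partial_def slice_insert_dom(2)[OF x] insert_fun_def drop_coord_apply)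
    then show "partial_d ?W (skip m i) (insert_fun m A B F) x a =
        insert_fun m A (\<lambda>a t. 0) (partial_d V i F) x a"
      by (rule partial_d_eqI[OF _ slice_perfect x]) (use i in \<open>simp add: skip_less\<close>)
  qed
qed

lemma partial_d2_insert_fun:
  assumes V: "slice_perfect d V" and S: "\<forall>t\<in>S. t islimpt S" and m: "m \<le> d"
    and A: "\<And>a. \<forall>t\<in>S. (A a has_vector_derivative A' a t) (at t within S)"
    and A': "\<And>a. \<forall>t\<in>S. (A' a has_vector_derivative A'' a t) (at t within S)"
    and B: "\<And>a. \<forall>t\<in>S. (B a has_vector_derivative B' a t) (at t within S)"
    and B': "\<And>a. \<forall>t\<in>S. (B' a has_vector_derivative B'' a t) (at t within S)"
    and F: "smooth_on d V F" and x: "x \<in> insert_dom m S V"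
  defines "W \<equiv> insert_dom m S V" and "G \<equiv> insert_fun m A B F"
  shows "partial_d W m (partial_d W m G) x = insert_fun m A'' B'' F x"
    and "i < d \<Longrightarrow> partial_d W (skip m i) (partial_d W m G) x = insert_fun m A' (\<lambda>a t. 0) (partial_d V i F) x"
    and "i < d \<Longrightarrow> partial_d W m (partial_d W (skip m i) G) x = insert_fun m A' (\<lambda>a t. 0) (partial_d V i F) x"
    and "i < d \<Longrightarrow> j < d \<Longrightarrow> partial_d W (skip m i) (partial_d W (skip m j) G) x =
       insert_fun m A (\<lambda>a t. 0) (partial_d V i (partial_d V j F)) x"
proof -
  note d1 = partial_d_insert_fun[OF V S m A B F]
  have xW: "x \<in> W" using x by (simp add: W_def)
  have c1: "partial_d W j (partial_d W m G) x = partial_d W j (insert_fun m A' B' F) x" for j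
    by (rule partial_d_cong[OF _ xW]) (use d1(1) in \<open>simp add: W_def G_def\<close>)
  have c2: "partial_d W j (partial_d W (skip m i) G) x =
      partial_d W j (insert_fun m A (\<lambda>a t. 0) (partial_d V i F)) x" if "i < d" for i j
    by (rule partial_d_cong[OF _ xW]) (use d1(2) that in \<open>simp add: W_def G_def\<close>)
  show "partial_d W m (partial_d W m G) x = insert_fun m A'' B'' F x"
    unfolding c1 unfolding W_def by (rule partial_d_insert_fun(1)[OF V S m A' B' F x])
  show "i < d \<Longrightarrow> partial_d W (skip m i) (partial_d W m G) x = insert_fun m A' (\<lambda>a t. 0) (partial_d V i F) x"
    unfolding c1 unfolding W_def by (rule partial_d_insert_fun(2)[OF V S m A' B' F x])
  have z: "\<forall>t\<in>S. ((\<lambda>t. 0 :: complex) has_vector_derivative 0) (at t within S)" by simp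
  show "partial_d W m (partial_d W (skip m i) G) x = insert_fun m A' (\<lambda>a t. 0) (partial_d V i F) x"
    if i: "i < d"
    unfolding c2[OF i] unfolding W_def
    by (rule partial_d_insert_fun(1)[OF V S m A z smooth_on_partial_d[OF F i] x])
  show "partial_d W (skip m i) (partial_d W (skip m j) G) x =
       insert_fun m A (\<lambda>a t. 0) (partial_d V i (partial_d V j F)) x" if i: "i < d" and j: "j < d"
    unfolding c2[OF j] unfolding W_def
    by (rule partial_d_insert_fun(2)[OF V S m A z smooth_on_partial_d[OF F j] x i])
qed

lemma has_vector_derivative_exponential:
  "((\<lambda>t. C * cis (w * t)) has_vector_derivative (C * (\<i> * of_real w)) * cis (w * t)) (at t within S)"
  unfolding cis_conv_exp
  by (auto intro!: derivative_eq_intros has_vector_derivative_real_field simp: algebra_simps)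

text \<open>
  All derivatives are multiples of the function itself, so the multiples form the required family.
\<close>

lemma smooth_curve_exponential: "smooth_curve S (\<lambda>t. C * cis (w * t))"
proof -
  have "\<exists>f'\<in>range (\<lambda>C t. C * cis (w * t)). \<forall>t\<in>S. (f has_vector_derivative f' t) (at t within S)"
    if f_rng: "f \<in> range (\<lambda>C t. C * cis (w * t))" for f
  proof -
    obtain C where f: "f = (\<lambda>t. C * cis (w * t))" using f_rng by blast
    show ?thesis
      unfolding f
      by (intro bexI[of _ "\<lambda>t. (C * (\<i> * of_real w)) * cis (w * t)"] ballI rangeI
          has_vector_derivative_exponential)
  qed
  then show ?thesis
    unfolding smooth_curve_def by (intro exI[of _ "range (\<lambda>C t. C * cis (w * t))"]) simp
qed

section \<open>Products of manifolds\<close>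

definition first_coords :: "nat \<Rightarrow> (nat \<Rightarrow> real) \<Rightarrow> nat \<Rightarrow> real" where
  "first_coords m x = (\<lambda>i. if i < m then x i else 0)"

definition last_coords :: "nat \<Rightarrow> (nat \<Rightarrow> real) \<Rightarrow> nat \<Rightarrow> real" where
  "last_coords m x = (\<lambda>i. x (i + m))"

definition prod_coords :: "nat \<Rightarrow> ('a \<Rightarrow> nat \<Rightarrow> real) \<Rightarrow> ('b \<Rightarrow> nat \<Rightarrow> real) \<Rightarrow> 'a \<times> 'b \<Rightarrow> nat \<Rightarrow> real" where
  "prod_coords m \<phi> \<kappa> = (\<lambda>(p, q) i. if i < m then \<phi> p i else \<kappa> q (i - m))"

definition prod_range :: "nat \<Rightarrow> (nat \<Rightarrow> real) set \<Rightarrow> (nat \<Rightarrow> real) set \<Rightarrow> (nat \<Rightarrow> real) set" where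
  "prod_range m A B = {x. first_coords m x \<in> A \<and> last_coords m x \<in> B}"

lemma prod_mfd_simps:
  "mtop (prod_mfd M N) = prod_topology (mtop M) (mtop N)"
  "mdim (prod_mfd M N) = mdim M + mdim N"
  by (simp_all add: prod_mfd_def)

lemma prod_mfd_atlas:
  "matlas (prod_mfd M N) = {(U \<times> V, prod_coords (mdim M) \<phi> \<kappa>) | U \<phi> V \<kappa>. (U, \<phi>) \<in> matlas M \<and> (V, \<kappa>) \<in> matlas N}"
  unfolding prod_mfd_def prod_coords_def by force

lemma prod_mfd_chartE:
  assumes "c \<in> matlas (prod_mfd M N)"
  obtains U \<phi> V \<kappa> where "c = (U \<times> V, prod_coords (mdim M) \<phi> \<kappa>)" "(U, \<phi>) \<in> matlas M" "(V, \<kappa>) \<in> matlas N"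
  using assms unfolding prod_mfd_atlas by blast

lemma last_coords_prod_coords [simp]: "last_coords m (prod_coords m \<phi> \<kappa> (p, q)) = \<kappa> q"
  by (auto simp: last_coords_def prod_coords_def)

lemma first_coords_prod_coords:
  "\<phi> p \<in> {x. \<forall>i\<ge>m. x i = 0} \<Longrightarrow> first_coords m (prod_coords m \<phi> \<kappa> (p, q)) = \<phi> p"
  by (auto simp: first_coords_def prod_coords_def fun_eq_iff)

lemma prod_coords_eq_iff: "prod_coords m \<phi> \<kappa> (p, q) = x \<longleftrightarrow> first_coords m x = first_coords m (\<phi> p) \<and> last_coords m x = \<kappa> q"
proof
  assume *: "first_coords m x = first_coords m (\<phi> p) \<and> last_coords m x = \<kappa> q"
  show "prod_coords m \<phi> \<kappa> (p, q) = x"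
  proof
    fix i show "prod_coords m \<phi> \<kappa> (p, q) i = x i"
      using * by (cases "i < m")
        (auto simp: prod_coords_def first_coords_def last_coords_def fun_eq_iff dest: spec[of _ "i - m"] split: if_splits)
  qed
qed (auto simp: prod_coords_def first_coords_def last_coords_def)

lemma first_coords_id: "x \<in> {x. \<forall>i\<ge>m. x i = 0} \<Longrightarrow> first_coords m x = x"
  by (auto simp: first_coords_def fun_eq_iff)

lemma prod_coords_image:
  assumes "\<phi> ` U \<subseteq> {x. \<forall>i\<ge>m. x i = 0}"
  shows "prod_coords m \<phi> \<kappa> ` (U \<times> V) = prod_range m (\<phi> ` U) (\<kappa> ` V)"
proof (intro set_eqI iffI)
  fix x assume "x \<in> prod_range m (\<phi> ` U) (\<kappa> ` V)"
  then obtain p q where pq: "p \<in> U" "q \<in> V" "first_coords m x = \<phi> p" "last_coords m x = \<kappa> q" by (auto simp: prod_range_def)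
  then have "prod_coords m \<phi> \<kappa> (p, q) = x"
    using assms first_coords_id[of "\<phi> p" m] unfolding prod_coords_eq_iff by auto
  then show "x \<in> prod_coords m \<phi> \<kappa> ` (U \<times> V)" using pq by blast
next
  fix x assume "x \<in> prod_coords m \<phi> \<kappa> ` (U \<times> V)"
  then obtain p q where pq: "p \<in> U" "q \<in> V" "x = prod_coords m \<phi> \<kappa> (p, q)" by blast
  have "\<phi> p \<in> {x. \<forall>i\<ge>m. x i = 0}" using assms pq(1) by blast
  then show "x \<in> prod_range m (\<phi> ` U) (\<kappa> ` V)"
    using pq first_coords_prod_coords[of \<phi> p m \<kappa> q] by (simp add: prod_range_def)
qed

lemma inj_on_prod_coords:
  assumes "\<phi> ` U \<subseteq> {x. \<forall>i\<ge>m. x i = 0}" "inj_on \<phi> U" "inj_on \<kappa> V"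
  shows "inj_on (prod_coords m \<phi> \<kappa>) (U \<times> V)"
proof (rule inj_onI, clarify)
  fix p q p' q' assume *: "p \<in> U" "q \<in> V" "p' \<in> U" "q' \<in> V"
    "prod_coords m \<phi> \<kappa> (p, q) = prod_coords m \<phi> \<kappa> (p', q')"
  have "\<phi> p \<in> {x. \<forall>i\<ge>m. x i = 0}" "\<phi> p' \<in> {x. \<forall>i\<ge>m. x i = 0}" using assms(1) * by blast+
  then have "\<phi> p = \<phi> p'"
    using arg_cong[OF *(5), of "first_coords m"] first_coords_prod_coords[of \<phi> p m \<kappa> q] first_coords_prod_coords[of \<phi> p' m \<kappa> q'] by simp
  moreover have "\<kappa> q = \<kappa> q'" using arg_cong[OF *(5), of "last_coords m"] by simp
  ultimately show "p = p' \<and> q = q'" using assms(2,3) * by (auto dest: inj_onD)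
qed

lemma inv_into_prod_coords:
  assumes "\<phi> ` U \<subseteq> {x. \<forall>i\<ge>m. x i = 0}" "inj_on \<phi> U" "inj_on \<kappa> V"
    and x: "x \<in> prod_range m (\<phi> ` U) (\<kappa> ` V)"
  shows "inv_into (U \<times> V) (prod_coords m \<phi> \<kappa>) x = (inv_into U \<phi> (first_coords m x), inv_into V \<kappa> (last_coords m x))"
proof (rule inv_into_f_eq[OF inj_on_prod_coords[OF assms(1-3)]])
  have l: "first_coords m x \<in> \<phi> ` U" and h: "last_coords m x \<in> \<kappa> ` V" using x by (auto simp: prod_range_def)
  show "(inv_into U \<phi> (first_coords m x), inv_into V \<kappa> (last_coords m x)) \<in> U \<times> V"
    using l h by (simp add: inv_into_into)
  have "first_coords m (first_coords m x) = first_coords m x" by (auto simp: first_coords_def)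
  then show "prod_coords m \<phi> \<kappa> (inv_into U \<phi> (first_coords m x), inv_into V \<kappa> (last_coords m x)) = x"
    unfolding prod_coords_eq_iff using l h by (simp add: f_inv_into_f)
qed

lemma continuous_on_first_coords: "continuous_on S (first_coords m)"
proof (rule continuous_on_coordinatewise_then_product)
  fix i show "continuous_on S (\<lambda>x. first_coords m x i)"
    by (cases "i < m") (auto simp: first_coords_def intro: continuous_on_subset[OF continuous_on_product_coordinates])
qed

lemma continuous_on_last_coords: "continuous_on S (last_coords m)"
  unfolding last_coords_def
  by (intro continuous_on_coordinatewise_then_product continuous_on_subset[OF continuous_on_product_coordinates]) simp

lemma openin_prod_range:
  assumes "openin (Euclidean_space m) A" "openin (Euclidean_space d) B"
  shows "openin (Euclidean_space (m + d)) (prod_range m A B)"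
proof -
  obtain G where G: "open G" "A = {x. \<forall>i\<ge>m. x i = 0} \<inter> G"
    using assms(1) by (auto simp: Euclidean_space_top_of_set openin_open)
  obtain H where H: "open H" "B = {x. \<forall>i\<ge>d. x i = 0} \<inter> H"
    using assms(2) by (auto simp: Euclidean_space_top_of_set openin_open)
  have "last_coords m x \<in> {x. \<forall>i\<ge>d. x i = 0} \<longleftrightarrow> x \<in> {x. \<forall>i\<ge>m + d. x i = 0}" for x
  proof -
    have "(\<forall>i\<ge>d. x (i + m) = 0) \<longleftrightarrow> (\<forall>i\<ge>m + d. x i = 0)"
      by (metis add.commute add_le_cancel_right le_add2 le_add_diff_inverse le_trans)
    then show ?thesis by (simp add: last_coords_def)
  qed
  moreover have "first_coords m x \<in> {x. \<forall>i\<ge>m. x i = 0}" for x by (simp add: first_coords_def)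
  ultimately have "prod_range m A B = {x. \<forall>i\<ge>m + d. x i = 0} \<inter> (first_coords m -` G \<inter> last_coords m -` H)"
    using G(2) H(2) unfolding prod_range_def by blast
  moreover have "open (first_coords m -` G \<inter> last_coords m -` H)"
    using continuous_on_first_coords[of UNIV m] continuous_on_last_coords[of UNIV m] G(1) H(1)
    by (auto simp: continuous_on_open_vimage[OF open_UNIV])
  ultimately show ?thesis by (auto simp: Euclidean_space_top_of_set openin_open)
qed

lemma openin_half_space_iff:
  "openin (half_space d) V \<longleftrightarrow> (\<exists>W. openin (Euclidean_space d) W \<and> V = W \<inter> {x. 0 \<le> x 0})"
  by (simp add: half_space_def openin_subtopology)

lemma openin_prod_range_half:
  assumes "openin (half_space m) A" "openin (Euclidean_space d) B" "0 < m"
  shows "openin (half_space (m + d)) (prod_range m A B)"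
proof -
  obtain W where W: "openin (Euclidean_space m) W" "A = W \<inter> {x. 0 \<le> x 0}"
    using assms(1) openin_half_space_iff by blast
  have "prod_range m A B = prod_range m W B \<inter> {x. 0 \<le> x 0}"
    using assms(3) by (auto simp: prod_range_def W(2) first_coords_def)
  then show ?thesis using openin_prod_range[OF W(1) assms(2)] openin_half_space_iff by blast
qed

lemma chart_range_prod_range:
  assumes "chart_range m A" "openin (Euclidean_space d) B" "0 < m \<or> openin (Euclidean_space m) A"
  shows "chart_range (m + d) (prod_range m A B)"
  using assms openin_prod_range openin_prod_range_half unfolding chart_range_def by blast

text \<open>
  The inverse applies the inverses of the factors to the two groups of coordinates.
\<close>

lemma homeomorphic_map_prod_coords:
  assumes \<phi>: "homeomorphic_map (subtopology X U) (subtopology (Euclidean_space m) (\<phi> ` U)) \<phi>"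
    and \<kappa>: "homeomorphic_map (subtopology Y V) (subtopology (Euclidean_space d) (\<kappa> ` V)) \<kappa>"
    and U: "U \<subseteq> topspace X" "\<phi> ` U \<subseteq> {x. \<forall>i\<ge>m. x i = 0}"
    and V: "V \<subseteq> topspace Y" "\<kappa> ` V \<subseteq> {x. \<forall>i\<ge>d. x i = 0}"
  shows "homeomorphic_map (subtopology (prod_topology X Y) (U \<times> V))
    (subtopology (Euclidean_space (m + d)) (prod_coords m \<phi> \<kappa> ` (U \<times> V))) (prod_coords m \<phi> \<kappa>)"
proof -
  let ?E = "subtopology (Euclidean_space (m + d)) (prod_range m (\<phi> ` U) (\<kappa> ` V))"
  obtain f where f: "homeomorphic_maps (subtopology X U) (subtopology (Euclidean_space m) (\<phi> ` U)) \<phi> f"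
    using \<phi> homeomorphic_map_maps by blast
  obtain g where g: "homeomorphic_maps (subtopology Y V) (subtopology (Euclidean_space d) (\<kappa> ` V)) \<kappa> g"
    using \<kappa> homeomorphic_map_maps by blast
  have f': "continuous_map (subtopology X U) (subtopology (Euclidean_space m) (\<phi> ` U)) \<phi>"
    "continuous_map (subtopology (Euclidean_space m) (\<phi> ` U)) (subtopology X U) f"
    "\<And>p. p \<in> U \<Longrightarrow> f (\<phi> p) = p"
    using f U by (auto simp: homeomorphic_maps_def)
  have g': "continuous_map (subtopology Y V) (subtopology (Euclidean_space d) (\<kappa> ` V)) \<kappa>"
    "continuous_map (subtopology (Euclidean_space d) (\<kappa> ` V)) (subtopology Y V) g"
    "\<And>p. p \<in> V \<Longrightarrow> g (\<kappa> p) = p"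
    using g V by (auto simp: homeomorphic_maps_def)
  have img: "prod_coords m \<phi> \<kappa> ` (U \<times> V) = prod_range m (\<phi> ` U) (\<kappa> ` V)"
    by (rule prod_coords_image[OF U(2)])
  have XY: "subtopology (prod_topology X Y) (U \<times> V) = prod_topology (subtopology X U) (subtopology Y V)"
    by (simp add: subtopology_Times)
  have rng: "prod_range m (\<phi> ` U) (\<kappa> ` V) \<subseteq> {x. \<forall>i\<ge>m + d. x i = 0}"
  proof
    fix x assume "x \<in> prod_range m (\<phi> ` U) (\<kappa> ` V)"
    then have "last_coords m x \<in> {x. \<forall>i\<ge>d. x i = 0}" using V(2) by (auto simp: prod_range_def)
    then have h: "x (i + m) = 0" if "i \<ge> d" for i using that by (auto simp: last_coords_def)
    have "x i = 0" if "i \<ge> m + d" for i using h[of "i - m"] that by simp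
    then show "x \<in> {x. \<forall>i\<ge>m + d. x i = 0}" by simp
  qed
  have E: "?E = top_of_set (prod_range m (\<phi> ` U) (\<kappa> ` V))"
    using rng by (simp add: Euclidean_space_top_of_set subtopology_subtopology Int_absorb1)
  have Em: "subtopology (Euclidean_space m) (\<phi> ` U) = top_of_set (\<phi> ` U)"
    using U(2) by (simp add: Euclidean_space_top_of_set subtopology_subtopology Int_absorb1)
  have Ed: "subtopology (Euclidean_space d) (\<kappa> ` V) = top_of_set (\<kappa> ` V)"
    using V(2) by (simp add: Euclidean_space_top_of_set subtopology_subtopology Int_absorb1)
  have coord: "continuous_map Z euclideanreal (\<lambda>p. h p i)" if "continuous_map Z (top_of_set T) h"
    for Z :: "'z topology" and T :: "(nat \<Rightarrow> real) set" and h i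
  proof -
    have "continuous_map Z (powertop_real UNIV) h"
      using that by (simp add: continuous_map_in_subtopology euclidean_product_topology)
    then show ?thesis by (simp add: continuous_map_componentwise_UNIV)
  qed
  have c1: "continuous_map (subtopology (prod_topology X Y) (U \<times> V)) ?E (prod_coords m \<phi> \<kappa>)"
    unfolding E continuous_map_in_subtopology
  proof
    have "continuous_map (prod_topology (subtopology X U) (subtopology Y V)) euclideanreal
        (\<lambda>z. prod_coords m \<phi> \<kappa> z i)" for i
    proof (cases "i < m")
      case True
      have "continuous_map (prod_topology (subtopology X U) (subtopology Y V)) euclideanreal
          ((\<lambda>p. \<phi> p i) \<circ> fst)"
        by (rule continuous_map_compose[OF continuous_map_fst coord[OF f'(1)[unfolded Em]]])
      then show ?thesis using True by (simp add: prod_coords_def case_prod_unfold o_def)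
    next
      case False
      have "continuous_map (prod_topology (subtopology X U) (subtopology Y V)) euclideanreal
          ((\<lambda>p. \<kappa> p (i - m)) \<circ> snd)"
        by (rule continuous_map_compose[OF continuous_map_snd coord[OF g'(1)[unfolded Ed]]])
      then show ?thesis using False by (simp add: prod_coords_def case_prod_unfold o_def)
    qed
    then have "continuous_map (subtopology (prod_topology X Y) (U \<times> V)) (powertop_real UNIV) (prod_coords m \<phi> \<kappa>)"
      unfolding XY continuous_map_componentwise_UNIV by blast
    then show "continuous_map (subtopology (prod_topology X Y) (U \<times> V)) euclidean (prod_coords m \<phi> \<kappa>)"
      by (simp add: euclidean_product_topology)
    show "prod_coords m \<phi> \<kappa> \<in> topspace (subtopology (prod_topology X Y) (U \<times> V)) \<rightarrow> prod_range m (\<phi> ` U) (\<kappa> ` V)"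
      using img by auto
  qed
  have c2: "continuous_map ?E (subtopology (prod_topology X Y) (U \<times> V)) (\<lambda>x. (f (first_coords m x), g (last_coords m x)))"
    unfolding XY continuous_map_pairwise o_def fst_conv snd_conv
  proof
    have "continuous_map ?E (top_of_set (\<phi> ` U)) (first_coords m)" "continuous_map ?E (top_of_set (\<kappa> ` V)) (last_coords m)"
      unfolding E using continuous_on_first_coords continuous_on_last_coords by (auto simp: prod_range_def image_subset_iff)
    then show "continuous_map ?E (subtopology X U) (\<lambda>x. f (first_coords m x))"
      "continuous_map ?E (subtopology Y V) (\<lambda>x. g (last_coords m x))"
      using f'(2) g'(2) continuous_map_compose unfolding Em Ed o_def by blast+
  qed
  have "homeomorphic_maps (subtopology (prod_topology X Y) (U \<times> V)) ?E (prod_coords m \<phi> \<kappa>) (\<lambda>x. (f (first_coords m x), g (last_coords m x)))"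
    unfolding homeomorphic_maps_def
  proof (intro conjI c1 c2 ballI)
    fix z assume "z \<in> topspace (subtopology (prod_topology X Y) (U \<times> V))"
    then obtain p q where z: "z = (p, q)" "p \<in> U" "q \<in> V" by auto
    have "\<phi> p \<in> {x. \<forall>i\<ge>m. x i = 0}" using z U by blast
    then show "(f (first_coords m (prod_coords m \<phi> \<kappa> z)), g (last_coords m (prod_coords m \<phi> \<kappa> z))) = z"
      using z f'(3) g'(3) first_coords_prod_coords[of \<phi> p m \<kappa> q] by simp
  next
    fix x assume "x \<in> topspace ?E"
    then have "x \<in> prod_coords m \<phi> \<kappa> ` (U \<times> V)" using img by auto
    then obtain p q where x: "x = prod_coords m \<phi> \<kappa> (p, q)" "p \<in> U" "q \<in> V" by blast
    have "\<phi> p \<in> {x. \<forall>i\<ge>m. x i = 0}" using x U by blast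
    then show "prod_coords m \<phi> \<kappa> (f (first_coords m x), g (last_coords m x)) = x"
      using x f'(3) g'(3) first_coords_prod_coords[of \<phi> p m \<kappa> q] by simp
  qed
  then show ?thesis unfolding img homeomorphic_map_maps by blast
qed

text \<open>
  The strong form of having no boundary. It permits a manifold as second factor of a product.
\<close>

definition open_charts :: "'a mfd \<Rightarrow> bool" where
  "open_charts M \<longleftrightarrow> (\<forall>(U, \<phi>)\<in>matlas M. openin (Euclidean_space (mdim M)) (\<phi> ` U))"

lemma open_chartsD: "open_charts M \<Longrightarrow> (U, \<phi>) \<in> matlas M \<Longrightarrow> openin (Euclidean_space (mdim M)) (\<phi> ` U)"
  by (auto simp: open_charts_def)

lemma second_countable_prod_topology:
  assumes "second_countable X" "second_countable Y"
  shows "second_countable (prod_topology X Y)"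
proof -
  obtain A where "countable A \<and> (\<forall>W\<in>A. openin X W) \<and>
      (\<forall>U x. openin X U \<and> x \<in> U \<longrightarrow> (\<exists>W\<in>A. x \<in> W \<and> W \<subseteq> U))"
    using assms(1) unfolding second_countable_def by (rule exE)
  then have A: "countable A" "\<And>W. W \<in> A \<Longrightarrow> openin X W"
    "\<And>U x. openin X U \<Longrightarrow> x \<in> U \<Longrightarrow> \<exists>W\<in>A. x \<in> W \<and> W \<subseteq> U"
    by simp_all
  obtain B where "countable B \<and> (\<forall>W\<in>B. openin Y W) \<and>
      (\<forall>U x. openin Y U \<and> x \<in> U \<longrightarrow> (\<exists>W\<in>B. x \<in> W \<and> W \<subseteq> U))"
    using assms(2) unfolding second_countable_def by (rule exE)
  then have B: "countable B" "\<And>W. W \<in> B \<Longrightarrow> openin Y W"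
    "\<And>U x. openin Y U \<Longrightarrow> x \<in> U \<Longrightarrow> \<exists>W\<in>B. x \<in> W \<and> W \<subseteq> U"
    by simp_all
  show ?thesis
    unfolding second_countable_def
  proof (intro exI conjI ballI allI impI)
    show "countable ((\<lambda>(S, T). S \<times> T) ` (A \<times> B))" using A(1) B(1) by simp
    show "openin (prod_topology X Y) V" if "V \<in> (\<lambda>(S, T). S \<times> T) ` (A \<times> B)" for V
      using that A(2) B(2) by (auto simp: openin_prod_Times_iff)
    fix U z assume "openin (prod_topology X Y) U \<and> z \<in> U"
    then have oU: "openin (prod_topology X Y) U" and zU: "(fst z, snd z) \<in> U" by simp_all
    from oU[unfolded openin_prod_topology_alt, rule_format, OF zU]
    obtain S T where ST: "openin X S" "openin Y T" "fst z \<in> S" "snd z \<in> T" "S \<times> T \<subseteq> U"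
      by (elim exE conjE)
    obtain S' where "S' \<in> A" "fst z \<in> S'" "S' \<subseteq> S" using A(3)[OF ST(1,3)] by blast
    moreover obtain T' where "T' \<in> B" "snd z \<in> T'" "T' \<subseteq> T" using B(3)[OF ST(2,4)] by blast
    ultimately show "\<exists>V\<in>(\<lambda>(S, T). S \<times> T) ` (A \<times> B). z \<in> V \<and> V \<subseteq> U"
      using ST(5) by (intro bexI[of _ "S' \<times> T'"]) (auto simp: mem_Times_iff)
  qed
qed

lemma smooth_mfd_iff:
  "smooth_mfd M \<longleftrightarrow> Hausdorff_space (mtop M) \<and> second_countable (mtop M) \<and>
     (\<Union>(U, \<phi>)\<in>matlas M. U) = mpoints M \<and>
     (\<forall>(U, \<phi>)\<in>matlas M. openin (mtop M) U \<and> chart_range (mdim M) (\<phi> ` U) \<and>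
        homeomorphic_map (subtopology (mtop M) U)
          (subtopology (Euclidean_space (mdim M)) (\<phi> ` U)) \<phi>) \<and>
     (\<forall>(U, \<phi>)\<in>matlas M. \<forall>(V, \<kappa>)\<in>matlas M.
        smooth_on (mdim M) (\<phi> ` (U \<inter> V)) (\<kappa> \<circ> inv_into U \<phi>))"
  unfolding smooth_mfd_def second_countable_def ..

lemma smooth_on_first_last_coords:
  assumes slice_perfect: "slice_perfect (m + d) (prod_range m A B)" and A: "slice_perfect m A" and B: "slice_perfect d B"
    and f: "smooth_on m A f" and g: "smooth_on d B g"
  shows "smooth_on (m + d) (prod_range m A B) (\<lambda>x i. if i < m then f (first_coords m x) i else g (last_coords m x) (i - m))"
  unfolding smooth_on_def
proof
  fix k
  let ?W = "prod_range m A B"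
  have "scalar_Ck k (m + d) ?W (\<lambda>x. f (first_coords m x) a)" for a
  proof (rule scalar_Ck_reindex[where W = A and d' = m and g = "\<lambda>y. f y a"])
    show "first_coords m ` ?W \<subseteq> A" by (auto simp: prod_range_def)
    show "continuous_on ?W (first_coords m)" by (rule continuous_on_first_coords)
    show "scalar_Ck k m A (\<lambda>y. f y a)" using f Ck_on_iff_scalar_Ck[OF A, of k f] by (simp add: smooth_on_def)
    fix i assume "i < m + d"
    show "(\<exists>j<m. \<forall>x\<in>?W. x i = first_coords m x j \<and> (\<forall>t. first_coords m (x(i := t)) = (first_coords m x)(j := t))) \<or>
        (\<forall>x\<in>?W. \<forall>t. first_coords m (x(i := t)) = first_coords m x)"
      by (cases "i < m") (auto simp: first_coords_def fun_eq_iff)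
  qed
  moreover have "scalar_Ck k (m + d) ?W (\<lambda>x. g (last_coords m x) a)" for a
  proof (rule scalar_Ck_reindex[where W = B and d' = d and g = "\<lambda>y. g y a"])
    show "last_coords m ` ?W \<subseteq> B" by (auto simp: prod_range_def)
    show "continuous_on ?W (last_coords m)" by (rule continuous_on_last_coords)
    show "scalar_Ck k d B (\<lambda>y. g y a)" using g Ck_on_iff_scalar_Ck[OF B, of k g] by (simp add: smooth_on_def)
    fix i assume i: "i < m + d"
    show "(\<exists>j<d. \<forall>x\<in>?W. x i = last_coords m x j \<and> (\<forall>t. last_coords m (x(i := t)) = (last_coords m x)(j := t))) \<or>
        (\<forall>x\<in>?W. \<forall>t. last_coords m (x(i := t)) = last_coords m x)"
    proof (cases "i < m")
      case False
      then show ?thesis using i by (intro disjI1 exI[of _ "i - m"]) (auto simp: last_coords_def fun_eq_iff)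
    qed (auto simp: last_coords_def fun_eq_iff)
  qed
  ultimately have "scalar_Ck k (m + d) ?W (\<lambda>x. if a < m then f (first_coords m x) a else g (last_coords m x) (a - m))" for a
    by (cases "a < m") simp_all
  then show "Ck_on k (m + d) ?W (\<lambda>x i. if i < m then f (first_coords m x) i else g (last_coords m x) (i - m))"
    using Ck_on_iff_scalar_Ck[OF slice_perfect, of k "\<lambda>x i. if i < m then f (first_coords m x) i else g (last_coords m x) (i - m)"] by simp
qed

lemma Ck_on_cong:
  assumes "\<And>x. x \<in> V \<Longrightarrow> f x = g x" "Ck_on k d V f"
  shows "Ck_on k d V g"
  using assms
proof (induction k arbitrary: f g)
  case 0
  then show ?case using continuous_on_cong[of V V f g] by simp
next
  case (Suc k)
  have "Ck_on k d V (partial_d V i g)" if "i < d" for i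
    by (rule Suc.IH[of "partial_d V i f"]) (use partial_d_cong[OF Suc.prems(1)] Suc.prems(2) that in auto)
  moreover have "partially_differentiable V i g" if "i < d" for i
    unfolding partially_differentiable_def
  proof (intro ballI allI)
    fix x a assume x: "x \<in> V"
    have "(\<lambda>t. f (x(i := t)) a) differentiable (at (x i) within slice V i x)"
      using Suc.prems(2) that x by (simp add: partially_differentiable_def slice_def)
    then obtain D where "has_partial V i (\<lambda>y. f y a) D x"
      unfolding has_partial_def using vector_derivative_works by blast
    then have "has_partial V i (\<lambda>y. g y a) D x"
      using has_partial_cong[of V "\<lambda>y. f y a" "\<lambda>y. g y a" x i D] Suc.prems(1) x by simp
    then show "(\<lambda>t. g (x(i := t)) a) differentiable (at (x i) within {t. x(i := t) \<in> V})"
      unfolding has_partial_def slice_def by (rule differentiableI_vector)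
  qed
  ultimately show ?case
    using Suc.prems continuous_on_cong[of V V f g] by simp
qed

lemma smooth_on_cong: "(\<And>x. x \<in> V \<Longrightarrow> f x = g x) \<Longrightarrow> smooth_on d V f \<Longrightarrow> smooth_on d V g"
  unfolding smooth_on_def using Ck_on_cong by blast

lemma smooth_on_empty:
  fixes f :: "(nat \<Rightarrow> real) \<Rightarrow> nat \<Rightarrow> 'b::real_normed_vector"
  shows "smooth_on k {} f"
proof -
  have "Ck_on l k {} f" for l and f :: "(nat \<Rightarrow> real) \<Rightarrow> nat \<Rightarrow> 'b"
    by (induction l arbitrary: f) (auto simp: partially_differentiable_def)
  then show ?thesis by (simp add: smooth_on_def)
qed

text \<open>
  A factor with half-space charts must have positive dimension: only then its coordinate \<open>0\<close> is
  coordinate \<open>0\<close> of the product.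
\<close>

theorem smooth_mfd_prod:
  assumes M: "smooth_mfd M" and N: "smooth_mfd N" and oN: "open_charts N"
    and oM: "0 < mdim M \<or> open_charts M"
  shows "smooth_mfd (prod_mfd M N)"
  unfolding smooth_mfd_iff prod_mfd_simps
proof (intro conjI)
  let ?m = "mdim M" and ?d = "mdim N"
  show "Hausdorff_space (prod_topology (mtop M) (mtop N))"
    using M N by (simp add: smooth_mfd_iff Hausdorff_space_prod_topology)
  show "second_countable (prod_topology (mtop M) (mtop N))"
    using M N by (simp add: smooth_mfd_iff second_countable_prod_topology)
  have cov: "(\<Union>(U, \<phi>)\<in>matlas M. U) = mpoints M" "(\<Union>(U, \<phi>)\<in>matlas N. U) = mpoints N"
    using M N by (simp_all add: smooth_mfd_iff)
  show "(\<Union>(U, \<phi>)\<in>matlas (prod_mfd M N). U) = topspace (prod_topology (mtop M) (mtop N))"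
    unfolding topspace_prod_topology
  proof (intro equalityI subsetI)
    fix z assume "z \<in> (\<Union>(U, \<phi>) \<in> matlas (prod_mfd M N). U)"
    then obtain W \<zeta> where W: "(W, \<zeta>) \<in> matlas (prod_mfd M N)" "z \<in> W" by blast
    then obtain U \<phi> V \<kappa> where "W = U \<times> V" and c: "(U, \<phi>) \<in> matlas M" "(V, \<kappa>) \<in> matlas N"
      by (auto elim: prod_mfd_chartE)
    then show "z \<in> mpoints M \<times> mpoints N"
      using W(2) smooth_mfd_chartD(4)[OF M c(1)] smooth_mfd_chartD(4)[OF N c(2)] by blast
  next
    fix z assume "z \<in> mpoints M \<times> mpoints N"
    then have "fst z \<in> (\<Union>(U, \<phi>)\<in>matlas M. U)" "snd z \<in> (\<Union>(U, \<phi>)\<in>matlas N. U)"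
      unfolding cov by auto
    then obtain U \<phi> V \<kappa> where c: "(U, \<phi>) \<in> matlas M" "(V, \<kappa>) \<in> matlas N" "fst z \<in> U" "snd z \<in> V"
      by blast
    then have "(U \<times> V, prod_coords ?m \<phi> \<kappa>) \<in> matlas (prod_mfd M N)" unfolding prod_mfd_atlas by blast
    moreover have "z \<in> U \<times> V" using c by (simp add: mem_Times_iff)
    ultimately show "z \<in> (\<Union>(U, \<phi>) \<in> matlas (prod_mfd M N). U)" by blast
  qed
  have rngU: "chart_range (?m + ?d) (prod_range ?m (\<phi> ` U') (\<kappa> ` V'))"
    if "(U, \<phi>) \<in> matlas M" "(V, \<kappa>) \<in> matlas N" "openin (mtop M) U'" "U' \<subseteq> U" "openin (mtop N) V'" "V' \<subseteq> V"
    for U \<phi> V \<kappa> U' V'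
  proof (rule chart_range_prod_range)
    show "chart_range ?m (\<phi> ` U')" by (rule chart_range_chart_image[OF M that(1,3,4)])
    show "openin (Euclidean_space ?d) (\<kappa> ` V')"
      by (rule openin_chart_image(1)[OF N that(2,5,6) open_chartsD[OF oN that(2)]])
    show "0 < ?m \<or> openin (Euclidean_space ?m) (\<phi> ` U')"
      using oM openin_chart_image(1)[OF M that(1,3,4)] open_chartsD[OF _ that(1)] by blast
  qed
  show "\<forall>(W, \<zeta>)\<in>matlas (prod_mfd M N). openin (prod_topology (mtop M) (mtop N)) W \<and>
      chart_range (?m + ?d) (\<zeta> ` W) \<and>
      homeomorphic_map (subtopology (prod_topology (mtop M) (mtop N)) W)
        (subtopology (Euclidean_space (?m + ?d)) (\<zeta> ` W)) \<zeta>"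
  proof (intro ballI, clarify elim!: prod_mfd_chartE)
    fix U \<phi> V \<kappa> assume c: "(U, \<phi>) \<in> matlas M" "(V, \<kappa>) \<in> matlas N"
    note C = smooth_mfd_chartD[OF M c(1)] and D = smooth_mfd_chartD[OF N c(2)]
    show "openin (prod_topology (mtop M) (mtop N)) (U \<times> V) \<and>
      chart_range (?m + ?d) (prod_coords ?m \<phi> \<kappa> ` (U \<times> V)) \<and>
      homeomorphic_map (subtopology (prod_topology (mtop M) (mtop N)) (U \<times> V))
        (subtopology (Euclidean_space (?m + ?d)) (prod_coords ?m \<phi> \<kappa> ` (U \<times> V))) (prod_coords ?m \<phi> \<kappa>)"
      using homeomorphic_map_prod_coords[OF C(5) D(5) C(4,6) D(4,6)] C(1) D(1)
        rngU[OF c C(1) order_refl D(1) order_refl]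
      by (simp add: prod_coords_image[OF C(6)] openin_prod_Times_iff)
  qed
  show "\<forall>(W, \<zeta>)\<in>matlas (prod_mfd M N). \<forall>(W', \<zeta>')\<in>matlas (prod_mfd M N).
      smooth_on (?m + ?d) (\<zeta> ` (W \<inter> W')) (\<zeta>' \<circ> inv_into W \<zeta>)"
  proof (intro ballI, clarify elim!: prod_mfd_chartE)
    fix U \<phi> V \<kappa> U' \<phi>' V' \<kappa>'
    assume c: "(U, \<phi>) \<in> matlas M" "(V, \<kappa>) \<in> matlas N" and c': "(U', \<phi>') \<in> matlas M" "(V', \<kappa>') \<in> matlas N"
    note C = smooth_mfd_chartD[OF M c(1)] and D = smooth_mfd_chartD[OF N c(2)]
      and C' = smooth_mfd_chartD[OF M c'(1)] and D' = smooth_mfd_chartD[OF N c'(2)]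
    have oi: "openin (mtop M) (U \<inter> U')" "openin (mtop N) (V \<inter> V')" using C(1) C'(1) D(1) D'(1) by auto
    let ?A = "\<phi> ` (U \<inter> U')" and ?B = "\<kappa> ` (V \<inter> V')"
    have img: "prod_coords ?m \<phi> \<kappa> ` (U \<times> V \<inter> U' \<times> V') = prod_range ?m ?A ?B"
      unfolding Times_Int_Times by (rule prod_coords_image) (use C(6) in blast)
    have "smooth_on (?m + ?d) (prod_range ?m ?A ?B)
        (\<lambda>x i. if i < ?m then (\<phi>' \<circ> inv_into U \<phi>) (first_coords ?m x) i else (\<kappa>' \<circ> inv_into V \<kappa>) (last_coords ?m x) (i - ?m))"
      by (rule smooth_on_first_last_coords[OF _ _ _ smooth_mfd_transition[OF M c(1) c'(1)] smooth_mfd_transition[OF N c(2) c'(2)]])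
        (use rngU[OF c oi(1) _ oi(2)] chart_range_chart_image[OF M c(1) oi(1)]
          chart_range_chart_image[OF N c(2) oi(2)] in \<open>auto intro!: chart_range_slice_perfect\<close>)
    then show "smooth_on (?m + ?d) (prod_coords ?m \<phi> \<kappa> ` (U \<times> V \<inter> U' \<times> V'))
        (prod_coords ?m \<phi>' \<kappa>' \<circ> inv_into (U \<times> V) (prod_coords ?m \<phi> \<kappa>))"
      unfolding img
    proof (rule smooth_on_cong[rotated])
      fix x assume "x \<in> prod_range ?m ?A ?B"
      then have x: "x \<in> prod_range ?m (\<phi> ` U) (\<kappa> ` V)" by (auto simp: prod_range_def)
      show "(\<lambda>i. if i < ?m then (\<phi>' \<circ> inv_into U \<phi>) (first_coords ?m x) i else (\<kappa>' \<circ> inv_into V \<kappa>) (last_coords ?m x) (i - ?m)) =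
          (prod_coords ?m \<phi>' \<kappa>' \<circ> inv_into (U \<times> V) (prod_coords ?m \<phi> \<kappa>)) x"
        using inv_into_prod_coords[OF C(6) C(3) D(3) x] by (auto simp: prod_coords_def)
    qed
  qed
qed

lemma open_charts_prod:
  assumes M: "smooth_mfd M" "open_charts M" and N: "open_charts N"
  shows "open_charts (prod_mfd M N)"
  unfolding open_charts_def
proof (intro ballI, clarify elim!: prod_mfd_chartE)
  fix U \<phi> V \<kappa> assume c: "(U, \<phi>) \<in> matlas M" "(V, \<kappa>) \<in> matlas N"
  show "openin (Euclidean_space (mdim (prod_mfd M N))) (prod_coords (mdim M) \<phi> \<kappa> ` (U \<times> V))"
    unfolding prod_coords_image[OF smooth_mfd_chartD(6)[OF M(1) c(1)]] prod_mfd_simps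
    by (rule openin_prod_range[OF open_chartsD[OF M(2) c(1)] open_chartsD[OF N c(2)]])
qed

section \<open>The torus\<close>

definition torus_dom :: "nat \<Rightarrow> cvec \<Rightarrow> cvec set" where
  "torus_dom m c = {z \<in> torus_set m. \<forall>i<m. z i \<noteq> - c i}"

definition torus_chart :: "nat \<Rightarrow> cvec \<Rightarrow> cvec \<Rightarrow> nat \<Rightarrow> real" where
  "torus_chart m c z i = (if i < m then Arg (z i / c i) else 0)"

definition torus_param :: "nat \<Rightarrow> cvec \<Rightarrow> (nat \<Rightarrow> real) \<Rightarrow> cvec" where
  "torus_param m c x i = (if i < m then c i * cis (x i) else 0)"

definition angle_box :: "nat \<Rightarrow> (nat \<Rightarrow> real) set" where
  "angle_box m = {x. (\<forall>i<m. x i \<in> {-pi<..<pi}) \<and> (\<forall>i\<ge>m. x i = 0)}"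

lemma torus_mfd_simps:
  "mtop (torus_mfd m) = top_of_set (torus_set m)" "mdim (torus_mfd m) = m"
  "matlas (torus_mfd m) = (\<lambda>c. (torus_dom m c, torus_chart m c)) ` torus_set m"
  by (simp_all add: torus_mfd_def torus_dom_def torus_chart_def[abs_def])

lemma torus_setD: "z \<in> torus_set m \<Longrightarrow> i < m \<Longrightarrow> cmod (z i) = 1" "z \<in> torus_set m \<Longrightarrow> i \<ge> m \<Longrightarrow> z i = 0"
  by (auto simp: torus_set_def Cn_def)

lemma unit_nonpos_iff:
  assumes "cmod u = 1" shows "u \<in> \<real>\<^sub>\<le>\<^sub>0 \<longleftrightarrow> u = -1"
proof
  assume u: "u \<in> \<real>\<^sub>\<le>\<^sub>0"
  then have "Im u = 0" "Re u \<le> 0" by (auto simp: complex_nonpos_Reals_iff)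
  moreover from this have "\<bar>Re u\<bar> = 1" using assms by (simp add: cmod_def)
  ultimately show "u = -1" by (auto simp: complex_eq_iff)
qed (auto simp: complex_nonpos_Reals_iff)

lemma Arg_unit_bounds:
  assumes "cmod u = 1" "u \<noteq> -1" shows "Arg u \<in> {-pi<..<pi}"
proof -
  have "Arg u \<noteq> pi"
  proof
    assume "Arg u = pi"
    then have "u \<in> \<real>\<^sub>\<le>\<^sub>0" by (auto simp: Arg_eq_pi complex_nonpos_Reals_iff)
    then show False using unit_nonpos_iff assms by blast
  qed
  then show ?thesis using mpi_less_Arg[of u] Arg_le_pi[of u] by auto
qed

lemma torus_param_chart:
  assumes "c \<in> torus_set m" "z \<in> torus_set m"
  shows "torus_param m c (torus_chart m c z) = z"
proof
  fix i
  show "torus_param m c (torus_chart m c z) i = z i"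
  proof (cases "i < m")
    case True
    then have "cmod (z i) = 1" "cmod (c i) = 1" using assms torus_setD by blast+
    then have "c i \<noteq> 0" "cmod (z i / c i) = 1" by (auto simp: norm_divide)
    then have "cis (Arg (z i / c i)) = z i / c i"
      by (subst cis_Arg) (auto simp: sgn_div_norm)
    then show ?thesis using True \<open>c i \<noteq> 0\<close> by (simp add: torus_param_def torus_chart_def)
  qed (use torus_setD(2)[OF assms(2)] in \<open>simp add: torus_param_def\<close>)
qed

lemma torus_param_mem: "c \<in> torus_set m \<Longrightarrow> torus_param m c x \<in> torus_set m"
  by (auto simp: torus_set_def torus_param_def Cn_def norm_mult)

lemma cis_neq_minus_one:
  assumes "t \<in> {-pi<..<pi}" shows "cis t \<noteq> -1"
proof
  assume "cis t = -1"
  then have "Arg (cis t) = pi" by (subst Arg_eq_pi) simp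
  then show False using Arg_cis[of t] assms by simp
qed

lemma torus_param_dom:
  assumes "c \<in> torus_set m" "x \<in> angle_box m"
  shows "torus_param m c x \<in> torus_dom m c"
  unfolding torus_dom_def
proof (intro CollectI conjI allI impI torus_param_mem[OF assms(1)])
  fix i assume i: "i < m"
  then have "cis (x i) \<noteq> -1" using assms(2) cis_neq_minus_one by (simp add: angle_box_def)
  moreover have "c i \<noteq> 0" using torus_setD(1)[OF assms(1) i] by auto
  ultimately show "torus_param m c x i \<noteq> - c i"
    using i mult_cancel_left[of "c i" "cis (x i)" "-1"] by (simp add: torus_param_def)
qed

lemma torus_chart_param:
  assumes "c \<in> torus_set m" "x \<in> angle_box m"
  shows "torus_chart m c (torus_param m c x) = x"
proof
  fix i
  show "torus_chart m c (torus_param m c x) i = x i"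
  proof (cases "i < m")
    case True
    then have "c i \<noteq> 0" using torus_setD(1)[OF assms(1)] by fastforce
    moreover have "Arg (cis (x i)) = x i"
      using True assms(2) by (intro Arg_cis) (auto simp: angle_box_def less_imp_le)
    ultimately show ?thesis using True by (simp add: torus_chart_def torus_param_def)
  qed (use assms(2) in \<open>simp add: torus_chart_def angle_box_def\<close>)
qed

lemma torus_chart_range:
  assumes "c \<in> torus_set m" shows "torus_chart m c ` torus_dom m c = angle_box m"
proof (intro equalityI subsetI)
  fix x assume "x \<in> torus_chart m c ` torus_dom m c"
  then obtain z where z: "z \<in> torus_set m" "\<And>i. i < m \<Longrightarrow> z i \<noteq> - c i" "x = torus_chart m c z"
    by (auto simp: torus_dom_def)
  have "Arg (z i / c i) \<in> {-pi<..<pi}" if i: "i < m" for i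
  proof (rule Arg_unit_bounds)
    have c: "cmod (c i) = 1" using torus_setD(1)[OF assms i] .
    then show "cmod (z i / c i) = 1" using torus_setD(1)[OF z(1) i] by (simp add: norm_divide)
    show "z i / c i \<noteq> -1"
      using z(2)[OF i] c by (auto simp: divide_eq_eq)
  qed
  then show "x \<in> angle_box m" by (auto simp: angle_box_def z(3) torus_chart_def)
next
  fix x assume "x \<in> angle_box m"
  then show "x \<in> torus_chart m c ` torus_dom m c"
    using torus_param_dom[OF assms] torus_chart_param[OF assms] by (metis image_eqI)
qed

lemma inj_on_torus_chart: "c \<in> torus_set m \<Longrightarrow> inj_on (torus_chart m c) (torus_dom m c)"
  by (rule inj_on_inverseI[of _ "torus_param m c"]) (simp add: torus_dom_def torus_param_chart)

lemma inv_into_torus_chart: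
  assumes "c \<in> torus_set m" "x \<in> angle_box m"
  shows "inv_into (torus_dom m c) (torus_chart m c) x = torus_param m c x"
  using torus_param_dom[OF assms] torus_chart_param[OF assms] inj_on_torus_chart[OF assms(1)]
  by (intro inv_into_f_eq)

lemma openin_angle_box: "openin (Euclidean_space m) (angle_box m)"
proof -
  have "open (\<Inter>i\<in>{..<m}. (\<lambda>x::nat \<Rightarrow> real. x i) -` {-pi<..<pi})"
    by (intro open_INT finite_lessThan ballI open_vimage continuous_on_product_coordinates) simp
  moreover have "angle_box m = {x. \<forall>i\<ge>m. x i = 0} \<inter> (\<Inter>i\<in>{..<m}. (\<lambda>x. x i) -` {-pi<..<pi})"
    by (auto simp: angle_box_def)
  ultimately show ?thesis by (auto simp: Euclidean_space_top_of_set openin_open)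
qed

lemma continuous_on_torus_param: "continuous_on S (torus_param m c)"
proof (rule continuous_on_coordinatewise_then_product)
  fix i
  have "continuous_on S (\<lambda>x. x i)" by (rule continuous_on_subset[OF continuous_on_product_coordinates]) simp
  then show "continuous_on S (\<lambda>x. torus_param m c x i)"
    unfolding torus_param_def by (cases "i < m") (auto intro!: continuous_intros simp: cis_conv_exp)
qed

lemma continuous_on_torus_chart:
  assumes "c \<in> torus_set m" shows "continuous_on (torus_dom m c) (torus_chart m c)"
proof (rule continuous_on_coordinatewise_then_product)
  fix i
  show "continuous_on (torus_dom m c) (\<lambda>z. torus_chart m c z i)"
  proof (cases "i < m")
    case True
    have ci: "cmod (c i) = 1" using torus_setD(1)[OF assms True] .
    have "continuous_on (- \<real>\<^sub>\<le>\<^sub>0) Arg"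
      using continuous_at_Arg by (simp add: continuous_at_imp_continuous_on)
    moreover have "continuous_on (torus_dom m c) (\<lambda>z. z i / c i)"
      using ci by (intro continuous_intros continuous_on_subset[OF continuous_on_product_coordinates]) auto
    moreover have "(\<lambda>z. z i / c i) ` torus_dom m c \<subseteq> - \<real>\<^sub>\<le>\<^sub>0"
    proof clarify
      fix z assume z: "z \<in> torus_dom m c" "z i / c i \<in> \<real>\<^sub>\<le>\<^sub>0"
      then have "cmod (z i / c i) = 1"
        using torus_setD(1)[of z m i] ci True by (simp add: torus_dom_def norm_divide)
      then have "z i / c i = -1" using unit_nonpos_iff z(2) by blast
      moreover have "c i \<noteq> 0" using ci by auto
      ultimately have "z i = - c i" by (simp add: divide_eq_eq)
      then show False using z(1) True by (simp add: torus_dom_def)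
    qed
    ultimately have "continuous_on (torus_dom m c) (\<lambda>z. Arg (z i / c i))"
      by (rule continuous_on_compose2)
    then show ?thesis using True by (simp add: torus_chart_def)
  qed (simp add: torus_chart_def)
qed

lemma torus_homeomorphic_maps:
  assumes c: "c \<in> torus_set m"
  shows "homeomorphic_maps (top_of_set (torus_dom m c)) (top_of_set (angle_box m)) (torus_chart m c) (torus_param m c)"
  unfolding homeomorphic_maps_def
  using continuous_on_torus_chart[OF c] continuous_on_torus_param[of _ m c] torus_chart_range[OF c]
    torus_param_dom[OF c] torus_chart_param[OF c] torus_param_chart[OF c]
  by (auto simp: torus_dom_def)

lemma openin_torus_dom: "openin (top_of_set (torus_set m)) (torus_dom m c)"
proof -
  have "open (\<Inter>i\<in>{..<m}. (\<lambda>z::cvec. z i) -` (- {- c i}))"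
    by (intro open_INT finite_lessThan ballI open_vimage continuous_on_product_coordinates) auto
  moreover have "torus_dom m c = torus_set m \<inter> (\<Inter>i\<in>{..<m}. (\<lambda>z. z i) -` (- {- c i}))"
    by (auto simp: torus_dom_def)
  ultimately show ?thesis unfolding openin_open by blast
qed

text \<open>
  A change of angular charts is locally a translation, as the imaginary part of the logarithm shows: its derivative
  is constant although the function itself need not be a translation globally.
\<close>

lemma has_partial_rotated_angle:
  assumes u: "cmod u = 1" and x: "u * cis (x a) \<noteq> -1"
  shows "has_partial V i (\<lambda>x. Arg (u * cis (x a))) (if i = a then 1 else 0) x"
proof (cases "i = a")
  case True
  have n1: "cmod (u * cis t) = 1" for t using u by (simp add: norm_mult)
  then have n0: "u * cis t \<noteq> 0" for t by (metis norm_zero zero_neq_one)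
  have "u * cis (x a) \<notin> \<real>\<^sub>\<le>\<^sub>0" using unit_nonpos_iff[OF n1] x by blast
  then have v: "((Ln \<circ> (\<lambda>t. u * cis (1 * t))) has_vector_derivative
      (u * (\<i> * of_real 1)) * cis (1 * x a) * inverse (u * cis (1 * x a))) (at (x a))"
    by (intro field_vector_diff_chain_at has_vector_derivative_exponential has_field_derivative_Ln) simp
  have e: "(u * (\<i> * of_real 1)) * cis (1 * x a) * inverse (u * cis (1 * x a)) = \<i>"
    using n0[of "x a"] by (simp add: field_simps)
  have "((\<lambda>t. Ln (u * cis t)) has_vector_derivative \<i>) (at (x a))"
    using v[unfolded e, unfolded o_def mult_1_left] .
  then have "((\<lambda>t. Im (Ln (u * cis t))) has_vector_derivative Im \<i>) (at (x a))"
    by (rule bounded_linear.has_vector_derivative[OF bounded_linear_Im])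
  then have "((\<lambda>t. Arg (u * cis t)) has_vector_derivative 1) (at (x a))"
    using n0 by (simp add: Arg_eq_Im_Ln)
  then show ?thesis using True by (auto simp: has_partial_def intro: has_vector_derivative_at_within)
qed (simp add: has_partial_def)

lemma smooth_torus_transition:
  assumes c: "c \<in> torus_set m" "c' \<in> torus_set m"
  shows "smooth_on m (torus_chart m c ` (torus_dom m c \<inter> torus_dom m c'))
    (torus_chart m c' \<circ> inv_into (torus_dom m c) (torus_chart m c))"
proof -
  let ?W = "torus_chart m c ` (torus_dom m c \<inter> torus_dom m c')"
  define f where "f x i = (if i < m then Arg (c i / c' i * cis (x i)) else 0)" for x :: "nat \<Rightarrow> real" and i
  have Wb: "?W \<subseteq> angle_box m" using torus_chart_range[OF c(1)] by blast
  have unit: "cmod (c i / c' i) = 1" if "i < m" for i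
    using torus_setD(1)[OF c(1) that] torus_setD(1)[OF c(2) that] by (simp add: norm_divide)
  have W: "c a / c' a * cis (x a) \<noteq> -1" if x: "x \<in> ?W" and a: "a < m" for x a
  proof
    assume *: "c a / c' a * cis (x a) = -1"
    obtain z where z: "z \<in> torus_dom m c" "z \<in> torus_dom m c'" "x = torus_chart m c z" using x by blast
    have "z = torus_param m c x" using z torus_param_chart[OF c(1), of z] by (simp add: torus_dom_def)
    then have "z a = c a * cis (x a)" using a by (simp add: torus_param_def)
    moreover have "c' a \<noteq> 0" using torus_setD(1)[OF c(2) a] by auto
    ultimately have "z a = - c' a" using * by (simp add: field_simps)
    then show False using z(2) a by (simp add: torus_dom_def)
  qed
  have "scalar_Ck k m ?W (\<lambda>x. f x a)" for k a
  proof (cases "a < m")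
    case True
    have cont: "continuous_on ?W (\<lambda>x. Arg (c a / c' a * cis (x a)))"
    proof (rule continuous_on_compose2[of "- \<real>\<^sub>\<le>\<^sub>0" Arg])
      show "continuous_on (- \<real>\<^sub>\<le>\<^sub>0) Arg"
        using continuous_at_Arg by (simp add: continuous_at_imp_continuous_on)
      have "continuous_on ?W (\<lambda>x. x a)"
        by (rule continuous_on_subset[OF continuous_on_product_coordinates]) simp
      then show "continuous_on ?W (\<lambda>x. c a / c' a * cis (x a))"
        unfolding cis_conv_exp by (intro continuous_intros)
      have n1: "cmod (c a / c' a * cis t) = 1" for t
        by (simp only: norm_mult unit[OF True] norm_cis mult_1_left)
      show "(\<lambda>x. c a / c' a * cis (x a)) ` ?W \<subseteq> - \<real>\<^sub>\<le>\<^sub>0"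
      proof (rule image_subsetI)
        fix x assume "x \<in> ?W"
        from W[OF this True] show "c a / c' a * cis (x a) \<in> - \<real>\<^sub>\<le>\<^sub>0"
          unfolding Compl_iff unit_nonpos_iff[OF n1] .
      qed
    qed
    have "scalar_Ck k m ?W (\<lambda>x. Arg (c a / c' a * cis (x a)))"
    proof (cases k)
      case (Suc l)
      have "\<exists>h'. (\<forall>x\<in>?W. has_partial ?W i (\<lambda>x. Arg (c a / c' a * cis (x a))) (h' x) x) \<and> scalar_Ck l m ?W h'" for i
        by (rule exI[of _ "\<lambda>x. if i = a then 1 else 0"])
          (use has_partial_rotated_angle[OF unit[OF True]] W[OF _ True] scalar_Ck_const in auto)
      then show ?thesis unfolding Suc scalar_Ck.simps using cont by blast
    qed (use cont in simp)
    then show ?thesis using True by (simp add: f_def)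
  qed (simp add: f_def scalar_Ck_const)
  moreover have "slice_perfect m ?W"
  proof -
    have "open_map (top_of_set (torus_dom m c)) (top_of_set (angle_box m)) (torus_chart m c)"
      using torus_homeomorphic_maps[OF c(1)] homeomorphic_map_maps homeomorphic_imp_open_map by blast
    moreover have "openin (top_of_set (torus_dom m c)) (torus_dom m c \<inter> torus_dom m c')"
    proof -
      have "openin (top_of_set (torus_set m)) (torus_dom m c \<inter> torus_dom m c')"
        using openin_torus_dom by (intro openin_Int)
      then show ?thesis by (rule openin_subset_trans) (auto simp: torus_dom_def)
    qed
    ultimately have "openin (top_of_set (angle_box m)) ?W" unfolding open_map_def by blast
    moreover have "openin (top_of_set {x. \<forall>i\<ge>m. x i = 0}) (angle_box m)"
      using openin_angle_box[of m] by (simp add: Euclidean_space_top_of_set)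
    ultimately have "openin (Euclidean_space m) ?W"
      unfolding Euclidean_space_top_of_set by (rule openin_trans)
    then show ?thesis using chart_range_slice_perfect chart_range_def by blast
  qed
  ultimately have "smooth_on m ?W f" unfolding smooth_on_def using Ck_on_iff_scalar_Ck[of m ?W _ f] by blast
  then show ?thesis
  proof (rule smooth_on_cong[rotated])
    fix x assume x: "x \<in> ?W"
    then have "x \<in> angle_box m" using Wb by blast
    then show "f x = (torus_chart m c' \<circ> inv_into (torus_dom m c) (torus_chart m c)) x"
      using inv_into_torus_chart[OF c(1)] by (auto simp: f_def torus_chart_def torus_param_def)
  qed
qed

lemma second_countable_euclidean: "second_countable (euclidean :: 'a::second_countable_topology topology)"
proof -
  obtain B :: "'a set set" where "countable B" "topological_basis B" using ex_countable_basis by blast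
  then show ?thesis
    unfolding second_countable_def
  proof (intro exI[of _ B] conjI ballI allI impI)
    fix U :: "'a set" and x assume B: "topological_basis B" and "openin euclidean U \<and> x \<in> U"
    then have "open U" "x \<in> U" by simp_all
    from topological_basisE[OF B \<open>open U\<close> \<open>x \<in> U\<close>]
    obtain V where "V \<in> B" "x \<in> V" "V \<subseteq> U" .
    then show "\<exists>V\<in>B. x \<in> V \<and> V \<subseteq> U" by blast
  qed (simp_all add: topological_basis_open)
qed

lemma smooth_mfd_torus: "smooth_mfd (torus_mfd m)"
  unfolding smooth_mfd_iff torus_mfd_simps
proof (intro conjI)
  show "Hausdorff_space (top_of_set (torus_set m))"
    by (intro Hausdorff_space_subtopology Hausdorff_space_euclidean)
  show "second_countable (top_of_set (torus_set m))"
    by (intro second_countable_subtopology second_countable_euclidean)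
  have "z \<in> torus_dom m z" if "z \<in> torus_set m" for z
  proof -
    have "z i \<noteq> - z i" if "i < m" for i
    proof
      assume "z i = - z i"
      then have "z i = 0" by (simp add: equal_neg_zero)
      then show False using torus_setD(1)[OF \<open>z \<in> torus_set m\<close> that] by simp
    qed
    then show ?thesis using that by (simp add: torus_dom_def)
  qed
  then show "(\<Union>(U, \<phi>)\<in>(\<lambda>c. (torus_dom m c, torus_chart m c)) ` torus_set m. U) = topspace (top_of_set (torus_set m))"
    by (auto simp: torus_dom_def)
  show "\<forall>(U, \<phi>)\<in>(\<lambda>c. (torus_dom m c, torus_chart m c)) ` torus_set m. openin (top_of_set (torus_set m)) U \<and>
      chart_range m (\<phi> ` U) \<and> homeomorphic_map (subtopology (top_of_set (torus_set m)) U)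
        (subtopology (Euclidean_space m) (\<phi> ` U)) \<phi>"
  proof (clarify, intro conjI)
    fix c assume c: "c \<in> torus_set m"
    show "openin (top_of_set (torus_set m)) (torus_dom m c)" by (rule openin_torus_dom)
    show "chart_range m (torus_chart m c ` torus_dom m c)"
      using openin_angle_box torus_chart_range[OF c] by (simp add: chart_range_def)
    have "subtopology (Euclidean_space m) (angle_box m) = top_of_set (angle_box m)"
      unfolding Euclidean_space_top_of_set subtopology_subtopology
      by (rule arg_cong[of _ _ top_of_set]) (auto simp: angle_box_def)
    moreover have "subtopology (top_of_set (torus_set m)) (torus_dom m c) = top_of_set (torus_dom m c)"
      unfolding subtopology_subtopology by (rule arg_cong[of _ _ top_of_set]) (auto simp: torus_dom_def)
    ultimately show "homeomorphic_map (subtopology (top_of_set (torus_set m)) (torus_dom m c))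
        (subtopology (Euclidean_space m) (torus_chart m c ` torus_dom m c)) (torus_chart m c)"
      unfolding torus_chart_range[OF c] homeomorphic_map_maps using torus_homeomorphic_maps[OF c] by auto
  qed
  show "\<forall>(U, \<phi>)\<in>(\<lambda>c. (torus_dom m c, torus_chart m c)) ` torus_set m.
      \<forall>(V, \<kappa>)\<in>(\<lambda>c. (torus_dom m c, torus_chart m c)) ` torus_set m.
        smooth_on m (\<phi> ` (U \<inter> V)) (\<kappa> \<circ> inv_into U \<phi>)"
    using smooth_torus_transition by auto
qed

lemma open_charts_torus: "open_charts (torus_mfd m)"
  using openin_angle_box by (auto simp: open_charts_def torus_mfd_simps torus_chart_range)

lemma compact_torus: "compact_space (mtop (torus_mfd m))"
proof -
  have "torus_set m = Pi\<^sub>E UNIV (\<lambda>i. if i < m then sphere 0 1 else {0})"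
  proof (intro set_eqI iffI)
    fix z :: cvec assume "z \<in> Pi\<^sub>E UNIV (\<lambda>i. if i < m then sphere 0 1 else {0})"
    then have z: "z i \<in> (if i < m then sphere 0 1 else {0})" for i by (auto simp: PiE_iff)
    have "cmod (z i) = 1" if "i < m" for i using z[of i] that by simp
    moreover have "z i = 0" if "i \<ge> m" for i using z[of i] that by simp
    ultimately show "z \<in> torus_set m" by (simp add: torus_set_def Cn_def)
  qed (auto simp: torus_set_def Cn_def PiE_iff)
  then have "compactin (product_topology (\<lambda>i. euclidean) UNIV) (torus_set m)"
    by (auto simp: compactin_PiE)
  then show ?thesis
    by (simp add: euclidean_product_topology torus_mfd_simps compact_space_subtopology)
qed

text \<open>
  The torus is the image of a vector space under the exponential map.
\<close>

lemma connected_torus: "connected_space (mtop (torus_mfd m))"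
proof -
  have one: "(\<lambda>i. if i < m then 1 else 0) \<in> torus_set m" by (auto simp: torus_set_def Cn_def)
  have "connected_space euclideanreal"
    using connectedin_topspace[of euclideanreal] connected_UNIV[where 'a = real] by simp
  then have "connected_space (product_topology (\<lambda>i. euclideanreal) (UNIV :: nat set))"
    unfolding connected_space_product_topology by simp
  then have "connected_space (euclidean :: (nat \<Rightarrow> real) topology)"
    by (simp add: euclidean_product_topology)
  then have "connected (UNIV :: (nat \<Rightarrow> real) set)"
    using connectedin_topspace[of "euclidean :: (nat \<Rightarrow> real) topology"] by simp
  then have "connected (torus_param m (\<lambda>i. if i < m then 1 else 0) ` UNIV)"
    by (rule connected_continuous_image[OF continuous_on_torus_param])
  moreover have "torus_param m (\<lambda>i. if i < m then 1 else 0) ` UNIV = torus_set m"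
  proof (intro equalityI subsetI)
    fix z assume "z \<in> torus_set m"
    then show "z \<in> torus_param m (\<lambda>i. if i < m then 1 else 0) ` UNIV"
      by (intro image_eqI[of _ _ "torus_chart m (\<lambda>i. if i < m then 1 else 0) z"])
        (simp_all add: torus_param_chart[OF one])
  qed (use torus_param_mem[OF one] in blast)
  ultimately show ?thesis
    using connectedin_iff_connected[of "torus_set m"] by (simp add: connectedin_def torus_mfd_simps)
qed

lemma torus_nonempty: "mpoints (torus_mfd m) \<noteq> {}"
proof -
  have "(\<lambda>i. if i < m then 1 else 0) \<in> torus_set m" by (auto simp: torus_set_def Cn_def)
  then show ?thesis by (auto simp: torus_mfd_simps)
qed

section \<open>The interval\<close>

definition half_interval :: "real \<Rightarrow> (nat \<Rightarrow> real) set" where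
  "half_interval L = {x. x 0 \<in> {0..<L} \<and> (\<forall>i\<ge>1. x i = 0)}"

definition left_coord :: "real \<Rightarrow> nat \<Rightarrow> real" where
  "left_coord s i = (if i = 0 then s else 0)"

definition right_coord :: "real \<Rightarrow> real \<Rightarrow> nat \<Rightarrow> real" where
  "right_coord L s i = (if i = 0 then L - s else 0)"

lemma interval_mfd_simps:
  "mtop (interval_mfd L) = top_of_set {0..L}" "mdim (interval_mfd L) = 1"
  "matlas (interval_mfd L) = {({0..<L}, left_coord), ({0<..L}, right_coord L)}"
  by (simp_all add: interval_mfd_def left_coord_def[abs_def] right_coord_def[abs_def])

lemma openin_half_interval: "openin (half_space 1) (half_interval L)"
proof -
  have "openin (Euclidean_space 1) ({x. \<forall>i\<ge>1. x i = 0} \<inter> (\<lambda>x. x 0) -` {..<L})"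
    unfolding Euclidean_space_top_of_set
    by (intro openin_open_Int open_vimage continuous_on_product_coordinates) auto
  moreover have "half_interval L = ({x. \<forall>i\<ge>1. x i = 0} \<inter> (\<lambda>x. x 0) -` {..<L}) \<inter> {x. 0 \<le> x 0}"
    by (auto simp: half_interval_def)
  ultimately show ?thesis unfolding openin_half_space_iff by blast
qed

text \<open>
  Both charts of the interval are affine: \<open>\<beta> = 1\<close> measures the distance from \<open>0\<close> and \<open>\<beta> = - 1\<close> the
  distance from \<open>L\<close>; \<open>\<alpha>\<close> is the end point that lies in the domain.
\<close>

definition affine_chart ::
  "real \<Rightarrow> real set \<Rightarrow> (real \<Rightarrow> nat \<Rightarrow> real) \<Rightarrow> real \<Rightarrow> real \<Rightarrow> bool" where
  "affine_chart L I \<iota> \<alpha> \<beta> \<longleftrightarrow> \<beta> \<in> {1, -1} \<and>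
     (\<forall>s. \<iota> s = (\<lambda>i. if i = 0 then \<beta> * (s - \<alpha>) else 0)) \<and>
     I = (\<lambda>t. \<alpha> + \<beta> * t) ` {0..<L} \<and> I \<subseteq> {0..L} \<and> \<alpha> = (if \<beta> = 1 then 0 else L)"

lemma affine_chartD:
  assumes "affine_chart L I \<iota> \<alpha> \<beta>"
  shows "\<beta> \<in> {1, -1}" "\<And>s. \<iota> s = (\<lambda>i. if i = 0 then \<beta> * (s - \<alpha>) else 0)"
    "I = (\<lambda>t. \<alpha> + \<beta> * t) ` {0..<L}" "I \<subseteq> {0..L}" "\<alpha> = (if \<beta> = 1 then 0 else L)"
  using assms unfolding affine_chart_def by blast+

lemma interval_charts:
  assumes "(I, \<iota>) \<in> matlas (interval_mfd L)"
  obtains \<alpha> \<beta> where "affine_chart L I \<iota> \<alpha> \<beta>"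
proof -
  consider "I = {0..<L}" "\<iota> = left_coord" | "I = {0<..L}" "\<iota> = right_coord L"
    using assms by (auto simp: interval_mfd_simps)
  then show thesis
  proof cases
    case 1
    then show thesis by (intro that[of 0 1]) (auto simp: affine_chart_def left_coord_def fun_eq_iff)
  next
    case 2
    have "{0<..L} = (\<lambda>t. L + -1 * t) ` {0..<L}"
    proof (intro set_eqI iffI)
      fix s assume "s \<in> {0<..L}"
      then show "s \<in> (\<lambda>t. L + -1 * t) ` {0..<L}" by (intro image_eqI[of _ _ "L - s"]) auto
    qed auto
    then show thesis using 2 by (intro that[of L "-1"]) (auto simp: affine_chart_def right_coord_def fun_eq_iff)
  qed
qed

lemma interval_chart_image:
  assumes "(I, \<iota>) \<in> matlas (interval_mfd L)"
  shows "\<iota> ` I = half_interval L"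
proof -
  obtain \<alpha> \<beta> where ab: "affine_chart L I \<iota> \<alpha> \<beta>" by (rule interval_charts[OF assms])
    note b = affine_chartD[OF ab]
  have "\<iota> (\<alpha> + \<beta> * t) = (\<lambda>i. if i = 0 then t else 0)" for t using b(1) by (auto simp: b(2))
  then have "\<iota> ` I = (\<lambda>t i. if i = 0 then t else 0) ` {0..<L}" unfolding b(3) image_image by simp
  also have "\<dots> = half_interval L"
  proof (intro set_eqI iffI)
    fix x assume x: "x \<in> half_interval L"
    then have "x = (\<lambda>i. if i = 0 then x 0 else 0)" by (auto simp: half_interval_def fun_eq_iff Suc_le_eq)
    moreover have "x 0 \<in> {0..<L}" using x by (simp add: half_interval_def)
    ultimately show "x \<in> (\<lambda>t i. if i = 0 then t else 0) ` {0..<L}" by blast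
  qed (auto simp: half_interval_def)
  finally show ?thesis .
qed

lemma interval_chart_inv:
  assumes ab: "affine_chart L I \<iota> \<alpha> \<beta>" and x: "x \<in> half_interval L"
  shows "inv_into I \<iota> x = \<alpha> + \<beta> * x 0"
proof (rule inv_into_f_eq)
  note b = affine_chartD[OF ab]
  show "inj_on \<iota> I"
  proof (rule inj_onI)
    fix s t assume "\<iota> s = \<iota> t"
    then have "\<iota> s 0 = \<iota> t 0" by simp
    then show "s = t" using b(1) by (auto simp: b(2))
  qed
  show "\<alpha> + \<beta> * x 0 \<in> I" using x by (auto simp: b(3) half_interval_def)
  show "\<iota> (\<alpha> + \<beta> * x 0) = x"
    using x b(1) by (auto simp: b(2) half_interval_def fun_eq_iff Suc_le_eq)
qed

lemma smooth_curve_affine: "smooth_curve S (\<lambda>t. a + b * t :: real)"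
proof -
  let ?A = "{f. \<exists>a b. f = (\<lambda>t. a + b * t :: real)}"
  have "\<exists>f'\<in>?A. \<forall>t\<in>S. (f has_vector_derivative f' t) (at t within S)" if fA: "f \<in> ?A" for f
  proof -
    obtain a b where f: "f = (\<lambda>t. a + b * t)" using fA by blast
    have "(f has_vector_derivative b + 0 * t) (at t within S)" for t
      unfolding f by (auto intro!: derivative_eq_intros simp flip: has_real_derivative_iff_has_vector_derivative)
    moreover have "(\<lambda>t. b + 0 * t) \<in> ?A" by blast
    ultimately show ?thesis by (intro bexI[of _ "\<lambda>t. b + 0 * t"]) simp_all
  qed
  then show ?thesis unfolding smooth_curve_def by (intro exI[of _ ?A]) blast
qed

lemma smooth_mfd_interval:
  assumes L: "0 < L"
  shows "smooth_mfd (interval_mfd L)"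
proof -
  have ho: "homeomorphic_map (subtopology (top_of_set {0..L}) I) (subtopology (Euclidean_space 1) (\<iota> ` I)) \<iota>"
    "openin (top_of_set {0..L}) I"
    if I: "(I, \<iota>) \<in> matlas (interval_mfd L)" for I \<iota>
  proof -
    obtain \<alpha> \<beta> where ab: "affine_chart L I \<iota> \<alpha> \<beta>" by (rule interval_charts[OF I])
    note b = affine_chartD[OF ab]
    have im: "\<iota> ` I = half_interval L" by (rule interval_chart_image[OF I])
    have "subtopology (Euclidean_space 1) (half_interval L) = top_of_set (half_interval L)"
      unfolding Euclidean_space_top_of_set subtopology_subtopology
      by (rule arg_cong[of _ _ top_of_set]) (auto simp: half_interval_def)
    moreover have "subtopology (top_of_set {0..L}) I = top_of_set I"
      using b(4) by (simp add: subtopology_subtopology Int_absorb1)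
    moreover have "homeomorphic_maps (top_of_set I) (top_of_set (half_interval L)) \<iota> (\<lambda>x. \<alpha> + \<beta> * x 0)"
      unfolding homeomorphic_maps_def
    proof (intro conjI)
      have "continuous_on I \<iota>"
      proof (rule continuous_on_coordinatewise_then_product)
        fix i show "continuous_on I (\<lambda>s. \<iota> s i)"
          unfolding b(2) by (cases "i = 0") (auto intro!: continuous_intros)
      qed
      then show "continuous_map (top_of_set I) (top_of_set (half_interval L)) \<iota>" using im by auto
      have "continuous_on (half_interval L) (\<lambda>x. \<alpha> + \<beta> * x 0)"
        by (intro continuous_intros continuous_on_subset[OF continuous_on_product_coordinates]) simp
      then show "continuous_map (top_of_set (half_interval L)) (top_of_set I) (\<lambda>x. \<alpha> + \<beta> * x 0)"
        by (auto simp: b(3) half_interval_def)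
      show "\<forall>s\<in>topspace (top_of_set I). \<alpha> + \<beta> * \<iota> s 0 = s" using b(1) by (auto simp: b(2))
      show "\<forall>x\<in>topspace (top_of_set (half_interval L)). \<iota> (\<alpha> + \<beta> * x 0) = x"
        using b(1) by (auto simp: b(2) half_interval_def fun_eq_iff Suc_le_eq)
    qed
    ultimately show "homeomorphic_map (subtopology (top_of_set {0..L}) I) (subtopology (Euclidean_space 1) (\<iota> ` I)) \<iota>"
      unfolding im homeomorphic_map_maps by auto
    have "I = {0..L} \<inter> {..<L} \<or> I = {0..L} \<inter> {0<..}" using I by (auto simp: interval_mfd_simps)
    then show "openin (top_of_set {0..L}) I" by (metis openin_open_Int open_lessThan open_greaterThan)
  qed
  have tr: "smooth_on 1 (\<iota> ` (I \<inter> I')) (\<iota>' \<circ> inv_into I \<iota>)"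
    if I: "(I, \<iota>) \<in> matlas (interval_mfd L)" and I': "(I', \<iota>') \<in> matlas (interval_mfd L)" for I \<iota> I' \<iota>'
  proof -
    obtain \<alpha> \<beta> where ab: "affine_chart L I \<iota> \<alpha> \<beta>" by (rule interval_charts[OF I])
    note b = affine_chartD[OF ab]
    obtain \<alpha>' \<beta>' where ab': "affine_chart L I' \<iota>' \<alpha>' \<beta>'" by (rule interval_charts[OF I'])
    note b' = affine_chartD(2)[OF ab']
    let ?W = "\<iota> ` (I \<inter> I')"
    have im: "\<iota> ` I = half_interval L" by (rule interval_chart_image[OF I])
    have "chart_range 1 ?W"
    proof (cases "I = I'")
      case True
      then have "?W = half_interval L" using im by simp
      then show ?thesis unfolding chart_range_def using openin_half_interval[of L] by (simp only: simp_thms)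
    next
      case False
      then have II: "I \<inter> I' = {0<..<L}" using I I' by (auto simp: interval_mfd_simps)
      have "?W = half_interval L \<inter> {x. 0 < x 0}"
      proof (intro equalityI subsetI)
        fix x assume "x \<in> ?W"
        then obtain t where t: "t \<in> {0<..<L}" "x = \<iota> t" unfolding II by blast
        then have "x \<in> half_interval L" using im \<open>x \<in> ?W\<close> by blast
        moreover have "0 < x 0" using t b(1,5) by (auto simp: b(2))
        ultimately show "x \<in> half_interval L \<inter> {x. 0 < x 0}" by simp
      next
        fix x assume x: "x \<in> half_interval L \<inter> {x. 0 < x 0}"
        then have "x = \<iota> (\<alpha> + \<beta> * x 0)"
          using b(1) by (auto simp: b(2) half_interval_def fun_eq_iff Suc_le_eq)
        moreover have "\<alpha> + \<beta> * x 0 \<in> {0<..<L}" using x b(1,5) by (auto simp: half_interval_def)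
        ultimately show "x \<in> ?W" unfolding II by blast
      qed
      moreover have "open {x :: nat \<Rightarrow> real. 0 < x 0}"
        using open_vimage[OF open_greaterThan[of 0] continuous_on_product_coordinates[of 0]]
        by (simp add: vimage_def)
      moreover have "half_space 1 = top_of_set ({x. \<forall>i\<ge>1. x i = 0} \<inter> {x. 0 \<le> x 0})"
        by (simp add: half_space_def Euclidean_space_top_of_set subtopology_subtopology)
      ultimately have "openin (half_space 1) ?W"
        using openin_half_interval[of L] by (simp only: openin_Int_open)
      then show ?thesis unfolding chart_range_def by (rule disjI2)
    qed
    then have slice_perfect: "slice_perfect 1 ?W" by (rule chart_range_slice_perfect)
    define f where "f x i = (if i = 0 then \<beta>' * (\<alpha> - \<alpha>') + (\<beta>' * \<beta>) * x 0 else 0)" for x :: "nat \<Rightarrow> real" and i :: nat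
    have "scalar_Ck k 1 ?W (\<lambda>x. f x a)" for k a
      using smooth_curve_imp_scalar_Ck[of ?W 0 UNIV "\<lambda>t. \<beta>' * (\<alpha> - \<alpha>') + (\<beta>' * \<beta>) * t" k 1] smooth_curve_affine
      by (cases "a = 0") (auto simp: f_def scalar_Ck_const)
    then have "smooth_on 1 ?W f" unfolding smooth_on_def using Ck_on_iff_scalar_Ck[OF slice_perfect, of _ f] by blast
    then show ?thesis
    proof (rule smooth_on_cong[rotated])
      fix x assume "x \<in> ?W"
      then have "x \<in> half_interval L" using im by blast
      then show "f x = (\<iota>' \<circ> inv_into I \<iota>) x"
        using interval_chart_inv[OF ab] by (auto simp: f_def b' algebra_simps)
    qed
  qed
  have cr: "chart_range 1 (\<iota> ` I)" if "(I, \<iota>) \<in> matlas (interval_mfd L)" for I \<iota>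
    using openin_half_interval by (simp add: interval_chart_image[OF that] chart_range_def)
  have cov: "(\<Union>(U, \<phi>)\<in>matlas (interval_mfd L). U) = {0..L}"
    using L by (auto simp: interval_mfd_simps)
  show ?thesis
    unfolding smooth_mfd_iff interval_mfd_simps(1,2)
  proof (intro conjI)
    show "Hausdorff_space (top_of_set {0..L})"
      by (intro Hausdorff_space_subtopology Hausdorff_space_euclidean)
    show "second_countable (top_of_set {0..L})"
      by (intro second_countable_subtopology second_countable_euclidean)
    show "(\<Union>(U, \<phi>)\<in>matlas (interval_mfd L). U) = topspace (top_of_set {0..L})"
      using cov by simp
  qed (use ho tr cr in blast)+
qed

lemma compact_interval: "compact_space (mtop (interval_mfd L))"
  by (simp add: interval_mfd_simps compact_space_subtopology)

section \<open>Immersions with prescribed jets\<close>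

lemma has_partial_cn_inner:
  assumes "\<And>a. has_partial V i (\<lambda>y. f y a) (f' a) x" "\<And>a. has_partial V i (\<lambda>y. g y a) (g' a) x"
  shows "has_partial V i (\<lambda>y. cn_inner n (f y) (g y)) (cn_inner n (f x) g' + cn_inner n f' (g x)) x"
proof -
  have "((\<lambda>t. \<Sum>a<n. f (x(i := t)) a \<bullet> g (x(i := t)) a) has_vector_derivative
      (\<Sum>a<n. f (x(i := x i)) a \<bullet> g' a + f' a \<bullet> g (x(i := x i)) a)) (at (x i) within slice V i x)"
    using assms unfolding has_partial_def
    by (intro has_vector_derivative_sum bounded_bilinear.has_vector_derivative[OF bounded_bilinear_inner]) auto
  then show ?thesis by (simp add: has_partial_def cn_inner_def sum.distrib)
qed

lemma has_partial_cn_J: "has_partial V i (\<lambda>y. f y a) f' x \<Longrightarrow> has_partial V i (\<lambda>y. cn_J (f y) a) (\<i> * f') x"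
  unfolding has_partial_def cn_J_def by (rule has_vector_derivative_mult_right)

lemma has_partial_const_on:
  assumes "has_partial V i f u x" "\<And>y. y \<in> V \<Longrightarrow> f y = c" "slice_perfect d V" "x \<in> V" "i < d"
  shows "u = 0"
proof -
  have "has_partial V i (\<lambda>y. c) u x" using has_partial_cong[of V f "\<lambda>y. c" x i u] assms(1,2,4) by simp
  moreover have "has_partial V i (\<lambda>y. c) 0 x" by (simp add: has_partial_def)
  ultimately show ?thesis using has_partial_unique assms(3-5) by blast
qed

lemma partial_d_Cn:
  assumes "slice_perfect d V" "x \<in> V" "i < d" "\<And>y. y \<in> V \<Longrightarrow> F y \<in> Cn n"
  shows "partial_d V i F x \<in> Cn n"
  unfolding Cn_def
proof (intro CollectI allI impI)
  fix a assume a: "n \<le> a"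
  have "has_partial V i (\<lambda>y. F y a) 0 x \<longleftrightarrow> has_partial V i (\<lambda>y. 0 :: complex) 0 x"
    by (rule has_partial_cong) (use assms a in \<open>auto simp: Cn_def\<close>)
  then have "has_partial V i (\<lambda>y. F y a) 0 x" by (simp add: has_partial_def)
  then show "partial_d V i F x a = 0" by (rule partial_d_eqI) (use assms in auto)
qed

lemma range_pushforward: "range (pushforward M c X p) = lin_span (mdim M) (\<lambda>i. coord_d c X i p)"
  by (simp add: lin_span_def pushforward_def[abs_def])

lemma coord_d_in_range:
  assumes "i < mdim M"
  shows "coord_d c X i p = pushforward M c X p (\<lambda>j. if j = i then 1 else 0)"
proof
  fix a
  show "coord_d c X i p a = pushforward M c X p (\<lambda>j. if j = i then 1 else 0) a"
    using assms by (simp add: pushforward_def if_distrib[of "\<lambda>r. r *\<^sub>R _"] cong: if_cong)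
qed

text \<open>
  Each condition of the jet is obtained by differentiating the preceding one: \<open>\<langle>P, P\<rangle> = 1\<close> gives \<open>\<langle>P, E i\<rangle> = 0\<close>,
  which gives \<open>\<langle>D i j, P\<rangle> = - g i j\<close>. For the Lagrangian condition \<open>\<langle>J P, E j\<rangle> = 0\<close> is differentiated, and
  the symmetry of \<open>D\<close> is used.
\<close>

lemma legendrian_jet_of_immersion:
  assumes M: "smooth_mfd M" "open_charts M" and dim: "mdim M = d"
    and leg: "legendrian_immersion M (Suc d) X" and min: "minimal_in_sphere M (Suc d) X"
    and c: "c \<in> matlas M" "p \<in> fst c"
  shows "\<exists>h. legendrian_jet d (X p) (\<lambda>i. coord_d c X i p) (\<lambda>i j. coord_d2 c X i j p) h"
proof -
  let ?n = "Suc d"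
  obtain U \<phi> where cU: "c = (U, \<phi>)" by (rule prod.exhaust)
  have cM: "(U, \<phi>) \<in> matlas M" and pU: "p \<in> U" using c by (simp_all add: cU)
  note C = smooth_mfd_chartD[OF M(1) cM]
  define V where "V = \<phi> ` U"
  define F where "F = chart_rep c X"
  have V: "openin (Euclidean_space d) V" using open_chartsD[OF M(2) cM] by (simp add: V_def dim)
  have slice_perfect: "slice_perfect d V" using V chart_range_slice_perfect chart_range_def by blast
  have imm: "immersion M ?n X" using leg by (simp add: legendrian_immersion_def)
  have F: "smooth_on d V F" using imm c(1) by (auto simp: immersion_def V_def F_def cU dim)
  define x where "x = \<phi> p"
  have xV: "x \<in> V" using pU by (simp add: x_def V_def)
  have pt: "\<exists>q\<in>U. F y = X q \<and> y = \<phi> q" if "y \<in> V" for y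
    using that C(3) by (auto simp: V_def F_def chart_rep_def cU)
  have Fx: "F x = X p" using C(3) pU by (simp add: F_def chart_rep_def cU x_def)
  have cd: "coord_d c X i q = partial_d V i F (\<phi> q)" for i q
    by (simp add: coord_d_def cU V_def F_def)
  define E where "E i y = partial_d V i F y" for i y
  define D where "D i j = partial_d V i (partial_d V j F) x" for i j
  have Ex: "coord_d c X i p = E i x" for i by (simp add: cd E_def x_def)
  have Dx: "coord_d2 c X i j p = D i j" for i j
    by (simp add: D_def x_def coord_d2_def cU V_def F_def)
  have FC: "F y \<in> Cn ?n" "cn_inner ?n (F y) (F y) = 1" if "y \<in> V" for y
    using pt[OF that] leg C(4) by (auto simp: legendrian_immersion_def cn_sphere_def cn_norm_def)
  have EC: "E i y \<in> Cn ?n" if "y \<in> V" "i < d" for i y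
    unfolding E_def using partial_d_Cn[OF slice_perfect that FC(1)] .
  have DC: "D i j \<in> Cn ?n" if "i < d" "j < d" for i j
    unfolding D_def by (rule partial_d_Cn[OF slice_perfect xV that(1)]) (use EC that(2) in \<open>simp add: E_def\<close>)
  have pF: "has_partial V i (\<lambda>y. F y a) (E i y a) y" if "y \<in> V" "i < d" for i y a
    unfolding E_def using smooth_on_has_partial[OF F that(2,1)] .
  have pE: "has_partial V i (\<lambda>y. E j y a) (D i j a) x" if "i < d" "j < d" for i j a
    unfolding E_def D_def using smooth_on_has_partial[OF smooth_on_partial_d[OF F that(2)] that(1) xV] .
  have FE: "cn_inner ?n (F y) (E i y) = 0" if "y \<in> V" "i < d" for i y
  proof -
    have "has_partial V i (\<lambda>y. cn_inner ?n (F y) (F y)) (cn_inner ?n (F y) (E i y) + cn_inner ?n (E i y) (F y)) y"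
      using pF[OF that] by (intro has_partial_cn_inner)
    then have "cn_inner ?n (F y) (E i y) + cn_inner ?n (E i y) (F y) = 0"
      by (rule has_partial_const_on[OF _ FC(2) slice_perfect that])
    then show ?thesis by (simp add: cn_inner_commute)
  qed
  have JFE: "cn_inner ?n (cn_J (F y)) (E i y) = 0" if y: "y \<in> V" and i: "i < d" for i y
  proof -
    obtain q where q: "q \<in> U" "F y = X q" "y = \<phi> q" using pt[OF y] by blast
    have "coord_d c X i q \<in> tangent_image M X q"
      unfolding tangent_image_def using coord_d_in_range[of i M c X q] i dim c(1) q(1) by (auto simp: cU)
    moreover have "q \<in> mpoints M" using q(1) C(4) by blast
    ultimately have "cn_inner ?n (cn_J (X q)) (coord_d c X i q) = 0"
      using leg by (simp add: legendrian_immersion_def)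
    then show ?thesis using q by (simp add: cd E_def)
  qed
  have DF: "cn_inner ?n (D i j) (F x) = - cn_inner ?n (E i x) (E j x)" if "i < d" "j < d" for i j
  proof -
    have "has_partial V i (\<lambda>y. cn_inner ?n (F y) (E j y)) (cn_inner ?n (F x) (D i j) + cn_inner ?n (E i x) (E j x)) x"
      using pF[OF xV that(1)] pE[OF that] by (intro has_partial_cn_inner)
    then have "cn_inner ?n (F x) (D i j) + cn_inner ?n (E i x) (E j x) = 0"
      by (rule has_partial_const_on[OF _ _ slice_perfect xV that(1)]) (use FE that(2) in blast)
    then show ?thesis by (simp add: cn_inner_commute)
  qed
  have JED: "cn_inner ?n (cn_J (F x)) (D i j) + cn_inner ?n (cn_J (E i x)) (E j x) = 0" if "i < d" "j < d" for i j
  proof -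
    have "has_partial V i (\<lambda>y. cn_J (F y) a) (cn_J (E i x) a) x" for a
      using has_partial_cn_J[OF pF[OF xV that(1)]] by (simp add: cn_J_def)
    then have "has_partial V i (\<lambda>y. cn_inner ?n (cn_J (F y)) (E j y))
        (cn_inner ?n (cn_J (F x)) (D i j) + cn_inner ?n (cn_J (E i x)) (E j x)) x"
      using pE[OF that] by (intro has_partial_cn_inner)
    then show ?thesis
      by (rule has_partial_const_on[OF _ _ slice_perfect xV that(1)]) (use JFE that(2) in blast)
  qed
  (* antisymmetric in i and j, but equal to a symmetric expression by JED *)
  have JEE: "cn_inner ?n (cn_J (E i x)) (E j x) = 0" if "i < d" "j < d" for i j
  proof -
    have "D i j = D j i" unfolding D_def by (rule partial_d_commute[OF V F xV that])
    then show ?thesis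
      using JED[OF that] JED[OF that(2,1)] cn_J_skew[of ?n "E i x" "E j x"] by simp
  qed
  define g where "g i j = cn_inner ?n (E i x) (E j x)" for i j
  have "\<exists>h. inverse_pair d g h"
  proof (rule posdef_inverse_pair)
    show "g i j = g j i" for i j by (simp add: g_def cn_inner_commute)
    fix v :: "nat \<Rightarrow> real" assume v: "\<exists>i<d. v i \<noteq> 0"
    define w where "w = (\<lambda>a. \<Sum>i<d. v i *\<^sub>R E i x a)"
    have "w = pushforward M c X p v" by (simp add: w_def pushforward_def Ex dim)
    moreover have "pushforward M c X p v \<noteq> (\<lambda>a. 0)"
      using imm c v by (auto simp: immersion_def dim)
    moreover have "w \<in> Cn ?n" using EC[OF xV] by (auto simp: w_def Cn_def intro!: sum.neutral)
    ultimately have "cn_inner ?n w w \<noteq> 0" using cn_inner_eq_zero by metis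
    then have "0 < cn_inner ?n w w" using cn_inner_nonneg[of ?n w] by simp
    also have "cn_inner ?n w w = (\<Sum>i<d. \<Sum>j<d. v i * v j * g i j)"
      by (simp add: w_def cn_inner_sum_left cn_inner_sum_right cn_inner_scaleR_left cn_inner_scaleR_right
          g_def sum_distrib_left mult_ac)
    finally show "0 < (\<Sum>i<d. \<Sum>j<d. v i * v j * g i j)" .
  qed
  then obtain h where h: "inverse_pair d g h" by blast
  have h': "inverse_pair d (\<lambda>i j. cn_inner ?n (E i x) (E j x)) h" using h by (simp add: g_def[abs_def])
  have T: "tangent_image M X p = lin_span d (\<lambda>i. E i x)"
    using tangent_image_chart[OF M(1) c, of X] imm range_pushforward[of M c X p]
    by (simp add: immersion_def dim Ex)
  (* the second derivatives with respect to the connection of the sphere *)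
  define W where "W i j = (\<lambda>a. D i j a - cn_inner ?n (D i j) (F x) *\<^sub>R F x a)" for i j
  have WC: "W i j \<in> Cn ?n" if "i < d" "j < d" for i j
    using DC[OF that] FC(1)[OF xV] by (simp add: W_def Cn_def)
  have "(\<Sum>i<d. \<Sum>j<d. h i j *\<^sub>R normal_proj ?n d (\<lambda>i. E i x) h (W i j) a) = 0" for a
  proof -
    have "(\<Sum>i<d. \<Sum>j<d. h i j *\<^sub>R normal_proj ?n d (\<lambda>i. E i x) h (W i j) a) =
        sphere_mean_curvature ?n M c X p a"
      unfolding sphere_mean_curvature_def metric_trace_def sphere_second_fundamental_form_def dim T Ex Dx
        induced_metric_def Fx[symmetric]
      using inverse_metric_eq[OF h'] normal_part_eq_normal_proj[OF h' _ EC[OF xV]] WC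
      by (intro sum.cong refl) (auto simp: W_def[symmetric] induced_metric_def)
    also have "\<dots> = 0" using min c by (simp add: minimal_in_sphere_def)
    finally show ?thesis .
  qed
  then have np: "normal_proj ?n d (\<lambda>i. E i x) h (\<lambda>a. \<Sum>i<d. \<Sum>j<d. h i j *\<^sub>R W i j a) a = 0" for a
    by (simp only: normal_proj_sum2)
  define \<tau> where "\<tau> i = (\<Sum>j<d. h i j * cn_inner ?n (\<lambda>a. \<Sum>i<d. \<Sum>j<d. h i j *\<^sub>R W i j a) (E j x))" for i
  have tr: "(\<Sum>i<d. \<Sum>j<d. h i j * g i j) = real d"
    by (rule inverse_pair_trace[OF h]) (simp add: g_def cn_inner_commute)
  have "(\<Sum>i<d. \<Sum>j<d. h i j *\<^sub>R D i j a) + real d *\<^sub>R F x a = (\<Sum>i<d. \<tau> i *\<^sub>R E i x a)" for a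
  proof -
    have "(\<Sum>i<d. \<Sum>j<d. h i j *\<^sub>R W i j a) = (\<Sum>i<d. \<Sum>j<d. h i j *\<^sub>R D i j a + (h i j * g i j) *\<^sub>R F x a)"
      by (intro sum.cong refl) (simp add: W_def DF g_def scaleR_diff_right scaleR_add_right)
    also have "\<dots> = (\<Sum>i<d. \<Sum>j<d. h i j *\<^sub>R D i j a) + real d *\<^sub>R F x a"
      by (simp add: sum.distrib flip: tr scaleR_sum_left)
    finally show ?thesis using np[of a] by (simp add: normal_proj_def \<tau>_def)
  qed
  then have "legendrian_jet d (F x) (\<lambda>i. E i x) D h"
    unfolding legendrian_jet_def
    using FC[OF xV] EC[OF xV] DC FE[OF xV] JFE[OF xV] JEE DF h' by blast
  then show ?thesis unfolding Ex Dx Fx by blast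
qed

text \<open>
  An invertible Gram matrix excludes linear relations between the coordinate derivatives.
\<close>

lemma immersion_of_inverse_pair:
  assumes M: "smooth_mfd M"
    and sm: "\<And>c. c \<in> matlas M \<Longrightarrow> smooth_on (mdim M) (snd c ` fst c) (chart_rep c X)"
    and Cn: "\<And>p. p \<in> mpoints M \<Longrightarrow> X p \<in> Cn n"
    and inv: "\<And>c p. c \<in> matlas M \<Longrightarrow> p \<in> fst c \<Longrightarrow>
      \<exists>h. inverse_pair (mdim M) (\<lambda>i j. cn_inner n (coord_d c X i p) (coord_d c X j p)) h"
  shows "immersion M n X"
  unfolding immersion_def
proof (intro conjI ballI allI impI)
  show "X ` mpoints M \<subseteq> Cn n" using Cn by blast
  show "smooth_on (mdim M) (snd c ` fst c) (chart_rep c X)" if "c \<in> matlas M" for c using sm[OF that] .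
  fix c p v i assume c: "c \<in> matlas M" "p \<in> fst c" and z: "pushforward M c X p v = (\<lambda>a. 0)" and i: "i < mdim M"
  obtain h where h: "inverse_pair (mdim M) (\<lambda>i j. cn_inner n (coord_d c X i p) (coord_d c X j p)) h"
    using inv[OF c] by blast
  let ?g = "\<lambda>i j. cn_inner n (coord_d c X i p) (coord_d c X j p)"
  have gv: "(\<Sum>k<mdim M. ?g j k * v k) = 0" for j
  proof -
    have "(\<Sum>k<mdim M. ?g j k * v k) = cn_inner n (coord_d c X j p) (pushforward M c X p v)"
      by (simp add: pushforward_def cn_inner_sum_right cn_inner_scaleR_right mult.commute)
    then show ?thesis by (simp add: z)
  qed
  have "v i = (\<Sum>k<mdim M. (if i = k then 1 else 0) * v k)" using i by (simp add: sum_delta_mult_left)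
  also have "\<dots> = (\<Sum>k<mdim M. (\<Sum>j<mdim M. h i j * ?g j k) * v k)"
    using h i by (intro sum.cong) (auto simp: inverse_pair_def)
  also have "\<dots> = (\<Sum>j<mdim M. h i j * (\<Sum>k<mdim M. ?g j k * v k))"
    unfolding sum_distrib_left sum_distrib_right by (subst sum.swap) (simp add: mult.assoc)
  finally show "v i = 0" by (simp add: gv)
qed

lemma mpoints_in_chart:
  assumes "smooth_mfd M" "p \<in> mpoints M"
  obtains c where "c \<in> matlas M" "p \<in> fst c"
proof -
  have "p \<in> (\<Union>(U, \<phi>)\<in>matlas M. U)" using assms by (simp add: smooth_mfd_iff)
  then obtain c where "c \<in> matlas M" "p \<in> fst c" by (auto simp: case_prod_unfold)
  then show thesis using that by blast
qed

text \<open>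
  The trace of the second fundamental form is the normal part of the trace of the derivatives, since the
  projection is linear; and the latter trace is tangent by assumption.
\<close>

lemma legendrian_minimal_of_jets:
  assumes M: "smooth_mfd M" and dim: "mdim M = d"
    and sm: "\<And>c. c \<in> matlas M \<Longrightarrow> smooth_on d (snd c ` fst c) (chart_rep c X)"
    and jet: "\<And>c p. c \<in> matlas M \<Longrightarrow> p \<in> fst c \<Longrightarrow>
      \<exists>h. legendrian_jet d (X p) (\<lambda>i. coord_d c X i p) (\<lambda>i j. coord_d2 c X i j p) h"
  shows "legendrian_immersion M (Suc d) X" and "minimal_in_sphere M (Suc d) X"
proof -
  let ?n = "Suc d"
  have XP: "X p \<in> Cn ?n" "cn_inner ?n (X p) (X p) = 1" if pM: "p \<in> mpoints M" for p
  proof -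
    obtain c where "c \<in> matlas M" "p \<in> fst c" using mpoints_in_chart[OF M pM] .
    then show "X p \<in> Cn ?n" "cn_inner ?n (X p) (X p) = 1" using jet unfolding legendrian_jet_def by blast+
  qed
  have imm: "immersion M ?n X"
  proof (rule immersion_of_inverse_pair[OF M])
    fix c p assume "c \<in> matlas M" "p \<in> fst c"
    then show "\<exists>h. inverse_pair (mdim M) (\<lambda>i j. cn_inner ?n (coord_d c X i p) (coord_d c X j p)) h"
      using jet dim unfolding legendrian_jet_def by blast
  qed (use sm dim XP in auto)
  have T: "tangent_image M X p = lin_span d (\<lambda>i. coord_d c X i p)" if "c \<in> matlas M" "p \<in> fst c" for c p
    using tangent_image_chart[OF M that, of X] sm dim range_pushforward[of M c X p] by simp
  show "legendrian_immersion M ?n X"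
    unfolding legendrian_immersion_def
  proof (intro conjI imm ballI)
    show "mdim M + 1 = ?n" using dim by simp
    show "X ` mpoints M \<subseteq> cn_sphere ?n" using XP by (auto simp: cn_sphere_def cn_norm_def)
    fix p W assume p: "p \<in> mpoints M" and W: "W \<in> tangent_image M X p"
    obtain c where c: "c \<in> matlas M" "p \<in> fst c" using mpoints_in_chart[OF M p] .
    obtain v where v: "W = (\<lambda>a. \<Sum>i<d. v i *\<^sub>R coord_d c X i p a)"
      using W unfolding T[OF c] lin_span_def by blast
    have "cn_inner ?n (cn_J (X p)) (coord_d c X i p) = 0" if "i < d" for i
      using jet[OF c] that unfolding legendrian_jet_def by blast
    then show "cn_inner ?n (cn_J (X p)) W = 0"
      by (simp add: v cn_inner_sum_right cn_inner_scaleR_right)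
  qed
  show "minimal_in_sphere M ?n X"
    unfolding minimal_in_sphere_def
  proof (intro ballI)
    fix c p assume c: "c \<in> matlas M" "p \<in> fst c"
    define E where "E i = coord_d c X i p" for i
    define D where "D i j = coord_d2 c X i j p" for i j
    obtain h where j: "legendrian_jet d (X p) E D h"
      using jet[OF c] by (auto simp: E_def[abs_def] D_def[abs_def])
    have inv: "inverse_pair d (\<lambda>i j. cn_inner ?n (E i) (E j)) h" and EC: "\<And>i. i < d \<Longrightarrow> E i \<in> Cn ?n"
      and DC: "\<And>i j. i < d \<Longrightarrow> j < d \<Longrightarrow> D i j \<in> Cn ?n" and PC: "X p \<in> Cn ?n"
      and DP: "\<And>i j. i < d \<Longrightarrow> j < d \<Longrightarrow> cn_inner ?n (D i j) (X p) = - cn_inner ?n (E i) (E j)"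
      using j unfolding legendrian_jet_def by blast+
    obtain \<tau> where \<tau>: "\<And>a. (\<Sum>i<d. \<Sum>j<d. h i j *\<^sub>R D i j a) + real d *\<^sub>R X p a = (\<Sum>i<d. \<tau> i *\<^sub>R E i a)"
      using j unfolding legendrian_jet_def by blast
    define W where "W i j = (\<lambda>a. D i j a - cn_inner ?n (D i j) (X p) *\<^sub>R X p a)" for i j
    have WC: "W i j \<in> Cn ?n" if "i < d" "j < d" for i j
      using DC[OF that] PC by (simp add: W_def Cn_def)
    have tr: "(\<Sum>i<d. \<Sum>j<d. h i j * cn_inner ?n (E i) (E j)) = real d"
      by (rule inverse_pair_trace[OF inv cn_inner_commute])
    have hW: "(\<Sum>i<d. \<Sum>j<d. h i j *\<^sub>R W i j a) = (\<Sum>i<d. \<tau> i *\<^sub>R E i a)" for a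
    proof -
      have "(\<Sum>i<d. \<Sum>j<d. h i j *\<^sub>R W i j a) =
          (\<Sum>i<d. \<Sum>j<d. h i j *\<^sub>R D i j a + (h i j * cn_inner ?n (E i) (E j)) *\<^sub>R X p a)"
        by (intro sum.cong refl) (simp add: W_def DP scaleR_diff_right scaleR_add_right)
      also have "\<dots> = (\<Sum>i<d. \<Sum>j<d. h i j *\<^sub>R D i j a) + real d *\<^sub>R X p a"
        by (simp add: sum.distrib flip: tr scaleR_sum_left)
      finally show ?thesis by (simp add: \<tau>)
    qed
    show "sphere_mean_curvature ?n M c X p = (\<lambda>a. 0)"
    proof
      fix a
      have "sphere_mean_curvature ?n M c X p a = (\<Sum>i<d. \<Sum>j<d. h i j *\<^sub>R normal_proj ?n d E h (W i j) a)"
        unfolding sphere_mean_curvature_def metric_trace_def sphere_second_fundamental_form_def dim T[OF c]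
          induced_metric_def E_def[symmetric] D_def[symmetric]
        using inverse_metric_eq[OF inv] normal_part_eq_normal_proj[OF inv _ EC] WC
        by (intro sum.cong refl) (auto simp: W_def[symmetric] induced_metric_def E_def[symmetric])
      also have "\<dots> = normal_proj ?n d E h (\<lambda>a. \<Sum>i<d. \<Sum>j<d. h i j *\<^sub>R W i j a) a"
        by (simp only: normal_proj_sum2)
      also have "\<dots> = normal_proj ?n d E h (\<lambda>a. \<Sum>i<d. \<tau> i *\<^sub>R E i a) a"
        by (simp only: hW)
      also have "\<dots> = 0" using normal_proj_lin_span[OF inv, of \<tau>] by (rule fun_cong)
      finally show "sphere_mean_curvature ?n M c X p a = 0" .
    qed
  qed
qed

text \<open>
  By linearity of the projection \<open>H + \<epsilon> X\<^sup>\<bottom>\<close> is the normal part of the trace of the second derivatives plus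
  \<open>\<epsilon> X\<close>, which is tangent by assumption.
\<close>

lemma lagrangian_soliton_of_jets:
  assumes M: "smooth_mfd M" and dim: "mdim M = n"
    and sm: "\<And>c. c \<in> matlas M \<Longrightarrow> smooth_on n (snd c ` fst c) (chart_rep c X)"
    and jet: "\<And>c p. c \<in> matlas M \<Longrightarrow> p \<in> fst c \<Longrightarrow>
      \<exists>h. soliton_jet n \<epsilon> (X p) (\<lambda>i. coord_d c X i p) (\<lambda>i j. coord_d2 c X i j p) h"
  shows "lagrangian_immersion M n X" and "soliton_equation \<epsilon> M n X"
proof -
  have Cn: "X p \<in> Cn n" if pM: "p \<in> mpoints M" for p
  proof -
    obtain c where "c \<in> matlas M" "p \<in> fst c" using mpoints_in_chart[OF M pM] .
    then show ?thesis using jet unfolding soliton_jet_def by blast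
  qed
  have imm: "immersion M n X"
  proof (rule immersion_of_inverse_pair[OF M])
    fix c p assume "c \<in> matlas M" "p \<in> fst c"
    then show "\<exists>h. inverse_pair (mdim M) (\<lambda>i j. cn_inner n (coord_d c X i p) (coord_d c X j p)) h"
      using jet dim unfolding soliton_jet_def by blast
  qed (use sm dim Cn in auto)
  have T: "tangent_image M X p = lin_span n (\<lambda>i. coord_d c X i p)" if "c \<in> matlas M" "p \<in> fst c" for c p
    using tangent_image_chart[OF M that, of X] sm dim range_pushforward[of M c X p] by simp
  show "lagrangian_immersion M n X"
    unfolding lagrangian_immersion_def
  proof (intro conjI imm dim ballI)
    fix p U V assume p: "p \<in> mpoints M" and UV: "U \<in> tangent_image M X p" "V \<in> tangent_image M X p"
    obtain c where c: "c \<in> matlas M" "p \<in> fst c" using mpoints_in_chart[OF M p] .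
    obtain u v where u: "U = (\<lambda>a. \<Sum>i<n. u i *\<^sub>R coord_d c X i p a)" and v: "V = (\<lambda>a. \<Sum>i<n. v i *\<^sub>R coord_d c X i p a)"
      using UV unfolding T[OF c] lin_span_def by blast
    have lag: "cn_inner n (cn_J (coord_d c X i p)) (coord_d c X j p) = 0" if "i < n" "j < n" for i j
      using jet[OF c] that unfolding soliton_jet_def by blast
    have "cn_J U = (\<lambda>a. \<Sum>i<n. u i *\<^sub>R cn_J (coord_d c X i p) a)"
      by (simp add: u cn_J_def sum_distrib_left)
    then show "kaehler_form n U V = 0"
      by (simp add: kaehler_form_def v cn_inner_sum_left cn_inner_sum_right cn_inner_scaleR_left
          cn_inner_scaleR_right lag)
  qed
  show "soliton_equation \<epsilon> M n X"
    unfolding soliton_equation_def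
  proof (intro ballI ext)
    fix c p a assume c: "c \<in> matlas M" "p \<in> fst c"
    define E where "E i = coord_d c X i p" for i
    define D where "D i j = coord_d2 c X i j p" for i j
    obtain h where jh: "soliton_jet n \<epsilon> (X p) E D h"
      using jet[OF c] by (auto simp: E_def[abs_def] D_def[abs_def])
    then have inv: "inverse_pair n (\<lambda>i j. cn_inner n (E i) (E j)) h" and PC: "X p \<in> Cn n"
      and EC: "\<And>i. i < n \<Longrightarrow> E i \<in> Cn n" and DC: "\<And>i j. i < n \<Longrightarrow> j < n \<Longrightarrow> D i j \<in> Cn n"
      unfolding soliton_jet_def by blast+
    obtain \<tau> where \<tau>: "\<And>a. (\<Sum>i<n. \<Sum>j<n. h i j *\<^sub>R D i j a) + \<epsilon> *\<^sub>R X p a = (\<Sum>i<n. \<tau> i *\<^sub>R E i a)"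
      using jh unfolding soliton_jet_def by blast
    note npe = normal_part_eq_normal_proj[OF inv _ EC]
    have "mean_curvature n M c X p a = (\<Sum>i<n. \<Sum>j<n. h i j *\<^sub>R normal_proj n n E h (D i j) a)"
      unfolding mean_curvature_def metric_trace_def second_fundamental_form_def dim T[OF c]
        induced_metric_def E_def[symmetric] D_def[symmetric]
      using inverse_metric_eq[OF inv] npe DC
      by (intro sum.cong refl) (auto simp: induced_metric_def E_def[symmetric] D_def[symmetric])
    also have "\<dots> = normal_proj n n E h (\<lambda>a. \<Sum>i<n. \<Sum>j<n. h i j *\<^sub>R D i j a) a"
      by (simp only: normal_proj_sum2)
    finally have H: "mean_curvature n M c X p a = normal_proj n n E h (\<lambda>a. \<Sum>i<n. \<Sum>j<n. h i j *\<^sub>R D i j a) a" .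
    have "normal_part n (tangent_image M X p) (X p) = normal_proj n n E h (X p)"
      unfolding T[OF c] E_def[symmetric] by (rule npe[OF PC])
    then have "mean_curvature n M c X p a + \<epsilon> *\<^sub>R normal_part n (tangent_image M X p) (X p) a =
        normal_proj n n E h (\<lambda>a. \<Sum>i<n. \<Sum>j<n. h i j *\<^sub>R D i j a) a + normal_proj n n E h (\<lambda>a. \<epsilon> *\<^sub>R X p a) a"
      by (simp add: H normal_proj_scaleR)
    also have "\<dots> = normal_proj n n E h (\<lambda>a. \<Sum>i<n. \<tau> i *\<^sub>R E i a) a"
      by (simp only: normal_proj_add[symmetric] \<tau>)
    also have "\<dots> = 0" using normal_proj_lin_span[OF inv, of \<tau>] by (rule fun_cong)
    finally show "mean_curvature n M c X p a + \<epsilon> *\<^sub>R normal_part n (tangent_image M X p) (X p) a = 0" .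
  qed
qed

section \<open>Iterated Calabi suspension\<close>

lemma powi_minus_cis:
  "(c * cis t) powi (- int k) = c powi (- int k) * cis (- real k * t)"
proof -
  have "(c * cis t) powi (- int k) = c powi (- int k) * inverse (cis t ^ k)"
    by (simp add: power_int_minus power_mult_distrib)
  also have "inverse (cis t ^ k) = cis (- real k * t)"
    by (simp only: Complex.DeMoivre cis_inverse mult_minus_left)
  finally show ?thesis .
qed

text \<open>
  The iterated suspension in the product of the torus chart centred at \<open>c\<close> with a chart whose
  inverse is \<open>g\<close>: the first \<open>m\<close> coordinates are the angles.
\<close>

definition torus_rep :: "nat \<Rightarrow> ('a \<Rightarrow> cvec) \<Rightarrow> ((nat \<Rightarrow> real) \<Rightarrow> 'a) \<Rightarrow> cvec \<Rightarrow> nat \<Rightarrow> (nat \<Rightarrow> real) \<Rightarrow> cvec" where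
  "torus_rep k \<psi> g c m x = iterated_calabi k \<psi> m (torus_param m c x, g (last_coords m x))"

lemma last_coords_drop_coord: "last_coords m (drop_coord m x) = last_coords (Suc m) x"
  by (auto simp: last_coords_def drop_coord_def skip_def)

lemma torus_param_drop_coord: "torus_param m c (drop_coord m x) = torus_param m c x"
  by (auto simp: torus_param_def drop_coord_def skip_def)

text \<open>
  The new angle comes after the old angles and before the coordinates of \<open>N\<close>, so it is inserted at
  index \<open>m\<close>.
\<close>

lemma torus_rep_Suc:
  fixes c :: cvec
  assumes k': "k' = k + m"
  shows "torus_rep k \<psi> g c (Suc m) =
    insert_fun m
      (\<lambda>a t. (if a < k' then of_real (sqrt (real k' / real (k' + 1))) * c m else 0) * cis (1 * t))
      (\<lambda>a t. (if a = k' then of_real (1 / sqrt (real (k' + 1))) * c m powi (- int k') else 0) * cis (- real k' * t))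
      (torus_rep k \<psi> g c m)"
proof (intro ext)
  fix x a
  have "(torus_param (Suc m) c x)(m := 0) = torus_param m c x" "torus_param (Suc m) c x m = c m * cis (x m)"
    by (auto simp: torus_param_def)
  then show "torus_rep k \<psi> g c (Suc m) x a = insert_fun m
      (\<lambda>a t. (if a < k' then of_real (sqrt (real k' / real (k' + 1))) * c m else 0) * cis (1 * t))
      (\<lambda>a t. (if a = k' then of_real (1 / sqrt (real (k' + 1))) * c m powi (- int k') else 0) * cis (- real k' * t))
      (torus_rep k \<psi> g c m) x a"
    by (simp add: torus_rep_def insert_fun_def calabi_suspension_def k' last_coords_drop_coord torus_param_drop_coord
        powi_minus_cis mult.assoc del: of_nat_add)
qed

lemma islimpt_open_interval: "t \<in> {a<..<b :: real} \<Longrightarrow> t islimpt {a<..<b}"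
  by (rule interior_limit_point) simp

lemma torus_range_Suc:
  "prod_range (Suc m) (angle_box (Suc m)) V = insert_dom m {-pi<..<pi} (prod_range m (angle_box m) V)"
proof -
  have "first_coords (Suc m) x \<in> angle_box (Suc m) \<longleftrightarrow> x m \<in> {-pi<..<pi} \<and> first_coords m (drop_coord m x) \<in> angle_box m" for x
    by (auto simp: first_coords_def angle_box_def drop_coord_def skip_def less_Suc_eq)
  then show ?thesis by (auto simp: prod_range_def insert_dom_def last_coords_drop_coord)
qed

text \<open>
  Induction over the suspensions. The jet of each is computed from that of the preceding one at the point where
  the new angle is dropped.
\<close>

lemma torus_rep_jets:
  assumes V: "slice_perfect d V" and F: "smooth_on d V (\<psi> \<circ> g)"
    and jet: "\<And>x. x \<in> V \<Longrightarrow> \<exists>h. legendrian_jet d ((\<psi> \<circ> g) x) (\<lambda>i. partial_d V i (\<psi> \<circ> g) x)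
        (\<lambda>i j. partial_d V i (partial_d V j (\<psi> \<circ> g)) x) h"
    and c: "\<And>i. i < m \<Longrightarrow> cmod (c i) = 1"
  shows "let W = prod_range m (angle_box m) V; G = torus_rep (Suc d) \<psi> g c m in
    slice_perfect (m + d) W \<and> smooth_on (m + d) W G \<and>
    (\<forall>x\<in>W. \<exists>h. legendrian_jet (m + d) (G x) (\<lambda>i. partial_d W i G x)
        (\<lambda>i j. partial_d W i (partial_d W j G) x) h)"
  using c
proof (induction m)
  case 0
  have V0: "prod_range 0 (angle_box 0) V = V"
    by (auto simp: prod_range_def first_coords_def last_coords_def angle_box_def)
  have G0: "torus_rep (Suc d) \<psi> g c 0 = \<psi> \<circ> g"
    by (auto simp: torus_rep_def last_coords_def fun_eq_iff)
  show ?case unfolding Let_def V0 G0 add_0 using V F jet by blast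
next
  case (Suc m)
  define S where "S = {-pi<..<pi}"
  define W where "W = prod_range m (angle_box m) V"
  define G where "G = torus_rep (Suc d) \<psi> g c m"
  have "cmod (c i) = 1" if "i < m" for i using Suc.prems that by simp
  from Suc.IH[OF this, unfolded Let_def, folded W_def G_def]
  have W: "slice_perfect (m + d) W" and G: "smooth_on (m + d) W G"
    and IH: "\<And>x. x \<in> W \<Longrightarrow> \<exists>h. legendrian_jet (m + d) (G x) (\<lambda>i. partial_d W i G x)
        (\<lambda>i j. partial_d W i (partial_d W j G) x) h" by blast+
  define k where "k = Suc (m + d)"
  define s where "s = sqrt (real k / real (k + 1))"
  define b where "b = 1 / sqrt (real (k + 1))"
  define CA where "CA a = (if a < k then of_real s * c m else 0)" for a
  define CB where "CB a = (if a = k then of_real b * c m powi (- int k) else 0)" for a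
  define A where "A a t = CA a * cis (1 * t)" for a t
  define B where "B a t = CB a * cis (- real k * t)" for a t
  define A1 where "A1 a t = (CA a * (\<i> * of_real 1)) * cis (1 * t)" for a t
  define B1 where "B1 a t = (CB a * (\<i> * of_real (- real k))) * cis (- real k * t)" for a t
  define A2 where "A2 a t = ((CA a * (\<i> * of_real 1)) * (\<i> * of_real 1)) * cis (1 * t)" for a t
  define B2 where "B2 a t = ((CB a * (\<i> * of_real (- real k))) * (\<i> * of_real (- real k))) * cis (- real k * t)" for a t
  have dA: "\<forall>t\<in>S. (A a has_vector_derivative A1 a t) (at t within S)" for a
    unfolding A_def[abs_def] A1_def by (intro ballI has_vector_derivative_exponential)
  have dB: "\<forall>t\<in>S. (B a has_vector_derivative B1 a t) (at t within S)" for a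
    unfolding B_def[abs_def] B1_def by (intro ballI has_vector_derivative_exponential)
  have dA1: "\<forall>t\<in>S. (A1 a has_vector_derivative A2 a t) (at t within S)" for a
    unfolding A1_def[abs_def] A2_def by (intro ballI has_vector_derivative_exponential)
  have dB1: "\<forall>t\<in>S. (B1 a has_vector_derivative B2 a t) (at t within S)" for a
    unfolding B1_def[abs_def] B2_def by (intro ballI has_vector_derivative_exponential)
  have smA: "smooth_curve S (A a)" for a unfolding A_def[abs_def] by (rule smooth_curve_exponential)
  have smB: "smooth_curve S (B a)" for a unfolding B_def[abs_def] by (rule smooth_curve_exponential)
  have S: "\<forall>t\<in>S. t islimpt S" using islimpt_open_interval by (simp add: S_def)
  have md: "m \<le> m + d" by simp
  define W' where "W' = insert_dom m S W"
  define G' where "G' = insert_fun m A B G"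
  have W'eq: "prod_range (Suc m) (angle_box (Suc m)) V = W'"
    unfolding W'_def W_def S_def by (rule torus_range_Suc)
  have G'eq: "torus_rep (Suc d) \<psi> g c (Suc m) = G'"
    unfolding G'_def G_def A_def[abs_def] B_def[abs_def] CA_def CB_def s_def b_def
    by (rule torus_rep_Suc) (simp add: k_def)
  have fat': "slice_perfect (Suc (m + d)) W'" unfolding W'_def by (rule slice_perfect_insert_dom[OF W S md])
  have sm': "smooth_on (Suc (m + d)) W' G'"
    unfolding W'_def G'_def by (rule smooth_on_insert_fun[OF W S md smA smB G])
  have "\<exists>h. legendrian_jet (Suc (m + d)) (G' x) (\<lambda>i. partial_d W' i G' x)
        (\<lambda>i j. partial_d W' i (partial_d W' j G') x) h" if x: "x \<in> W'" for x
  proof -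
    define y where "y = drop_coord m x"
    have y: "y \<in> W" using x by (simp add: W'_def insert_dom_def y_def)
    have xi: "x \<in> insert_dom m S W" using x by (simp add: W'_def)
    obtain h where h: "legendrian_jet (m + d) (G y) (\<lambda>i. partial_d W i G y)
        (\<lambda>i j. partial_d W i (partial_d W j G) y) h" using IH[OF y] by blast
    define u where "u = c m * cis (x m)"
    define w where "w = c m powi (- int k) * cis (- real k * x m)"
    have u: "cmod u = 1" using Suc.prems[of m] by (simp add: u_def norm_mult)
    have w: "cmod w = 1" using Suc.prems[of m] by (simp add: w_def norm_mult norm_power_int)
    note d1 = partial_d_insert_fun[where A = A and A' = A1 and B = B and B' = B1, OF W S md dA dB G xi, folded W'_def G'_def]
    note d2 = partial_d2_insert_fun[where A = A and A' = A1 and A'' = A2 and B = B and B' = B1 and B'' = B2,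
        OF W S md dA dA1 dB dB1 G xi, folded W'_def G'_def]
    have vals: "A a (x m) = (if a < k then of_real s * u else 0)"
      "B a (x m) = (if a = k then of_real b * w else 0)"
      "A1 a (x m) = (if a < k then \<i> * of_real s * u else 0)"
      "B1 a (x m) = (if a = k then - (\<i> * of_real (real k * b) * w) else 0)"
      "A2 a (x m) = (if a < k then - (of_real s * u) else 0)"
      "B2 a (x m) = (if a = k then - (of_real ((real k)\<^sup>2 * b) * w) else 0)" for a
      by (simp_all add: A_def B_def A1_def B1_def A2_def B2_def CA_def CB_def u_def w_def power2_eq_square mult_ac)
    have "legendrian_jet (Suc (m + d)) (G' x) (\<lambda>i. partial_d W' i G' x)
        (\<lambda>i j. partial_d W' i (partial_d W' j G') x) (block_inverse m (real k) (s\<^sup>2) h)"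
    proof (rule legendrian_jet_calabi[OF h md k_def u w s_def b_def])
      show "G' x = (\<lambda>a. if a < k then of_real s * u * G y a else if a = k then of_real b * w else 0)"
        by (auto simp: G'_def insert_fun_def vals y_def)
      show "partial_d W' m G' x = (\<lambda>a. if a < k then \<i> * of_real s * u * G y a
          else if a = k then - (\<i> * of_real (real k * b) * w) else 0)"
        unfolding d1(1) by (auto simp: insert_fun_def vals y_def)
      show "partial_d W' m (partial_d W' m G') x = (\<lambda>a. if a < k then - (of_real s * u * G y a)
          else if a = k then - (of_real ((real k)\<^sup>2 * b) * w) else 0)"
        unfolding d2(1) by (auto simp: insert_fun_def vals y_def)
      fix i assume i: "i < m + d"
      show "partial_d W' (skip m i) G' x = (\<lambda>a. if a < k then of_real s * u * partial_d W i G y a else 0)"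
        unfolding d1(2)[OF i] by (auto simp: insert_fun_def vals y_def)
      show "partial_d W' m (partial_d W' (skip m i) G') x =
          (\<lambda>a. if a < k then \<i> * of_real s * u * partial_d W i G y a else 0)"
        unfolding d2(3)[OF i] by (auto simp: insert_fun_def vals y_def)
      show "partial_d W' (skip m i) (partial_d W' m G') x =
          (\<lambda>a. if a < k then \<i> * of_real s * u * partial_d W i G y a else 0)"
        unfolding d2(2)[OF i] by (auto simp: insert_fun_def vals y_def)
      fix j assume j: "j < m + d"
      show "partial_d W' (skip m i) (partial_d W' (skip m j) G') x =
          (\<lambda>a. if a < k then of_real s * u * partial_d W i (partial_d W j G) y a else 0)"
        unfolding d2(4)[OF i j] by (auto simp: insert_fun_def vals y_def)
    qed
    then show ?thesis by blast
  qed
  then show ?case unfolding Let_def W'eq G'eq using fat' sm' by simp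
qed

lemma partial_d2_cong:
  assumes "\<And>y. y \<in> V \<Longrightarrow> f y = g y" "x \<in> V"
  shows "partial_d V i (partial_d V j f) x = partial_d V i (partial_d V j g) x"
proof (rule partial_d_cong[OF _ assms(2)])
  fix y assume "y \<in> V"
  then show "partial_d V j f y = partial_d V j g y" by (intro partial_d_cong[OF assms(1)])
qed

lemma coord_d_eq:
  assumes "\<And>y. y \<in> \<phi> ` U \<Longrightarrow> chart_rep (U, \<phi>) X y = F y" "p \<in> U"
  shows "coord_d (U, \<phi>) X i p = partial_d (\<phi> ` U) i F (\<phi> p)"
    and "coord_d2 (U, \<phi>) X i j p = partial_d (\<phi> ` U) i (partial_d (\<phi> ` U) j F) (\<phi> p)"
proof -
  have p: "\<phi> p \<in> \<phi> ` U" using assms(2) by blast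
  show "coord_d (U, \<phi>) X i p = partial_d (\<phi> ` U) i F (\<phi> p)"
    unfolding coord_d_def fst_conv snd_conv by (rule partial_d_cong[OF assms(1) p])
  show "coord_d2 (U, \<phi>) X i j p = partial_d (\<phi> ` U) i (partial_d (\<phi> ` U) j F) (\<phi> p)"
    unfolding coord_d2_def fst_conv snd_conv by (rule partial_d2_cong[OF assms(1) p])
qed

text \<open>
  If a half-space chart does not meet the boundary hyperplane, its range is open in the whole space.
\<close>

lemma closed_mfd_open_charts:
  assumes N: "closed_mfd N"
  shows "open_charts N"
  unfolding open_charts_def
proof clarify
  have N': "smooth_mfd N" using N by (simp add: closed_mfd_def compact_mfd_def)
  fix U \<phi> assume c: "(U, \<phi>) \<in> matlas N"
  show "openin (Euclidean_space (mdim N)) (\<phi> ` U)"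
  proof (rule ccontr)
    assume no: "\<not> openin (Euclidean_space (mdim N)) (\<phi> ` U)"
    then have half: "openin (half_space (mdim N)) (\<phi> ` U)"
      using smooth_mfd_chartD(2)[OF N' c] by (simp add: chart_range_def)
    then obtain W where W: "openin (Euclidean_space (mdim N)) W" "\<phi> ` U = W \<inter> {x. 0 \<le> x 0}"
      using openin_half_space_iff by blast
    have nz: "\<phi> p 0 \<noteq> 0" if "p \<in> U" for p
      using N c no that unfolding closed_mfd_def mboundary_def by blast
    have "\<phi> ` U = W \<inter> {x. 0 < x 0}"
    proof (intro equalityI subsetI)
      fix x assume x: "x \<in> \<phi> ` U"
      then have "x \<in> W" "0 \<le> x 0" using W(2) by auto
      moreover have "x 0 \<noteq> 0" using x nz by auto
      ultimately show "x \<in> W \<inter> {x. 0 < x 0}" by simp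
    next
      fix x assume "x \<in> W \<inter> {x. 0 < x 0}"
      then show "x \<in> \<phi> ` U" unfolding W(2) by simp
    qed
    moreover have "open {x :: nat \<Rightarrow> real. 0 < x 0}"
      using open_vimage[OF open_greaterThan[of 0] continuous_on_product_coordinates[of 0]]
      by (simp add: vimage_def)
    ultimately have "openin (Euclidean_space (mdim N)) (\<phi> ` U)"
      using W(1) unfolding Euclidean_space_top_of_set by (simp only: openin_Int_open)
    then show False using no by blast
  qed
qed

text \<open>
  The jets are part of the conclusion because the profile immersion is built on them.
\<close>

theorem iterated_calabi_legendrian:
  assumes N: "closed_mfd N" and dim: "mdim N = d"
    and leg: "legendrian_immersion N (Suc d) \<psi>" and min: "minimal_in_sphere N (Suc d) \<psi>"
  defines "K \<equiv> \<lambda>m. prod_mfd (torus_mfd m) N"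
  shows "smooth_mfd (K m)" and "open_charts (K m)"
    and "\<And>c p. c \<in> matlas (K m) \<Longrightarrow> p \<in> fst c \<Longrightarrow> \<exists>h. legendrian_jet (m + d) (iterated_calabi (Suc d) \<psi> m p)
        (\<lambda>i. coord_d c (iterated_calabi (Suc d) \<psi> m) i p)
        (\<lambda>i j. coord_d2 c (iterated_calabi (Suc d) \<psi> m) i j p) h"
    and "legendrian_immersion (K m) (Suc (m + d)) (iterated_calabi (Suc d) \<psi> m)"
    and "minimal_in_sphere (K m) (Suc (m + d)) (iterated_calabi (Suc d) \<psi> m)"
proof -
  have N': "smooth_mfd N" using N by (simp add: closed_mfd_def compact_mfd_def)
  have oN: "open_charts N" by (rule closed_mfd_open_charts[OF N])
  show sK: "smooth_mfd (K m)"
    unfolding K_def by (rule smooth_mfd_prod[OF smooth_mfd_torus N' oN]) (simp add: open_charts_torus)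
  show "open_charts (K m)"
    unfolding K_def by (rule open_charts_prod[OF smooth_mfd_torus open_charts_torus oN])
  let ?\<Psi> = "iterated_calabi (Suc d) \<psi> m"
  have dK: "mdim (K m) = m + d" by (simp add: K_def prod_mfd_simps torus_mfd_simps dim)
  have main: "smooth_on (m + d) (snd c ` fst c) (chart_rep c ?\<Psi>) \<and>
      (\<forall>p\<in>fst c. \<exists>h. legendrian_jet (m + d) (?\<Psi> p) (\<lambda>i. coord_d c ?\<Psi> i p) (\<lambda>i j. coord_d2 c ?\<Psi> i j p) h)"
    if cK: "c \<in> matlas (K m)" for c
  proof -
    from cK[unfolded K_def] obtain U' \<theta> U \<phi> where cc: "c = (U' \<times> U, prod_coords (mdim (torus_mfd m)) \<theta> \<phi>)"
      "(U', \<theta>) \<in> matlas (torus_mfd m)" "(U, \<phi>) \<in> matlas N" by (rule prod_mfd_chartE)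
    obtain e where e: "e \<in> torus_set m" "U' = torus_dom m e" "\<theta> = torus_chart m e"
      using cc(2) by (auto simp: torus_mfd_simps)
    have ceq: "c = (torus_dom m e \<times> U, prod_coords m (torus_chart m e) \<phi>)"
      using cc(1) by (simp add: e torus_mfd_simps)
    note C = smooth_mfd_chartD[OF N' cc(3)]
    let ?V = "\<phi> ` U" and ?g = "inv_into U \<phi>"
    let ?W = "prod_range m (angle_box m) ?V" and ?G = "torus_rep (Suc d) \<psi> ?g e m"
    have rep0: "chart_rep (U, \<phi>) \<psi> = \<psi> \<circ> ?g" by (simp add: chart_rep_def)
    have jets0: "\<exists>h. legendrian_jet d ((\<psi> \<circ> ?g) x) (\<lambda>i. partial_d ?V i (\<psi> \<circ> ?g) x)
        (\<lambda>i j. partial_d ?V i (partial_d ?V j (\<psi> \<circ> ?g)) x) h" if x: "x \<in> ?V" for x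
    proof -
      have p: "?g x \<in> U" "\<phi> (?g x) = x" using x by (auto simp: inv_into_into f_inv_into_f)
      show ?thesis
        using legendrian_jet_of_immersion[OF N' oN dim leg min cc(3), of "?g x"] p
          coord_d_eq[of \<phi> U \<psi> "\<psi> \<circ> ?g" "?g x"] rep0 by simp
    qed
    have F: "smooth_on d ?V (\<psi> \<circ> ?g)"
      using leg cc(3) dim unfolding legendrian_immersion_def immersion_def by (auto simp: rep0[symmetric])
    have fatV: "slice_perfect d ?V" using chart_range_slice_perfect[OF C(2)] by (simp add: dim)
    have main0: "slice_perfect (m + d) ?W \<and> smooth_on (m + d) ?W ?G \<and>
      (\<forall>x\<in>?W. \<exists>h. legendrian_jet (m + d) (?G x) (\<lambda>i. partial_d ?W i ?G x)
          (\<lambda>i j. partial_d ?W i (partial_d ?W j ?G) x) h)"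
      by (rule torus_rep_jets[of d ?V \<psi> ?g m e, unfolded Let_def, OF fatV F jets0 torus_setD(1)[OF e(1)]])
    have tb: "torus_chart m e ` torus_dom m e = angle_box m" by (rule torus_chart_range[OF e(1)])
    have tb0: "torus_chart m e ` torus_dom m e \<subseteq> {x. \<forall>i\<ge>m. x i = 0}"
      unfolding tb by (auto simp: angle_box_def)
    have img: "prod_coords m (torus_chart m e) \<phi> ` (torus_dom m e \<times> U) = ?W"
      using prod_coords_image[OF tb0] by (simp add: tb)
    have rep: "chart_rep c ?\<Psi> x = ?G x" if x: "x \<in> ?W" for x
    proof -
      have "first_coords m x \<in> angle_box m" using x by (simp add: prod_range_def)
      moreover have "torus_param m e (first_coords m x) = torus_param m e x" by (auto simp: torus_param_def first_coords_def)
      ultimately show ?thesis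
        using inv_into_prod_coords[OF tb0 inj_on_torus_chart[OF e(1)] C(3), of x] x
        by (simp add: chart_rep_def ceq torus_rep_def tb inv_into_torus_chart[OF e(1)])
    qed
    have "smooth_on (m + d) (snd c ` fst c) (chart_rep c ?\<Psi>)"
      using smooth_on_cong[of ?W ?G "chart_rep c ?\<Psi>" "m + d"] rep main0 by (simp add: ceq img)
    moreover have "\<exists>h. legendrian_jet (m + d) (?\<Psi> p) (\<lambda>i. coord_d c ?\<Psi> i p) (\<lambda>i j. coord_d2 c ?\<Psi> i j p) h"
      if p: "p \<in> fst c" for p
    proof -
      have pU: "p \<in> torus_dom m e \<times> U" using p by (simp add: ceq)
      define x where "x = prod_coords m (torus_chart m e) \<phi> p"
      have x: "x \<in> ?W" using pU img by (auto simp: x_def)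
      have "inv_into (torus_dom m e \<times> U) (prod_coords m (torus_chart m e) \<phi>) x = p"
        unfolding x_def by (rule inv_into_f_f[OF inj_on_prod_coords[OF tb0 inj_on_torus_chart[OF e(1)] C(3)] pU])
      then have "?\<Psi> p = ?G x" using rep[OF x] by (simp add: chart_rep_def ceq)
      moreover have "coord_d c ?\<Psi> i p = partial_d ?W i ?G x"
        "coord_d2 c ?\<Psi> i j p = partial_d ?W i (partial_d ?W j ?G) x" for i j
        using coord_d_eq[of "prod_coords m (torus_chart m e) \<phi>" "torus_dom m e \<times> U" ?\<Psi> ?G p] rep pU
        by (simp_all add: ceq img x_def)
      ultimately show ?thesis using main0 x by simp
    qed
    ultimately show ?thesis by blast
  qed
  show jets: "\<exists>h. legendrian_jet (m + d) (?\<Psi> p) (\<lambda>i. coord_d c ?\<Psi> i p) (\<lambda>i j. coord_d2 c ?\<Psi> i j p) h"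
    if "c \<in> matlas (K m)" "p \<in> fst c" for c p using main that by blast
  have smc: "\<And>c. c \<in> matlas (K m) \<Longrightarrow> smooth_on (m + d) (snd c ` fst c) (chart_rep c ?\<Psi>)" using main by blast
  show "legendrian_immersion (K m) (Suc (m + d)) ?\<Psi>" "minimal_in_sphere (K m) (Suc (m + d)) ?\<Psi>"
    using legendrian_minimal_of_jets[OF sK dK smc jets] by blast+
qed

section \<open>Anciaux profiles\<close>

text \<open>
  The generators are chosen such that the derivative of each is a polynomial in the generators, by the equations
  of the profile.
\<close>

inductive_set profile_algebra :: "(real \<Rightarrow> complex) \<Rightarrow> (real \<Rightarrow> real) \<Rightarrow> (real \<Rightarrow> real) \<Rightarrow> (real \<Rightarrow> complex) set"
  for \<gamma> r \<Theta> where
  gen_gamma: "\<gamma> \<in> profile_algebra \<gamma> r \<Theta>"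
| gen_r: "(\<lambda>s. of_real (r s)) \<in> profile_algebra \<gamma> r \<Theta>"
| gen_inv_r: "(\<lambda>s. of_real (1 / r s)) \<in> profile_algebra \<gamma> r \<Theta>"
| gen_cos: "(\<lambda>s. of_real (cos (\<Theta> s))) \<in> profile_algebra \<gamma> r \<Theta>"
| gen_sin: "(\<lambda>s. of_real (sin (\<Theta> s))) \<in> profile_algebra \<gamma> r \<Theta>"
| gen_const: "(\<lambda>s. c) \<in> profile_algebra \<gamma> r \<Theta>"
| gen_add: "f \<in> profile_algebra \<gamma> r \<Theta> \<Longrightarrow> g \<in> profile_algebra \<gamma> r \<Theta> \<Longrightarrow> (\<lambda>s. f s + g s) \<in> profile_algebra \<gamma> r \<Theta>"
| gen_mult: "f \<in> profile_algebra \<gamma> r \<Theta> \<Longrightarrow> g \<in> profile_algebra \<gamma> r \<Theta> \<Longrightarrow> (\<lambda>s. f s * g s) \<in> profile_algebra \<gamma> r \<Theta>"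

lemma smooth_curve_profile_algebra:
  fixes \<gamma> :: "real \<Rightarrow> complex" and r \<Theta> :: "real \<Rightarrow> real"
  assumes r0: "\<And>s. s \<in> S \<Longrightarrow> r s > 0"
    and d\<gamma>: "\<And>s. s \<in> S \<Longrightarrow> (\<gamma> has_vector_derivative \<gamma> s * (of_real (cos (\<Theta> s)) + \<i> * of_real (sin (\<Theta> s))) * of_real (1 / r s)) (at s within S)"
    and dr: "\<And>s. s \<in> S \<Longrightarrow> (r has_real_derivative cos (\<Theta> s)) (at s within S)"
    and d\<Theta>: "\<And>s. s \<in> S \<Longrightarrow> (\<Theta> has_real_derivative (\<epsilon> * r s - real n / r s) * sin (\<Theta> s)) (at s within S)"
    and u: "u \<in> profile_algebra \<gamma> r \<Theta>"
  shows "smooth_curve S u"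
proof -
  let ?A = "profile_algebra \<gamma> r \<Theta>"
  note intros = profile_algebra.intros
  have "\<exists>f'\<in>?A. \<forall>t\<in>S. (f has_vector_derivative f' t) (at t within S)" if "f \<in> ?A" for f
    using that
  proof induction
    case gen_gamma
    show ?case
      by (intro bexI[of _ "\<lambda>s. \<gamma> s * (of_real (cos (\<Theta> s)) + \<i> * of_real (sin (\<Theta> s))) * of_real (1 / r s)"] ballI d\<gamma> intros)
  next
    case gen_r
    show ?case
      by (intro bexI[of _ "\<lambda>s. of_real (cos (\<Theta> s))"] ballI has_vector_derivative_of_real dr intros)
  next
    case gen_inv_r
    have d: "((\<lambda>s. 1 / r s) has_real_derivative - cos (\<Theta> s) * (1 / r s) * (1 / r s)) (at s within S)" if "s \<in> S" for s
      using dr[OF that] r0[OF that] by (auto intro!: derivative_eq_intros simp: field_simps power2_eq_square)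
    have "((\<lambda>s. of_real (1 / r s) :: complex) has_vector_derivative
        (-1) * of_real (cos (\<Theta> s)) * of_real (1 / r s) * of_real (1 / r s)) (at s within S)" if "s \<in> S" for s
      by (rule has_vector_derivative_eq_rhs[OF has_vector_derivative_of_real[OF d[OF that]]]) simp
    then show ?case
      by (intro bexI[of _ "\<lambda>s. (-1) * of_real (cos (\<Theta> s)) * of_real (1 / r s) * of_real (1 / r s)"] ballI intros)
  next
    case gen_cos
    have d: "((\<lambda>s. cos (\<Theta> s)) has_real_derivative - sin (\<Theta> s) * ((\<epsilon> * r s - real n * (1 / r s)) * sin (\<Theta> s))) (at s within S)"
      if "s \<in> S" for s using d\<Theta>[OF that] by (auto intro!: derivative_eq_intros)
    have "((\<lambda>s. of_real (cos (\<Theta> s)) :: complex) has_vector_derivative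
        (-1) * of_real (sin (\<Theta> s)) * ((of_real \<epsilon> * of_real (r s) + (- of_nat n) * of_real (1 / r s)) * of_real (sin (\<Theta> s)))) (at s within S)"
      if "s \<in> S" for s
      by (rule has_vector_derivative_eq_rhs[OF has_vector_derivative_of_real[OF d[OF that]]]) simp
    then show ?case
      by (intro bexI[of _ "\<lambda>s. (-1) * of_real (sin (\<Theta> s)) * ((of_real \<epsilon> * of_real (r s) + (- of_nat n) * of_real (1 / r s)) * of_real (sin (\<Theta> s)))"] ballI intros)
  next
    case gen_sin
    have d: "((\<lambda>s. sin (\<Theta> s)) has_real_derivative cos (\<Theta> s) * ((\<epsilon> * r s - real n * (1 / r s)) * sin (\<Theta> s))) (at s within S)"
      if "s \<in> S" for s using d\<Theta>[OF that] by (auto intro!: derivative_eq_intros)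
    have "((\<lambda>s. of_real (sin (\<Theta> s)) :: complex) has_vector_derivative
        of_real (cos (\<Theta> s)) * ((of_real \<epsilon> * of_real (r s) + (- of_nat n) * of_real (1 / r s)) * of_real (sin (\<Theta> s)))) (at s within S)"
      if "s \<in> S" for s
      by (rule has_vector_derivative_eq_rhs[OF has_vector_derivative_of_real[OF d[OF that]]]) simp
    then show ?case
      by (intro bexI[of _ "\<lambda>s. of_real (cos (\<Theta> s)) * ((of_real \<epsilon> * of_real (r s) + (- of_nat n) * of_real (1 / r s)) * of_real (sin (\<Theta> s)))"] ballI intros)
  next
    case (gen_const c)
    show ?case by (intro bexI[of _ "\<lambda>s. 0"] ballI has_vector_derivative_const intros)
  next
    case (gen_add f g)
    obtain f' g' where "f' \<in> ?A" "\<forall>t\<in>S. (f has_vector_derivative f' t) (at t within S)"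
      "g' \<in> ?A" "\<forall>t\<in>S. (g has_vector_derivative g' t) (at t within S)" using gen_add.IH by blast
    then show ?case
      by (intro bexI[of _ "\<lambda>s. f' s + g' s"] ballI has_vector_derivative_add intros) auto
  next
    case (gen_mult f g)
    obtain f' g' where "f' \<in> ?A" "\<forall>t\<in>S. (f has_vector_derivative f' t) (at t within S)"
      "g' \<in> ?A" "\<forall>t\<in>S. (g has_vector_derivative g' t) (at t within S)" using gen_mult.IH by blast
    then show ?case using gen_mult.hyps
      by (intro bexI[of _ "\<lambda>s. f s * g' s + f' s * g s"] ballI has_vector_derivative_mult intros) auto
  qed
  then show ?thesis using u unfolding smooth_curve_def by (intro exI[of _ ?A]) blast
qed

text \<open>
  \<open>\<gamma>1\<close> and \<open>\<gamma>2\<close> are velocity and acceleration. The last condition says that the component of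
  \<open>\<gamma>2 - (n - 1) \<gamma> / |\<gamma>|\<^sup>2 + \<epsilon> \<gamma>\<close> orthogonal to \<open>\<gamma>1\<close> vanishes.
\<close>

definition regular_profile :: "nat \<Rightarrow> real \<Rightarrow> real \<Rightarrow> (real \<Rightarrow> complex) \<Rightarrow> (real \<Rightarrow> complex) \<Rightarrow> (real \<Rightarrow> complex) \<Rightarrow> bool" where
  "regular_profile n \<epsilon> L \<gamma> \<gamma>1 \<gamma>2 \<longleftrightarrow> smooth_curve {0..L} \<gamma> \<and>
     (\<forall>s\<in>{0..L}. (\<gamma> has_vector_derivative \<gamma>1 s) (at s within {0..L}) \<and>
        (\<gamma>1 has_vector_derivative \<gamma>2 s) (at s within {0..L}) \<and> \<gamma> s \<noteq> 0 \<and> cmod (\<gamma>1 s) = 1 \<and>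
        (\<exists>\<kappa>. \<gamma>2 s - of_real ((real n - 1) / (cmod (\<gamma> s))\<^sup>2) * \<gamma> s + of_real \<epsilon> * \<gamma> s = of_real \<kappa> * \<gamma>1 s))"

text \<open>
  Differentiating \<open>\<gamma>' = e\<^bsup>i\<alpha>\<^esup>\<close> with \<open>\<alpha>' = \<Theta>' + sin \<Theta> / r = p sin \<Theta>\<close>, where
  \<open>p = \<epsilon> r - (n - 1)/r\<close>, gives \<open>\<gamma>'' = i p sin \<Theta> \<gamma>'\<close>. Because \<open>\<gamma> = r e\<^bsup>-i\<Theta>\<^esup> \<gamma>'\<close>, the remaining
  terms are \<open>p e\<^bsup>-i\<Theta>\<^esup> \<gamma>'\<close>, and the sum is the real multiple \<open>p cos \<Theta>\<close> of \<open>\<gamma>'\<close>. At the ends the first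
  integral determines \<open>sin \<Theta>\<close>, which is less than \<open>1\<close>, so that \<open>cos \<Theta>\<close> does not vanish; its sign is that of
  \<open>r'\<close>, and \<open>r\<close> has its maximum at both ends.
\<close>

theorem anciaux_profile_regular:
  assumes prof: "anciaux_profile n \<epsilon> L \<gamma> E" and L: "0 < L" and E: "0 < E" "E < exp (- \<epsilon> / 2)"
  obtains \<gamma>1 \<gamma>2 \<Theta>0 \<Theta>1 where "regular_profile n \<epsilon> L \<gamma> \<gamma>1 \<gamma>2"
    "\<And>s. s \<in> {0<..<L} \<Longrightarrow> cmod (\<gamma> s) < 1" "cmod (\<gamma> 0) = 1" "cmod (\<gamma> L) = 1"
    "\<gamma>1 0 = \<gamma> 0 * cis \<Theta>0" "\<gamma>1 L = \<gamma> L * cis \<Theta>1"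
    "cos \<Theta>0 < 0" "0 < cos \<Theta>1" "sin \<Theta>0 = sin \<Theta>1"
proof -
  obtain r \<phi> \<alpha> :: "real \<Rightarrow> real" where
    P: "\<And>s. s \<in> {0..L} \<Longrightarrow> 0 < r s \<and> \<gamma> s = complex_of_real (r s) * cis (\<phi> s) \<and>
           (\<gamma> has_vector_derivative cis (\<alpha> s)) (at s within {0..L}) \<and>
           (r has_real_derivative cos (\<alpha> s - \<phi> s)) (at s within {0..L}) \<and>
           ((\<lambda>s. \<alpha> s - \<phi> s) has_real_derivative
              (\<epsilon> * r s - real n / r s) * sin (\<alpha> s - \<phi> s)) (at s within {0..L}) \<and>
           r s ^ n * exp (- \<epsilon> * (r s)\<^sup>2 / 2) * sin (\<alpha> s - \<phi> s) = E"
    and ends: "r 0 = 1" "r L = 1" and inner: "\<And>s. s \<in> {0<..<L} \<Longrightarrow> r s < 1"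
    using prof unfolding anciaux_profile_def by blast
  define \<Theta> where "\<Theta> s = \<alpha> s - \<phi> s" for s
  let ?S = "{0..L}"
  have r0: "0 < r s" and \<gamma>s: "\<gamma> s = complex_of_real (r s) * cis (\<phi> s)"
    and dr: "(r has_real_derivative cos (\<Theta> s)) (at s within ?S)"
    and d\<Theta>: "(\<Theta> has_real_derivative (\<epsilon> * r s - real n / r s) * sin (\<Theta> s)) (at s within ?S)"
    and Es: "r s ^ n * exp (- \<epsilon> * (r s)\<^sup>2 / 2) * sin (\<Theta> s) = E"
    and d\<gamma>0: "(\<gamma> has_vector_derivative cis (\<alpha> s)) (at s within ?S)" if "s \<in> ?S" for s
    using P[OF that] by (simp_all add: \<Theta>_def[abs_def])
  have cm: "cmod (\<gamma> s) = r s" if "s \<in> ?S" for s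
    using \<gamma>s[OF that] r0[OF that] by (simp add: norm_mult)
  define C where "C s = (of_real (cos (\<Theta> s)) + \<i> * of_real (sin (\<Theta> s)) :: complex)" for s
  have Ccis: "C s = cis (\<Theta> s)" for s by (simp add: C_def complex_eq_iff)
  (* equal to cis (\<alpha> s), but written in the generators of the algebra *)
  define \<gamma>1 where "\<gamma>1 s = \<gamma> s * C s * of_real (1 / r s)" for s
  have \<gamma>1: "\<gamma>1 s = cis (\<alpha> s)" if "s \<in> ?S" for s
  proof -
    have "cis (\<phi> s) * cis (\<Theta> s) = cis (\<alpha> s)" by (simp add: cis_mult \<Theta>_def)
    then show ?thesis using r0[OF that] by (simp add: \<gamma>1_def \<gamma>s[OF that] Ccis)
  qed
  have d\<gamma>: "(\<gamma> has_vector_derivative \<gamma>1 s) (at s within ?S)" if "s \<in> ?S" for s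
    using d\<gamma>0[OF that] \<gamma>1[OF that] by simp
  define \<gamma>2 where "\<gamma>2 s = \<gamma>1 s * (\<i> * of_real ((\<epsilon> * r s - (real n - 1) / r s) * sin (\<Theta> s)))" for s
  have d\<gamma>1: "(\<gamma>1 has_vector_derivative \<gamma>2 s) (at s within ?S)" if s: "s \<in> ?S" for s
  proof -
    define q where "q = (\<epsilon> * r s - real n / r s) * sin (\<Theta> s)"
    have "((\<lambda>s. cos (\<Theta> s)) has_real_derivative - sin (\<Theta> s) * q) (at s within ?S)"
      "((\<lambda>s. sin (\<Theta> s)) has_real_derivative cos (\<Theta> s) * q) (at s within ?S)"
      unfolding q_def using d\<Theta>[OF s] by (auto intro!: derivative_eq_intros)
    then have "((\<lambda>s. of_real (cos (\<Theta> s)) + \<i> * of_real (sin (\<Theta> s))) has_vector_derivative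
        of_real (- sin (\<Theta> s) * q) + \<i> * of_real (cos (\<Theta> s) * q)) (at s within ?S)"
      by (intro has_vector_derivative_add has_vector_derivative_mult_right has_vector_derivative_of_real)
    then have "((\<lambda>s. of_real (cos (\<Theta> s)) + \<i> * of_real (sin (\<Theta> s))) has_vector_derivative
        \<i> * of_real q * C s) (at s within ?S)"
      by (rule has_vector_derivative_eq_rhs) (simp add: C_def complex_eq_iff)
    then have dC: "(C has_vector_derivative \<i> * of_real q * C s) (at s within ?S)"
      by (simp add: C_def[abs_def])
    have "((\<lambda>s. 1 / r s) has_real_derivative - cos (\<Theta> s) * (1 / r s) * (1 / r s)) (at s within ?S)"
      using dr[OF s] r0[OF s] by (auto intro!: derivative_eq_intros simp: field_simps power2_eq_square)
    then have dI: "((\<lambda>s. of_real (1 / r s) :: complex) has_vector_derivative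
        of_real (- cos (\<Theta> s) * (1 / r s) * (1 / r s))) (at s within ?S)"
      by (rule has_vector_derivative_of_real)
    have "(\<gamma>1 has_vector_derivative
        (\<gamma> s * C s) * of_real (- cos (\<Theta> s) * (1 / r s) * (1 / r s)) +
        (\<gamma> s * (\<i> * of_real q * C s) + \<gamma>1 s * C s) * of_real (1 / r s)) (at s within ?S)"
      unfolding \<gamma>1_def[abs_def]
      by (intro has_vector_derivative_mult dC dI d\<gamma>[OF s, unfolded \<gamma>1_def])
    moreover have "(\<gamma> s * C s) * of_real (- cos (\<Theta> s) * (1 / r s) * (1 / r s)) +
        (\<gamma> s * (\<i> * of_real q * C s) + \<gamma>1 s * C s) * of_real (1 / r s) = \<gamma>2 s"
    proof -
      have "(\<gamma> s * C s) * of_real (- cos (\<Theta> s) * (1 / r s) * (1 / r s)) +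
        (\<gamma> s * (\<i> * of_real q * C s) + \<gamma>1 s * C s) * of_real (1 / r s) =
        \<gamma>1 s * (- of_real (cos (\<Theta> s) * (1 / r s)) + \<i> * of_real q + C s * of_real (1 / r s))"
        by (simp add: \<gamma>1_def algebra_simps)
      also have "- of_real (cos (\<Theta> s) * (1 / r s)) + \<i> * of_real q + C s * of_real (1 / r s) =
          \<i> * of_real (q + sin (\<Theta> s) / r s)"
        by (simp add: C_def complex_eq_iff)
      also have "q + sin (\<Theta> s) / r s = (\<epsilon> * r s - (real n - 1) / r s) * sin (\<Theta> s)"
        by (simp add: q_def diff_divide_distrib algebra_simps)
      finally show ?thesis by (simp add: \<gamma>2_def)
    qed
    ultimately show ?thesis by simp
  qed
  have eq: "\<gamma>2 s - of_real ((real n - 1) / (cmod (\<gamma> s))\<^sup>2) * \<gamma> s + of_real \<epsilon> * \<gamma> s =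
      of_real ((\<epsilon> * r s - (real n - 1) / r s) * cos (\<Theta> s)) * \<gamma>1 s" if s: "s \<in> ?S" for s
  proof -
    define p where "p = \<epsilon> * r s - (real n - 1) / r s"
    have "cis (- \<Theta> s) * C s = 1" by (simp add: Ccis cis_mult)
    then have "\<gamma>1 s * of_real (r s) * cis (- \<Theta> s) = \<gamma> s"
      using r0[OF s] by (simp add: \<gamma>1_def mult_ac)
    then have g: "\<gamma> s = \<gamma>1 s * (of_real (r s) * cis (- \<Theta> s))" by (simp add: mult_ac)
    have "\<epsilon> * r s - (real n - 1) / (r s)\<^sup>2 * r s = p"
      using r0[OF s] by (simp add: p_def power2_eq_square)
    then have e: "of_real \<epsilon> * of_real (r s) - of_real ((real n - 1) / (r s)\<^sup>2) * of_real (r s) = (of_real p :: complex)"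
      by (metis of_real_diff of_real_mult)
    have gen: "- (B * z) + A * z = y * ((A * t - B * t) * c)" if "z = y * (t * c)" for A B z y t c :: complex
      by (simp add: that algebra_simps)
    have "- (of_real ((real n - 1) / (r s)\<^sup>2) * \<gamma> s) + of_real \<epsilon> * \<gamma> s = \<gamma>1 s * (of_real p * cis (- \<Theta> s))"
      using gen[OF g, of "of_real ((real n - 1) / (r s)\<^sup>2)" "of_real \<epsilon>"] unfolding e .
    moreover have "\<gamma>1 s * (\<i> * of_real (p * sin (\<Theta> s))) + \<gamma>1 s * (of_real p * cis (- \<Theta> s)) =
        of_real (p * cos (\<Theta> s)) * \<gamma>1 s"
    proof -
      have "\<i> * of_real (p * sin (\<Theta> s)) + of_real p * cis (- \<Theta> s) = of_real (p * cos (\<Theta> s))"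
        by (simp add: complex_eq_iff)
      then show ?thesis by (metis distrib_left mult.commute)
    qed
    moreover have "\<gamma>2 s - B + A = \<gamma>1 s * (\<i> * of_real (p * sin (\<Theta> s))) + (- B + A)" for A B
      by (simp add: \<gamma>2_def p_def)
    ultimately show ?thesis
      unfolding cm[OF s] p_def[symmetric] by (simp only:)
  qed
  have "smooth_curve ?S \<gamma>"
    by (rule smooth_curve_profile_algebra[OF r0 d\<gamma>[unfolded \<gamma>1_def C_def] dr d\<Theta> profile_algebra.gen_gamma])
  then have reg: "regular_profile n \<epsilon> L \<gamma> \<gamma>1 \<gamma>2"
    unfolding regular_profile_def
  proof (intro conjI ballI)
    fix s assume s: "s \<in> ?S"
    show "\<gamma> s \<noteq> 0" using cm[OF s] r0[OF s] by auto
    show "cmod (\<gamma>1 s) = 1" using \<gamma>1[OF s] by simp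
    show "\<exists>\<kappa>. \<gamma>2 s - of_real ((real n - 1) / (cmod (\<gamma> s))\<^sup>2) * \<gamma> s + of_real \<epsilon> * \<gamma> s = of_real \<kappa> * \<gamma>1 s"
      using eq[OF s] by blast
  qed (use d\<gamma> d\<gamma>1 in auto)
  have S0: "0 \<in> ?S" "L \<in> ?S" using L by auto
  have sn: "sin (\<Theta> 0) = E * exp (\<epsilon> / 2)" "sin (\<Theta> L) = E * exp (\<epsilon> / 2)"
    using Es[OF S0(1)] Es[OF S0(2)] ends by (simp_all add: exp_minus field_simps)
  have "E * exp (\<epsilon> / 2) < exp (- \<epsilon> / 2) * exp (\<epsilon> / 2)" using E by simp
  also have "\<dots> = 1" by (simp flip: exp_add)
  finally have lt: "E * exp (\<epsilon> / 2) < 1" .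
  have pos: "0 < E * exp (\<epsilon> / 2)" using E by simp
  have cnz: "cos x \<noteq> 0" if "sin x = E * exp (\<epsilon> / 2)" for x
  proof
    assume "cos x = 0"
    then have "(sin x)\<^sup>2 = 1" using sin_cos_squared_add[of x] by simp
    then show False using that lt pos by (simp add: power2_eq_1_iff)
  qed
  have "cos (\<Theta> 0) \<le> 0"
  proof (rule ccontr)
    assume "\<not> cos (\<Theta> 0) \<le> 0"
    then obtain d where d: "d > 0" "\<And>h. h > 0 \<Longrightarrow> 0 + h \<in> ?S \<Longrightarrow> h < d \<Longrightarrow> r 0 < r (0 + h)"
      using has_real_derivative_pos_inc_right[OF dr[OF S0(1)]] by auto
    define h where "h = min d L / 2"
    have "0 < h" "h < d" "h < L" using d(1) L by (auto simp: h_def)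
    then show False using d(2)[of h] inner[of h] ends by auto
  qed
  then have c0: "cos (\<Theta> 0) < 0" using cnz[OF sn(1)] by simp
  have "0 \<le> cos (\<Theta> L)"
  proof (rule ccontr)
    assume "\<not> 0 \<le> cos (\<Theta> L)"
    then obtain d where d: "d > 0" "\<And>h. h > 0 \<Longrightarrow> L - h \<in> ?S \<Longrightarrow> h < d \<Longrightarrow> r L < r (L - h)"
      using has_real_derivative_neg_dec_left[OF dr[OF S0(2)]] by auto
    define h where "h = min d L / 2"
    have "0 < h" "h < d" "h < L" using d(1) L by (auto simp: h_def)
    then show False using d(2)[of h] inner[of "L - h"] ends by auto
  qed
  then have c1: "0 < cos (\<Theta> L)" using cnz[OF sn(2)] by simp
  show thesis
  proof (rule that[OF reg, of "\<Theta> 0" "\<Theta> L"])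
    show "cmod (\<gamma> s) < 1" if "s \<in> {0<..<L}" for s using cm[of s] inner[OF that] that by auto
    show "cmod (\<gamma> 0) = 1" "cmod (\<gamma> L) = 1" using cm S0 ends by simp_all
    show "\<gamma>1 0 = \<gamma> 0 * cis (\<Theta> 0)" "\<gamma>1 L = \<gamma> L * cis (\<Theta> L)" by (simp_all add: \<gamma>1_def ends Ccis)
    show "cos (\<Theta> 0) < 0" "0 < cos (\<Theta> L)" using c0 c1 by auto
    show "sin (\<Theta> 0) = sin (\<Theta> L)" using sn by simp
  qed
qed

text \<open>
  A positive derivative makes \<open>f\<close> strictly increasing; by the intermediate value theorem its image contains an
  interval around each value, on which the inverse is continuous, so that the inverse function rule applies.
\<close>

lemma increasing_inverse:
  fixes f f' :: "real \<Rightarrow> real"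
  assumes d: "\<And>x. x \<in> {a<..<b} \<Longrightarrow> (f has_real_derivative f' x) (at x)"
    and pos: "\<And>x. x \<in> {a<..<b} \<Longrightarrow> 0 < f' x"
  obtains g where "\<And>x. x \<in> {a<..<b} \<Longrightarrow> g (f x) = x"
    "\<And>x. x \<in> {a<..<b} \<Longrightarrow> (g has_real_derivative inverse (f' x)) (at (f x))"
    "\<And>x y. x \<in> {a<..<b} \<Longrightarrow> y \<in> {a<..<b} \<Longrightarrow> x < y \<Longrightarrow> f x < f y"
proof -
  have mono: "f x < f y" if "x \<in> {a<..<b}" "y \<in> {a<..<b}" "x < y" for x y
  proof (rule DERIV_pos_imp_increasing[OF that(3)])
    fix z assume "x \<le> z" "z \<le> y"
    then have "z \<in> {a<..<b}" using that by auto
    then show "\<exists>y. (f has_real_derivative y) (at z) \<and> 0 < y" using d pos by blast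
  qed
  have inj: "inj_on f {a<..<b}"
    by (rule inj_onI) (metis mono less_irrefl linorder_neqE_linordered_idom)
  define g where "g = inv_into {a<..<b} f"
  have g: "g (f x) = x" if "x \<in> {a<..<b}" for x
    unfolding g_def using inj that by (rule inv_into_f_f)
  have "(g has_real_derivative inverse (f' x)) (at (f x))" if x: "x \<in> {a<..<b}" for x
  proof -
    define e where "e = min (x - a) (b - x) / 2"
    have e: "e > 0" using x by (auto simp: e_def)
    have skip: "z \<in> {a<..<b}" if "\<bar>z - x\<bar> \<le> e" for z
    proof -
      have "e \<le> (x - a) / 2" "e \<le> (b - x) / 2" by (auto simp: e_def)
      then show ?thesis using that x unfolding greaterThanLessThan_iff abs_le_iff by auto
    qed
    have contf: "isCont f z" if "\<bar>z - x\<bar> \<le> e" for z using d[OF skip[OF that]] by (rule DERIV_isCont)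
    have cont: "isCont g (f x)"
      by (rule isCont_inverse_function[where f = f, OF e]) (fact g[OF skip] contf)+
    have "f (g y) = y" if y: "f (x - e) < y" "y < f (x + e)" for y
    proof -
      have "\<exists>z\<ge>x - e. z \<le> x + e \<and> f z = y"
        by (rule IVT) (use y e contf in \<open>auto simp: abs_le_iff\<close>)
      then obtain z where "f z = y" "\<bar>z - x\<bar> \<le> e" by (auto simp: abs_le_iff)
      then show ?thesis using g[OF skip] by auto
    qed
    moreover have "f (x - e) < f x" "f x < f (x + e)" using mono skip e x by auto
    moreover have "f' x \<noteq> 0" using pos[OF x] by simp
    ultimately show ?thesis
      using d[OF x] cont g[OF x]
      by (intro DERIV_inverse_function[where f = f and a = "f (x - e)" and b = "f (x + e)"]) auto
  qed
  then show thesis using that g mono by blast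
qed

text \<open>
  The profile is parametrized by its angle \<open>\<Theta> \<in> [q, \<pi> - q]\<close>: the radius is \<open>\<rho> \<Theta> = F\<^sup>-\<^sup>1 (E / sin \<Theta>)\<close>, and
  \<open>\<Theta>' = - G \<Theta>\<close> with \<open>G > 0\<close>, so the arc length is minus the integral \<open>S\<close> of \<open>1 / G\<close> up to a constant.
  Inverting \<open>S\<close> gives \<open>\<Theta>\<close>, and \<open>\<phi>\<close> is the integral of \<open>sin \<Theta> / r\<close>.
\<close>

theorem anciaux_profile_exists:
  assumes n: "2 \<le> n" and eps: "\<epsilon> \<le> 1" and E: "0 < E" "E < exp (- \<epsilon> / 2)"
  shows "\<exists>L \<gamma>. 0 < L \<and> anciaux_profile n \<epsilon> L \<gamma> E"
proof -
  define F where "F x = x ^ n * exp (- \<epsilon> * x\<^sup>2 / 2)" for x :: real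
  define w where "w x = real n / x - \<epsilon> * x" for x :: real
  have F0: "0 < F x" if "0 < x" for x using that by (simp add: F_def)
  (* w is the logarithmic derivative of F. The end point 1 of the radii has to be interior, and
     any bound above 1 with square below 2 is good enough, as \<epsilon> \<le> 1 and 2 \<le> n *)
  have w0: "0 < w x" if "x \<in> {0<..<6/5}" for x
  proof -
    have "x * x \<le> (6/5) * (6/5)" using that by (intro mult_mono) auto
    then have "\<epsilon> * (x * x) \<le> 36/25"
      using eps mult_right_mono[of \<epsilon> 1 "x * x"] by auto
    then have "\<epsilon> * x * x < real n" using n by (simp add: mult.assoc)
    then show ?thesis using that by (simp add: w_def field_simps)
  qed
  have dF: "(F has_real_derivative w x * F x) (at x)" if "x \<noteq> 0" for x
  proof -
    have p: "real n * x ^ (n - 1) = real n / x * x ^ n"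
      using that n by (cases n) auto
    have "(F has_real_derivative (real n * x ^ (n - 1)) * exp (- \<epsilon> * x\<^sup>2 / 2) +
        (exp (- \<epsilon> * x\<^sup>2 / 2) * (- \<epsilon> * x)) * x ^ n) (at x)"
      unfolding F_def[abs_def] by (auto intro!: derivative_eq_intros)
    then show ?thesis unfolding p by (simp add: F_def w_def algebra_simps)
  qed
  obtain R where R: "\<And>x. x \<in> {0<..<6/5} \<Longrightarrow> R (F x) = x"
    "\<And>x. x \<in> {0<..<6/5} \<Longrightarrow> (R has_real_derivative inverse (w x * F x)) (at (F x))"
    and Fmono: "\<And>x y. x \<in> {0<..<6/5} \<Longrightarrow> y \<in> {0<..<6/5} \<Longrightarrow> x < y \<Longrightarrow> F x < F y"
    by (rule increasing_inverse[of 0 "6/5" F "\<lambda>x. w x * F x"]) (use dF w0 F0 in auto)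
  have F1: "F 1 = exp (- \<epsilon> / 2)" by (simp add: F_def)
  define q where "q = arcsin (E / F 1)"
  have EF: "0 < E / F 1" "E / F 1 < 1" using E F1 by simp_all
  have sq: "sin q = E / F 1" using EF by (simp add: q_def)
  have q: "0 < q" "q < pi / 2"
    using EF arcsin_less_mono[of 0 "E / F 1"] arcsin_less_mono[of "E / F 1" 1] by (auto simp: q_def)
  let ?T = "{q..pi - q}"
  have sin_ge: "sin q \<le> sin t" if "t \<in> ?T" for t
  proof (cases "t \<le> pi / 2")
    case True
    then show ?thesis using that q by (intro sin_monotone_2pi_le) auto
  next
    case False
    then have "sin q \<le> sin (pi - t)" using that q by (intro sin_monotone_2pi_le) auto
    then show ?thesis by simp
  qed
  have sin_gt: "sin q < sin t" if "t \<in> {q<..<pi - q}" for t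
  proof (cases "t \<le> pi / 2")
    case True
    then show ?thesis using that q by (intro sin_monotone_2pi) auto
  next
    case False
    then have "sin q < sin (pi - t)" using that q by (intro sin_monotone_2pi) auto
    then show ?thesis by simp
  qed
  define \<rho> where "\<rho> t = R (E / sin t)" for t
  have sin0: "0 < sin t" if "t \<in> ?T" for t using sin_ge[OF that] sq EF by simp
  have \<rho>: "0 < \<rho> t \<and> \<rho> t \<le> 1 \<and> F (\<rho> t) = E / sin t" if t: "t \<in> ?T" for t
  proof -
    have "E / sin t \<le> F 1"
      using sin_ge[OF t] sin0[OF t] sq F0[of 1] by (simp add: field_simps)
    moreover have "0 < E / sin t" using E sin0[OF t] by simp
    moreover have "continuous_on {0..1} F" unfolding F_def[abs_def] by (auto intro!: continuous_intros)
    moreover have "F 0 = 0" using n by (simp add: F_def)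
    ultimately obtain x where x: "0 \<le> x" "x \<le> 1" "F x = E / sin t"
      using IVT'[of F 0 "E / sin t" 1] by auto
    then have "x \<noteq> 0" using \<open>F 0 = 0\<close> \<open>0 < E / sin t\<close> by auto
    then have "R (F x) = x" using x by (intro R(1)) simp
    then have "\<rho> t = x" by (simp only: \<rho>_def x(3)[symmetric])
    then show ?thesis using x \<open>x \<noteq> 0\<close> by simp
  qed
  have \<rho>in: "\<rho> t \<in> {0<..<6/5}" if "t \<in> ?T" for t using \<rho>[OF that] by simp
  have d\<rho>: "(\<rho> has_real_derivative - cos t / (w (\<rho> t) * sin t)) (at t)" if t: "t \<in> ?T" for t
  proof -
    have "((\<lambda>t. E / sin t) has_real_derivative - (E * cos t) / (sin t * sin t)) (at t)"
      using sin0[OF t] by (auto intro!: derivative_eq_intros)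
    moreover have "(R has_real_derivative inverse (w (\<rho> t) * F (\<rho> t))) (at (E / sin t))"
      using R(2)[OF \<rho>in[OF t]] \<rho>[OF t] by simp
    ultimately have "((R \<circ> (\<lambda>t. E / sin t)) has_real_derivative
        inverse (w (\<rho> t) * F (\<rho> t)) * (- (E * cos t) / (sin t * sin t))) (at t)"
      by (intro DERIV_chain)
    moreover have "inverse (w (\<rho> t) * F (\<rho> t)) * (- (E * cos t) / (sin t * sin t)) = - cos t / (w (\<rho> t) * sin t)"
      using \<rho>[OF t] w0[OF \<rho>in[OF t]] sin0[OF t] E by (simp add: field_simps)
    ultimately show ?thesis by (simp add: \<rho>_def[abs_def] o_def)
  qed
  define G where "G t = w (\<rho> t) * sin t" for t
  have G0: "0 < G t" if "t \<in> ?T" for t using w0[OF \<rho>in[OF that]] sin0[OF that] by (simp add: G_def)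
  have \<rho>cont: "continuous_on ?T \<rho>"
    by (rule DERIV_continuous_on) (use d\<rho> in \<open>auto intro: has_field_derivative_at_within\<close>)
  have "continuous_on ?T (\<lambda>t. 1 / G t)"
    unfolding G_def w_def using \<rho> G0[unfolded G_def w_def]
    by (intro continuous_intros \<rho>cont) (force dest: \<rho>)+
  (* 1 / G is continued by constants beyond [q, \<pi> - q], so that its integral S is differentiable and
     increasing on a neighbourhood of this interval *)
  define clamp where "clamp t = max q (min (pi - q) t)" for t
  have clamp: "clamp t \<in> ?T" for t using q by (auto simp: clamp_def)
  have clamp_id: "clamp t = t" if "t \<in> ?T" for t using that by (auto simp: clamp_def)
  define g where "g t = 1 / G (clamp t)" for t
  have gcont: "continuous_on A g" for A
    unfolding g_def
    by (rule continuous_on_compose2[OF \<open>continuous_on ?T (\<lambda>t. 1 / G t)\<close>, of A clamp])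
      (use clamp in \<open>auto simp: clamp_def intro!: continuous_intros\<close>)
  have g0: "0 < g t" for t using G0[OF clamp] by (simp add: g_def)
  (* any interval around [q, \<pi> - q] would do *)
  define a b where "a = q - 1" and "b = pi - q + 1"
  define S where "S t = integral {a..t} g" for t
  have dS: "(S has_real_derivative g t) (at t)" if "t \<in> {a<..<b}" for t
  proof -
    have "(S has_real_derivative g t) (at t within {a..b})"
      unfolding S_def[abs_def] by (rule integral_has_real_derivative[OF gcont]) (use that in auto)
    moreover have "at t within {a..b} = at t" using that by (intro at_within_interior) simp
    ultimately show ?thesis by simp
  qed
  obtain h where h: "\<And>x. x \<in> {a<..<b} \<Longrightarrow> h (S x) = x"
    "\<And>x. x \<in> {a<..<b} \<Longrightarrow> (h has_real_derivative inverse (g x)) (at (S x))"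
    and Smono: "\<And>x y. x \<in> {a<..<b} \<Longrightarrow> y \<in> {a<..<b} \<Longrightarrow> x < y \<Longrightarrow> S x < S y"
    by (rule increasing_inverse[of a b S g]) (use dS g0 in auto)
  have Tab: "t \<in> {a<..<b}" if "t \<in> ?T" for t using that by (auto simp: a_def b_def)
  have qT: "q \<in> ?T" "pi - q \<in> ?T" using q by auto
  define L where "L = S (pi - q) - S q"
  have L: "0 < L" unfolding L_def using Smono[OF Tab[OF qT(1)] Tab[OF qT(2)]] q by simp
  (* the angle decreases from \<pi> - q, so arc length is measured backwards in S *)
  define \<Theta> where "\<Theta> s = h (S (pi - q) - s)" for s
  have ST: "\<Theta> s \<in> ?T \<and> S (\<Theta> s) = S (pi - q) - s" if s: "s \<in> {0..L}" for s
  proof -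
    have "continuous_on ?T S"
      by (rule DERIV_continuous_on) (use dS Tab in \<open>auto intro: has_field_derivative_at_within\<close>)
    then obtain t where "q \<le> t" "t \<le> pi - q" "S t = S (pi - q) - s"
      using IVT'[of S q "S (pi - q) - s" "pi - q"] s q by (auto simp: L_def)
    then show ?thesis using h(1)[OF Tab, of t] by (auto simp: \<Theta>_def)
  qed
  have \<Theta>0: "\<Theta> 0 = pi - q" using h(1)[OF Tab[OF qT(2)]] by (simp add: \<Theta>_def)
  have \<Theta>L: "\<Theta> L = q" using h(1)[OF Tab[OF qT(1)]] by (simp add: \<Theta>_def L_def)
  have d\<Theta>: "(\<Theta> has_real_derivative - G (\<Theta> s)) (at s)" if s: "s \<in> {0..L}" for s
  proof -
    have "(h has_real_derivative inverse (g (\<Theta> s))) (at (S (pi - q) - s))"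
      using h(2)[OF Tab, of "\<Theta> s"] ST[OF s] by simp
    then have "((h \<circ> (\<lambda>s. S (pi - q) - s)) has_real_derivative inverse (g (\<Theta> s)) * (-1)) (at s)"
      by (intro DERIV_chain) (auto intro!: derivative_eq_intros)
    moreover have "g (\<Theta> s) = 1 / G (\<Theta> s)" using clamp_id ST[OF s] by (simp add: g_def)
    ultimately show ?thesis by (simp add: \<Theta>_def[abs_def] o_def)
  qed
  define r where "r s = \<rho> (\<Theta> s)" for s
  have dr: "(r has_real_derivative cos (\<Theta> s)) (at s)" if s: "s \<in> {0..L}" for s
  proof -
    have T: "\<Theta> s \<in> ?T" using ST[OF s] by simp
    have "((\<rho> \<circ> \<Theta>) has_real_derivative - cos (\<Theta> s) / (w (\<rho> (\<Theta> s)) * sin (\<Theta> s)) * (- G (\<Theta> s))) (at s)"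
      by (rule DERIV_chain[OF d\<rho>[OF T] d\<Theta>[OF s]])
    moreover have "- cos (\<Theta> s) / (w (\<rho> (\<Theta> s)) * sin (\<Theta> s)) * (- G (\<Theta> s)) = cos (\<Theta> s)"
      using w0[OF \<rho>in[OF T]] sin0[OF T] by (simp add: G_def)
    ultimately show ?thesis by (simp add: r_def[abs_def] o_def)
  qed
  have rpos: "0 < r s" if "s \<in> {0..L}" for s using \<rho> ST[OF that] by (simp add: r_def)
  define \<phi> where "\<phi> s = integral {0..s} (\<lambda>s. sin (\<Theta> s) / r s)" for s
  have "continuous_on {0..L} (\<lambda>s. sin (\<Theta> s) / r s)"
  proof (intro continuous_intros)
    show "continuous_on {0..L} \<Theta>"
      by (rule DERIV_continuous_on) (use d\<Theta> in \<open>auto intro: has_field_derivative_at_within\<close>)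
    show "continuous_on {0..L} r"
      by (rule DERIV_continuous_on) (use dr in \<open>auto intro: has_field_derivative_at_within\<close>)
  qed (use rpos in force)
  then have d\<phi>: "(\<phi> has_real_derivative sin (\<Theta> s) / r s) (at s within {0..L})" if "s \<in> {0..L}" for s
    unfolding \<phi>_def[abs_def] using that by (rule integral_has_real_derivative)
  define \<alpha> where "\<alpha> s = \<Theta> s + \<phi> s" for s
  define \<gamma> where "\<gamma> s = complex_of_real (r s) * cis (\<phi> s)" for s
  have d\<gamma>: "(\<gamma> has_vector_derivative cis (\<alpha> s)) (at s within {0..L})" if s: "s \<in> {0..L}" for s
  proof -
    have "((\<lambda>s. cos (\<phi> s)) has_real_derivative - sin (\<phi> s) * (sin (\<Theta> s) / r s)) (at s within {0..L})"
      "((\<lambda>s. sin (\<phi> s)) has_real_derivative cos (\<phi> s) * (sin (\<Theta> s) / r s)) (at s within {0..L})"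
      "(r has_real_derivative cos (\<Theta> s)) (at s within {0..L})"
      using d\<phi>[OF s] dr[OF s] by (auto intro!: derivative_eq_intros intro: has_field_derivative_at_within)
    then have "((\<lambda>s. of_real (r s) * (of_real (cos (\<phi> s)) + \<i> * of_real (sin (\<phi> s)))) has_vector_derivative
        of_real (r s) * (of_real (- sin (\<phi> s) * (sin (\<Theta> s) / r s)) + \<i> * of_real (cos (\<phi> s) * (sin (\<Theta> s) / r s)))
        + of_real (cos (\<Theta> s)) * (of_real (cos (\<phi> s)) + \<i> * of_real (sin (\<phi> s)))) (at s within {0..L})"
      by (intro has_vector_derivative_mult has_vector_derivative_add has_vector_derivative_mult_right
          has_vector_derivative_of_real)
    moreover have "of_real (r s) * (of_real (- sin (\<phi> s) * (sin (\<Theta> s) / r s)) + \<i> * of_real (cos (\<phi> s) * (sin (\<Theta> s) / r s)))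
        + of_real (cos (\<Theta> s)) * (of_real (cos (\<phi> s)) + \<i> * of_real (sin (\<phi> s))) = cis (\<alpha> s)"
      using rpos[OF s] by (simp add: complex_eq_iff \<alpha>_def cos_add sin_add algebra_simps)
    moreover have "(\<lambda>s. of_real (r s) * (of_real (cos (\<phi> s)) + \<i> * of_real (sin (\<phi> s)))) = \<gamma>"
      by (simp add: fun_eq_iff \<gamma>_def complex_eq_iff)
    ultimately show ?thesis by simp
  qed
  have FE: "F (r s) * sin (\<Theta> s) = E" if "s \<in> {0..L}" for s
    using \<rho>[of "\<Theta> s"] ST[OF that] sin0[of "\<Theta> s"] by (simp add: r_def)
  have rend: "r 0 = 1" "r L = 1"
  proof -
    have "E = F 1 * sin q" "sin q \<noteq> 0" using sq EF F0[of 1] by auto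
    then have "E / sin q = F 1" by simp
    then have "\<rho> q = 1" "\<rho> (pi - q) = 1" using R(1)[of 1] by (simp_all add: \<rho>_def)
    then show "r 0 = 1" "r L = 1" by (simp_all add: r_def \<Theta>0 \<Theta>L)
  qed
  have rin: "r s < 1" if s: "s \<in> {0<..<L}" for s
  proof (rule ccontr)
    assume "\<not> r s < 1"
    then have "r s = 1" using \<rho>[of "\<Theta> s"] ST[of s] s by (simp add: r_def)
    then have "F 1 * sin (\<Theta> s) = F 1 * sin q" using FE[of s] s sq F0[of 1] by simp
    then have "sin (\<Theta> s) = sin q" using F0[of 1] by simp
    moreover have "\<Theta> s \<noteq> q" "\<Theta> s \<noteq> pi - q"
      using ST[of s] s by (auto simp: L_def)
    ultimately show False using sin_gt[of "\<Theta> s"] ST[of s] s by auto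
  qed
  have "anciaux_profile n \<epsilon> L \<gamma> E"
    unfolding anciaux_profile_def
  proof (rule exI[of _ r], rule exI[of _ \<phi>], rule exI[of _ \<alpha>], intro conjI ballI)
    show "continuous_on {0..L} \<phi>" by (rule DERIV_continuous_on[OF d\<phi>])
    moreover have "continuous_on {0..L} \<Theta>"
      by (rule DERIV_continuous_on) (use d\<Theta> in \<open>auto intro: has_field_derivative_at_within\<close>)
    ultimately show "continuous_on {0..L} \<alpha>" unfolding \<alpha>_def by (intro continuous_intros)
    fix s assume s: "s \<in> {0..L}"
    have e: "\<alpha> s - \<phi> s = \<Theta> s" for s by (simp add: \<alpha>_def)
    show "0 < r s" by (rule rpos[OF s])
    show "\<gamma> s = complex_of_real (r s) * cis (\<phi> s)" by (simp add: \<gamma>_def)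
    show "(\<gamma> has_vector_derivative cis (\<alpha> s)) (at s within {0..L})" by (rule d\<gamma>[OF s])
    show "(r has_real_derivative cos (\<alpha> s - \<phi> s)) (at s within {0..L})"
      unfolding e using dr[OF s] by (rule has_field_derivative_at_within)
    have "- G (\<Theta> s) = (\<epsilon> * r s - real n / r s) * sin (\<Theta> s)"
      by (simp add: G_def w_def r_def algebra_simps)
    then show "((\<lambda>s. \<alpha> s - \<phi> s) has_real_derivative (\<epsilon> * r s - real n / r s) * sin (\<alpha> s - \<phi> s)) (at s within {0..L})"
      unfolding e using d\<Theta>[OF s] by (metis has_field_derivative_at_within)
    show "r s ^ n * exp (- \<epsilon> * (r s)\<^sup>2 / 2) * sin (\<alpha> s - \<phi> s) = E"
      unfolding e using FE[OF s] by (simp add: F_def)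
  qed (use rend rin in auto)
  then show ?thesis using L by blast
qed

section \<open>The cylinder over a Legendrian immersion\<close>

lemma half_interval_insert: "prod_range 1 (half_interval L) V = insert_dom 0 {0..<L} V"
proof -
  have "last_coords 1 x = drop_coord 0 x" for x by (auto simp: last_coords_def drop_coord_def)
  moreover have "first_coords 1 x \<in> half_interval L \<longleftrightarrow> x 0 \<in> {0..<L}" for x
    by (auto simp: first_coords_def half_interval_def)
  ultimately show ?thesis by (auto simp: prod_range_def insert_dom_def)
qed

lemma islimpt_half_interval:
  fixes L :: real
  assumes t: "t \<in> {0..<L}"
  shows "t islimpt {0..<L}"
proof -
  show ?thesis
    unfolding islimpt_approachable
  proof (intro allI impI)
    fix e :: real assume "e > 0"
    then show "\<exists>x'\<in>{0..<L}. x' \<noteq> t \<and> dist x' t < e"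
      using t by (intro bexI[of _ "t + min e (L - t) / 2"]) (auto simp: dist_real_def min_def field_simps)
  qed
qed

lemma has_vector_derivative_reparam:
  fixes f :: "real \<Rightarrow> complex"
  assumes "(f has_vector_derivative f') (at (\<alpha> + \<beta> * t) within {0..L})"
    and "(\<lambda>t. \<alpha> + \<beta> * t) ` {0..<L} \<subseteq> {0..L}"
  shows "((\<lambda>t. f (\<alpha> + \<beta> * t)) has_vector_derivative of_real \<beta> * f') (at t within {0..<L})"
proof -
  have "((\<lambda>t. \<alpha> + \<beta> * t) has_vector_derivative \<beta>) (at t within {0..<L})"
    unfolding has_real_derivative_iff_has_vector_derivative[symmetric] by (auto intro!: derivative_eq_intros)
  moreover have "(f has_vector_derivative f') (at (\<alpha> + \<beta> * t) within (\<lambda>t. \<alpha> + \<beta> * t) ` {0..<L})"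
    using assms by (rule has_vector_derivative_within_subset)
  ultimately have "(f \<circ> (\<lambda>t. \<alpha> + \<beta> * t) has_vector_derivative \<beta> *\<^sub>R f') (at t within {0..<L})"
    by (rule vector_diff_chain_within)
  then show ?thesis by (simp add: o_def scaleR_conv_of_real)
qed

text \<open>
  The chain rule contributes a factor \<open>\<beta>\<close> for each derivative, so the reparametrized family is closed under
  differentiation only together with its constant multiples.
\<close>

lemma smooth_curve_reparam:
  fixes f :: "real \<Rightarrow> complex"
  assumes "smooth_curve {0..L} f" and sub: "(\<lambda>t. \<alpha> + \<beta> * t) ` {0..<L} \<subseteq> {0..L}"
  shows "smooth_curve {0..<L} (\<lambda>t. f (\<alpha> + \<beta> * t))"
proof -
  obtain A where A: "f \<in> A"
    "\<And>f. f \<in> A \<Longrightarrow> \<exists>f'\<in>A. \<forall>t\<in>{0..L}. (f has_vector_derivative f' t) (at t within {0..L})"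
    using assms(1) unfolding smooth_curve_def by auto
  let ?B = "{\<lambda>t. c * g (\<alpha> + \<beta> * t) | c g. g \<in> A}"
  have "\<exists>u'\<in>?B. \<forall>t\<in>{0..<L}. (u has_vector_derivative u' t) (at t within {0..<L})" if u_in: "u \<in> ?B" for u
  proof -
    obtain c g where u: "u = (\<lambda>t. c * g (\<alpha> + \<beta> * t))" and g: "g \<in> A" using u_in by blast
    obtain g' where g': "g' \<in> A" "\<forall>t\<in>{0..L}. (g has_vector_derivative g' t) (at t within {0..L})"
      using A(2)[OF g] by blast
    have "(u has_vector_derivative (c * of_real \<beta>) * g' (\<alpha> + \<beta> * t)) (at t within {0..<L})" if "t \<in> {0..<L}" for t
    proof -
      have "\<alpha> + \<beta> * t \<in> {0..L}" using sub that by blast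
      then have "((\<lambda>t. g (\<alpha> + \<beta> * t)) has_vector_derivative of_real \<beta> * g' (\<alpha> + \<beta> * t)) (at t within {0..<L})"
        using g'(2) sub by (intro has_vector_derivative_reparam) auto
      then show ?thesis unfolding u mult.assoc by (rule has_vector_derivative_mult_right)
    qed
    moreover have "(\<lambda>t. (c * of_real \<beta>) * g' (\<alpha> + \<beta> * t)) \<in> ?B" using g'(1) by blast
    ultimately show ?thesis by (intro bexI[of _ "\<lambda>t. (c * of_real \<beta>) * g' (\<alpha> + \<beta> * t)"]) auto
  qed
  moreover have "(\<lambda>t. f (\<alpha> + \<beta> * t)) \<in> ?B"
  proof -
    have "(\<lambda>t. f (\<alpha> + \<beta> * t)) = (\<lambda>t. 1 * f (\<alpha> + \<beta> * t))" by simp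
    then show ?thesis using A(1) by blast
  qed
  ultimately show ?thesis unfolding smooth_curve_def by (intro exI[of _ ?B]) blast
qed

text \<open>
  The setting of the map \<open>\<gamma>(s) \<psi>(q)\<close> on \<open>[0, L] \<times> K\<close>, where \<open>\<psi>\<close> is a minimal Legendrian immersion of the closed
  connected manifold \<open>K\<close>, given by its jets.
\<close>

locale cylinder =
  fixes K :: "'a mfd" and \<psi> :: "'a \<Rightarrow> cvec" and d :: nat and \<epsilon> L :: real and \<gamma> \<gamma>1 \<gamma>2 :: "real \<Rightarrow> complex"
  assumes K: "smooth_mfd K" and oK: "open_charts K" and compK: "compact_space (mtop K)"
    and connK: "connected_space (mtop K)" and neK: "mpoints K \<noteq> {}" and dimK: "mdim K = d"
    and leg: "legendrian_immersion K (Suc d) \<psi>"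
    and jets: "\<And>c p. c \<in> matlas K \<Longrightarrow> p \<in> fst c \<Longrightarrow>
      \<exists>h. legendrian_jet d (\<psi> p) (\<lambda>i. coord_d c \<psi> i p) (\<lambda>i j. coord_d2 c \<psi> i j p) h"
    and L: "0 < L" and reg: "regular_profile (Suc d) \<epsilon> L \<gamma> \<gamma>1 \<gamma>2"
begin

definition M where "M = prod_mfd (interval_mfd L) K"

definition X where "X = profile_immersion \<gamma> \<psi>"

lemma M_top_dim: "mtop M = prod_topology (top_of_set {0..L}) (mtop K)" "mdim M = Suc d"
  by (simp_all add: M_def prod_mfd_simps interval_mfd_simps dimK)

lemma smooth_M: "smooth_mfd M"
  unfolding M_def by (rule smooth_mfd_prod[OF smooth_mfd_interval[OF L] K oK]) (simp add: interval_mfd_simps)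

lemma compact_M: "compact_mfd M"
  using smooth_M compact_interval[of L] compK
  by (simp add: compact_mfd_def M_def prod_mfd_simps compact_space_prod_topology)

lemma M_chartE:
  assumes "c \<in> matlas M"
  obtains I \<iota> W \<kappa> \<alpha> \<beta> where "c = (I \<times> W, prod_coords 1 \<iota> \<kappa>)" "(I, \<iota>) \<in> matlas (interval_mfd L)"
    "(W, \<kappa>) \<in> matlas K" "affine_chart L I \<iota> \<alpha> \<beta>"
proof -
  obtain I \<iota> W \<kappa> where c: "c = (I \<times> W, prod_coords (mdim (interval_mfd L)) \<iota> \<kappa>)"
    "(I, \<iota>) \<in> matlas (interval_mfd L)" "(W, \<kappa>) \<in> matlas K"
    using assms unfolding M_def by (rule prod_mfd_chartE)
  obtain \<alpha> \<beta> where ab: "affine_chart L I \<iota> \<alpha> \<beta>" by (rule interval_charts[OF c(2)])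
    note b = affine_chartD[OF ab]
  show thesis by (rule that[OF _ c(2,3) ab]) (use c(1) in \<open>simp add: interval_mfd_simps\<close>)
qed

lemma profileD:
  assumes "s \<in> {0..L}"
  shows "(\<gamma> has_vector_derivative \<gamma>1 s) (at s within {0..L})"
    "(\<gamma>1 has_vector_derivative \<gamma>2 s) (at s within {0..L})" "\<gamma> s \<noteq> 0" "cmod (\<gamma>1 s) = 1"
    "\<exists>\<kappa>. \<gamma>2 s - of_real (real d / (cmod (\<gamma> s))\<^sup>2) * \<gamma> s + of_real \<epsilon> * \<gamma> s = of_real \<kappa> * \<gamma>1 s"
  using reg assms unfolding regular_profile_def by auto

text \<open>
  In a chart of the product the map is \<open>insert_fun\<close> at index \<open>0\<close> of the reparametrized profile, so all derivatives are
  those of \<open>\<gamma>\<close> and \<open>\<psi>\<close>. The sign \<open>\<beta>\<close> tells from which end the interval chart starts; at an end point only one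
  of the two charts is available.
\<close>

lemma cylinder_chart:
  assumes c: "c \<in> matlas M" and p: "(s, q) \<in> fst c"
  obtains \<beta> W \<kappa> where "\<beta> \<in> {1, -1}" "(W, \<kappa>) \<in> matlas K" "q \<in> W" "s \<in> {0..L}"
    "s = 0 \<Longrightarrow> \<beta> = 1" "s = L \<Longrightarrow> \<beta> = -1"
    "smooth_on (Suc d) (snd c ` fst c) (chart_rep c X)"
    "coord_d c X 0 (s, q) = (\<lambda>a. of_real \<beta> * \<gamma>1 s * \<psi> q a)"
    "\<And>i. i < d \<Longrightarrow> coord_d c X (Suc i) (s, q) = (\<lambda>a. \<gamma> s * coord_d (W, \<kappa>) \<psi> i q a)"
    "coord_d2 c X 0 0 (s, q) = (\<lambda>a. \<gamma>2 s * \<psi> q a)"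
    "\<And>i. i < d \<Longrightarrow> coord_d2 c X 0 (Suc i) (s, q) = (\<lambda>a. of_real \<beta> * \<gamma>1 s * coord_d (W, \<kappa>) \<psi> i q a)"
    "\<And>i. i < d \<Longrightarrow> coord_d2 c X (Suc i) 0 (s, q) = (\<lambda>a. of_real \<beta> * \<gamma>1 s * coord_d (W, \<kappa>) \<psi> i q a)"
    "\<And>i j. i < d \<Longrightarrow> j < d \<Longrightarrow> coord_d2 c X (Suc i) (Suc j) (s, q) = (\<lambda>a. \<gamma> s * coord_d2 (W, \<kappa>) \<psi> i j q a)"
proof -
  obtain I \<iota> W \<kappa> \<alpha> \<beta> where cc: "c = (I \<times> W, prod_coords 1 \<iota> \<kappa>)" "(I, \<iota>) \<in> matlas (interval_mfd L)"
    "(W, \<kappa>) \<in> matlas K" and ab: "affine_chart L I \<iota> \<alpha> \<beta>"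
    by (rule M_chartE[OF c])
  note b = affine_chartD[OF ab]
  note C = smooth_mfd_chartD[OF smooth_mfd_interval[OF L] cc(2)] and D = smooth_mfd_chartD[OF K cc(3)]
  let ?S = "{0..<L}"
  define V where "V = \<kappa> ` W"
  define F where "F = chart_rep (W, \<kappa>) \<psi>"
  define A where "A t = \<gamma> (\<alpha> + \<beta> * t)" for t
  define A1 where "A1 t = of_real \<beta> * \<gamma>1 (\<alpha> + \<beta> * t)" for t
  define A2 where "A2 t = of_real \<beta> * (of_real \<beta> * \<gamma>2 (\<alpha> + \<beta> * t))" for t
  define Z where "Z = (\<lambda>(a::nat) (t::real). 0 :: complex)"
  define V' where "V' = insert_dom 0 ?S V"
  define G where "G = insert_fun 0 (\<lambda>a. A) Z F"
  have sq: "s \<in> I" "q \<in> W" using p by (simp_all add: cc(1))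
  have sub: "(\<lambda>t. \<alpha> + \<beta> * t) ` ?S \<subseteq> {0..L}" using b(3,4) by simp
  have fatV: "slice_perfect d V" using chart_range_slice_perfect[OF D(2)] by (simp add: V_def dimK)
  have F: "smooth_on d V F"
    using leg cc(3) dimK unfolding legendrian_immersion_def immersion_def F_def V_def by force
  have S: "\<forall>t\<in>?S. t islimpt ?S" using islimpt_half_interval by blast
  have dA: "\<forall>t\<in>?S. (A has_vector_derivative A1 t) (at t within ?S)"
  proof
    fix t assume "t \<in> ?S"
    then have "\<alpha> + \<beta> * t \<in> {0..L}" using sub by blast
    then show "(A has_vector_derivative A1 t) (at t within ?S)"
      unfolding A_def[abs_def] A1_def by (intro has_vector_derivative_reparam profileD(1) sub)
  qed
  have dA1: "\<forall>t\<in>?S. (A1 has_vector_derivative A2 t) (at t within ?S)"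
  proof
    fix t assume "t \<in> ?S"
    then have "\<alpha> + \<beta> * t \<in> {0..L}" using sub by blast
    then show "(A1 has_vector_derivative A2 t) (at t within ?S)"
      unfolding A1_def[abs_def] A2_def
      by (intro has_vector_derivative_mult_right has_vector_derivative_reparam profileD(2) sub)
  qed
  have dZ: "\<forall>t\<in>?S. (Z a has_vector_derivative Z a t) (at t within ?S)" for a by (simp add: Z_def)
  have smA: "smooth_curve ?S A"
    using reg unfolding A_def[abs_def] regular_profile_def by (intro smooth_curve_reparam sub) simp
  have smZ: "smooth_curve ?S (Z a)" for a
    unfolding smooth_curve_def Z_def by (intro exI[of _ "{\<lambda>t. 0}"]) simp
  have GV: "smooth_on (Suc d) V' G"
    unfolding V'_def G_def by (rule smooth_on_insert_fun[OF fatV S _ smA smZ F]) simp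
  have im: "\<iota> ` I = half_interval L" by (rule interval_chart_image[OF cc(2)])
  have C6: "\<iota> ` I \<subseteq> {x. \<forall>i\<ge>1. x i = 0}" using C(6) by (simp add: interval_mfd_simps)
  have img: "prod_coords 1 \<iota> \<kappa> ` (I \<times> W) = V'"
    unfolding prod_coords_image[OF C6] im V'_def V_def by (rule half_interval_insert)
  have rep: "chart_rep c X x = G x" if x: "x \<in> V'" for x
  proof -
    have xr: "x \<in> prod_range 1 (\<iota> ` I) (\<kappa> ` W)"
      using x unfolding V'_def V_def im half_interval_insert .
    then have "first_coords 1 x \<in> half_interval L" by (simp add: prod_range_def im)
    from interval_chart_inv[OF ab this]
    have "inv_into I \<iota> (first_coords 1 x) = \<alpha> + \<beta> * x 0" by (simp add: first_coords_def)
    moreover have "last_coords 1 x = drop_coord 0 x" by (auto simp: last_coords_def drop_coord_def)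
    ultimately have "inv_into (I \<times> W) (prod_coords 1 \<iota> \<kappa>) x = (\<alpha> + \<beta> * x 0, inv_into W \<kappa> (drop_coord 0 x))"
      using inv_into_prod_coords[OF C6 C(3) D(3) xr] by simp
    then show ?thesis
      by (simp add: chart_rep_def cc(1) X_def profile_immersion_def G_def insert_fun_def A_def Z_def F_def)
  qed
  have dom: "snd c ` fst c = V'" using img by (simp only: cc(1) fst_conv snd_conv)
  have sm: "smooth_on (Suc d) (snd c ` fst c) (chart_rep c X)"
    unfolding dom by (rule smooth_on_cong[OF _ GV]) (simp only: rep)
  define x where "x = prod_coords 1 \<iota> \<kappa> (s, q)"
  have xV: "x \<in> V'" using sq img by (auto simp: x_def)
  have xi: "x \<in> insert_dom 0 ?S V" using xV by (simp add: V'_def)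
  have x0: "\<alpha> + \<beta> * x 0 = s" using b(1) by (auto simp: x_def prod_coords_def b(2))
  have dx: "drop_coord 0 x = \<kappa> q" by (auto simp: x_def prod_coords_def drop_coord_def)
  have Fq: "F (\<kappa> q) = \<psi> q" using D(3) sq by (simp add: F_def chart_rep_def)
  have Fd: "partial_d V i F (\<kappa> q) = coord_d (W, \<kappa>) \<psi> i q"
    "partial_d V i (partial_d V j F) (\<kappa> q) = coord_d2 (W, \<kappa>) \<psi> i j q" for i j
    by (simp_all add: coord_d_def coord_d2_def F_def V_def)
  have cd: "coord_d c X i (s, q) = partial_d V' i G x" "coord_d2 c X i j (s, q) = partial_d V' i (partial_d V' j G) x" for i j
  proof -
    have r: "chart_rep (I \<times> W, prod_coords 1 \<iota> \<kappa>) X y = G y" if "y \<in> prod_coords 1 \<iota> \<kappa> ` (I \<times> W)" for y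
      using rep that unfolding img cc(1) .
    have p': "(s, q) \<in> I \<times> W" using sq by simp
    show "coord_d c X i (s, q) = partial_d V' i G x"
      unfolding cc(1) x_def img[symmetric] by (rule coord_d_eq(1)[OF r p'])
    show "coord_d2 c X i j (s, q) = partial_d V' i (partial_d V' j G) x"
      unfolding cc(1) x_def img[symmetric] by (rule coord_d_eq(2)[OF r p'])
  qed
  have vals: "A (x 0) = \<gamma> s" "A1 (x 0) = of_real \<beta> * \<gamma>1 s" "A2 (x 0) = \<gamma>2 s"
    using b(1) by (auto simp: A_def A1_def A2_def x0)
  note d1 = partial_d_insert_fun[where A = "\<lambda>a. A" and A' = "\<lambda>a. A1" and B = Z and B' = Z,
      OF fatV S _ dA dZ F xi, folded V'_def G_def, unfolded skip_simps]
  note d2 = partial_d2_insert_fun[where A = "\<lambda>a. A" and A' = "\<lambda>a. A1" and A'' = "\<lambda>a. A2" and B = Z and B' = Z and B'' = Z,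
      OF fatV S _ dA dA1 dZ dZ F xi, folded V'_def G_def, unfolded skip_simps]
  show thesis
  proof (rule that[OF b(1) cc(3) sq(2) _ _ _ sm])
    show "s \<in> {0..L}" using sq b(4) by blast
    show "s = 0 \<Longrightarrow> \<beta> = 1" "s = L \<Longrightarrow> \<beta> = -1" using sq(1) b(1,3,5) by (auto split: if_splits)
    show "coord_d c X 0 (s, q) = (\<lambda>a. of_real \<beta> * \<gamma>1 s * \<psi> q a)"
      unfolding cd d1(1)[OF le0] by (simp add: insert_fun_def vals dx Fq Z_def)
    show "coord_d2 c X 0 0 (s, q) = (\<lambda>a. \<gamma>2 s * \<psi> q a)"
      unfolding cd d2(1)[OF le0] by (simp add: insert_fun_def vals dx Fq Z_def)
    fix i assume i: "i < d"
    show "coord_d c X (Suc i) (s, q) = (\<lambda>a. \<gamma> s * coord_d (W, \<kappa>) \<psi> i q a)"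
      unfolding cd d1(2)[OF le0 i] by (simp add: insert_fun_def vals dx Fd)
    show "coord_d2 c X 0 (Suc i) (s, q) = (\<lambda>a. of_real \<beta> * \<gamma>1 s * coord_d (W, \<kappa>) \<psi> i q a)"
      unfolding cd d2(3)[OF le0 i] by (simp add: insert_fun_def vals dx Fd)
    show "coord_d2 c X (Suc i) 0 (s, q) = (\<lambda>a. of_real \<beta> * \<gamma>1 s * coord_d (W, \<kappa>) \<psi> i q a)"
      unfolding cd d2(2)[OF le0 i] by (simp add: insert_fun_def vals dx Fd)
    fix j assume j: "j < d"
    show "coord_d2 c X (Suc i) (Suc j) (s, q) = (\<lambda>a. \<gamma> s * coord_d2 (W, \<kappa>) \<psi> i j q a)"
      unfolding cd d2(4)[OF le0 i j] by (simp add: insert_fun_def vals dx Fd)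
  qed
qed

lemma M_jet:
  assumes c: "c \<in> matlas M" and p: "p \<in> fst c"
  shows "smooth_on (Suc d) (snd c ` fst c) (chart_rep c X)"
    and "\<exists>h. soliton_jet (Suc d) \<epsilon> (X p) (\<lambda>i. coord_d c X i p) (\<lambda>i j. coord_d2 c X i j p) h"
proof -
  obtain s q where pq: "p = (s, q)" by (rule prod.exhaust)
  obtain \<beta> W \<kappa> where H: "\<beta> \<in> {1, -1}" "(W, \<kappa>) \<in> matlas K" "q \<in> W" "s \<in> {0..L}"
    "s = 0 \<Longrightarrow> \<beta> = 1" "s = L \<Longrightarrow> \<beta> = -1"
    "smooth_on (Suc d) (snd c ` fst c) (chart_rep c X)"
    "coord_d c X 0 (s, q) = (\<lambda>a. of_real \<beta> * \<gamma>1 s * \<psi> q a)"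
    "\<And>i. i < d \<Longrightarrow> coord_d c X (Suc i) (s, q) = (\<lambda>a. \<gamma> s * coord_d (W, \<kappa>) \<psi> i q a)"
    "coord_d2 c X 0 0 (s, q) = (\<lambda>a. \<gamma>2 s * \<psi> q a)"
    "\<And>i. i < d \<Longrightarrow> coord_d2 c X 0 (Suc i) (s, q) = (\<lambda>a. of_real \<beta> * \<gamma>1 s * coord_d (W, \<kappa>) \<psi> i q a)"
    "\<And>i. i < d \<Longrightarrow> coord_d2 c X (Suc i) 0 (s, q) = (\<lambda>a. of_real \<beta> * \<gamma>1 s * coord_d (W, \<kappa>) \<psi> i q a)"
    "\<And>i j. i < d \<Longrightarrow> j < d \<Longrightarrow> coord_d2 c X (Suc i) (Suc j) (s, q) = (\<lambda>a. \<gamma> s * coord_d2 (W, \<kappa>) \<psi> i j q a)"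
    by (rule cylinder_chart[OF c p[unfolded pq]]) (rule that)
  show "smooth_on (Suc d) (snd c ` fst c) (chart_rep c X)" by (rule H(7))
  obtain h where h: "legendrian_jet d (\<psi> q) (\<lambda>i. coord_d (W, \<kappa>) \<psi> i q) (\<lambda>i j. coord_d2 (W, \<kappa>) \<psi> i j q) h"
    using jets[OF H(2)] H(3) by auto
  obtain k where k: "\<gamma>2 s - of_real (real d / (cmod (\<gamma> s))\<^sup>2) * \<gamma> s + of_real \<epsilon> * \<gamma> s = of_real k * \<gamma>1 s"
    using profileD(5)[OF H(4)] by blast
  have n1: "cmod (of_real \<beta> * \<gamma>1 s) = 1" using H(1) profileD(4)[OF H(4)] by (auto simp: norm_mult)
  (* the sign \<beta> of the velocity in the chart is absorbed into the real factor *)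
  have ode: "\<gamma>2 s - of_real (real d / (cmod (\<gamma> s))\<^sup>2) * \<gamma> s + of_real \<epsilon> * \<gamma> s = of_real (k * \<beta>) * (of_real \<beta> * \<gamma>1 s)"
    using H(1) k by auto
  note pj = profile_jet[where E' = "\<lambda>i. coord_d c X i (s, q)" and D' = "\<lambda>i j. coord_d2 c X i j (s, q)",
      OF h profileD(3)[OF H(4)] n1 ode H(8) H(9) H(10) H(11) H(12) H(13)]
  show "\<exists>h. soliton_jet (Suc d) \<epsilon> (X p) (\<lambda>i. coord_d c X i p) (\<lambda>i j. coord_d2 c X i j p) h"
    unfolding pq X_def profile_immersion_def prod.case
    by (rule exI, rule pj[unfolded X_def profile_immersion_def]; assumption)
qed

lemma \<psi>_sphere: "q \<in> mpoints K \<Longrightarrow> \<psi> q \<in> Cn (Suc d)" "q \<in> mpoints K \<Longrightarrow> cn_inner (Suc d) (\<psi> q) (\<psi> q) = 1"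
  using leg by (auto simp: legendrian_immersion_def cn_sphere_def cn_norm_def)

lemma mpoints_M: "mpoints M = {0..L} \<times> mpoints K"
  by (simp add: M_top_dim)

lemma X_norm:
  assumes "s \<in> {0..L}" "q \<in> mpoints K"
  shows "X (s, q) \<in> Cn (Suc d)" "cn_norm (Suc d) (X (s, q)) = cmod (\<gamma> s)"
proof -
  show "X (s, q) \<in> Cn (Suc d)" using \<psi>_sphere[OF assms(2)] by (auto simp: X_def profile_immersion_def Cn_def)
  have "cn_inner (Suc d) (X (s, q)) (X (s, q)) = Re (\<gamma> s * cnj (\<gamma> s))"
    by (simp add: X_def profile_immersion_def cn_inner_cmult \<psi>_sphere[OF assms(2)])
  also have "\<dots> = (cmod (\<gamma> s))\<^sup>2" by (simp add: cmod_def power2_eq_square)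
  finally show "cn_norm (Suc d) (X (s, q)) = cmod (\<gamma> s)" by (simp add: cn_norm_def)
qed

theorem lagrangian_soliton: "lagrangian_immersion M (Suc d) X" "soliton_equation \<epsilon> M (Suc d) X"
proof -
  have sm: "smooth_on (Suc d) (snd c ` fst c) (chart_rep c X)" if c: "c \<in> matlas M" for c
    using M_jet(1)[OF c] smooth_on_empty by (cases "fst c = {}") auto
  show "lagrangian_immersion M (Suc d) X" "soliton_equation \<epsilon> M (Suc d) X"
    using lagrangian_soliton_of_jets[OF smooth_M M_top_dim(2) sm M_jet(2)] by blast+
qed

text \<open>
  An end point of the interval has chart coordinate \<open>0\<close>, and the range of a chart around it is not open in the whole space,
  because coordinate \<open>0\<close> cannot become negative.
\<close>

lemma mboundary_M: "mboundary M = {0, L} \<times> mpoints K"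
proof (intro set_eqI iffI)
  fix p assume "p \<in> mboundary M"
  then obtain c where c: "c \<in> matlas M" "p \<in> fst c" "snd c p 0 = 0"
    unfolding mboundary_def by force
  obtain I \<iota> W \<kappa> \<alpha> \<beta> where cc: "c = (I \<times> W, prod_coords 1 \<iota> \<kappa>)" "(I, \<iota>) \<in> matlas (interval_mfd L)"
    "(W, \<kappa>) \<in> matlas K" and ab: "affine_chart L I \<iota> \<alpha> \<beta>"
    by (rule M_chartE[OF c(1)])
  note b = affine_chartD[OF ab]
  obtain s q where p: "p = (s, q)" by (rule prod.exhaust)
  have "\<beta> * (s - \<alpha>) = 0" using c(3) by (simp add: p cc(1) prod_coords_def b(2))
  then have "s \<in> {0, L}" using b(1,5) by (auto split: if_splits)
  moreover have "q \<in> mpoints K" using c(2) smooth_mfd_chartD(4)[OF K cc(3)] by (auto simp: p cc(1))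
  ultimately show "p \<in> {0, L} \<times> mpoints K" by (simp add: p)
next
  fix p assume "p \<in> {0, L} \<times> mpoints K"
  then obtain s q where p: "p = (s, q)" "s = 0 \<or> s = L" "q \<in> mpoints K" by auto
  obtain c where c: "c \<in> matlas M" "p \<in> fst c"
  proof (rule mpoints_in_chart[OF smooth_M])
    show "p \<in> mpoints M" using p L by (auto simp: mpoints_M)
  qed
  obtain I \<iota> W \<kappa> \<alpha> \<beta> where cc: "c = (I \<times> W, prod_coords 1 \<iota> \<kappa>)" "(I, \<iota>) \<in> matlas (interval_mfd L)"
    "(W, \<kappa>) \<in> matlas K" and ab: "affine_chart L I \<iota> \<alpha> \<beta>"
    by (rule M_chartE[OF c(1)])
  note b = affine_chartD[OF ab]
  have sI: "s \<in> I" "q \<in> W" using c(2) by (simp_all add: p cc(1))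
  then have "s = \<alpha>" using p(2) b(1,3,5) L by (auto split: if_splits)
  then have z: "prod_coords 1 \<iota> \<kappa> p 0 = 0" by (simp add: p(1) prod_coords_def b(2))
  have C6: "\<iota> ` I \<subseteq> {x. \<forall>i\<ge>1. x i = 0}"
    using smooth_mfd_chartD(6)[OF smooth_mfd_interval[OF L] cc(2)] by (simp add: interval_mfd_simps)
  have img: "prod_coords 1 \<iota> \<kappa> ` (I \<times> W) = insert_dom 0 {0..<L} (\<kappa> ` W)"
    unfolding prod_coords_image[OF C6] interval_chart_image[OF cc(2)] by (rule half_interval_insert)
  have no: "\<not> openin (Euclidean_space (mdim M)) (snd c ` fst c)"
  proof
    assume "openin (Euclidean_space (mdim M)) (snd c ` fst c)"
    then have o: "openin (Euclidean_space (Suc d)) (prod_coords 1 \<iota> \<kappa> ` (I \<times> W))"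
      by (simp add: M_top_dim cc(1))
    define x where "x = prod_coords 1 \<iota> \<kappa> p"
    have x: "x \<in> prod_coords 1 \<iota> \<kappa> ` (I \<times> W)" using sI by (auto simp: x_def p)
    define Q :: "nat \<Rightarrow> real set" where "Q = (\<lambda>k. if k < Suc d then UNIV else {0})"
    have Q: "orthant_open (Suc d) Q (prod_coords 1 \<iota> \<kappa> ` (I \<times> W))"
      using openin_Euclidean_orthant[OF o] by (simp add: Q_def)
    obtain \<delta> where \<delta>: "\<delta> > 0"
      "\<And>z. (\<And>k. z k \<in> Q k) \<Longrightarrow> (\<And>i. \<bar>z i - x i\<bar> < \<delta>) \<Longrightarrow> z \<in> prod_coords 1 \<iota> \<kappa> ` (I \<times> W)"
      using orthant_open_cube[OF Q x] by blast
    have "x(0 := - \<delta> / 2) \<in> prod_coords 1 \<iota> \<kappa> ` (I \<times> W)"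
    proof (rule \<delta>(2))
      show "(x(0 := - \<delta> / 2)) k \<in> Q k" for k using orthant_open_mem[OF Q x, of k] by (simp add: Q_def split: if_splits)
      show "\<bar>(x(0 := - \<delta> / 2)) i - x i\<bar> < \<delta>" for i using \<delta>(1) z by (simp add: x_def)
    qed
    then show False using \<delta>(1) unfolding img by (simp add: insert_dom_def)
  qed
  have "case c of (U, \<phi>) \<Rightarrow> p \<in> U \<and> \<phi> p 0 = 0 \<and> \<not> openin (Euclidean_space (mdim M)) (\<phi> ` U)"
    using c(2) z no by (simp only: cc(1) prod.case fst_conv snd_conv simp_thms)
  then show "p \<in> mboundary M" unfolding mboundary_def by (intro CollectI bexI[OF _ c(1)])
qed

text \<open>
  The first coordinate vector of a chart at an end is the inward unit vector \<open>\<beta> \<gamma>1 s \<psi> q\<close>. It is orthogonal to the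
  boundary because \<open>\<psi>\<close> and \<open>J \<psi>\<close> are orthogonal to the derivatives of \<open>\<psi>\<close>.
\<close>

lemma outward_conormal:
  assumes s: "s = 0 \<or> s = L" and q: "q \<in> mpoints K"
  shows "outward_unit_conormal (Suc d) M X (s, q) (\<lambda>a. of_real (if s = 0 then -1 else 1) * \<gamma>1 s * \<psi> q a)"
  unfolding outward_unit_conormal_def
proof (intro conjI ballI allI impI)
  let ?\<nu> = "\<lambda>a. of_real (if s = 0 then -1 else 1) * \<gamma>1 s * \<psi> q a"
  have sL: "s \<in> {0..L}" using s L by auto
  have g1: "Re (\<gamma>1 s) * Re (\<gamma>1 s) + Im (\<gamma>1 s) * Im (\<gamma>1 s) = 1"
    using profileD(4)[OF sL] by (simp add: cmod_def power2_eq_square)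
  have "cn_inner (Suc d) ?\<nu> ?\<nu> = 1"
    unfolding cn_inner_cmult using g1 by (auto simp: \<psi>_sphere[OF q])
  then show "cn_norm (Suc d) ?\<nu> = 1" by (simp add: cn_norm_def)
  fix c assume c: "c \<in> matlas M" "(s, q) \<in> fst c"
  obtain \<beta> W \<kappa> where H: "\<beta> \<in> {1, -1}" "(W, \<kappa>) \<in> matlas K" "q \<in> W" "s \<in> {0..L}"
    "s = 0 \<Longrightarrow> \<beta> = 1" "s = L \<Longrightarrow> \<beta> = -1"
    "smooth_on (Suc d) (snd c ` fst c) (chart_rep c X)"
    "coord_d c X 0 (s, q) = (\<lambda>a. of_real \<beta> * \<gamma>1 s * \<psi> q a)"
    "\<And>i. i < d \<Longrightarrow> coord_d c X (Suc i) (s, q) = (\<lambda>a. \<gamma> s * coord_d (W, \<kappa>) \<psi> i q a)"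
    by (rule cylinder_chart[OF c]) (rule that)
  have \<beta>: "- of_real \<beta> = (of_real (if s = 0 then -1 else 1) :: complex)" using s H(5,6) L by auto
  obtain h where h: "legendrian_jet d (\<psi> q) (\<lambda>i. coord_d (W, \<kappa>) \<psi> i q) (\<lambda>i j. coord_d2 (W, \<kappa>) \<psi> i j q) h"
    using jets[OF H(2)] H(3) by auto
  show "\<exists>v. v 0 < 0 \<and> ?\<nu> = pushforward M c X (s, q) v"
  proof (intro exI[of _ "\<lambda>i. if i = 0 then -1 else 0"] conjI ext)
    fix a
    have "pushforward M c X (s, q) (\<lambda>i. if i = 0 then -1 else 0) a = - coord_d c X 0 (s, q) a"
      unfolding pushforward_def M_top_dim sum.lessThan_Suc_shift by simp
    then show "?\<nu> a = pushforward M c X (s, q) (\<lambda>i. if i = 0 then -1 else 0) a"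
      by (simp add: H(8) flip: \<beta>)
  qed simp
  fix v :: "nat \<Rightarrow> real" assume v: "v 0 = 0"
  have "cn_inner (Suc d) ?\<nu> (coord_d c X (Suc i) (s, q)) = 0" if i: "i < d" for i
    using h i unfolding legendrian_jet_def H(9)[OF i] cn_inner_cmult by simp
  then show "cn_inner (Suc d) ?\<nu> (pushforward M c X (s, q) v) = 0"
    unfolding pushforward_def M_top_dim sum.lessThan_Suc_shift cn_inner_sum_right
    by (simp add: v cn_inner_sum_right cn_inner_scaleR_right)
qed

lemma boundary_mfd_simps:
  "mtop (boundary_mfd M) = subtopology (mtop M) ({0, L} \<times> mpoints K)"
  "mdim (boundary_mfd M) = d"
  "matlas (boundary_mfd M) = (\<lambda>(U, \<phi>). (U \<inter> ({0, L} \<times> mpoints K), \<lambda>p i. \<phi> p (Suc i))) `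
        {(U, \<phi>) \<in> matlas M. U \<inter> ({0, L} \<times> mpoints K) \<noteq> {}}"
  by (simp_all add: boundary_mfd_def mboundary_M M_top_dim)

text \<open>
  The boundary is the product of a two-point discrete space with the connected space \<open>K\<close>.
\<close>

lemma boundary_components_M: "boundary_components M = {{0} \<times> mpoints K, {L} \<times> mpoints K}"
proof -
  have "mtop (boundary_mfd M) = prod_topology (subtopology (top_of_set {0..L}) {0, L}) (subtopology (mtop K) (mpoints K))"
    unfolding boundary_mfd_simps M_top_dim by (rule subtopology_Times)
  also have "subtopology (top_of_set {0..L}) {0, L} = discrete_topology {0, L}"
  proof -
    have "subtopology (top_of_set {0..L}) {0, L} = top_of_set {0, L}"
      using L by (simp add: subtopology_subtopology Int_absorb1)
    moreover have "discrete_topology {0, L} = top_of_set {0, L}"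
      unfolding discrete_topology_unique
    proof (intro conjI ballI)
      fix x assume "x \<in> {0, L}"
      then have "{x} = {0, L} \<inter> ball x L" using L by (auto simp: dist_real_def)
      then show "openin (top_of_set {0, L}) {x}" by (metis openin_open_Int open_ball)
    qed simp
    ultimately show ?thesis by simp
  qed
  finally have top: "mtop (boundary_mfd M) = prod_topology (discrete_topology {0, L}) (mtop K)" by simp
  have "connected_components_of (mtop K) = {mpoints K}"
    using connK neK by (metis connected_components_of_eq_singleton null_topspace_iff_trivial)
  then show ?thesis
    unfolding boundary_components_def top connected_components_of_prod_topology
    by (auto simp: connected_components_of_discrete_topology)
qed

text \<open>
  Coordinate \<open>0\<close> is dropped in a chart of the boundary, and only a chart of \<open>K\<close> remains. Charts of the cylinder that
  miss the given end leave an empty domain behind.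
\<close>

lemma boundary_chart:
  assumes b: "b \<in> {0, L}" and c: "(D, \<zeta>) \<in> matlas (open_submfd (boundary_mfd M) ({b} \<times> mpoints K))"
  obtains "D = {}" | W \<kappa> where "(W, \<kappa>) \<in> matlas K" "D = {b} \<times> W" "\<And>s q. \<zeta> (s, q) = \<kappa> q"
proof -
  obtain U \<phi> where U: "(U, \<phi>) \<in> matlas (boundary_mfd M)" "D = U \<inter> ({b} \<times> mpoints K)" "\<zeta> = \<phi>"
    using c by (auto simp: open_submfd_def)
  obtain U' \<phi>' where c': "(U', \<phi>') \<in> matlas M" "U = U' \<inter> ({0, L} \<times> mpoints K)" "\<phi> = (\<lambda>p i. \<phi>' p (Suc i))"
  proof -
    obtain z where z: "z \<in> {(U, \<phi>) \<in> matlas M. U \<inter> ({0, L} \<times> mpoints K) \<noteq> {}}"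
      "(U, \<phi>) = (case z of (U, \<phi>) \<Rightarrow> (U \<inter> ({0, L} \<times> mpoints K), \<lambda>p i. \<phi> p (Suc i)))"
      using U(1) unfolding boundary_mfd_simps by (rule imageE)
    show thesis by (rule that[of "fst z" "snd z"]) (use z in \<open>auto simp: case_prod_unfold\<close>)
  qed
  obtain I \<iota> W \<kappa> \<alpha> \<beta> where cc: "(U', \<phi>') = (I \<times> W, prod_coords 1 \<iota> \<kappa>)" "(I, \<iota>) \<in> matlas (interval_mfd L)"
    "(W, \<kappa>) \<in> matlas K"
    by (rule M_chartE[OF c'(1)]) (rule that)
  have WK: "W \<subseteq> mpoints K" by (rule smooth_mfd_chartD(4)[OF K cc(3)])
  show thesis
  proof (cases "b \<in> I")
    case True
    then have "D = {b} \<times> W" using b WK cc(1) by (auto simp: U(2) c'(2))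
    then show thesis by (intro that(2)[OF cc(3)]) (use cc(1) in \<open>auto simp: U(3) c'(3) prod_coords_def\<close>)
  next
    case False
    then show thesis by (intro that(1)) (use cc(1) in \<open>auto simp: U(2) c'(2)\<close>)
  qed
qed

lemma boundary_diffeomorphic:
  assumes b: "b \<in> {0, L}"
  shows "diffeomorphic (open_submfd (boundary_mfd M) ({b} \<times> mpoints K)) K"
proof -
  let ?B = "open_submfd (boundary_mfd M) ({b} \<times> mpoints K)"
  have bL: "b \<in> {0..L}" using b L by auto
  have top: "mtop ?B = subtopology (prod_topology (top_of_set {0..L}) (mtop K)) ({b} \<times> mpoints K)"
    using b by (simp add: open_submfd_def boundary_mfd_simps M_top_dim subtopology_subtopology)
      (auto intro!: arg_cong[of _ _ "subtopology _"])
  have dim: "mdim ?B = d" by (simp add: open_submfd_def boundary_mfd_simps)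
  have pts: "mpoints ?B = {b} \<times> mpoints K" using bL by (auto simp: top)
  have s1: "smooth_map ?B K snd"
    unfolding smooth_map_def
  proof (intro conjI)
    show "continuous_map (mtop ?B) (mtop K) snd"
      unfolding top by (intro continuous_map_from_subtopology continuous_map_snd)
    show "\<forall>(U, \<phi>)\<in>matlas ?B. \<forall>(V, \<kappa>)\<in>matlas K.
        smooth_on (mdim ?B) (\<phi> ` (U \<inter> snd -` V)) (\<kappa> \<circ> snd \<circ> inv_into U \<phi>)"
    proof clarify
      fix D \<zeta> V \<kappa>' assume c: "(D, \<zeta>) \<in> matlas ?B" and c': "(V, \<kappa>') \<in> matlas K"
      show "smooth_on (mdim ?B) (\<zeta> ` (D \<inter> snd -` V)) (\<kappa>' \<circ> snd \<circ> inv_into D \<zeta>)"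
        using b c
      proof (cases rule: boundary_chart)
        case 1
        then show ?thesis by (simp add: smooth_on_empty)
      next
        case (2 W \<kappa>)
        have inj: "inj_on \<kappa> W" by (rule smooth_mfd_chartD(3)[OF K 2(1)])
        have "D \<inter> snd -` V = (\<lambda>q. (b, q)) ` (W \<inter> V)" by (auto simp: 2(2))
        then have img: "\<zeta> ` (D \<inter> snd -` V) = \<kappa> ` (W \<inter> V)" by (simp add: image_image 2(3))
        have injD: "inj_on \<zeta> D" using inj by (auto simp: inj_on_def 2(2,3))
        show ?thesis
          unfolding img dim
        proof (rule smooth_on_cong[OF _ smooth_mfd_transition[OF K 2(1) c', unfolded dimK]])
          fix x assume "x \<in> \<kappa> ` (W \<inter> V)"
          then obtain q where q: "q \<in> W" "x = \<kappa> q" by blast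
          have "inv_into D \<zeta> x = (b, q)"
            using q by (intro inv_into_f_eq[OF injD]) (auto simp: 2(2,3))
          then show "(\<kappa>' \<circ> inv_into W \<kappa>) x = (\<kappa>' \<circ> snd \<circ> inv_into D \<zeta>) x"
            using q inj by simp
        qed
      qed
    qed
  qed
  have s2: "smooth_map K ?B (\<lambda>q. (b, q))"
    unfolding smooth_map_def
  proof (intro conjI)
    have "continuous_map (mtop K) (prod_topology (top_of_set {0..L}) (mtop K)) (\<lambda>q. (b, q))"
      using bL by (simp add: continuous_map_paired)
    then show "continuous_map (mtop K) (mtop ?B) (\<lambda>q. (b, q))"
      unfolding top continuous_map_in_subtopology by auto
    show "\<forall>(U, \<phi>)\<in>matlas K. \<forall>(V, \<kappa>)\<in>matlas ?B.
        smooth_on (mdim K) (\<phi> ` (U \<inter> (\<lambda>q. (b, q)) -` V)) (\<kappa> \<circ> (\<lambda>q. (b, q)) \<circ> inv_into U \<phi>)"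
    proof clarify
      fix W \<kappa> D \<zeta> assume c: "(W, \<kappa>) \<in> matlas K" and c': "(D, \<zeta>) \<in> matlas ?B"
      show "smooth_on (mdim K) (\<kappa> ` (W \<inter> (\<lambda>q. (b, q)) -` D)) (\<zeta> \<circ> (\<lambda>q. (b, q)) \<circ> inv_into W \<kappa>)"
        using b c'
      proof (cases rule: boundary_chart)
        case 1
        then show ?thesis by (simp add: smooth_on_empty)
      next
        case (2 W' \<kappa>')
        have "W \<inter> (\<lambda>q. (b, q)) -` D = W \<inter> W'" by (auto simp: 2(2))
        moreover have "\<zeta> \<circ> (\<lambda>q. (b, q)) \<circ> inv_into W \<kappa> = \<kappa>' \<circ> inv_into W \<kappa>"
          by (auto simp: 2(3))
        ultimately show ?thesis using smooth_mfd_transition[OF K c 2(1)] by simp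
      qed
    qed
  qed
  show ?thesis
    unfolding diffeomorphic_def by (rule exI[of _ snd], rule exI[of _ "\<lambda>q. (b, q)"]) (use s1 s2 pts in auto)
qed

text \<open>
  The contact angle \<open>\<theta>\<close> satisfies \<open>sin \<theta> = cos \<Theta>\<close> and \<open>cos \<theta> = sin \<Theta>\<close> at the end \<open>L\<close>, and the same equations with
  opposite signs at the end \<open>0\<close>, where the conormal is opposite to the velocity. As \<open>sin \<Theta>0 = sin \<Theta>1\<close> and
  \<open>cos \<Theta>0 = - cos \<Theta>1\<close>, the two angles are supplementary.
\<close>

theorem capillary_boundary:
  assumes ends: "cmod (\<gamma> 0) = 1" "cmod (\<gamma> L) = 1"
    and g: "\<gamma>1 0 = \<gamma> 0 * cis \<Theta>0" "\<gamma>1 L = \<gamma> L * cis \<Theta>1"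
    and cs: "cos \<Theta>0 < 0" "0 < cos \<Theta>1" "sin \<Theta>0 = sin \<Theta>1"
  shows "\<exists>B0 B1 \<theta>0 \<theta>1. boundary_components M = {B0, B1} \<and> B0 \<noteq> B1 \<and>
     legendrian_capillary (Suc d) M X B0 \<theta>0 \<and> legendrian_capillary (Suc d) M X B1 \<theta>1 \<and>
     diffeomorphic (open_submfd (boundary_mfd M) B0) K \<and>
     diffeomorphic (open_submfd (boundary_mfd M) B1) K \<and> \<theta>0 + \<theta>1 = pi"
proof -
  define \<theta>1 where "\<theta>1 = arccos (sin \<Theta>1)"
  have c2: "(cos \<Theta>1)\<^sup>2 = 1 - (sin \<Theta>1)\<^sup>2" "(cos \<Theta>0)\<^sup>2 = 1 - (sin \<Theta>1)\<^sup>2"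
    using sin_cos_squared_add2[of \<Theta>1] sin_cos_squared_add2[of \<Theta>0] unfolding cs(3) by linarith+
  have s1: "-1 < sin \<Theta>1" "sin \<Theta>1 < 1"
  proof -
    have "(sin \<Theta>1)\<^sup>2 < 1" using c2(1) cs(2) by (metis diff_gt_0_iff_gt zero_less_power)
    then show "-1 < sin \<Theta>1" "sin \<Theta>1 < 1" by (simp_all add: abs_square_less_1 abs_less_iff)
  qed
  have "sin \<theta>1 = cos \<Theta>1"
    using s1 cs(2) c2(1) by (simp add: \<theta>1_def sin_arccos flip: c2(1))
  moreover have "cos \<theta>1 = sin \<Theta>1" using s1 by (simp add: \<theta>1_def)
  ultimately have t1: "sin \<theta>1 = cos \<Theta>1" "cos \<theta>1 = sin \<Theta>1" by simp_all
  have rng: "0 < \<theta>1" "\<theta>1 < pi" using s1 arccos_lt_bounded[of "sin \<Theta>1"] by (auto simp: \<theta>1_def)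
  have "cos \<Theta>0 = - cos \<Theta>1"
  proof -
    have "(cos \<Theta>0)\<^sup>2 = (cos \<Theta>1)\<^sup>2" using c2 by simp
    then have "cos \<Theta>0 = cos \<Theta>1 \<or> cos \<Theta>0 = - cos \<Theta>1" by (simp add: power2_eq_iff)
    then show ?thesis using cs by linarith
  qed
  then have t0: "sin (pi - \<theta>1) = - cos \<Theta>0" "cos (pi - \<theta>1) = - sin \<Theta>0" using t1 cs(3) by simp_all
  have cap: "legendrian_capillary (Suc d) M X ({b} \<times> mpoints K) \<theta>"
    if b: "b = 0 \<or> b = L" and th: "0 < \<theta>" "\<theta> < pi" and nb: "cmod (\<gamma> b) = 1"
      and e: "of_real (if b = 0 then -1 else 1) * \<gamma>1 b = \<gamma> b * (of_real (sin \<theta>) + \<i> * of_real (cos \<theta>))" for b \<theta>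
    unfolding legendrian_capillary_def
  proof (intro conjI th ballI)
    have bL: "b \<in> {0..L}" using b L by auto
    show "X ` ({b} \<times> mpoints K) \<subseteq> cn_sphere (Suc d)"
      using X_norm[OF bL] nb by (auto simp: cn_sphere_def)
    fix p assume "p \<in> {b} \<times> mpoints K"
    then obtain q where p: "p = (b, q)" "q \<in> mpoints K" by blast
    have "(\<lambda>a. of_real (if b = 0 then -1 else 1) * \<gamma>1 b * \<psi> q a) =
        (\<lambda>a. sin \<theta> *\<^sub>R X p a + cos \<theta> *\<^sub>R cn_J (X p) a)"
      unfolding e by (simp add: p X_def profile_immersion_def cn_J_def scaleR_conv_of_real algebra_simps)
    then show "outward_unit_conormal (Suc d) M X p (\<lambda>a. sin \<theta> *\<^sub>R X p a + cos \<theta> *\<^sub>R cn_J (X p) a)"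
      using outward_conormal[OF b p(2)] by (simp add: p(1))
  qed
  have cis: "cis t = of_real (cos t) + \<i> * of_real (sin t)" for t by (simp add: complex_eq_iff)
  obtain q where q: "q \<in> mpoints K" using neK by blast
  then have "(0, q) \<in> {0} \<times> mpoints K" "(0, q) \<notin> {L} \<times> mpoints K" using L by auto
  then have "{0} \<times> mpoints K \<noteq> {L} \<times> mpoints K" by blast
  moreover have "legendrian_capillary (Suc d) M X ({0} \<times> mpoints K) (pi - \<theta>1)"
    by (rule cap) (use rng ends t0 g(1) in \<open>simp_all add: cis algebra_simps\<close>)
  moreover have "legendrian_capillary (Suc d) M X ({L} \<times> mpoints K) \<theta>1"
    by (rule cap) (use rng ends t1 g(2) L in \<open>simp_all add: cis\<close>)
  ultimately show ?thesis
    using boundary_components_M boundary_diffeomorphic[of 0] boundary_diffeomorphic[of L]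
    by (intro exI[of _ "{0} \<times> mpoints K"] exI[of _ "{L} \<times> mpoints K"] exI[of _ "pi - \<theta>1"] exI[of _ \<theta>1]) simp
qed

end

section \<open>Capillary solitons in the ball\<close>

theorem theorem1p4:
  fixes k0 :: nat and N :: "'a mfd" and \<psi>0 :: "'a \<Rightarrow> cvec"
  assumes "2 \<le> k0"
    and "closed_mfd N" and "connected_space (mtop N)" and "mpoints N \<noteq> {}"
    and "mdim N = k0 - 1"
    and "legendrian_immersion N k0 \<psi>0" and "minimal_in_sphere N k0 \<psi>0"
  shows "\<forall>n\<ge>k0.
    let K = prod_mfd (torus_mfd (n - k0)) N;
        \<psi> = iterated_calabi k0 \<psi>0 (n - k0)
    in closed_mfd K \<and> legendrian_immersion K n \<psi> \<and> minimal_in_sphere K n \<psi> \<and>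
      (\<forall>\<epsilon>\<in>{-1, 0, 1 :: real}. \<forall>E\<in>{0<..<exp (- \<epsilon> / 2)}.
        (\<exists>L \<gamma>. 0 < L \<and> anciaux_profile n \<epsilon> L \<gamma> E) \<and>
        (\<forall>L \<gamma>. 0 < L \<and> anciaux_profile n \<epsilon> L \<gamma> E \<longrightarrow>
          (let M = prod_mfd (interval_mfd L) K;
               X = profile_immersion \<gamma> \<psi>
           in compact_mfd M \<and> lagrangian_immersion M n X \<and> soliton_equation \<epsilon> M n X \<and>
              X ` mpoints M \<subseteq> cn_cball n \<and> X ` minterior M \<subseteq> cn_ball n \<and>
              (\<exists>B0 B1 \<theta>0 \<theta>1. boundary_components M = {B0, B1} \<and> B0 \<noteq> B1 \<and>
                 legendrian_capillary n M X B0 \<theta>0 \<and> legendrian_capillary n M X B1 \<theta>1 \<and>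
                 diffeomorphic (open_submfd (boundary_mfd M) B0) K \<and>
                 diffeomorphic (open_submfd (boundary_mfd M) B1) K \<and>
                 \<theta>0 + \<theta>1 = pi))))"
proof (intro allI impI)
  fix n :: nat assume n: "k0 \<le> n"
  define m where "m = n - k0"
  define d where "d = k0 - 1"
  define K where "K = prod_mfd (torus_mfd m) N"
  define \<psi> where "\<psi> = iterated_calabi k0 \<psi>0 m"
  have k0: "Suc d = k0" and nn: "Suc (m + d) = n" using assms(1) n by (simp_all add: d_def m_def)
  have dimN: "mdim N = d" using assms(5) by (simp add: d_def)
  note leg0 = assms(6)[folded k0] and min0 = assms(7)[folded k0]
  note cal = iterated_calabi_legendrian[OF assms(2) dimN leg0 min0, where m=m, folded K_def, unfolded k0, folded \<psi>_def]
  note cal' = cal(4,5)[unfolded nn]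
  have dimK: "mdim K = m + d" by (simp add: K_def prod_mfd_simps torus_mfd_simps dimN)
  have cK: "compact_space (mtop K)"
    using assms(2) compact_torus[of m]
    by (simp add: K_def prod_mfd_simps compact_space_prod_topology closed_mfd_def compact_mfd_def)
  have conK: "connected_space (mtop K)"
    using assms(3) connected_torus[of m] by (simp add: K_def prod_mfd_simps connected_space_prod_topology)
  have neK: "mpoints K \<noteq> {}"
    using assms(4) torus_nonempty[of m] by (simp add: K_def prod_mfd_simps)
  have "mboundary K = {}"
    using cal(2) unfolding mboundary_def open_charts_def by auto
  then have closedK: "closed_mfd K"
    using cal(1) cK by (simp add: closed_mfd_def compact_mfd_def)
  have main: "(\<exists>L \<gamma>. 0 < L \<and> anciaux_profile n \<epsilon> L \<gamma> E) \<and>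
        (\<forall>L \<gamma>. 0 < L \<and> anciaux_profile n \<epsilon> L \<gamma> E \<longrightarrow>
          (let M = prod_mfd (interval_mfd L) K;
               X = profile_immersion \<gamma> \<psi>
           in compact_mfd M \<and> lagrangian_immersion M n X \<and> soliton_equation \<epsilon> M n X \<and>
              X ` mpoints M \<subseteq> cn_cball n \<and> X ` minterior M \<subseteq> cn_ball n \<and>
              (\<exists>B0 B1 \<theta>0 \<theta>1. boundary_components M = {B0, B1} \<and> B0 \<noteq> B1 \<and>
                 legendrian_capillary n M X B0 \<theta>0 \<and> legendrian_capillary n M X B1 \<theta>1 \<and>
                 diffeomorphic (open_submfd (boundary_mfd M) B0) K \<and>
                 diffeomorphic (open_submfd (boundary_mfd M) B1) K \<and>
                 \<theta>0 + \<theta>1 = pi)))"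
    if eps: "\<epsilon> \<in> {-1, 0, 1 :: real}" and E: "E \<in> {0<..<exp (- \<epsilon> / 2)}" for \<epsilon> E
  proof (intro conjI allI impI)
    show "\<exists>L \<gamma>. 0 < L \<and> anciaux_profile n \<epsilon> L \<gamma> E"
      by (rule anciaux_profile_exists) (use assms(1) n eps E in auto)
    fix L \<gamma> assume prof: "0 < L \<and> anciaux_profile n \<epsilon> L \<gamma> E"
    then have L: "0 < L" by simp
    obtain \<gamma>1 \<gamma>2 \<Theta>0 \<Theta>1 where reg: "regular_profile n \<epsilon> L \<gamma> \<gamma>1 \<gamma>2"
      and inner: "\<And>s. s \<in> {0<..<L} \<Longrightarrow> cmod (\<gamma> s) < 1" and ends: "cmod (\<gamma> 0) = 1" "cmod (\<gamma> L) = 1"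
      and g: "\<gamma>1 0 = \<gamma> 0 * cis \<Theta>0" "\<gamma>1 L = \<gamma> L * cis \<Theta>1"
      and cs: "cos \<Theta>0 < 0" "0 < cos \<Theta>1" "sin \<Theta>0 = sin \<Theta>1"
      by (rule anciaux_profile_regular[of n \<epsilon> L \<gamma> E]) (use prof E in \<open>auto intro: that\<close>)
    interpret C: cylinder K \<psi> "m + d" \<epsilon> L \<gamma> \<gamma>1 \<gamma>2
    proof
      show "smooth_mfd K" "open_charts K" "legendrian_immersion K (Suc (m + d)) \<psi>" by (fact cal)+
      show "\<exists>h. legendrian_jet (m + d) (\<psi> p) (\<lambda>i. coord_d c \<psi> i p) (\<lambda>i j. coord_d2 c \<psi> i j p) h"
        if "c \<in> matlas K" "p \<in> fst c" for c p
        by (rule cal(3)[OF that])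
    qed (fact cK conK neK dimK L reg[folded nn])+
    note C_defs = C.M_def C.X_def
    have XM: "X' ` mpoints C.M \<subseteq> cn_cball n" if "X' = C.X" for X'
    proof clarify
      fix p assume "p \<in> mpoints C.M"
      then obtain s q where p: "p = (s, q)" "s \<in> {0..L}" "q \<in> mpoints K" unfolding C.mpoints_M by blast
      have "cmod (\<gamma> s) \<le> 1"
        using p(2) ends inner[of s] by (cases "s = 0 \<or> s = L") (auto simp: less_imp_le)
      then show "X' p \<in> cn_cball n" using C.X_norm[OF p(2,3)] by (simp add: that p(1) cn_cball_def nn)
    qed
    have XI: "C.X ` minterior C.M \<subseteq> cn_ball n"
    proof clarify
      fix p assume "p \<in> minterior C.M"
      then obtain s q where p: "p = (s, q)" "s \<in> {0<..<L}" "q \<in> mpoints K"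
        unfolding minterior_def C.mpoints_M C.mboundary_M by force
      then show "C.X p \<in> cn_ball n"
        using C.X_norm[of s q] inner[of s] by (simp add: cn_ball_def nn)
    qed
    show "let M = prod_mfd (interval_mfd L) K; X = profile_immersion \<gamma> \<psi>
           in compact_mfd M \<and> lagrangian_immersion M n X \<and> soliton_equation \<epsilon> M n X \<and>
              X ` mpoints M \<subseteq> cn_cball n \<and> X ` minterior M \<subseteq> cn_ball n \<and>
              (\<exists>B0 B1 \<theta>0 \<theta>1. boundary_components M = {B0, B1} \<and> B0 \<noteq> B1 \<and>
                 legendrian_capillary n M X B0 \<theta>0 \<and> legendrian_capillary n M X B1 \<theta>1 \<and>
                 diffeomorphic (open_submfd (boundary_mfd M) B0) K \<and>
                 diffeomorphic (open_submfd (boundary_mfd M) B1) K \<and>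
                 \<theta>0 + \<theta>1 = pi)"
      unfolding Let_def C_defs[symmetric]
      by (intro conjI C.compact_M C.lagrangian_soliton[unfolded nn] XM[OF refl] XI
          C.capillary_boundary[OF ends g cs, unfolded nn])
  qed
  show "let K = prod_mfd (torus_mfd (n - k0)) N;
        \<psi> = iterated_calabi k0 \<psi>0 (n - k0)
    in closed_mfd K \<and> legendrian_immersion K n \<psi> \<and> minimal_in_sphere K n \<psi> \<and>
      (\<forall>\<epsilon>\<in>{-1, 0, 1 :: real}. \<forall>E\<in>{0<..<exp (- \<epsilon> / 2)}.
        (\<exists>L \<gamma>. 0 < L \<and> anciaux_profile n \<epsilon> L \<gamma> E) \<and>
        (\<forall>L \<gamma>. 0 < L \<and> anciaux_profile n \<epsilon> L \<gamma> E \<longrightarrow>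
          (let M = prod_mfd (interval_mfd L) K;
               X = profile_immersion \<gamma> \<psi>
           in compact_mfd M \<and> lagrangian_immersion M n X \<and> soliton_equation \<epsilon> M n X \<and>
              X ` mpoints M \<subseteq> cn_cball n \<and> X ` minterior M \<subseteq> cn_ball n \<and>
              (\<exists>B0 B1 \<theta>0 \<theta>1. boundary_components M = {B0, B1} \<and> B0 \<noteq> B1 \<and>
                 legendrian_capillary n M X B0 \<theta>0 \<and> legendrian_capillary n M X B1 \<theta>1 \<and>
                 diffeomorphic (open_submfd (boundary_mfd M) B0) K \<and>
                 diffeomorphic (open_submfd (boundary_mfd M) B1) K \<and>
                 \<theta>0 + \<theta>1 = pi))))"
    unfolding Let_def[of "prod_mfd (torus_mfd (n - k0)) N"] Let_def[of "iterated_calabi k0 \<psi>0 (n - k0)"]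
    unfolding m_def[symmetric]
    unfolding K_def[symmetric] \<psi>_def[symmetric]
    by (rule conjI[OF closedK conjI[OF cal'(1) conjI[OF cal'(2)]]]) (intro ballI main)
qed

end
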